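(* Let $m\ge 1$, $N=1+m$, $\lambda\ge 1$, $0<\nu<1$, $Q=(m+1)+\lambda m$, let $\Omega\subset\mathbb{R}^{N}$ be a $\Lambda$-connected bounded open set, and let $f\in L^r(\Omega)$ for some $1\le r<\frac{2Q}{(Q+2)+\nu(Q-2)}$ be a nonnegative function which is not identically zero. Put $q=\frac{Qr(\nu+1)}{Q-r(1-\nu)}$. Then there exists $u\in W^{1,\lambda,q}_0(\Omega)$ which is a solution of $$-\Delta_\lambda u=\frac{f}{u^\nu}\ \text{ in }\Omega,\qquad u>0\ \text{ in }\Omega,\qquad u=0\ \text{ on }\partial\Omega$$ in the sense that $$\int_\Omega\langle A\nabla^*u,\nabla v\rangle\,dX=\int_\Omega\frac{fv}{u^\nu}\,dX\quad\text{for all }v\in C^1_0(\Omega).$$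
   Context: Points of $\mathbb{R}^N=\mathbb{R}^{1+m}$ are written $X=(x,y)$ with $x\in\mathbb{R}$, $y\in\mathbb{R}^m$. The Grushin operator is $\Delta_\lambda u=u_{xx}+|x|^{2\lambda}\Delta_y u=\operatorname{div}(A\nabla u)$, where $A(X)=\operatorname{diag}(1,|x|^{2\lambda}I_m)$. An open set $\Omega$ is $\Lambda$-connected if any two points of $\Omega$ can be joined by a continuous curve lying in $\Omega$ which is piecewise an integral curve of the vector fields $\pm\partial_x,\pm|x|^\lambda\partial_{y_1},\dots,\pm|x|^\lambda\partial_{y_m}$. $C^1_0(\Omega)$ is the space of $C^1$ functions with compact support in $\Omega$. Function spaces: for $1\le p<\infty$, $W^{1,\lambda,p}_0(\Omega)$ is the completion of $C^1_0(\Omega)$ under the norm $\|u\|_0:=\left(\int_\Omega\langle A\nabla u,\nabla u\rangle^{p/2}dX\right)^{1/p}$ (equivalent on $C^1_0(\Omega)$ to $\left(\int_\Omega|u|^pdX+\int_\Omega\langle A\nabla u,\nabla u\rangle^{p/2}dX\right)^{1/p}$ by a Poincaré inequality). An element represented by a Cauchy sequence $\{u_n\}$ is identified with $u=\lim u_n$ in $L^p(\Omega)$; setting $U=\lim\sqrt{A}\nabla u_n$ in $L^p(\Omega)^N$ (which is uniquely determined by $u$), the weak quasi-gradient is $\nabla^*u:=(\sqrt{A})^{-1}U$, defined a.e. in $\Omega$. *)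

theory Defs
  imports "HOL-Analysis.Analysis"
begin

text \<open>Points \<open>X = (x, y)\<close> of \<open>\<real> \<times> \<real>\<^sup>m\<close> have type \<open>real \<times> (real ^ 'm)\<close>, where \<open>m = CARD('m)\<close>;
  \<open>x = fst X\<close> and \<open>y = snd X\<close>. Real-valued functions on an open set \<open>\<Omega>\<close> are total functions whose
  values outside \<open>\<Omega>\<close> are irrelevant.\<close>

definition grushin_A :: "real \<Rightarrow> real \<times> (real ^ 'm) \<Rightarrow> real \<times> (real ^ 'm) \<Rightarrow> real \<times> (real ^ 'm)" where
  "grushin_A lam X h = (fst h, (\<bar>fst X\<bar> powr (2 * lam)) *\<^sub>R snd h)"

definition grushin_sqrtA :: "real \<Rightarrow> real \<times> (real ^ 'm) \<Rightarrow> real \<times> (real ^ 'm) \<Rightarrow> real \<times> (real ^ 'm)" where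
  "grushin_sqrtA lam X h = (fst h, (\<bar>fst X\<bar> powr lam) *\<^sub>R snd h)"

lemma grushin_sqrtA_sqrtA: "grushin_sqrtA lam X (grushin_sqrtA lam X h) = grushin_A lam X h"
  by (simp add: grushin_sqrtA_def grushin_A_def flip: powr_add mult_2)

lemma inv_grushin_sqrtA:
  assumes "fst X \<noteq> 0"
  shows "inv (grushin_sqrtA lam X) h = (fst h, (\<bar>fst X\<bar> powr (- lam)) *\<^sub>R snd h)"
proof (rule inv_f_eq)
  show "inj (grushin_sqrtA lam X)"
    using assms by (auto simp: inj_def grushin_sqrtA_def prod_eq_iff)
  show "grushin_sqrtA lam X (fst h, (\<bar>fst X\<bar> powr (- lam)) *\<^sub>R snd h) = h"
    using assms by (simp add: grushin_sqrtA_def powr_minus)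
qed

definition grushin_fields :: "real \<Rightarrow> (real \<times> (real ^ 'm) \<Rightarrow> real \<times> (real ^ 'm)) set" where
  "grushin_fields lam =
     {V. \<exists>s\<in>{1, -1}. V = (\<lambda>X. (s, 0)) \<or>
           (\<exists>i. V = (\<lambda>X. (0, (s * \<bar>fst X\<bar> powr lam) *\<^sub>R axis i 1)))}"

definition integral_curve_on ::
    "('a::real_normed_vector \<Rightarrow> 'a) \<Rightarrow> (real \<Rightarrow> 'a) \<Rightarrow> real \<Rightarrow> real \<Rightarrow> bool" where
  "integral_curve_on V \<gamma> a b \<longleftrightarrow>
     (\<forall>t\<in>{a..b}. (\<gamma> has_vector_derivative V (\<gamma> t)) (at t within {a..b}))"

text \<open>Integral curves cannot be reparametrised freely, so the parameter interval \<open>{0..T}\<close> is arbitrary;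
  \<open>\<tau> 0 < \<dots> < \<tau> k\<close> is the subdivision into integral curves.\<close>

definition Lambda_connected :: "real \<Rightarrow> (real \<times> (real ^ 'm)) set \<Rightarrow> bool" where
  "Lambda_connected lam \<Omega> \<longleftrightarrow>
     (\<forall>P\<in>\<Omega>. \<forall>R\<in>\<Omega>. \<exists>\<gamma> T. 0 \<le> T \<and> continuous_on {0..T} \<gamma> \<and> \<gamma> ` {0..T} \<subseteq> \<Omega> \<and>
        \<gamma> 0 = P \<and> \<gamma> T = R \<and>
        (\<exists>(k::nat) \<tau>. \<tau> 0 = 0 \<and> \<tau> k = T \<and>
           (\<forall>i<k. \<tau> i < \<tau> (Suc i) \<and>
              (\<exists>V\<in>grushin_fields lam. integral_curve_on V \<gamma> (\<tau> i) (\<tau> (Suc i))))))"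

definition gradient :: "('a::real_inner \<Rightarrow> real) \<Rightarrow> 'a \<Rightarrow> 'a" where
  "gradient v X = (THE D. GDERIV v X :> D)"

definition C1_0 :: "'a::euclidean_space set \<Rightarrow> ('a \<Rightarrow> real) set" where
  "C1_0 \<Omega> = {v. (\<forall>X\<in>\<Omega>. GDERIV v X :> gradient v X) \<and> continuous_on \<Omega> (gradient v) \<and>
      compact (closure {X\<in>\<Omega>. v X \<noteq> 0}) \<and> closure {X\<in>\<Omega>. v X \<noteq> 0} \<subseteq> \<Omega>}"

definition Lp_fun :: "real \<Rightarrow> 'a::euclidean_space set \<Rightarrow> ('a \<Rightarrow> 'b::euclidean_space) \<Rightarrow> bool" where
  "Lp_fun p \<Omega> f \<longleftrightarrow> f \<in> borel_measurable (lebesgue_on \<Omega>) \<and>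
     integrable (lebesgue_on \<Omega>) (\<lambda>X. norm (f X) powr p)"

definition Lp_norm :: "real \<Rightarrow> 'a::euclidean_space set \<Rightarrow> ('a \<Rightarrow> 'b::euclidean_space) \<Rightarrow> real" where
  "Lp_norm p \<Omega> f = (LINT X|lebesgue_on \<Omega>. norm (f X) powr p) powr (1 / p)"

definition Lp_lim ::
    "real \<Rightarrow> 'a::euclidean_space set \<Rightarrow> (nat \<Rightarrow> 'a \<Rightarrow> 'b::euclidean_space) \<Rightarrow> ('a \<Rightarrow> 'b) \<Rightarrow> bool" where
  "Lp_lim p \<Omega> \<phi> u \<longleftrightarrow> (\<forall>n. Lp_fun p \<Omega> (\<phi> n)) \<and> Lp_fun p \<Omega> u \<and>
     (\<lambda>n. Lp_norm p \<Omega> (\<lambda>X. \<phi> n X - u X)) \<longlonglongrightarrow> 0"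

definition norm0 :: "real \<Rightarrow> real \<Rightarrow> (real \<times> (real ^ 'm)) set \<Rightarrow> (real \<times> (real ^ 'm) \<Rightarrow> real) \<Rightarrow> real" where
  "norm0 lam p \<Omega> v =
     (LINT X|lebesgue_on \<Omega>. (grushin_A lam X (gradient v X) \<bullet> gradient v X) powr (p / 2)) powr (1 / p)"

definition Cauchy0 ::
    "real \<Rightarrow> real \<Rightarrow> (real \<times> (real ^ 'm)) set \<Rightarrow> (nat \<Rightarrow> real \<times> (real ^ 'm) \<Rightarrow> real) \<Rightarrow> bool" where
  "Cauchy0 lam p \<Omega> \<phi> \<longleftrightarrow> (\<forall>n. \<phi> n \<in> C1_0 \<Omega>) \<and>
     (\<forall>e>0. \<exists>M. \<forall>j\<ge>M. \<forall>k\<ge>M. norm0 lam p \<Omega> (\<lambda>X. \<phi> j X - \<phi> k X) < e)"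

text \<open>The completion of \<open>C1_0 \<Omega>\<close> under \<open>norm0\<close>, each class of Cauchy sequences being identified with
  its limit in \<open>L\<^sup>p\<close>; a limit is represented by any of its almost-everywhere versions.\<close>

definition W0 :: "real \<Rightarrow> real \<Rightarrow> (real \<times> (real ^ 'm)) set \<Rightarrow> (real \<times> (real ^ 'm) \<Rightarrow> real) set" where
  "W0 lam p \<Omega> = {u. \<exists>\<phi>. Cauchy0 lam p \<Omega> \<phi> \<and> Lp_lim p \<Omega> \<phi> u}"

text \<open>\<open>G\<close> is (a version of) the weak quasi-gradient of \<open>u\<close>. It is determined only almost everywhere,
  hence a relation; \<open>grushin_sqrtA lam X\<close> is invertible off the null set \<open>fst X = 0\<close>.\<close>

definition has_weak_quasi_gradient ::
    "real \<Rightarrow> real \<Rightarrow> (real \<times> (real ^ 'm)) set \<Rightarrow> (real \<times> (real ^ 'm) \<Rightarrow> real) \<Rightarrow>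
     (real \<times> (real ^ 'm) \<Rightarrow> real \<times> (real ^ 'm)) \<Rightarrow> bool" where
  "has_weak_quasi_gradient lam p \<Omega> u G \<longleftrightarrow>
     (\<exists>\<phi> U. Cauchy0 lam p \<Omega> \<phi> \<and> Lp_lim p \<Omega> \<phi> u \<and>
        Lp_lim p \<Omega> (\<lambda>n X. grushin_sqrtA lam X (gradient (\<phi> n) X)) U \<and>
        (AE X in lebesgue_on \<Omega>. G X = inv (grushin_sqrtA lam X) (U X)))"

end

theory Submission
  imports Defs
begin

text \<open>Regularise the nonlinearity: let \<open>u\<^sub>n\<close> solve
  \<open>- \<Delta>\<^sub>\<lambda> u\<^sub>n = f\<^sub>n (u\<^sub>n + 1/(n+1))\<^sup>-\<^sup>\<nu>\<close> with \<open>f\<^sub>n = min f (n+1)\<close>, obtained by minimising a strictly convex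
  functional. Comparison gives \<open>0 \<le> u\<^sub>n \<le> u\<^sub>n\<^sub>+\<^sub>1\<close>. Testing with a smooth substitute for \<open>u\<^sub>n\<^sup>\<theta>\<close>, where \<open>\<theta>\<close> balances the
  integrability of \<open>f\<close> against the Sobolev inequality with exponent \<open>2Q/(Q-2)\<close>, bounds \<open>u\<^sub>n\<close> in
  \<open>L\<^sup>\<sigma>\<close> with \<open>\<sigma> = (1+\<theta>)Q/(Q-2) \<ge> q\<close>; testing the difference of two equations with a concave
  function of \<open>u\<^sub>m - u\<^sub>n\<close> makes the quasi-gradients Cauchy in \<open>L\<^sup>q\<close>. In the limit equation the
  singularity is controlled by testing with \<open>\<psi> d\<^sup>2/(d\<^sup>2 + u\<^sub>n\<^sup>2)\<close>, which needs only \<open>u > 0\<close> almost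
  everywhere. That follows from \<open>u \<ge> u\<^sub>0\<close> and a logarithmic Caccioppoli estimate: the indicator of
  \<open>u\<^sub>0 > 0\<close> is a limit of functions whose local energies vanish, hence locally constant.\<close>

section \<open>Integrability of powers\<close>

text \<open>The limit u is not controlled in the energy space: only an L^q bound on its
  quasi-gradient, with q < 2, survives. Membership in \<open>W0\<close> asks for C1 functions whose
  quasi-gradients converge strongly, so a bound on the approximations would leave work to do. The
  Cauchy property comes from pairing a weighted L^2 bound on \<open>Wn m - Wn n\<close> with
  integrability of a negative power of the weight, which is exactly u in L^\<sigma>. The bound on r
  says 2 \<kappa> < 1 - \<nu>, hence \<theta> < 1; then the weight decays at infinity, which is why
  q < 2. Two constraints shape the rest. The energy does not see y-derivatives where x = 0, so every
  translation estimate moves in x before it moves in y. Composition preserves the energy space for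
  C1 functions with bounded derivative, so positive parts, powers, logarithms and truncations all
  occur as C1 substitutes, continued linearly below 0 where their natural domain is [0, infinity).
  In the limit the singular term is recovered by monotone convergence, which also yields its
  integrability.\<close>

lemma weighted_AM_GM:
  fixes a b :: real
  assumes "0 < \<alpha>" "\<alpha> < 1" "0 \<le> a" "0 \<le> b"
  shows "a powr \<alpha> * b powr (1 - \<alpha>) \<le> \<alpha> * a + (1 - \<alpha>) * b"
proof (cases "a = 0 \<or> b = 0")
  case True
  then show ?thesis using assms by auto
next
  case False
  then show ?thesis using assms by (intro Youngs_inequality_0) auto
qed

text \<open>Integrates \<open>weighted_AM_GM\<close> after both factors are scaled to integral 1; if
  one integral vanishes, that factor is zero almost everywhere. Writing the exponents as \<alpha>
  and 1 - \<alpha> suits the later uses with 1/2, s/t, 1/r and q/2.\<close>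

lemma Holder_integral:
  fixes a b :: "'a \<Rightarrow> real"
  assumes ia: "integrable M a" and ib: "integrable M b" and a: "\<And>x. 0 \<le> a x" and b: "\<And>x. 0 \<le> b x"
    and al: "0 < \<alpha>" "\<alpha> < 1"
  shows "integrable M (\<lambda>x. a x powr \<alpha> * b x powr (1 - \<alpha>))" (is ?int)
    and "(LINT x|M. a x powr \<alpha> * b x powr (1 - \<alpha>)) \<le> (LINT x|M. a x) powr \<alpha> * (LINT x|M. b x) powr (1 - \<alpha>)" (is ?le)
proof -
  have [measurable]: "a \<in> borel_measurable M" "b \<in> borel_measurable M" using ia ib by auto
  show int: ?int
  proof (rule Bochner_Integration.integrable_bound)
    show "integrable M (\<lambda>x. \<alpha> * a x + (1 - \<alpha>) * b x)" using ia ib by auto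
    show "AE x in M. norm (a x powr \<alpha> * b x powr (1 - \<alpha>)) \<le> norm (\<alpha> * a x + (1 - \<alpha>) * b x)"
      using weighted_AM_GM[OF al a b] a b al by (auto simp: abs_mult)
  qed measurable
  define A where "A = (LINT x|M. a x)"
  define B where "B = (LINT x|M. b x)"
  have A0: "0 \<le> A" and B0: "0 \<le> B" using a b by (auto simp: A_def B_def)
  show ?le
  proof (cases "A = 0 \<or> B = 0")
    case True
    have "AE x in M. a x powr \<alpha> * b x powr (1 - \<alpha>) = 0"
    proof (cases "A = 0")
      case True
      then have "AE x in M. a x = 0"
        using integral_nonneg_eq_0_iff_AE[OF ia] a by (auto simp: A_def)
      then show ?thesis by eventually_elim simp
    next
      case False
      then have "AE x in M. b x = 0"
        using integral_nonneg_eq_0_iff_AE[OF ib] b True by (auto simp: B_def)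
      then show ?thesis by eventually_elim simp
    qed
    then have "(LINT x|M. a x powr \<alpha> * b x powr (1 - \<alpha>)) = 0"
      by (simp cong: integral_cong_AE add: integral_eq_zero_AE)
    then show ?thesis by simp
  next
    case False
    with A0 B0 have A: "0 < A" and B: "0 < B" by auto
    have "(LINT x|M. a x powr \<alpha> * b x powr (1 - \<alpha>)) \<le>
       (LINT x|M. (A powr \<alpha> * B powr (1 - \<alpha>)) * (\<alpha> * (a x / A) + (1 - \<alpha>) * (b x / B)))"
    proof (rule integral_mono[OF int])
      show "integrable M (\<lambda>x. (A powr \<alpha> * B powr (1 - \<alpha>)) * (\<alpha> * (a x / A) + (1 - \<alpha>) * (b x / B)))"
        using ia ib by auto
      fix x
      have "(a x / A) powr \<alpha> * (b x / B) powr (1 - \<alpha>) \<le> \<alpha> * (a x / A) + (1 - \<alpha>) * (b x / B)"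
        by (rule weighted_AM_GM) (use al a b A B in auto)
      then have "(A powr \<alpha> * B powr (1 - \<alpha>)) * ((a x / A) powr \<alpha> * (b x / B) powr (1 - \<alpha>))
         \<le> (A powr \<alpha> * B powr (1 - \<alpha>)) * (\<alpha> * (a x / A) + (1 - \<alpha>) * (b x / B))"
        using A B by (intro mult_left_mono) auto
      moreover have "(A powr \<alpha> * B powr (1 - \<alpha>)) * ((a x / A) powr \<alpha> * (b x / B) powr (1 - \<alpha>))
         = a x powr \<alpha> * b x powr (1 - \<alpha>)"
        using A B a b by (simp add: powr_divide)
      ultimately show "a x powr \<alpha> * b x powr (1 - \<alpha>)
         \<le> (A powr \<alpha> * B powr (1 - \<alpha>)) * (\<alpha> * (a x / A) + (1 - \<alpha>) * (b x / B))" by simp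
    qed
    also have "\<dots> = (A powr \<alpha> * B powr (1 - \<alpha>)) * (\<alpha> * (A / A) + (1 - \<alpha>) * (B / B))"
      using ia ib by (simp add: A_def B_def)
    also have "\<dots> = A powr \<alpha> * B powr (1 - \<alpha>)" using A B by simp
    finally show ?thesis by (simp add: A_def B_def)
  qed
qed

definition Lp_on :: "real \<Rightarrow> 'a measure \<Rightarrow> ('a \<Rightarrow> 'b::euclidean_space) \<Rightarrow> bool" where
  "Lp_on p M F \<longleftrightarrow> F \<in> borel_measurable M \<and> integrable M (\<lambda>x. norm (F x) powr p)"

text \<open>The p-th power of the norm, without the root. Sums then obey a triangle inequality up to
  the factor 2^p, which is enough because these integrals are only ever shown to be bounded or
  small.\<close>

definition Lp_int :: "real \<Rightarrow> 'a measure \<Rightarrow> ('a \<Rightarrow> 'b::euclidean_space) \<Rightarrow> real" where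
  "Lp_int p M F = (LINT x|M. norm (F x) powr p)"

lemma Lp_onD:
  assumes "Lp_on p M F"
  shows "F \<in> borel_measurable M" "integrable M (\<lambda>x. norm (F x) powr p)"
  using assms by (auto simp: Lp_on_def)

lemma Lp_int_nonneg: "0 \<le> Lp_int p M F"
  by (auto simp: Lp_int_def)

lemma Lp_on_bound:
  assumes "Lp_on p M G" "F \<in> borel_measurable M" "AE x in M. norm (F x) \<le> C * norm (G x)" "0 \<le> C" "0 \<le> p"
  shows "Lp_on p M F" "Lp_int p M F \<le> C powr p * Lp_int p M G"
proof -
  have [measurable]: "F \<in> borel_measurable M" by fact
  have ae: "AE x in M. norm (F x) powr p \<le> C powr p * norm (G x) powr p"
    using assms(3)
  proof eventually_elim
    case (elim x)
    then have "norm (F x) powr p \<le> (C * norm (G x)) powr p" using assms by (intro powr_mono2) auto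
    then show ?case using assms by (simp add: powr_mult)
  qed
  have i: "integrable M (\<lambda>x. norm (F x) powr p)"
    by (rule Bochner_Integration.integrable_bound[of _ "\<lambda>x. C powr p * norm (G x) powr p"])
       (use ae Lp_onD[OF assms(1)] in auto)
  show "Lp_on p M F" using i assms(2) by (simp add: Lp_on_def)
  have "Lp_int p M F \<le> (LINT x|M. C powr p * norm (G x) powr p)"
    unfolding Lp_int_def using i ae Lp_onD[OF assms(1)] by (intro integral_mono_AE) auto
  then show "Lp_int p M F \<le> C powr p * Lp_int p M G" by (simp add: Lp_int_def)
qed

text \<open>Comparison with twice the larger of the two norms, which works for every p >= 0 and not
  only for p >= 1.\<close>

lemma norm_add_powr:
  fixes a b :: "'b::real_normed_vector"
  assumes "0 \<le> p"
  shows "norm (a + b) powr p \<le> 2 powr p * (norm a powr p + norm b powr p)"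
proof -
  have *: "norm (a + b) powr p \<le> 2 powr p * (norm c powr p)" if "norm (a + b) \<le> 2 * norm c" for c :: 'b
    using powr_mono2[OF assms _ that] by (simp add: powr_mult)
  show ?thesis
  proof (cases "norm a \<le> norm b")
    case True
    then have "norm (a + b) powr p \<le> 2 powr p * (norm b powr p)"
      using norm_triangle_ineq[of a b] by (intro *) auto
    then show ?thesis by (smt (verit) mult_left_mono powr_ge_zero)
  next
    case False
    then have "norm (a + b) powr p \<le> 2 powr p * (norm a powr p)"
      using norm_triangle_ineq[of a b] by (intro *) auto
    then show ?thesis by (smt (verit) mult_left_mono powr_ge_zero)
  qed
qed

lemma Lp_on_add:
  assumes "Lp_on p M F" "Lp_on p M G" "0 \<le> p"
  shows "Lp_on p M (\<lambda>x. F x + G x)" "Lp_int p M (\<lambda>x. F x + G x) \<le> 2 powr p * (Lp_int p M F + Lp_int p M G)"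
proof -
  have [measurable]: "F \<in> borel_measurable M" "G \<in> borel_measurable M" using assms by (auto simp: Lp_on_def)
  have i2: "integrable M (\<lambda>x. 2 powr p * (norm (F x) powr p + norm (G x) powr p))" using assms by (auto simp: Lp_on_def)
  have i: "integrable M (\<lambda>x. norm (F x + G x) powr p)"
    by (rule Bochner_Integration.integrable_bound[OF i2]) (use norm_add_powr[OF assms(3), of "F _" "G _"] in auto)
  show "Lp_on p M (\<lambda>x. F x + G x)" using i unfolding Lp_on_def by simp
  have "Lp_int p M (\<lambda>x. F x + G x) \<le> (LINT x|M. 2 powr p * (norm (F x) powr p + norm (G x) powr p))"
    unfolding Lp_int_def using norm_add_powr[OF assms(3)] by (intro integral_mono i i2) auto
  then show "Lp_int p M (\<lambda>x. F x + G x) \<le> 2 powr p * (Lp_int p M F + Lp_int p M G)"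
    using Lp_onD[OF assms(1)] Lp_onD[OF assms(2)] by (simp add: Lp_int_def)
qed

lemma Lp_on_minus: "Lp_on p M F \<Longrightarrow> Lp_on p M (\<lambda>x. - F x)"
  by (simp add: Lp_on_def)

lemma Lp_on_diff:
  assumes "Lp_on p M F" "Lp_on p M G" "0 \<le> p"
  shows "Lp_on p M (\<lambda>x. F x - G x)" "Lp_int p M (\<lambda>x. F x - G x) \<le> 2 powr p * (Lp_int p M F + Lp_int p M G)"
  using Lp_on_add[OF assms(1) Lp_on_minus[OF assms(2)] assms(3)] by (simp_all add: Lp_int_def)

lemma Lp_int_commute: "Lp_int p M (\<lambda>x. F x - G x) = Lp_int p M (\<lambda>x. G x - F x)"
  by (simp add: Lp_int_def norm_minus_commute)

lemma Lp_int_triangle: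
  assumes "Lp_on p M F" "Lp_on p M G" "Lp_on p M K" "0 \<le> p"
  shows "Lp_int p M (\<lambda>x. F x - K x) \<le> 2 powr p * (Lp_int p M (\<lambda>x. F x - G x) + Lp_int p M (\<lambda>x. G x - K x))"
  using Lp_on_add(2)[OF Lp_on_diff(1)[OF assms(1,2,4)] Lp_on_diff(1)[OF assms(2,3,4)] assms(4)] by simp

lemma Lp_on_scaleR:
  assumes "Lp_on p M F" "0 \<le> p"
  shows "Lp_on p M (\<lambda>x. c *\<^sub>R F x)"
proof -
  have [measurable]: "F \<in> borel_measurable M" using assms by (simp add: Lp_on_def)
  show ?thesis
    by (rule Lp_on_bound(1)[OF assms(1), of _ "\<bar>c\<bar>"]) (use assms in auto)
qed

lemma (in finite_measure) Lp_on_bounded: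
  assumes "F \<in> borel_measurable M" "AE x in M. norm (F x) \<le> C" "0 \<le> p"
  shows "Lp_on p M F"
proof -
  have [measurable]: "F \<in> borel_measurable M" by fact
  have "integrable M (\<lambda>x. norm (F x) powr p)"
    using assms by (intro integrable_const_bound[of _ "C powr p"]) (auto elim!: eventually_mono intro: powr_mono2)
  then show ?thesis using assms by (simp add: Lp_on_def)
qed

lemma Lp_lim_AE_subseq:
  assumes F: "\<And>k. Lp_on p M (F k)" and G: "Lp_on p M G" and p: "0 < p"
    and lim: "(\<lambda>k. Lp_int p M (\<lambda>x. F k x - G x)) \<longlonglongrightarrow> 0"
  shows "\<exists>r::nat \<Rightarrow> nat. strict_mono r \<and> (AE x in M. (\<lambda>k. F (r k) x) \<longlonglongrightarrow> G x)"
proof -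
  have i: "integrable M (\<lambda>x. norm (F k x - G x) powr p)" for k
    using Lp_on_diff(1)[OF F G] p by (auto simp: Lp_on_def)
  obtain r where r: "strict_mono r" "AE x in M. (\<lambda>k. norm (F (r k) x - G x) powr p) \<longlonglongrightarrow> 0"
    using tendsto_L1_AE_subseq[where u="\<lambda>k x. norm (F k x - G x) powr p", OF i] lim by (auto simp: Lp_int_def)
  have "AE x in M. (\<lambda>k. F (r k) x) \<longlonglongrightarrow> G x"
    using r(2)
  proof eventually_elim
    case (elim x)
    have "(\<lambda>k. (norm (F (r k) x - G x) powr p) powr (1/p)) \<longlonglongrightarrow> 0"
      using tendsto_powr'[OF elim tendsto_const[of "1/p"]] p by auto
    then have "(\<lambda>k. norm (F (r k) x - G x)) \<longlonglongrightarrow> 0"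
      using p by (simp add: powr_powr)
    then show ?case by (rule Lim_null[THEN iffD2, OF tendsto_norm_zero_cancel])
  qed
  with r(1) show ?thesis by blast
qed

text \<open>Riesz-Fischer: a rapidly Cauchy subsequence has increments summable in L^1, so it
  converges almost everywhere, and Fatou's lemma turns the pointwise limit into a limit in L^p.
  Finiteness of the measure enters when the increments are summed in L^1.\<close>

lemma (in finite_measure) Lp_complete:
  fixes F :: "nat \<Rightarrow> 'a \<Rightarrow> 'b::euclidean_space"
  assumes F: "\<And>k. Lp_on p M (F k)" and p: "1 \<le> p"
    and cau: "\<And>e. e > 0 \<Longrightarrow> \<exists>N. \<forall>j\<ge>N. \<forall>k\<ge>N. Lp_int p M (\<lambda>x. F j x - F k x) < e"
  shows "\<exists>G. Lp_on p M G \<and> (\<lambda>k. Lp_int p M (\<lambda>x. F k x - G x)) \<longlonglongrightarrow> 0"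
proof -
  have [measurable]: "F k \<in> borel_measurable M" for k using F by (simp add: Lp_on_def)
  have dint: "integrable M (\<lambda>x. norm (F j x - F k x) powr p)" for j k
    using Lp_on_diff(1)[OF F F] p by (auto simp: Lp_on_def)
  \<comment> \<open>The rate 2^(-k p) leaves 2^(-k) after multiplication by the factor 2^(k (p - 1))
    of the pointwise bound \<open>pw\<close>.\<close>
  have "\<exists>N. \<forall>k. (\<forall>j\<ge>N k. \<forall>l\<ge>N k. Lp_int p M (\<lambda>x. F j x - F l x) < 2 powr (- real k * p))"
    by (rule choice) (use cau in auto)
  then obtain N where N: "\<And>k j l. j \<ge> N k \<Longrightarrow> l \<ge> N k \<Longrightarrow> Lp_int p M (\<lambda>x. F j x - F l x) < 2 powr (- real k * p)"
    by blast
  \<comment> \<open>The running maximum makes the indices nondecreasing; repetitions are harmless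
    since only limits along \<open>r\<close> are taken.\<close>
  define r where "r k = Max (N ` {..k})" for k
  have rN: "N k \<le> r k" and rS: "r k \<le> r (Suc k)" for k
    unfolding r_def by (auto intro!: Max_ge Max_mono)
  have rmono: "k \<le> l \<Longrightarrow> r k \<le> r l" for k l using rS by (rule lift_Suc_mono_le)
  define d where "d k x = F (r (Suc k)) x - F (r k) x" for k x
  have [measurable]: "d k \<in> borel_measurable M" for k unfolding d_def by measurable
  have dk: "(\<integral>\<^sup>+x. ennreal (norm (d k x)) \<partial>M) \<le> ennreal ((1/2)^k * (measure M (space M) + 1))" for k
  proof -
    \<comment> \<open>Either the increment n is at most 2^(-k), or n = n^(1-p) n^p with n^(1-p) <=
      2^(k (p - 1)) because 1 - p <= 0.\<close>
    have pw: "norm (d k x) \<le> (1/2)^k + 2 powr (real k * (p - 1)) * norm (d k x) powr p" for x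
    proof (cases "norm (d k x) \<le> (1/2)^k")
      case True
      then show ?thesis by (smt (verit) mult_nonneg_nonneg powr_ge_zero)
    next
      case False
      define n where "n = norm (d k x)"
      have n: "n > 2 powr (- real k)" using False by (simp add: n_def powr_minus powr_realpow power_divide field_simps)
      then have n0: "n > 0" using powr_gt_zero[of 2 "- real k"] by linarith
      have "n powr (1 - p) \<le> (2 powr (- real k)) powr (1 - p)"
        using n p by (intro powr_mono2') auto
      also have "\<dots> = 2 powr (real k * (p - 1))" by (simp add: powr_powr algebra_simps)
      finally have "n powr (1 - p) * n powr p \<le> 2 powr (real k * (p - 1)) * n powr p"
        by (intro mult_right_mono) auto
      moreover have "n powr (1 - p) * n powr p = n" using n0 by (simp flip: powr_add)
      ultimately show ?thesis by (auto simp: n_def intro: add_increasing)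
    qed
    have i: "integrable M (\<lambda>x. norm (d k x) powr p)" unfolding d_def by (rule dint)
    have "(\<integral>\<^sup>+x. ennreal (norm (d k x)) \<partial>M) \<le> (\<integral>\<^sup>+x. ennreal ((1/2)^k + 2 powr (real k * (p - 1)) * norm (d k x) powr p) \<partial>M)"
      by (intro nn_integral_mono ennreal_leI pw)
    also have "\<dots> = ennreal (LINT x|M. (1/2)^k + 2 powr (real k * (p - 1)) * norm (d k x) powr p)"
      by (rule nn_integral_eq_integral) (use i in auto)
    also have "(LINT x|M. (1/2)^k + 2 powr (real k * (p - 1)) * norm (d k x) powr p)
       = (1/2)^k * measure M (space M) + 2 powr (real k * (p - 1)) * Lp_int p M (d k)"
      using i by (simp add: Lp_int_def)
    also have "\<dots> \<le> (1/2)^k * measure M (space M) + 2 powr (real k * (p - 1)) * 2 powr (- real k * p)"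
      using N[of k "r (Suc k)" "r k"] rN[of k] rS[of k] unfolding d_def by (intro add_left_mono mult_left_mono) auto
    also have "2 powr (real k * (p - 1)) * 2 powr (- real k * p) = 2 powr (- real k)"
      by (simp add: algebra_simps flip: powr_add)
    also have "\<dots> = (1/2::real)^k"
      by (simp add: powr_minus powr_realpow power_one_over inverse_eq_divide)
    finally show ?thesis by (simp add: algebra_simps ennreal_leI)
  qed
  have "(\<integral>\<^sup>+x. (\<Sum>k. ennreal (norm (d k x))) \<partial>M) = (\<Sum>k. \<integral>\<^sup>+x. ennreal (norm (d k x)) \<partial>M)"
    by (rule nn_integral_suminf) measurable
  also have "\<dots> \<le> (\<Sum>k. ennreal ((1/2)^k * (measure M (space M) + 1)))"
    by (intro suminf_le dk) auto
  also have "\<dots> < \<infinity>"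
    by (subst suminf_ennreal2) (auto intro!: summable_mult2)
  finally have "(\<integral>\<^sup>+x. (\<Sum>k. ennreal (norm (d k x))) \<partial>M) \<noteq> \<infinity>" by simp
  then have "AE x in M. (\<Sum>k. ennreal (norm (d k x))) \<noteq> \<infinity>"
    by (intro nn_integral_PInf_AE) auto
  then have conv: "AE x in M. (\<lambda>k. F (r k) x) \<longlonglongrightarrow> lim (\<lambda>k. F (r k) x)"
  proof eventually_elim
    case (elim x)
    have "summable (\<lambda>k. norm (d k x))"
      using elim by (intro summable_suminf_not_top) auto
    then have "summable (\<lambda>k. d k x)" by (rule summable_norm_cancel)
    then have "convergent (\<lambda>n. \<Sum>k<n. d k x)" by (simp add: summable_iff_convergent)
    moreover have "(\<Sum>k<n. d k x) = F (r n) x - F (r 0) x" for n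
      unfolding d_def by (rule sum_lessThan_telescope)
    ultimately have "convergent (\<lambda>n. (F (r n) x - F (r 0) x) + F (r 0) x)"
      by (intro convergent_add) (auto simp: convergent_const)
    then show ?case by (simp add: convergent_LIMSEQ_iff)
  qed
  define G where "G x = lim (\<lambda>k. F (r k) x)" for x
  have [measurable]: "G \<in> borel_measurable M" unfolding G_def by measurable
  have fat: "(\<integral>\<^sup>+x. ennreal (norm (F j x - G x) powr p) \<partial>M) \<le> ennreal (2 powr (- real n * p))"
    if "j \<ge> r n" for j n
  proof -
    have "(\<integral>\<^sup>+x. ennreal (norm (F j x - G x) powr p) \<partial>M) =
      (\<integral>\<^sup>+x. liminf (\<lambda>k. ennreal (norm (F j x - F (r k) x) powr p)) \<partial>M)"
    proof (rule nn_integral_cong_AE)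
      show "AE x in M. ennreal (norm (F j x - G x) powr p) = liminf (\<lambda>k. ennreal (norm (F j x - F (r k) x) powr p))"
        using conv
      proof eventually_elim
        case (elim x)
        have "(\<lambda>k. norm (F j x - F (r k) x) powr p) \<longlonglongrightarrow> norm (F j x - G x) powr p"
          using p by (intro tendsto_powr' tendsto_intros elim[folded G_def]) auto
        then have "(\<lambda>k. ennreal (norm (F j x - F (r k) x) powr p)) \<longlonglongrightarrow> ennreal (norm (F j x - G x) powr p)"
          by (intro tendsto_ennrealI)
        then show ?case using lim_imp_Liminf[OF sequentially_bot] by metis
      qed
    qed
    also have "\<dots> \<le> liminf (\<lambda>k. \<integral>\<^sup>+x. ennreal (norm (F j x - F (r k) x) powr p) \<partial>M)"
      by (rule nn_integral_liminf) measurable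
    also have "\<dots> \<le> liminf (\<lambda>k. ennreal (2 powr (- real n * p)))"
    proof (rule Liminf_mono, rule eventually_sequentiallyI[of n])
      fix k assume "n \<le> k"
      have "(\<integral>\<^sup>+x. ennreal (norm (F j x - F (r k) x) powr p) \<partial>M) = ennreal (Lp_int p M (\<lambda>x. F j x - F (r k) x))"
        unfolding Lp_int_def by (rule nn_integral_eq_integral) (use dint in auto)
      also have "\<dots> \<le> ennreal (2 powr (- real n * p))"
        using N[of n j "r k"] that rN[of n] rmono[OF \<open>n \<le> k\<close>] by (intro ennreal_leI) auto
      finally show "(\<integral>\<^sup>+x. ennreal (norm (F j x - F (r k) x) powr p) \<partial>M) \<le> ennreal (2 powr (- real n * p))" .
    qed
    also have "\<dots> = ennreal (2 powr (- real n * p))" by (simp add: Liminf_const)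
    finally show ?thesis .
  qed
  have FG: "Lp_on p M (\<lambda>x. F j x - G x)" if "j \<ge> r n" for j n
    unfolding Lp_on_def using fat[OF that]
    by (auto intro!: integrableI_bounded simp: le_less_trans[OF _ ennreal_less_top])
  have "Lp_on p M (\<lambda>x. F (r 0) x - (F (r 0) x - G x))"
    by (rule Lp_on_diff(1)[OF F FG]) (use p in auto)
  then have G: "Lp_on p M G" by simp
  have le: "Lp_int p M (\<lambda>x. F j x - G x) \<le> 2 powr (- real n * p)" if "j \<ge> r n" for j n
  proof -
    have "ennreal (Lp_int p M (\<lambda>x. F j x - G x)) \<le> ennreal (2 powr (- real n * p))"
      using fat[OF that] FG[OF that] unfolding Lp_int_def Lp_on_def by (subst nn_integral_eq_integral[symmetric]) auto
    then show ?thesis by (simp add: ennreal_le_iff)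
  qed
  have "2 powr (- p) < (1::real)" using p powr_less_mono[of "- p" 0 "2::real"] by simp
  then have "(\<lambda>n. (2 powr (- p)) ^ n) \<longlonglongrightarrow> 0" by (intro LIMSEQ_realpow_zero) auto
  then have z: "(\<lambda>n. 2 powr (- real n * p)) \<longlonglongrightarrow> 0"
    by (simp add: powr_realpow[symmetric] powr_powr mult.commute)
  have "(\<lambda>k. Lp_int p M (\<lambda>x. F k x - G x)) \<longlonglongrightarrow> 0"
  proof (rule LIMSEQ_I)
    fix e :: real assume "e > 0"
    then obtain n where "2 powr (- real n * p) < e"
      using order_tendstoD(2)[OF z, of e] by (auto simp: eventually_sequentially)
    then show "\<exists>no. \<forall>k\<ge>no. norm (Lp_int p M (\<lambda>x. F k x - G x) - 0) < e"
      using le[of n] by (intro exI[of _ "r n"]) (auto simp: Lp_int_nonneg intro: le_less_trans)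
  qed
  with G show ?thesis by blast
qed

text \<open>Hoelder against the constant 1, which is integrable because the measure is
  finite.\<close>

lemma (in finite_measure) Lp_int_mono_exponent:
  assumes F: "Lp_on t M F" and st: "0 < s" "s < t"
  shows "Lp_on s M F" "Lp_int s M F \<le> Lp_int t M F powr (s / t) * measure M (space M) powr (1 - s / t)"
proof -
  have [measurable]: "F \<in> borel_measurable M" using F by (simp add: Lp_on_def)
  have i: "integrable M (\<lambda>x. norm (F x) powr t)" using F by (simp add: Lp_on_def)
  have st': "0 < s / t" "s / t < 1" using st by auto
  have eq: "(norm (F x) powr t) powr (s / t) * 1 powr (1 - s / t) = norm (F x) powr s" for x
    using st by (simp add: powr_powr)
  note H = Holder_integral[OF i, of "\<lambda>x. 1" "s / t", OF _ _ _ st', unfolded eq]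
  show "Lp_on s M F" using H(1) by (simp add: Lp_on_def)
  show "Lp_int s M F \<le> Lp_int t M F powr (s / t) * measure M (space M) powr (1 - s / t)"
    using H(2) by (simp add: Lp_int_def)
qed

lemma (in finite_measure) Lp_lim_mono_exponent:
  assumes F: "\<And>k. Lp_on t M (F k)" "Lp_on t M G" and st: "0 < s" "s < t"
    and lim: "(\<lambda>k. Lp_int t M (\<lambda>x. F k x - G x)) \<longlonglongrightarrow> 0"
  shows "(\<lambda>k. Lp_int s M (\<lambda>x. F k x - G x)) \<longlonglongrightarrow> 0"
proof (rule tendsto_sandwich)
  show "\<forall>\<^sub>F k in sequentially. 0 \<le> Lp_int s M (\<lambda>x. F k x - G x)" by (simp add: Lp_int_nonneg)
  show "\<forall>\<^sub>F k in sequentially. Lp_int s M (\<lambda>x. F k x - G x)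
     \<le> Lp_int t M (\<lambda>x. F k x - G x) powr (s / t) * measure M (space M) powr (1 - s / t)"
    using Lp_int_mono_exponent(2)[OF Lp_on_diff(1)[OF F(1) F(2)] st] st by auto
  have "(\<lambda>k. Lp_int t M (\<lambda>x. F k x - G x) powr (s / t) * measure M (space M) powr (1 - s / t))
     \<longlonglongrightarrow> 0 powr (s / t) * measure M (space M) powr (1 - s / t)"
    using st by (intro tendsto_intros tendsto_powr' lim) (auto simp: Lp_int_nonneg)
  then show "(\<lambda>k. Lp_int t M (\<lambda>x. F k x - G x) powr (s / t) * measure M (space M) powr (1 - s / t)) \<longlonglongrightarrow> 0"
    by simp
qed auto

lemma L2_inner:
  fixes F G :: "'a \<Rightarrow> 'b::euclidean_space"
  assumes F: "Lp_on 2 M F" and G: "Lp_on 2 M G"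
  shows "integrable M (\<lambda>x. norm (F x) * norm (G x))" "integrable M (\<lambda>x. F x \<bullet> G x)"
    "(LINT x|M. norm (F x) * norm (G x)) \<le> sqrt (Lp_int 2 M F) * sqrt (Lp_int 2 M G)"
    "\<bar>LINT x|M. F x \<bullet> G x\<bar> \<le> sqrt (Lp_int 2 M F) * sqrt (Lp_int 2 M G)"
proof -
  have [measurable]: "F \<in> borel_measurable M" "G \<in> borel_measurable M" using F G by (auto simp: Lp_on_def)
  have i: "integrable M (\<lambda>x. (norm (F x))\<^sup>2)" "integrable M (\<lambda>x. (norm (G x))\<^sup>2)" using F G by (auto simp: Lp_on_def)
  have eq: "((norm (F x))\<^sup>2) powr (1/2) * ((norm (G x))\<^sup>2) powr (1 - 1/2) = norm (F x) * norm (G x)" for x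
    by (simp add: powr_half_sqrt)
  note H = Holder_integral[OF i, of "1/2", unfolded eq]
  show 1: "integrable M (\<lambda>x. norm (F x) * norm (G x))" using H(1) by simp
  show 3: "(LINT x|M. norm (F x) * norm (G x)) \<le> sqrt (Lp_int 2 M F) * sqrt (Lp_int 2 M G)"
    using H(2) by (simp add: powr_half_sqrt Lp_int_def)
  show 2: "integrable M (\<lambda>x. F x \<bullet> G x)"
    by (rule Bochner_Integration.integrable_bound[OF 1]) (auto simp: Cauchy_Schwarz_ineq2)
  have "\<bar>LINT x|M. F x \<bullet> G x\<bar> \<le> (LINT x|M. \<bar>F x \<bullet> G x\<bar>)" by (rule integral_abs_bound)
  also have "\<dots> \<le> (LINT x|M. norm (F x) * norm (G x))"
    using 1 2 by (intro integral_mono) (auto simp: Cauchy_Schwarz_ineq2)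
  finally show "\<bar>LINT x|M. F x \<bullet> G x\<bar> \<le> sqrt (Lp_int 2 M F) * sqrt (Lp_int 2 M G)" using 3 by simp
qed

lemma L2_inner_lim:
  fixes F :: "nat \<Rightarrow> 'a \<Rightarrow> 'b::euclidean_space"
  assumes F: "\<And>k. Lp_on 2 M (F k)" and F': "Lp_on 2 M F'" and G: "Lp_on 2 M G"
    and lim: "(\<lambda>k. Lp_int 2 M (\<lambda>x. F k x - F' x)) \<longlonglongrightarrow> 0"
  shows "(\<lambda>k. LINT x|M. F k x \<bullet> G x) \<longlonglongrightarrow> (LINT x|M. F' x \<bullet> G x)"
proof (rule Lim_null[THEN iffD2], rule tendsto_sandwich)
  have eq: "(LINT x|M. F k x \<bullet> G x) - (LINT x|M. F' x \<bullet> G x) = (LINT x|M. (F k x - F' x) \<bullet> G x)" for k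
    using L2_inner(2)[OF F G] L2_inner(2)[OF F' G] by (simp add: inner_diff_left)
  have b: "\<bar>(LINT x|M. F k x \<bullet> G x) - (LINT x|M. F' x \<bullet> G x)\<bar> \<le> sqrt (Lp_int 2 M (\<lambda>x. F k x - F' x)) * sqrt (Lp_int 2 M G)" for k
    unfolding eq by (rule L2_inner(4)[OF Lp_on_diff(1)[OF F F'] G]) simp
  show "\<forall>\<^sub>F k in sequentially. - (sqrt (Lp_int 2 M (\<lambda>x. F k x - F' x)) * sqrt (Lp_int 2 M G)) \<le> (LINT x|M. F k x \<bullet> G x) - (LINT x|M. F' x \<bullet> G x)"
    using b by (intro always_eventually allI) (smt (verit))
  show "\<forall>\<^sub>F k in sequentially. (LINT x|M. F k x \<bullet> G x) - (LINT x|M. F' x \<bullet> G x) \<le> (sqrt (Lp_int 2 M (\<lambda>x. F k x - F' x)) * sqrt (Lp_int 2 M G))"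
    using b by (intro always_eventually allI) (smt (verit))
  have "(\<lambda>k. sqrt (Lp_int 2 M (\<lambda>x. F k x - F' x)) * sqrt (Lp_int 2 M G)) \<longlonglongrightarrow> sqrt 0 * sqrt (Lp_int 2 M G)"
    by (intro tendsto_intros lim)
  then show *: "(\<lambda>k. sqrt (Lp_int 2 M (\<lambda>x. F k x - F' x)) * sqrt (Lp_int 2 M G)) \<longlonglongrightarrow> 0" by simp
  show "(\<lambda>k. - (sqrt (Lp_int 2 M (\<lambda>x. F k x - F' x)) * sqrt (Lp_int 2 M G))) \<longlonglongrightarrow> 0"
    using tendsto_minus[OF *] by simp
qed

text \<open>Expanding the square writes the norm of \<open>F k\<close> through its distance to
  \<open>F'\<close> and an inner product with \<open>F'\<close>, and both converge.\<close>

lemma L2_norm_lim: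
  fixes F :: "nat \<Rightarrow> 'a \<Rightarrow> 'b::euclidean_space"
  assumes F: "\<And>k. Lp_on 2 M (F k)" and F': "Lp_on 2 M F'"
    and lim: "(\<lambda>k. Lp_int 2 M (\<lambda>x. F k x - F' x)) \<longlonglongrightarrow> 0"
  shows "(\<lambda>k. Lp_int 2 M (F k)) \<longlonglongrightarrow> Lp_int 2 M F'"
proof -
  have eq: "Lp_int 2 M (F k) = Lp_int 2 M (\<lambda>x. F k x - F' x) + 2 * (LINT x|M. F k x \<bullet> F' x) - Lp_int 2 M F'" for k
  proof -
    have i: "integrable M (\<lambda>x. (norm (F k x))\<^sup>2)" "integrable M (\<lambda>x. (norm (F' x))\<^sup>2)" using F[of k] F' by (auto simp: Lp_on_def)
    have "Lp_int 2 M (\<lambda>x. F k x - F' x) = (LINT x|M. (norm (F k x))\<^sup>2 - 2 * (F k x \<bullet> F' x) + (norm (F' x))\<^sup>2)"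
      by (simp add: Lp_int_def power2_norm_eq_inner inner_diff_left inner_diff_right inner_commute algebra_simps)
    also have "\<dots> = Lp_int 2 M (F k) - 2 * (LINT x|M. F k x \<bullet> F' x) + Lp_int 2 M F'"
      using i L2_inner(2)[OF F F'] by (simp add: Lp_int_def)
    finally show ?thesis by simp
  qed
  have "(LINT x|M. F' x \<bullet> F' x) = Lp_int 2 M F'" by (simp add: Lp_int_def power2_norm_eq_inner)
  then have "(\<lambda>k. Lp_int 2 M (\<lambda>x. F k x - F' x) + 2 * (LINT x|M. F k x \<bullet> F' x) - Lp_int 2 M F') \<longlonglongrightarrow> 0 + 2 * Lp_int 2 M F' - Lp_int 2 M F'"
    using L2_inner_lim[OF F F' F' lim] by (intro tendsto_intros lim) auto
  then show ?thesis by (simp add: eq)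
qed

section \<open>Translations along the Grushin fields\<close>

text \<open>The gradient is carried as an explicit function on the whole space, so that it can be
  computed with directly; \<open>gradient\<close> is a definite description.\<close>

definition C1_pair :: "('a::euclidean_space \<Rightarrow> real) \<Rightarrow> ('a \<Rightarrow> 'a) \<Rightarrow> bool" where
  "C1_pair v g \<longleftrightarrow> (\<forall>X. GDERIV v X :> g X) \<and> continuous_on UNIV g"

lemma C1_pair_cont: "C1_pair v g \<Longrightarrow> continuous_on S v"
  unfolding C1_pair_def gderiv_def
  by (meson continuous_at_imp_continuous_on has_derivative_continuous)

lemma C1_pair_cont_grad: "C1_pair v g \<Longrightarrow> continuous_on S g"
  unfolding C1_pair_def by (meson continuous_on_subset subset_UNIV)

lemma C1_pair_measurable:
  assumes "C1_pair v g"
  shows "v \<in> borel_measurable borel" "g \<in> borel_measurable borel"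
  using C1_pair_cont[OF assms] C1_pair_cont_grad[OF assms] by (auto intro: borel_measurable_continuous_onI)

lemma nn_integral_lborel_shift:
  assumes [measurable]: "f \<in> borel_measurable borel"
  shows "(\<integral>\<^sup>+X. f (X + c) \<partial>lborel) = (\<integral>\<^sup>+X. f (X::'a::euclidean_space) \<partial>lborel)"
proof -
  have "(\<integral>\<^sup>+X. f X \<partial>lborel) = (\<integral>\<^sup>+X. f X \<partial>distr lborel borel ((+) c))"
    by (simp add: lborel_distr_plus)
  also have "\<dots> = (\<integral>\<^sup>+X. f (c + X) \<partial>lborel)" by (rule nn_integral_distr) auto
  finally show ?thesis by (simp add: add.commute)
qed

text \<open>Fundamental theorem of calculus along the segment from X to X + e, then Cauchy-Schwarz
  against the indicator of [0, 1]. Extended nonnegative values allow the bound to be integrated over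
  X by Tonelli without side conditions.\<close>

lemma C1_pair_difference_le:
  fixes v :: "'a::euclidean_space \<Rightarrow> real"
  assumes "C1_pair v g"
  shows "ennreal ((v (X + e) - v X)\<^sup>2) \<le> (\<integral>\<^sup>+t. ennreal ((g (X + t *\<^sub>R e) \<bullet> e)\<^sup>2) * indicator {0..1} t \<partial>lborel)"
proof -
  define f where "f t = g (X + t *\<^sub>R e) \<bullet> e" for t :: real
  define F where "F t = f t * indicator {0..1} t" for t
  have f: "continuous_on S f" for S unfolding f_def
    by (intro continuous_intros continuous_on_compose2[OF C1_pair_cont_grad[OF assms, of UNIV]]) auto
  have D: "((\<lambda>t. v (X + t *\<^sub>R e)) has_real_derivative f t) (at t)" for t
  proof -
    have 1: "((\<lambda>t. X + t *\<^sub>R e) has_derivative (\<lambda>s. s *\<^sub>R e)) (at t)" by (auto intro!: derivative_eq_intros)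
    have 2: "(v has_derivative (\<lambda>h. h \<bullet> g (X + t *\<^sub>R e))) (at (X + t *\<^sub>R e))"
      using assms by (auto simp: C1_pair_def gderiv_def)
    show ?thesis using has_derivative_compose[OF 1 2]
      by (simp add: has_field_derivative_def f_def inner_commute mult_commute_abs)
  qed
  have [measurable]: "f \<in> borel_measurable borel" by (rule borel_measurable_continuous_onI[OF f])
  have [measurable]: "F \<in> borel_measurable borel" unfolding F_def by measurable
  have FTC: "(LINT t|lborel. F t) = v (X + e) - v X" unfolding F_def
    using integral_FTC_Icc_real[of 0 1 "\<lambda>t. v (X + t *\<^sub>R e)" f] D f[of UNIV] continuous_on_eq_continuous_at[of UNIV f] by auto
  have F2: "Lp_on 2 lborel F"
  proof -
    have "integrable lborel (\<lambda>x. indicator {0..1} x *\<^sub>R (f x)\<^sup>2)"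
      by (rule borel_integrable_compact) (auto intro!: continuous_intros f)
    moreover have "(\<lambda>x. indicator {0..1} x *\<^sub>R (f x)\<^sup>2) = (\<lambda>x. norm (F x) powr 2)"
      by (auto simp: F_def indicator_def fun_eq_iff)
    ultimately show ?thesis unfolding Lp_on_def by simp
  qed
  have I2: "Lp_on 2 lborel (\<lambda>t::real. indicator {0..1} t :: real)"
  proof -
    have "(\<lambda>t::real. norm (indicator {0..1} t :: real) powr 2) = indicator {0..1}"
      by (auto simp: indicator_def fun_eq_iff)
    then show ?thesis unfolding Lp_on_def by simp
  qed
  have "LINT t|lborel. (indicator {0..1} (t::real) :: real)\<^sup>2 = 1"
    by (simp add: power2_eq_square flip: indicator_inter_arith)
  then have one: "Lp_int 2 lborel (\<lambda>t::real. indicator {0..1} t :: real) = 1"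
    by (simp add: Lp_int_def content_real)
  have "\<bar>v (X + e) - v X\<bar> \<le> sqrt (Lp_int 2 lborel F)"
    using L2_inner(4)[OF F2 I2] FTC by (simp add: one F_def mult.assoc flip: indicator_inter_arith)
  then have "(v (X + e) - v X)\<^sup>2 \<le> Lp_int 2 lborel F"
    by (metis Lp_int_nonneg abs_ge_zero power2_abs power_mono real_sqrt_pow2)
  then have "ennreal ((v (X + e) - v X)\<^sup>2) \<le> ennreal (Lp_int 2 lborel F)" by (rule ennreal_leI)
  also have "\<dots> = (\<integral>\<^sup>+t. ennreal ((F t)\<^sup>2) \<partial>lborel)"
    using F2 by (auto simp: Lp_int_def Lp_on_def intro!: nn_integral_eq_integral[symmetric])
  also have "\<dots> = (\<integral>\<^sup>+t. ennreal ((g (X + t *\<^sub>R e) \<bullet> e)\<^sup>2) * indicator {0..1} t \<partial>lborel)"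
    by (intro nn_integral_cong) (auto simp: F_def f_def indicator_def)
  finally show ?thesis .
qed

text \<open>The segment bound is integrated over B, the integrals are exchanged, and for each t
  translation invariance moves the inner integral to a shifted copy of B, which stays inside
  B'.\<close>

lemma C1_pair_shift_L2:
  fixes v :: "'a::euclidean_space \<Rightarrow> real"
  assumes v: "C1_pair v g" and [measurable]: "B \<in> sets borel" "B' \<in> sets borel"
    and B: "\<And>X t. X \<in> B \<Longrightarrow> 0 \<le> t \<Longrightarrow> t \<le> 1 \<Longrightarrow> X + t *\<^sub>R e \<in> B'"
  shows "(\<integral>\<^sup>+X. ennreal ((v (X + e) - v X)\<^sup>2) * indicator B X \<partial>lborel)
    \<le> (\<integral>\<^sup>+X. ennreal ((g X \<bullet> e)\<^sup>2) * indicator B' X \<partial>lborel)"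
proof -
  have [measurable]: "v \<in> borel_measurable borel" "g \<in> borel_measurable borel" using C1_pair_measurable[OF v] by auto
  let ?f = "\<lambda>X t. ennreal ((g (X + t *\<^sub>R e) \<bullet> e)\<^sup>2) * indicator {0..1} t * indicator B X"
  let ?R = "\<integral>\<^sup>+X. ennreal ((g X \<bullet> e)\<^sup>2) * indicator B' X \<partial>lborel"
  have "(\<integral>\<^sup>+X. ennreal ((v (X + e) - v X)\<^sup>2) * indicator B X \<partial>lborel)
    \<le> (\<integral>\<^sup>+X. (\<integral>\<^sup>+t. ennreal ((g (X + t *\<^sub>R e) \<bullet> e)\<^sup>2) * indicator {0..1} t \<partial>lborel) * indicator B X \<partial>lborel)"
    by (intro nn_integral_mono mult_right_mono C1_pair_difference_le[OF v]) auto
  also have "\<dots> = (\<integral>\<^sup>+X. (\<integral>\<^sup>+t. ?f X t \<partial>lborel) \<partial>lborel)"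
    by (intro nn_integral_cong nn_integral_multc[symmetric]) measurable
  also have "\<dots> = (\<integral>\<^sup>+t. (\<integral>\<^sup>+X. ?f X t \<partial>lborel) \<partial>lborel)"
    by (rule lborel_pair.Fubini'[symmetric]) measurable
  also have "\<dots> \<le> (\<integral>\<^sup>+t. ?R * indicator {0..1::real} t \<partial>lborel)"
  proof (rule nn_integral_mono)
    fix t :: real
    have "(\<integral>\<^sup>+X. ?f X t \<partial>lborel) \<le> (\<integral>\<^sup>+X. (ennreal ((g (X + t *\<^sub>R e) \<bullet> e)\<^sup>2) * indicator B' (X + t *\<^sub>R e)) * indicator {0..1} t \<partial>lborel)"
      using B by (intro nn_integral_mono) (auto simp: indicator_def)
    also have "\<dots> = (\<integral>\<^sup>+X. (ennreal ((g (X + t *\<^sub>R e) \<bullet> e)\<^sup>2) * indicator B' (X + t *\<^sub>R e)) \<partial>lborel) * indicator {0..1} t"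
      by (rule nn_integral_multc) measurable
    also have "(\<integral>\<^sup>+X. (ennreal ((g (X + t *\<^sub>R e) \<bullet> e)\<^sup>2) * indicator B' (X + t *\<^sub>R e)) \<partial>lborel) = ?R"
      by (rule nn_integral_lborel_shift) measurable
    finally show "(\<integral>\<^sup>+X. ?f X t \<partial>lborel) \<le> ?R * indicator {0..1} t" .
  qed
  also have "\<dots> = ?R" by (subst nn_integral_cmult) auto
  finally show ?thesis .
qed

lemma norm_grushin_sqrtA_sq:
  "(norm (grushin_sqrtA lam X h))\<^sup>2 = (fst h)\<^sup>2 + (\<bar>fst X\<bar> powr lam)\<^sup>2 * (norm (snd h))\<^sup>2"
  by (simp add: grushin_sqrtA_def norm_prod_def power_mult_distrib)

lemma continuous_on_grushin_sqrtA:
  assumes "0 < lam" "continuous_on S g" "continuous_on S X"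
  shows "continuous_on S (\<lambda>x. grushin_sqrtA lam (X x) (g x))"
  unfolding grushin_sqrtA_def using assms by (intro continuous_intros continuous_on_powr') auto

lemma grushin_shift_x:
  fixes v :: "real \<times> (real ^ 'm) \<Rightarrow> real"
  assumes v: "C1_pair v g" and lam: "0 < lam" and m: "B \<in> sets borel" "B' \<in> sets borel"
    and B: "\<And>X t. X \<in> B \<Longrightarrow> 0 \<le> t \<Longrightarrow> t \<le> 1 \<Longrightarrow> X + (t * h, 0) \<in> B'"
  shows "(\<integral>\<^sup>+X. ennreal ((v (X + (h, 0)) - v X)\<^sup>2) * indicator B X \<partial>lborel)
    \<le> ennreal (h\<^sup>2) * (\<integral>\<^sup>+X. ennreal ((norm (grushin_sqrtA lam X (g X)))\<^sup>2) * indicator B' X \<partial>lborel)"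
proof -
  have [measurable]: "g \<in> borel_measurable borel" using C1_pair_measurable[OF v] by auto
  have [measurable]: "(\<lambda>X. grushin_sqrtA lam X (g X)) \<in> borel_measurable borel"
    by (intro borel_measurable_continuous_onI continuous_on_grushin_sqrtA lam C1_pair_cont_grad[OF v]) auto
  note [measurable] = m
  have pw: "(g X \<bullet> (h, 0))\<^sup>2 \<le> h\<^sup>2 * (norm (grushin_sqrtA lam X (g X)))\<^sup>2" for X
    by (simp add: norm_grushin_sqrtA_sq inner_prod_def power_mult_distrib algebra_simps)
  have "(\<integral>\<^sup>+X. ennreal ((v (X + (h, 0)) - v X)\<^sup>2) * indicator B X \<partial>lborel)
    \<le> (\<integral>\<^sup>+X. ennreal ((g X \<bullet> (h, 0))\<^sup>2) * indicator B' X \<partial>lborel)"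
    using B by (intro C1_pair_shift_L2[OF v m]) auto
  also have "\<dots> \<le> (\<integral>\<^sup>+X. ennreal (h\<^sup>2) * (ennreal ((norm (grushin_sqrtA lam X (g X)))\<^sup>2) * indicator B' X) \<partial>lborel)"
    using pw by (intro nn_integral_mono)
       (auto simp: indicator_def simp flip: ennreal_mult intro!: ennreal_leI)
  also have "\<dots> = ennreal (h\<^sup>2) * (\<integral>\<^sup>+X. ennreal ((norm (grushin_sqrtA lam X (g X)))\<^sup>2) * indicator B' X \<partial>lborel)"
    by (rule nn_integral_cmult) measurable
  finally show ?thesis .
qed

text \<open>The energy controls y-derivatives only at the price of |x|^(-lam), hence the lower bound
  d for |x| on all of B'.\<close>

lemma grushin_shift_y:
  fixes v :: "real \<times> (real ^ 'm) \<Rightarrow> real"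
  assumes v: "C1_pair v g" and lam: "0 < lam" and m: "B \<in> sets borel" "B' \<in> sets borel"
    and B: "\<And>X t. X \<in> B \<Longrightarrow> 0 \<le> t \<Longrightarrow> t \<le> 1 \<Longrightarrow> X + (0, t *\<^sub>R k) \<in> B'"
    and d: "0 < d" and Bd: "\<And>X. X \<in> B' \<Longrightarrow> d \<le> \<bar>fst X\<bar>"
  shows "(\<integral>\<^sup>+X. ennreal ((v (X + (0, k)) - v X)\<^sup>2) * indicator B X \<partial>lborel)
    \<le> ennreal ((norm k / d powr lam)\<^sup>2) * (\<integral>\<^sup>+X. ennreal ((norm (grushin_sqrtA lam X (g X)))\<^sup>2) * indicator B' X \<partial>lborel)"
proof -
  have [measurable]: "g \<in> borel_measurable borel" using C1_pair_measurable[OF v] by auto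
  have [measurable]: "(\<lambda>X. grushin_sqrtA lam X (g X)) \<in> borel_measurable borel"
    by (intro borel_measurable_continuous_onI continuous_on_grushin_sqrtA lam C1_pair_cont_grad[OF v]) auto
  note [measurable] = m
  have pw: "(g X \<bullet> (0, k))\<^sup>2 \<le> (norm k / d powr lam)\<^sup>2 * (norm (grushin_sqrtA lam X (g X)))\<^sup>2" if "X \<in> B'" for X
  proof -
    have "(g X \<bullet> (0, k))\<^sup>2 = (snd (g X) \<bullet> k)\<^sup>2" by (simp add: inner_prod_def)
    also have "\<dots> \<le> (norm (snd (g X)) * norm k)\<^sup>2"
      using Cauchy_Schwarz_ineq2[of "snd (g X)" k] by (metis abs_ge_zero power2_abs power_mono)
    also have "\<dots> = (norm k / d powr lam)\<^sup>2 * ((d powr lam)\<^sup>2 * (norm (snd (g X)))\<^sup>2)"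
      using d by (simp add: power_mult_distrib power_divide)
    also have "\<dots> \<le> (norm k / d powr lam)\<^sup>2 * (norm (grushin_sqrtA lam X (g X)))\<^sup>2"
    proof (rule mult_left_mono)
      have "d powr lam \<le> \<bar>fst X\<bar> powr lam" using Bd[OF that] d lam by (intro powr_mono2) auto
      then have "(d powr lam)\<^sup>2 * (norm (snd (g X)))\<^sup>2 \<le> (\<bar>fst X\<bar> powr lam)\<^sup>2 * (norm (snd (g X)))\<^sup>2"
        by (intro mult_right_mono power_mono) auto
      then show "(d powr lam)\<^sup>2 * (norm (snd (g X)))\<^sup>2 \<le> (norm (grushin_sqrtA lam X (g X)))\<^sup>2"
        unfolding norm_grushin_sqrtA_sq by (smt (verit) zero_le_power2)
    qed simp
    finally show ?thesis .
  qed
  have "(\<integral>\<^sup>+X. ennreal ((v (X + (0, k)) - v X)\<^sup>2) * indicator B X \<partial>lborel)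
    \<le> (\<integral>\<^sup>+X. ennreal ((g X \<bullet> (0, k))\<^sup>2) * indicator B' X \<partial>lborel)"
    using B by (intro C1_pair_shift_L2[OF v m]) auto
  also have "\<dots> \<le> (\<integral>\<^sup>+X. ennreal ((norm k / d powr lam)\<^sup>2) * (ennreal ((norm (grushin_sqrtA lam X (g X)))\<^sup>2) * indicator B' X) \<partial>lborel)"
    using pw by (intro nn_integral_mono)
       (auto simp: indicator_def simp flip: ennreal_mult intro!: ennreal_leI)
  also have "\<dots> = ennreal ((norm k / d powr lam)\<^sup>2) * (\<integral>\<^sup>+X. ennreal ((norm (grushin_sqrtA lam X (g X)))\<^sup>2) * indicator B' X \<partial>lborel)"
    by (rule nn_integral_cmult) measurable
  finally show ?thesis .
qed

lemma nn_integral_add_sq_le: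
  fixes p q :: "'a \<Rightarrow> real"
  assumes [measurable]: "p \<in> borel_measurable M" "q \<in> borel_measurable M" "B \<in> sets M"
  shows "(\<integral>\<^sup>+X. ennreal ((p X + q X)\<^sup>2) * indicator B X \<partial>M)
    \<le> 2 * (\<integral>\<^sup>+X. ennreal ((p X)\<^sup>2) * indicator B X \<partial>M) + 2 * (\<integral>\<^sup>+X. ennreal ((q X)\<^sup>2) * indicator B X \<partial>M)"
proof -
  have "(a + b)\<^sup>2 \<le> 2 * a\<^sup>2 + 2 * b\<^sup>2" for a b :: real
    using sum_squares_bound[of a b] by (simp add: power2_sum)
  then have "ennreal ((a + b)\<^sup>2) \<le> ennreal (2 * a\<^sup>2 + 2 * b\<^sup>2)" for a b :: real by (intro ennreal_leI)
  then have *: "ennreal ((a + b)\<^sup>2) \<le> 2 * ennreal (a\<^sup>2) + 2 * ennreal (b\<^sup>2)" for a b :: real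
    by (simp add: ennreal_mult)
  have "(\<integral>\<^sup>+X. ennreal ((p X + q X)\<^sup>2) * indicator B X \<partial>M)
    \<le> (\<integral>\<^sup>+X. 2 * (ennreal ((p X)\<^sup>2) * indicator B X) + 2 * (ennreal ((q X)\<^sup>2) * indicator B X) \<partial>M)"
    using * by (intro nn_integral_mono) (auto simp: indicator_def)
  also have "\<dots> = 2 * (\<integral>\<^sup>+X. ennreal ((p X)\<^sup>2) * indicator B X \<partial>M) + 2 * (\<integral>\<^sup>+X. ennreal ((q X)\<^sup>2) * indicator B X \<partial>M)"
    by (simp add: nn_integral_add nn_integral_cmult)
  finally show ?thesis .
qed

text \<open>The step in x comes first. \<open>B2\<close> only has to contain the y-segments that
  start after it, so B itself may meet the degenerate set x = 0.\<close>

lemma grushin_shift_xy: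
  fixes v :: "real \<times> (real ^ 'm) \<Rightarrow> real"
  assumes v: "C1_pair v g" and lam: "0 < lam"
    and m: "B \<in> sets borel" "B1 \<in> sets borel" "B2 \<in> sets borel"
    and B1: "\<And>X t. X \<in> B \<Longrightarrow> 0 \<le> t \<Longrightarrow> t \<le> 1 \<Longrightarrow> X + (t * h, 0) \<in> B1"
    and B2: "\<And>X t. X \<in> B \<Longrightarrow> 0 \<le> t \<Longrightarrow> t \<le> 1 \<Longrightarrow> X + (h, t *\<^sub>R k) \<in> B2"
    and d: "0 < d" and Bd: "\<And>X. X \<in> B2 \<Longrightarrow> d \<le> \<bar>fst X\<bar>"
  shows "(\<integral>\<^sup>+X. ennreal ((v (X + (h, k)) - v X)\<^sup>2) * indicator B X \<partial>lborel)
    \<le> 2 * (ennreal ((norm k / d powr lam)\<^sup>2) * (\<integral>\<^sup>+X. ennreal ((norm (grushin_sqrtA lam X (g X)))\<^sup>2) * indicator B2 X \<partial>lborel))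
     + 2 * (ennreal (h\<^sup>2) * (\<integral>\<^sup>+X. ennreal ((norm (grushin_sqrtA lam X (g X)))\<^sup>2) * indicator B1 X \<partial>lborel))"
proof -
  have [measurable]: "v \<in> borel_measurable borel" using C1_pair_measurable[OF v] by auto
  note [measurable] = m
  \<comment> \<open>B translated by (h, 0): the starting points of the y-step.\<close>
  define B' where "B' = (\<lambda>X. X - (h, 0)) -` B"
  have B'[measurable]: "B' \<in> sets borel"
    using measurable_sets[of "\<lambda>X. X - (h, 0::real^'m)" borel borel B] m by (simp add: B'_def)
  have eq: "(h, k) = (h, 0) + (0, k)" by simp
  let ?D = "\<lambda>B. \<integral>\<^sup>+X. ennreal ((norm (grushin_sqrtA lam X (g X)))\<^sup>2) * indicator B X \<partial>lborel"
  have "(\<integral>\<^sup>+X. ennreal ((v (X + (h, k)) - v (X + (h, 0)))\<^sup>2) * indicator B X \<partial>lborel)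
     = (\<integral>\<^sup>+X. (\<lambda>X. ennreal ((v (X + (0, k)) - v X)\<^sup>2) * indicator B' X) (X + (h, 0)) \<partial>lborel)"
    by (intro nn_integral_cong) (simp add: B'_def indicator_def add.assoc)
  also have "\<dots> = (\<integral>\<^sup>+X. ennreal ((v (X + (0, k)) - v X)\<^sup>2) * indicator B' X \<partial>lborel)"
    by (intro nn_integral_lborel_shift) measurable
  also have "\<dots> \<le> ennreal ((norm k / d powr lam)\<^sup>2) * ?D B2"
  proof (rule grushin_shift_y[OF v lam B' m(3) _ d Bd])
    fix X :: "real \<times> (real ^ 'm)" and t :: real assume "X \<in> B'" "0 \<le> t" "t \<le> 1"
    then have "(X - (h, 0)) + (h, t *\<^sub>R k) \<in> B2" by (intro B2) (auto simp: B'_def)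
    moreover have "(X - (h, 0)) + (h, t *\<^sub>R k) = X + (0, t *\<^sub>R k)" by (simp add: prod_eq_iff)
    ultimately show "X + (0, t *\<^sub>R k) \<in> B2" by simp
  qed
  finally have 1: "(\<integral>\<^sup>+X. ennreal ((v (X + (h, k)) - v (X + (h, 0)))\<^sup>2) * indicator B X \<partial>lborel)
     \<le> ennreal ((norm k / d powr lam)\<^sup>2) * ?D B2" .
  have 2: "(\<integral>\<^sup>+X. ennreal ((v (X + (h, 0)) - v X)\<^sup>2) * indicator B X \<partial>lborel) \<le> ennreal (h\<^sup>2) * ?D B1"
    by (rule grushin_shift_x[OF v lam m(1,2) B1])
  have "(\<integral>\<^sup>+X. ennreal ((v (X + (h, k)) - v X)\<^sup>2) * indicator B X \<partial>lborel)
     = (\<integral>\<^sup>+X. ennreal (((v (X + (h, k)) - v (X + (h, 0))) + (v (X + (h, 0)) - v X))\<^sup>2) * indicator B X \<partial>lborel)" by simp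
  also have "\<dots> \<le> 2 * (\<integral>\<^sup>+X. ennreal ((v (X + (h, k)) - v (X + (h, 0)))\<^sup>2) * indicator B X \<partial>lborel)
     + 2 * (\<integral>\<^sup>+X. ennreal ((v (X + (h, 0)) - v X)\<^sup>2) * indicator B X \<partial>lborel)"
    by (rule nn_integral_add_sq_le) measurable
  also have "\<dots> \<le> 2 * (ennreal ((norm k / d powr lam)\<^sup>2) * ?D B2) + 2 * (ennreal (h\<^sup>2) * ?D B1)"
    by (rule add_mono; rule mult_left_mono) (use 1 2 in auto)
  finally show ?thesis .
qed

section \<open>The Sobolev inequality\<close>

text \<open>For \<open>s X\<^sub>1 \<ge> 0\<close> and \<open>e\<close> in this box, \<open>X + e\<close> is reached by a step in \<open>x\<close> of size about \<open>\<rho>\<close>, which leaves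
  the degenerate set, and then a step in \<open>y\<close> of length at most \<open>m \<rho>\<^sup>1\<^sup>+\<^sup>\<lambda>\<close>, where the coefficient \<open>\<bar>x\<bar>\<^sup>\<lambda>\<close> is at least \<open>\<rho>\<^sup>\<lambda>\<close>.
  Its volume is \<open>\<rho>\<^sup>Q\<close>, which is how the homogeneous dimension \<open>Q\<close> enters.\<close>

definition grushin_box :: "real \<Rightarrow> real \<Rightarrow> real \<Rightarrow> (real \<times> (real ^ 'm)) set" where
  "grushin_box lam s \<rho> = {e. \<rho> \<le> s * fst e \<and> s * fst e \<le> 2 * \<rho> \<and> snd e \<in> cbox 0 ((\<rho> powr (1 + lam)) *\<^sub>R One)}"

lemma emeasure_grushin_box:
  assumes "s = 1 \<or> s = -1" "0 < \<rho>"
  shows "emeasure lborel (grushin_box lam s \<rho> :: (real \<times> (real ^ 'm)) set)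
     = ennreal (\<rho> powr ((real CARD('m) + 1) + lam * real CARD('m)))"
    and "grushin_box lam s \<rho> \<in> sets (borel :: (real \<times> (real ^ 'm)) measure)"
proof -
  define I where "I = (if s = 1 then {\<rho>..2*\<rho>} else {-2*\<rho>..-\<rho>})"
  define C where "C = cbox (0::real^'m) ((\<rho> powr (1 + lam)) *\<^sub>R One)"
  have eq: "grushin_box lam s \<rho> = I \<times> C" using assms by (auto simp: grushin_box_def I_def C_def)
  have [measurable]: "I \<in> sets borel" "C \<in> sets borel" by (auto simp: I_def C_def)
  have eI: "emeasure lborel I = ennreal \<rho>" using assms by (auto simp: I_def)
  have eC: "emeasure lborel C = ennreal ((\<rho> powr (1 + lam)) ^ CARD('m))"
    unfolding C_def by (subst emeasure_lborel_cbox) (auto simp: inner_diff_left)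
  have "emeasure lborel (I \<times> C) = emeasure (lborel \<Otimes>\<^sub>M lborel) (I \<times> C)" by (simp add: lborel_prod)
  also have "\<dots> = emeasure lborel I * emeasure lborel C"
    by (rule lborel.emeasure_pair_measure_Times) auto
  also have "\<dots> = ennreal (\<rho> * (\<rho> powr (1 + lam)) ^ CARD('m))"
    unfolding eI eC using assms by (simp add: ennreal_mult)
  also have "\<rho> * (\<rho> powr (1 + lam)) ^ CARD('m) = \<rho> powr ((real CARD('m) + 1) + lam * real CARD('m))"
    using assms by (simp add: powr_realpow[symmetric] powr_powr powr_add algebra_simps)
  finally show "emeasure lborel (grushin_box lam s \<rho> :: (real \<times> (real ^ 'm)) set)
     = ennreal (\<rho> powr ((real CARD('m) + 1) + lam * real CARD('m)))" by (simp add: eq)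
  show "grushin_box lam s \<rho> \<in> sets (borel :: (real \<times> (real ^ 'm)) measure)"
    unfolding eq borel_prod[symmetric] by measurable
qed

text \<open>On the half space where s x >= 0, a step of sign s and length at least \<rho> ends where
  |x| >= \<rho>. The y-step then costs at most (m \<rho>)^2 and the x-step (2 \<rho>)^2; the squared
  sum doubles both, which gives 2 m^2 + 8.\<close>

lemma grushin_half_shift:
  fixes v :: "real \<times> (real ^ 'm) \<Rightarrow> real"
  assumes v: "C1_pair v g" and lam: "0 < lam" and s: "s = 1 \<or> s = -1" and \<rho>: "0 < \<rho>"
    and e: "e \<in> grushin_box lam s \<rho>"
  shows "(\<integral>\<^sup>+X. ennreal ((v (X + e) - v X)\<^sup>2) * indicator {X. 0 \<le> s * fst X} X \<partial>lborel)
    \<le> ennreal ((2 * (real CARD('m))\<^sup>2 + 8) * \<rho>\<^sup>2) * (\<integral>\<^sup>+X. ennreal ((norm (grushin_sqrtA lam X (g X)))\<^sup>2) \<partial>lborel)"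
proof -
  obtain h k where hk: "e = (h, k)" by (cases e)
  have h: "\<rho> \<le> s * h" "s * h \<le> 2 * \<rho>" and k: "k \<in> cbox 0 ((\<rho> powr (1 + lam)) *\<^sub>R One)"
    using e by (auto simp: hk grushin_box_def)
  let ?D = "\<integral>\<^sup>+X. ennreal ((norm (grushin_sqrtA lam X (g X)))\<^sup>2) \<partial>lborel"
  let ?B2 = "{X::real \<times> (real ^ 'm). \<rho> \<le> \<bar>fst X\<bar>}"
  have nk: "norm k \<le> real CARD('m) * \<rho> powr (1 + lam)"
  proof -
    have "norm k \<le> (\<Sum>b\<in>Basis. \<bar>k \<bullet> b\<bar>)" by (rule norm_le_l1)
    also have "\<dots> \<le> (\<Sum>b\<in>(Basis::(real^'m) set). \<rho> powr (1 + lam))"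
      using k by (intro sum_mono) (auto simp: mem_box)
    finally show ?thesis by simp
  qed
  have 1: "(norm k / \<rho> powr lam)\<^sup>2 \<le> (real CARD('m))\<^sup>2 * \<rho>\<^sup>2"
  proof -
    have "norm k / \<rho> powr lam \<le> real CARD('m) * \<rho> powr (1 + lam) / \<rho> powr lam"
      using nk \<rho> by (intro divide_right_mono) auto
    also have "\<dots> = real CARD('m) * \<rho>" using \<rho> by (simp add: powr_add)
    finally have "(norm k / \<rho> powr lam)\<^sup>2 \<le> (real CARD('m) * \<rho>)\<^sup>2" by (intro power_mono) auto
    then show ?thesis by (simp add: power_mult_distrib)
  qed
  have "h\<^sup>2 = (s * h)\<^sup>2" using s by auto
  also have "\<dots> \<le> (2 * \<rho>)\<^sup>2" using h \<rho> by (intro power_mono) auto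
  finally have 2: "h\<^sup>2 \<le> 4 * \<rho>\<^sup>2" by (simp add: power_mult_distrib)
  have "(\<integral>\<^sup>+X. ennreal ((v (X + (h, k)) - v X)\<^sup>2) * indicator {X. 0 \<le> s * fst X} X \<partial>lborel)
    \<le> 2 * (ennreal ((norm k / \<rho> powr lam)\<^sup>2) * (\<integral>\<^sup>+X. ennreal ((norm (grushin_sqrtA lam X (g X)))\<^sup>2) * indicator ?B2 X \<partial>lborel))
     + 2 * (ennreal (h\<^sup>2) * (\<integral>\<^sup>+X. ennreal ((norm (grushin_sqrtA lam X (g X)))\<^sup>2) * indicator UNIV X \<partial>lborel))"
  proof (rule grushin_shift_xy[OF v lam])
    have "closed {X::real \<times> (real ^ 'm). 0 \<le> s * fst X}" "closed ?B2"
      by (auto intro!: closed_Collect_le continuous_intros)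
    then show "{X::real \<times> (real ^ 'm). 0 \<le> s * fst X} \<in> sets borel" "?B2 \<in> sets borel" by auto
  qed (use s h \<rho> in auto)
  also have "\<dots> \<le> 2 * (ennreal ((real CARD('m))\<^sup>2 * \<rho>\<^sup>2) * ?D) + 2 * (ennreal (4 * \<rho>\<^sup>2) * ?D)"
    using 1 2 by (intro add_mono mult_left_mono mult_mono ennreal_leI nn_integral_mono) (auto simp: indicator_def)
  also have "\<dots> = (ennreal (2 * ((real CARD('m))\<^sup>2 * \<rho>\<^sup>2)) + ennreal (2 * (4 * \<rho>\<^sup>2))) * ?D"
    by (simp add: ennreal_mult distrib_right mult.assoc)
  also have "\<dots> = ennreal ((2 * (real CARD('m))\<^sup>2 + 8) * \<rho>\<^sup>2) * ?D"
    by (subst ennreal_plus[symmetric]) (auto simp: algebra_simps)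
  finally show ?thesis by (simp add: hk)
qed

text \<open>Wherever \<open>w X \<ge> a\<close>, smallness of \<open>\<integral>w\<close> bounds the mean of \<open>(w (X + e) - w X)\<^sup>2\<close> over the shifts \<open>e\<close> below
  by \<open>a\<^sup>2/2\<close>.\<close>

lemma grushin_half_level_set:
  fixes w :: "real \<times> (real ^ 'm) \<Rightarrow> real"
  assumes w: "C1_pair w g" and lam: "0 < lam" and s: "s = 1 \<or> s = -1" and \<rho>: "0 < \<rho>" and a: "0 < a"
    and w0: "\<And>X. 0 \<le> w X" and Q: "Q = (real CARD('m) + 1) + lam * real CARD('m)"
    and small: "(\<integral>\<^sup>+X. ennreal (w X) \<partial>lborel) \<le> ennreal (\<rho> powr Q * a / 4)"
  shows "emeasure lborel {X. a \<le> w X \<and> 0 \<le> s * fst X}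
    \<le> ennreal (2 * (2 * (real CARD('m))\<^sup>2 + 8) * \<rho>\<^sup>2 / a\<^sup>2) * (\<integral>\<^sup>+X. ennreal ((norm (grushin_sqrtA lam X (g X)))\<^sup>2) \<partial>lborel)"
proof -
  let ?D = "\<integral>\<^sup>+X. ennreal ((norm (grushin_sqrtA lam X (g X)))\<^sup>2) \<partial>lborel"
  define C where "C = 2 * (real CARD('m))\<^sup>2 + 8"
  define E where "E = (grushin_box lam s \<rho> :: (real \<times> (real ^ 'm)) set)"
  define R where "R = \<rho> powr Q"
  have R: "0 < R" using \<rho> by (simp add: R_def)
  have C: "0 < C" by (simp add: C_def add_nonneg_pos)
  have eE: "emeasure lborel E = ennreal R" and [measurable]: "E \<in> sets borel"
    using emeasure_grushin_box[OF s \<rho>, where 'm='m] by (auto simp: E_def R_def Q)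
  have [measurable]: "w \<in> borel_measurable borel" using C1_pair_measurable[OF w] by auto
  define H where "H = {X::real \<times> (real ^ 'm). 0 \<le> s * fst X}"
  have "closed H" unfolding H_def by (auto intro!: closed_Collect_le continuous_intros)
  then have [measurable]: "H \<in> sets borel" by auto
  define S where "S = {X\<in>H. a \<le> w X}"
  have [measurable]: "S \<in> sets borel" unfolding S_def by measurable
  define I where "I X = (\<integral>\<^sup>+e. ennreal ((w (X + e) - w X)\<^sup>2) * indicator E e \<partial>lborel)" for X
  \<comment> \<open>Over the box of volume R the mean of w (X + e) is at most a/4, so R w(X)^2 <= I
    X + R a w(X) / 2. As a <= w(X), the last term is at most half of the left side. If
    \<open>I X\<close> is infinite there is nothing to prove.\<close>
  have low: "ennreal (R * a\<^sup>2 / 2) \<le> I X" if "a \<le> w X" for X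
  proof (cases "I X")
    case (real i)
    have sh: "(\<integral>\<^sup>+e. ennreal (w (X + e)) \<partial>lborel) \<le> ennreal (R * a / 4)"
      using nn_integral_lborel_shift[of "\<lambda>X. ennreal (w X)" X] small by (simp add: add.commute R_def)
    have "ennreal (R * (w X)\<^sup>2) = (\<integral>\<^sup>+e. ennreal ((w X)\<^sup>2) * indicator E e \<partial>lborel)"
      using R by (subst nn_integral_cmult_indicator) (auto simp: eE mult.commute simp flip: ennreal_mult)
    also have "\<dots> \<le> (\<integral>\<^sup>+e. ennreal ((w (X + e) - w X)\<^sup>2) * indicator E e + ennreal (2 * w X) * ennreal (w (X + e)) \<partial>lborel)"
    proof (rule nn_integral_mono)
      fix e
      have "(w X)\<^sup>2 \<le> (w (X + e) - w X)\<^sup>2 + 2 * w X * w (X + e)"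
        by (simp add: power2_eq_square algebra_simps)
      then have "ennreal ((w X)\<^sup>2) \<le> ennreal ((w (X + e) - w X)\<^sup>2 + 2 * w X * w (X + e))" by (rule ennreal_leI)
      also have "\<dots> = ennreal ((w (X + e) - w X)\<^sup>2) + ennreal (2 * w X) * ennreal (w (X + e))"
        using w0[of X] w0[of "X + e"] by (subst ennreal_plus) (auto simp: ennreal_mult)
      finally have "ennreal ((w X)\<^sup>2) \<le> ennreal ((w (X + e) - w X)\<^sup>2) + ennreal (2 * w X) * ennreal (w (X + e))" .
      then show "ennreal ((w X)\<^sup>2) * indicator E e \<le> ennreal ((w (X + e) - w X)\<^sup>2) * indicator E e + ennreal (2 * w X) * ennreal (w (X + e))"
        by (auto simp: indicator_def)
    qed
    also have "\<dots> = I X + ennreal (2 * w X) * (\<integral>\<^sup>+e. ennreal (w (X + e)) \<partial>lborel)"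
      unfolding I_def by (subst nn_integral_add) (auto simp: nn_integral_cmult)
    also have "\<dots> \<le> ennreal i + ennreal (2 * w X) * ennreal (R * a / 4)"
      unfolding real by (intro add_left_mono mult_left_mono sh) auto
    also have "\<dots> = ennreal (i + 2 * w X * (R * a / 4))"
      using w0[of X] R a real by (subst ennreal_mult[symmetric], simp, simp, subst ennreal_plus[symmetric]) auto
    finally have "R * (w X)\<^sup>2 \<le> i + 2 * w X * (R * a / 4)"
      using w0[of X] R a real by (subst (asm) ennreal_le_iff) auto
    moreover have "R * (w X * a) \<le> R * (w X * w X)"
      using that w0[of X] R by (intro mult_left_mono) auto
    moreover have "R * (a * a) \<le> R * (w X * w X)"
      using that w0[of X] R a by (intro mult_left_mono mult_mono) auto
    ultimately have "R * a\<^sup>2 / 2 \<le> i" by (simp add: power2_eq_square algebra_simps)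
    then show ?thesis unfolding real by (rule ennreal_leI)
  qed simp
  have "ennreal (R * a\<^sup>2 / 2) * emeasure lborel S = (\<integral>\<^sup>+X. ennreal (R * a\<^sup>2 / 2) * indicator S X \<partial>lborel)"
    by (subst nn_integral_cmult_indicator) auto
  also have "\<dots> \<le> (\<integral>\<^sup>+X. (\<integral>\<^sup>+e. ennreal ((w (X + e) - w X)\<^sup>2) * indicator E e * indicator H X \<partial>lborel) \<partial>lborel)"
  proof (rule nn_integral_mono)
    fix X
    have "(\<integral>\<^sup>+e. ennreal ((w (X + e) - w X)\<^sup>2) * indicator E e * indicator H X \<partial>lborel) = I X * indicator H X"
      unfolding I_def by (rule nn_integral_multc) measurable
    then show "ennreal (R * a\<^sup>2 / 2) * indicator S X \<le> (\<integral>\<^sup>+e. ennreal ((w (X + e) - w X)\<^sup>2) * indicator E e * indicator H X \<partial>lborel)"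
      using low[of X] by (auto simp: S_def indicator_def)
  qed
  also have "\<dots> = (\<integral>\<^sup>+e. (\<integral>\<^sup>+X. ennreal ((w (X + e) - w X)\<^sup>2) * indicator E e * indicator H X \<partial>lborel) \<partial>lborel)"
    by (rule lborel_pair.Fubini'[symmetric]) measurable
  also have "\<dots> \<le> (\<integral>\<^sup>+e. (ennreal (C * \<rho>\<^sup>2) * ?D) * indicator E e \<partial>lborel)"
  proof (rule nn_integral_mono)
    fix e
    show "(\<integral>\<^sup>+X. ennreal ((w (X + e) - w X)\<^sup>2) * indicator E e * indicator H X \<partial>lborel) \<le> (ennreal (C * \<rho>\<^sup>2) * ?D) * indicator E e"
      using grushin_half_shift[OF w lam s \<rho>, of e] by (auto simp: indicator_def E_def C_def H_def)
  qed
  also have "\<dots> = ennreal (C * \<rho>\<^sup>2) * ?D * ennreal R"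
    by (subst nn_integral_cmult_indicator) (auto simp: eE)
  finally have "ennreal (2 / (R * a\<^sup>2)) * (ennreal (R * a\<^sup>2 / 2) * emeasure lborel S)
      \<le> ennreal (2 / (R * a\<^sup>2)) * (ennreal (C * \<rho>\<^sup>2) * ?D * ennreal R)"
    by (intro mult_left_mono) auto
  also have "ennreal (2 / (R * a\<^sup>2)) * (ennreal (R * a\<^sup>2 / 2) * emeasure lborel S) = emeasure lborel S"
    using R a by (simp add: mult.assoc[symmetric] flip: ennreal_mult)
  also have "ennreal (2 / (R * a\<^sup>2)) * (ennreal (C * \<rho>\<^sup>2) * ?D * ennreal R)
     = (ennreal (2 / (R * a\<^sup>2)) * ennreal (C * \<rho>\<^sup>2) * ennreal R) * ?D" by (simp add: ac_simps)
  also have "ennreal (2 / (R * a\<^sup>2)) * ennreal (C * \<rho>\<^sup>2) * ennreal R = ennreal (2 * C * \<rho>\<^sup>2 / a\<^sup>2)"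
    using R C a by (simp flip: ennreal_mult)
  finally show ?thesis by (simp add: S_def H_def C_def conj_commute)
qed

lemma grushin_level_set:
  fixes w :: "real \<times> (real ^ 'm) \<Rightarrow> real"
  assumes w: "C1_pair w g" and lam: "0 < lam" and \<rho>: "0 < \<rho>" and a: "0 < a"
    and w0: "\<And>X. 0 \<le> w X" and Q: "Q = (real CARD('m) + 1) + lam * real CARD('m)"
    and small: "(\<integral>\<^sup>+X. ennreal (w X) \<partial>lborel) \<le> ennreal (\<rho> powr Q * a / 4)"
  shows "emeasure lborel {X. a \<le> w X}
    \<le> ennreal (8 * ((real CARD('m))\<^sup>2 + 4) * \<rho>\<^sup>2 / a\<^sup>2) * (\<integral>\<^sup>+X. ennreal ((norm (grushin_sqrtA lam X (g X)))\<^sup>2) \<partial>lborel)"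
proof -
  let ?D = "\<integral>\<^sup>+X. ennreal ((norm (grushin_sqrtA lam X (g X)))\<^sup>2) \<partial>lborel"
  let ?c = "2 * (2 * (real CARD('m))\<^sup>2 + 8) * \<rho>\<^sup>2 / a\<^sup>2"
  let ?H = "\<lambda>s. {X. a \<le> w X \<and> 0 \<le> s * fst X}"
  have [measurable]: "w \<in> borel_measurable borel" using C1_pair_measurable[OF w] by auto
  have m: "?H s \<in> sets lborel" for s :: real
    using C1_pair_cont[OF w, of UNIV] by (auto intro!: borel_closed closed_Collect_conj closed_Collect_le continuous_intros)
  have "{X. a \<le> w X} = ?H 1 \<union> ?H (-1)" by auto
  then have "emeasure lborel {X. a \<le> w X} \<le> emeasure lborel (?H 1) + emeasure lborel (?H (-1))"
    using emeasure_subadditive[OF m[of 1] m[of "-1"]] by (simp only:)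
  also have "\<dots> \<le> ennreal ?c * ?D + ennreal ?c * ?D"
    by (intro add_mono grushin_half_level_set[OF w lam _ \<rho> a w0 Q small]) auto
  also have "\<dots> = ennreal (?c + ?c) * ?D" by (subst ennreal_plus) (auto simp: distrib_right)
  also have "?c + ?c = 8 * ((real CARD('m))\<^sup>2 + 4) * \<rho>\<^sup>2 / a\<^sup>2" by (simp add: field_simps)
  finally show ?thesis .
qed

text \<open>Continuation by the tangent at 0 keeps a function C1, with the derivative frozen at
  \<open>T' 0\<close>. Compositions need functions on the whole line, while the squares, logarithms
  and negative powers used later are natural on [0, infinity); along nonnegative solutions the
  continuation is invisible.\<close>

lemma DERIV_extend_linear:
  fixes T T' :: "real \<Rightarrow> real"
  assumes T: "\<And>t. 0 \<le> t \<Longrightarrow> (T has_real_derivative T' t) (at t within {0..})"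
  shows "((\<lambda>t. T (max t 0) + T' 0 * min t 0) has_real_derivative T' (max t 0)) (at t)"
proof (cases t "0::real" rule: linorder_cases)
  case less
  have "((\<lambda>t. T 0 + T' 0 * t) has_real_derivative T' (max t 0)) (at t)"
    using less by (auto intro!: derivative_eq_intros)
  then show ?thesis
    by (rule has_field_derivative_transform_within_open[of _ _ _ "{..<0}"]) (use less in auto)
next
  case greater
  have "at t within {0..} = at t" using greater by (intro at_within_interior) auto
  then have "(T has_real_derivative T' t) (at t)" using T[of t] greater by simp
  then have "(T has_real_derivative T' (max t 0)) (at t)" using greater by (simp add: max_def)
  then show ?thesis
    by (rule has_field_derivative_transform_within_open[of _ _ _ "{0<..}"]) (use greater in auto)
next
  case equal
  let ?f = "\<lambda>t. T (max t 0) + T' 0 * min t 0"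
  have "((\<lambda>y. (?f y - ?f 0) / (y - 0)) \<longlongrightarrow> T' 0) (at 0)"
  proof (rule filterlim_split_at)
    have "\<forall>\<^sub>F y in at_left 0. T' 0 = (?f y - ?f 0) / (y - 0)"
      unfolding eventually_at by (intro exI[of _ 1]) auto
    then show "((\<lambda>y. (?f y - ?f 0) / (y - 0)) \<longlongrightarrow> T' 0) (at_left 0)"
      by (rule Lim_transform_eventually[OF tendsto_const])
    have "((\<lambda>y. (T y - T 0) / (y - 0)) \<longlongrightarrow> T' 0) (at 0 within {0..})"
      using T[of 0] by (simp add: has_field_derivative_iff)
    then have "((\<lambda>y. (T y - T 0) / (y - 0)) \<longlongrightarrow> T' 0) (at_right 0)"
      by (rule tendsto_within_subset) auto
    moreover have "\<forall>\<^sub>F y in at_right 0. (T y - T 0) / (y - 0) = (?f y - ?f 0) / (y - 0)"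
      unfolding eventually_at by (intro exI[of _ 1]) auto
    ultimately show "((\<lambda>y. (?f y - ?f 0) / (y - 0)) \<longlongrightarrow> T' 0) (at_right 0)"
      by (rule Lim_transform_eventually)
  qed
  then show ?thesis using equal by (simp add: has_field_derivative_iff)
qed

lemma DERIV_max_sq: "((\<lambda>t. (max t 0)\<^sup>2) has_real_derivative 2 * max t 0) (at (t::real))"
proof -
  have 1: "((\<lambda>t. t\<^sup>2) has_real_derivative 2 * t) (at t within {0..})" for t :: real
    by (auto intro!: derivative_eq_intros)
  show ?thesis using DERIV_extend_linear[of "\<lambda>t. t\<^sup>2" "\<lambda>t. 2 * t" t, OF 1] by simp
qed

text \<open>A quotient P / (P + R) of C1 functions, where P vanishes exactly for |s| <= 1 and R
  exactly for |s| >= 2, so the denominator has no zero. Compactness of [-2, 2] supplies the bound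
  L.\<close>

lemma smooth_truncation:
  "\<exists>\<tau> \<tau>' L. (\<forall>s::real. (\<tau> has_real_derivative \<tau>' s) (at s)) \<and> continuous_on UNIV \<tau>' \<and> (0::real) \<le> L \<and>
     (\<forall>s. 0 \<le> \<tau> s \<and> \<tau> s \<le> (1::real) \<and> \<bar>\<tau>' s\<bar> \<le> L \<and> (\<bar>s\<bar> \<le> 1 \<longrightarrow> \<tau> s = 0 \<and> \<tau>' s = 0) \<and> (2 \<le> \<bar>s\<bar> \<longrightarrow> \<tau> s = 1 \<and> \<tau>' s = 0))"
proof -
  define P where "P s = (max (s\<^sup>2 - 1) 0)\<^sup>2" for s :: real
  define R where "R s = (max (4 - s\<^sup>2) 0)\<^sup>2" for s :: real
  define P' where "P' s = 2 * max (s\<^sup>2 - 1) 0 * (2 * s)" for s :: real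
  define R' where "R' s = 2 * max (4 - s\<^sup>2) 0 * (- (2 * s))" for s :: real
  have P: "(P has_real_derivative P' s) (at s)" for s
    unfolding P_def P'_def by (rule DERIV_chain2[OF DERIV_max_sq]) (auto intro!: derivative_eq_intros)
  have R: "(R has_real_derivative R' s) (at s)" for s
    unfolding R_def R'_def by (rule DERIV_chain2[OF DERIV_max_sq]) (auto intro!: derivative_eq_intros)
  have pos: "0 < P s + R s" for s
  proof (cases "s\<^sup>2 > 1")
    case True then show ?thesis by (auto simp: P_def R_def intro!: add_pos_nonneg)
  next
    case False then show ?thesis by (auto simp: P_def R_def intro!: add_nonneg_pos)
  qed
  define \<tau> where "\<tau> s = P s / (P s + R s)" for s
  define \<tau>' where "\<tau>' s = (P' s * (P s + R s) - P s * (P' s + R' s)) / ((P s + R s) * (P s + R s))" for s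
  have D: "(\<tau> has_real_derivative \<tau>' s) (at s)" for s
    unfolding \<tau>_def \<tau>'_def using pos[of s] by (intro DERIV_divide P R DERIV_add) auto
  have cont: "continuous_on S \<tau>'" for S
    unfolding \<tau>'_def P_def R_def P'_def R'_def
    using pos unfolding P_def R_def by (intro continuous_intros) (auto dest: less_imp_neq simp: less_imp_neq[THEN not_sym])
  have small: "\<tau> s = 0 \<and> \<tau>' s = 0" if "\<bar>s\<bar> \<le> 1" for s
  proof -
    have "s\<^sup>2 \<le> 1" using that by (simp add: abs_square_le_1)
    then show ?thesis by (simp add: \<tau>_def \<tau>'_def P_def P'_def)
  qed
  have big: "\<tau> s = 1 \<and> \<tau>' s = 0" if "2 \<le> \<bar>s\<bar>" for s
  proof -
    have "2\<^sup>2 \<le> s\<^sup>2" using that by (metis abs_ge_zero abs_numeral abs_le_square_iff)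
    then show ?thesis using pos[of s] by (simp add: \<tau>_def \<tau>'_def R_def R'_def)
  qed
  have "compact (\<tau>' ` {-2..2})" by (intro compact_continuous_image cont) auto
  then obtain L where L: "\<And>s. s \<in> {-2..2} \<Longrightarrow> \<bar>\<tau>' s\<bar> \<le> L"
    using compact_imp_bounded[of "\<tau>' ` {-2..2}"] unfolding bounded_iff by (metis image_eqI real_norm_def)
  have "\<bar>\<tau>' s\<bar> \<le> \<bar>L\<bar>" for s
  proof (cases "\<bar>s\<bar> \<le> 2")
    case True then show ?thesis using L[of s] by (auto simp: abs_le_iff)
  next
    case False then show ?thesis using big[of s] by auto
  qed
  moreover have "0 \<le> \<tau> s \<and> \<tau> s \<le> 1" for s
    using pos[of s] by (auto simp: \<tau>_def P_def R_def)
  ultimately show ?thesis using D cont small big by (intro exI[of _ \<tau>] exI[of _ \<tau>'] exI[of _ "\<bar>L\<bar>"]) auto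
qed

lemma C1_pair_compose:
  assumes v: "C1_pair v g" and T: "\<And>s. (T has_real_derivative T' s) (at s)" "continuous_on UNIV T'"
  shows "C1_pair (\<lambda>X. T (v X)) (\<lambda>X. T' (v X) *\<^sub>R g X)"
  unfolding C1_pair_def
proof (intro conjI allI)
  show "GDERIV (\<lambda>X. T (v X)) X :> T' (v X) *\<^sub>R g X" for X
    using v T by (intro GDERIV_DERIV_compose) (auto simp: C1_pair_def)
  show "continuous_on UNIV (\<lambda>X. T' (v X) *\<^sub>R g X)"
    by (intro continuous_intros continuous_on_compose2[OF T(2)] C1_pair_cont[OF v] C1_pair_cont_grad[OF v]) auto
qed

lemma C1_pair_scale: "C1_pair v g \<Longrightarrow> C1_pair (\<lambda>X. c * v X) (\<lambda>X. c *\<^sub>R g X)"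
  using C1_pair_compose[of v g "\<lambda>s. c * s" "\<lambda>_. c"] by (auto intro!: derivative_eq_intros)

lemma grushin_sqrtA_scaleR: "grushin_sqrtA lam X (c *\<^sub>R h) = c *\<^sub>R grushin_sqrtA lam X h"
  by (simp add: grushin_sqrtA_def)

lemma integrable_continuous_compact_support:
  fixes f :: "'a::euclidean_space \<Rightarrow> real"
  assumes "continuous_on UNIV f" "compact K" "\<And>X. X \<notin> K \<Longrightarrow> f X = 0"
  shows "integrable lborel f"
proof -
  have "integrable lborel (\<lambda>X. indicator K X *\<^sub>R f X)"
    by (rule borel_integrable_compact) (use assms in \<open>auto intro: continuous_on_subset\<close>)
  moreover have "(\<lambda>X. indicator K X *\<^sub>R f X) = f" using assms(3) by (auto simp: indicator_def fun_eq_iff)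
  ultimately show ?thesis by simp
qed

text \<open>Apply the level set bound to smooth truncations of \<open>v\<close> between the heights \<open>t\<close> and \<open>2t\<close>, with \<open>\<rho>\<^sup>Q\<close>
  proportional to \<open>t\<^sup>-\<^sup>p \<integral>\<bar>v\<bar>\<^sup>p\<close>, and integrate the layer-cake formula in \<open>t\<close>.\<close>

lemma grushin_sobolev:
  fixes lam Q :: real
  assumes lam: "0 < lam" and Q: "Q = (real CARD('m) + 1) + lam * real CARD('m)" and Q2: "2 < Q"
  defines "p \<equiv> 2 * Q / (Q - 2)"
  shows "\<exists>C>0. \<forall>(v :: real \<times> (real ^ 'm) \<Rightarrow> real) g K. C1_pair v g \<longrightarrow> compact K \<longrightarrow> (\<forall>X. X \<notin> K \<longrightarrow> v X = 0 \<and> g X = 0) \<longrightarrow>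
    (LINT X|lborel. \<bar>v X\<bar> powr p) powr (2 / p) \<le> C * (LINT X|lborel. (norm (grushin_sqrtA lam X (g X)))\<^sup>2)"
proof -
  obtain \<tau> \<tau>' L where \<tau>: "\<And>s::real. (\<tau> has_real_derivative \<tau>' s) (at s)" "continuous_on UNIV \<tau>'" "(0::real) \<le> L"
     and \<tau>b: "\<And>s. 0 \<le> \<tau> s" "\<And>s. \<tau> s \<le> (1::real)" "\<And>s. \<bar>\<tau>' s\<bar> \<le> L" "\<And>s. \<bar>s\<bar> \<le> 1 \<Longrightarrow> \<tau> s = 0 \<and> \<tau>' s = 0"
       "\<And>s. 2 \<le> \<bar>s\<bar> \<Longrightarrow> \<tau> s = 1 \<and> \<tau>' s = 0"
    using smooth_truncation by metis
  define c where "c = 8 * ((real CARD('m))\<^sup>2 + 4)"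
  have c: "0 < c" by (simp add: c_def add_nonneg_pos)
  have p2: "2 < p" unfolding p_def using Q2 by (simp add: field_simps)
  \<comment> \<open>The first identity makes the powers of t collapse to 1/t, the second turns N /
    N^(2/Q) into N^(2/p) at the end.\<close>
  have pQ: "2 * p / Q = p - 2" "2 / p = 1 - 2 / Q" unfolding p_def using Q2 by (simp_all add: field_simps)
  \<comment> \<open>The summand 1 only ensures that C is positive.\<close>
  define C where "C = 4 powr p * (c * L\<^sup>2 * 4 powr (2 / Q)) + 1"
  have C0: "0 < C" using c by (simp add: C_def add_nonneg_pos)
  have main: "(LINT X|lborel. \<bar>v X\<bar> powr p) powr (2 / p) \<le> C * (LINT X|lborel. (norm (grushin_sqrtA lam X (g X)))\<^sup>2)"
    if v: "C1_pair v g" and K: "compact K" "\<And>X. X \<notin> K \<Longrightarrow> v X = 0 \<and> g X = 0" for v :: "real \<times> (real ^ 'm) \<Rightarrow> real" and g K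
  proof -
    define N where "N = (LINT X|lborel. \<bar>v X\<bar> powr p)"
    define S where "S X = (norm (grushin_sqrtA lam X (g X)))\<^sup>2" for X
    define D where "D = (LINT X|lborel. S X)"
    have [measurable]: "v \<in> borel_measurable borel" using C1_pair_measurable[OF v] by auto
    have iN: "integrable lborel (\<lambda>X. \<bar>v X\<bar> powr p)"
    proof (rule integrable_continuous_compact_support[OF _ K(1)])
      show "continuous_on UNIV (\<lambda>X. \<bar>v X\<bar> powr p)"
        by (rule continuous_on_powr') (use p2 in \<open>auto intro!: continuous_intros C1_pair_cont[OF v]\<close>)
    qed (use K in auto)
    have Scont: "continuous_on UNIV S" unfolding S_def
      by (intro continuous_intros continuous_on_grushin_sqrtA lam C1_pair_cont_grad[OF v])
    then have [measurable]: "S \<in> borel_measurable borel" by (rule borel_measurable_continuous_onI)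
    have iS: "integrable lborel S"
      by (rule integrable_continuous_compact_support[OF Scont K(1)]) (use K in \<open>auto simp: S_def grushin_sqrtA_def zero_prod_def\<close>)
    have S0: "0 \<le> S X" for X by (simp add: S_def)
    have N0: "0 \<le> N" and D0: "0 \<le> D" by (auto simp: N_def D_def S0)
    have nnN: "(\<integral>\<^sup>+X. ennreal (\<bar>v X\<bar> powr p) \<partial>lborel) = ennreal N"
      unfolding N_def by (rule nn_integral_eq_integral[OF iN]) auto
    have nnS: "(\<integral>\<^sup>+X. ennreal (S X) \<partial>lborel) = ennreal D"
      unfolding D_def by (rule nn_integral_eq_integral[OF iS]) (auto simp: S0)
    show ?thesis
    proof (cases "N = 0")
      case True
      then show ?thesis using C0 D0 by (auto simp: N_def[symmetric] D_def[symmetric] S_def[symmetric])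
    next
      case False
      with N0 have N: "0 < N" by simp
      define A where "A = c * L\<^sup>2 * (4 * N) powr (2 / Q)"
      have A0: "0 \<le> A" using c by (simp add: A_def)
      have level: "ennreal (t powr (p - 1)) * emeasure lborel {X. 2 * t \<le> \<bar>v X\<bar>}
         \<le> (\<integral>\<^sup>+X. ennreal (A / t) * (indicator {X. t < \<bar>v X\<bar> \<and> \<bar>v X\<bar> < 2 * t} X * ennreal (S X)) \<partial>lborel)" if t: "0 < t" for t
      proof -
        \<comment> \<open>Chosen so that \<rho>^Q t / 4 = t^(1-p) N, which is the Chebyshev bound
          for the integral of the truncation w.\<close>
        define \<rho> where "\<rho> = (4 * N / t powr p) powr (1 / Q)"
        have \<rho>: "0 < \<rho>" using N t by (simp add: \<rho>_def)
        have \<rho>Q: "\<rho> powr Q = 4 * N / t powr p" using N t Q2 by (simp add: \<rho>_def powr_powr)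
        have \<rho>2: "\<rho>\<^sup>2 = (4 * N) powr (2 / Q) * t powr (2 - p)"
        proof -
          have "\<rho>\<^sup>2 = \<rho> powr 2" using \<rho> by simp
          also have "\<dots> = (4 * N / t powr p) powr (2 / Q)" by (simp add: \<rho>_def powr_powr)
          also have "\<dots> = (4 * N) powr (2 / Q) / t powr (2 * p / Q)" using N t by (simp add: powr_divide powr_powr mult.commute)
          also have "\<dots> = (4 * N) powr (2 / Q) * t powr (2 - p)"
            unfolding pQ using t by (simp add: powr_diff field_simps)
          finally show ?thesis .
        qed
        define w where "w X = t * \<tau> (v X * (1 / t))" for X
        define h where "h X = t *\<^sub>R (\<tau>' (v X * (1 / t)) *\<^sub>R ((1 / t) *\<^sub>R g X))" for X
        have wh: "C1_pair w h" unfolding w_def h_def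
          using C1_pair_scale[OF C1_pair_compose[OF C1_pair_scale[OF v, of "1/t"] \<tau>(1,2)], of t] by (simp add: mult.commute)
        have w0: "0 \<le> w X" for X using t \<tau>b(1) by (simp add: w_def)
        have wle: "w X \<le> t powr (1 - p) * \<bar>v X\<bar> powr p" for X
        proof (cases "\<bar>v X\<bar> \<le> t")
          case True
          then have "\<tau> (v X * (1 / t)) = 0" using t \<tau>b(4)[of "v X * (1 / t)"] by (simp add: abs_mult)
          then show ?thesis by (simp add: w_def)
        next
          case False
          have "w X \<le> t" using t \<tau>b(2)[of "v X * (1/t)"] by (simp add: w_def mult_left_le)
          also have "t = t powr (1 - p) * t powr p" using t by (simp flip: powr_add)
          also have "\<dots> \<le> t powr (1 - p) * \<bar>v X\<bar> powr p"
            using False t p2 by (intro mult_left_mono powr_mono2) auto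
          finally show ?thesis .
        qed
        have small: "(\<integral>\<^sup>+X. ennreal (w X) \<partial>lborel) \<le> ennreal (\<rho> powr Q * t / 4)"
        proof -
          have "(\<integral>\<^sup>+X. ennreal (w X) \<partial>lborel) \<le> (\<integral>\<^sup>+X. ennreal (t powr (1 - p)) * ennreal (\<bar>v X\<bar> powr p) \<partial>lborel)"
            using wle by (intro nn_integral_mono) (auto simp flip: ennreal_mult intro: ennreal_leI)
          also have "\<dots> = ennreal (t powr (1 - p)) * ennreal N"
            by (subst nn_integral_cmult) (auto simp: nnN)
          also have "\<dots> = ennreal (t powr (1 - p) * N)" using N0 by (simp add: ennreal_mult)
          also have "t powr (1 - p) * N = \<rho> powr Q * t / 4" unfolding \<rho>Q using t by (simp add: powr_diff)
          finally show ?thesis .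
        qed
        have "{X. 2 * t \<le> \<bar>v X\<bar>} \<subseteq> {X. t \<le> w X}"
        proof safe
          fix a b assume "2 * t \<le> \<bar>v (a, b)\<bar>"
          then have "2 \<le> \<bar>v (a, b) * (1/t)\<bar>" using t by (simp add: abs_mult field_simps)
          from \<tau>b(5)[OF this] show "t \<le> w (a, b)" by (simp add: w_def)
        qed
        moreover have [measurable]: "w \<in> borel_measurable borel" using C1_pair_measurable[OF wh] by auto
        ultimately have "emeasure lborel {X. 2 * t \<le> \<bar>v X\<bar>} \<le> emeasure lborel {X. t \<le> w X}"
          by (intro emeasure_mono) auto
        also have "\<dots> \<le> ennreal (c * \<rho>\<^sup>2 / t\<^sup>2) * (\<integral>\<^sup>+X. ennreal ((norm (grushin_sqrtA lam X (h X)))\<^sup>2) \<partial>lborel)"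
          using grushin_level_set[OF wh lam \<rho> t w0 Q small] by (simp add: c_def)
        also have "\<dots> \<le> ennreal (c * \<rho>\<^sup>2 / t\<^sup>2) * (\<integral>\<^sup>+X. ennreal (L\<^sup>2) * (indicator {X. t < \<bar>v X\<bar> \<and> \<bar>v X\<bar> < 2 * t} X * ennreal (S X)) \<partial>lborel)"
        proof (intro mult_left_mono nn_integral_mono)
          fix X
          have hg: "h X = \<tau>' (v X * (1/t)) *\<^sub>R g X" using t by (simp add: h_def)
          have eq: "(norm (grushin_sqrtA lam X (h X)))\<^sup>2 = (\<tau>' (v X * (1/t)))\<^sup>2 * S X"
            unfolding hg grushin_sqrtA_scaleR by (simp add: S_def power_mult_distrib)
          show "ennreal ((norm (grushin_sqrtA lam X (h X)))\<^sup>2) \<le> ennreal (L\<^sup>2) * (indicator {X. t < \<bar>v X\<bar> \<and> \<bar>v X\<bar> < 2 * t} X * ennreal (S X))"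
          proof (cases "t < \<bar>v X\<bar> \<and> \<bar>v X\<bar> < 2 * t")
            case True
            have "(\<tau>' (v X * (1/t)))\<^sup>2 \<le> L\<^sup>2" using \<tau>b(3)[of "v X * (1/t)"] by (metis abs_ge_zero power2_abs power_mono)
            then show ?thesis using True S0 by (simp add: eq mult_right_mono ennreal_leI flip: ennreal_mult)
          next
            case False
            then have "\<bar>v X * (1/t)\<bar> \<le> 1 \<or> 2 \<le> \<bar>v X * (1/t)\<bar>" using t by (auto simp: abs_mult field_simps)
            then have "\<tau>' (v X * (1/t)) = 0" using \<tau>b(4,5) by blast
            then show ?thesis by (simp add: eq)
          qed
        qed auto
        finally have e: "emeasure lborel {X. 2 * t \<le> \<bar>v X\<bar>} \<le> ennreal (c * \<rho>\<^sup>2 / t\<^sup>2) *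
            (\<integral>\<^sup>+X. ennreal (L\<^sup>2) * (indicator {X. t < \<bar>v X\<bar> \<and> \<bar>v X\<bar> < 2 * t} X * ennreal (S X)) \<partial>lborel)" .
        have "t powr (p - 1) * (c * \<rho>\<^sup>2 / t\<^sup>2) * L\<^sup>2 = c * L\<^sup>2 * (4 * N) powr (2 / Q) * (t powr (p - 1) * t powr (2 - p) / t powr 2)"
          unfolding \<rho>2 using t by simp
        also have "t powr (p - 1) * t powr (2 - p) / t powr 2 = 1 / t"
        proof -
          have "t powr (p - 1) * t powr (2 - p) = t powr 1" unfolding powr_add[symmetric] by simp
          then show ?thesis using t by (simp add: power2_eq_square)
        qed
        finally have At: "t powr (p - 1) * (c * \<rho>\<^sup>2 / t\<^sup>2) * L\<^sup>2 = A / t" by (simp add: A_def)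
        have "ennreal (t powr (p - 1)) * emeasure lborel {X. 2 * t \<le> \<bar>v X\<bar>}
          \<le> ennreal (t powr (p - 1)) * (ennreal (c * \<rho>\<^sup>2 / t\<^sup>2) *
            (\<integral>\<^sup>+X. ennreal (L\<^sup>2) * (indicator {X. t < \<bar>v X\<bar> \<and> \<bar>v X\<bar> < 2 * t} X * ennreal (S X)) \<partial>lborel))"
          by (intro mult_left_mono e) auto
        also have "\<dots> = (ennreal (t powr (p - 1)) * ennreal (c * \<rho>\<^sup>2 / t\<^sup>2) * ennreal (L\<^sup>2)) *
            (\<integral>\<^sup>+X. (indicator {X. t < \<bar>v X\<bar> \<and> \<bar>v X\<bar> < 2 * t} X * ennreal (S X)) \<partial>lborel)"
          by (subst nn_integral_cmult) (auto simp: mult.assoc)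
        also have "ennreal (t powr (p - 1)) * ennreal (c * \<rho>\<^sup>2 / t\<^sup>2) * ennreal (L\<^sup>2) = ennreal (A / t)"
          unfolding At[symmetric] using c by (simp flip: ennreal_mult)
        also have "ennreal (A / t) * (\<integral>\<^sup>+X. (indicator {X. t < \<bar>v X\<bar> \<and> \<bar>v X\<bar> < 2 * t} X * ennreal (S X)) \<partial>lborel)
          = (\<integral>\<^sup>+X. ennreal (A / t) * (indicator {X. t < \<bar>v X\<bar> \<and> \<bar>v X\<bar> < 2 * t} X * ennreal (S X)) \<partial>lborel)"
          by (subst nn_integral_cmult) auto
        finally show ?thesis .
      qed
      \<comment> \<open>From the integral of t^(p-1) over (0, |a|/2] only the piece [|a|/4, |a|/2]
        is kept; this is the origin of the factor 4^p.\<close>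
      have lower: "ennreal (4 powr (- p)) * ennreal (\<bar>a\<bar> powr p) \<le> (\<integral>\<^sup>+t. ennreal (t powr (p - 1)) * indicator {t. 0 < t \<and> 2 * t \<le> \<bar>a\<bar>} t \<partial>lborel)" for a :: real
      proof (cases "a = 0")
        case False
        define b where "b = \<bar>a\<bar> / 4"
        have b: "0 < b" using False by (simp add: b_def)
        have "ennreal (4 powr (- p)) * ennreal (\<bar>a\<bar> powr p) = ennreal (b powr p)"
          by (simp add: b_def powr_divide powr_minus field_simps flip: ennreal_mult)
        also have "b powr p = b powr (p - 1) * b" using b by (simp add: powr_diff)
        also have "ennreal (b powr (p - 1) * b) = ennreal (b powr (p - 1)) * emeasure lborel {b..2*b}"
          using b by (simp add: ennreal_mult)
        also have "\<dots> = (\<integral>\<^sup>+t. ennreal (b powr (p - 1)) * indicator {b..2*b} t \<partial>lborel)"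
          by (subst nn_integral_cmult_indicator) auto
        also have "\<dots> \<le> (\<integral>\<^sup>+t. ennreal (t powr (p - 1)) * indicator {t. 0 < t \<and> 2 * t \<le> \<bar>a\<bar>} t \<partial>lborel)"
          using b p2 by (intro nn_integral_mono) (auto simp: indicator_def b_def intro!: ennreal_leI powr_mono2)
        finally show ?thesis .
      qed simp
      \<comment> \<open>The window |a|/2 < t < |a| has length |a|/2, and 1/t <= 2/|a| on it, so the
        integral of dt/t is bounded independently of a.\<close>
      have upper: "(\<integral>\<^sup>+t. ennreal (A / t) * indicator {t. 0 < t \<and> t < \<bar>a\<bar> \<and> \<bar>a\<bar> < 2 * t} t \<partial>lborel) \<le> ennreal A" for a :: real
      proof (cases "a = 0")
        case False
        define b where "b = \<bar>a\<bar> / 2"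
        have b: "0 < b" using False by (simp add: b_def)
        have "(\<integral>\<^sup>+t. ennreal (A / t) * indicator {t. 0 < t \<and> t < \<bar>a\<bar> \<and> \<bar>a\<bar> < 2 * t} t \<partial>lborel)
          \<le> (\<integral>\<^sup>+t. ennreal (A / b) * indicator {b..2*b} t \<partial>lborel)"
        proof (intro nn_integral_mono)
          fix t
          have "\<bar>a\<bar> = 2 * b" by (simp add: b_def)
          then show "ennreal (A / t) * indicator {t. 0 < t \<and> t < \<bar>a\<bar> \<and> \<bar>a\<bar> < 2 * t} t \<le> ennreal (A / b) * indicator {b..2*b} t"
            using b A0 by (auto simp: indicator_def intro!: ennreal_leI divide_left_mono)
        qed
        also have "\<dots> = ennreal (A / b) * ennreal b"
          using b by (subst nn_integral_cmult_indicator) auto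
        also have "\<dots> = ennreal A" using b A0 by (simp flip: ennreal_mult)
        finally show ?thesis .
      next
        case True
        then have "{t. 0 < t \<and> t < \<bar>a\<bar> \<and> \<bar>a\<bar> < 2 * t} = {}" by auto
        then show ?thesis by (simp only:) simp
      qed
      have "ennreal (4 powr (- p)) * ennreal N = (\<integral>\<^sup>+X. ennreal (4 powr (- p)) * ennreal (\<bar>v X\<bar> powr p) \<partial>lborel)"
        by (subst nn_integral_cmult) (auto simp: nnN)
      also have "\<dots> \<le> (\<integral>\<^sup>+X. (\<integral>\<^sup>+t. ennreal (t powr (p - 1)) * indicator {t. 0 < t \<and> 2 * t \<le> \<bar>v X\<bar>} t \<partial>lborel) \<partial>lborel)"
        by (intro nn_integral_mono lower)
      also have "\<dots> = (\<integral>\<^sup>+t. (\<integral>\<^sup>+X. ennreal (t powr (p - 1)) * indicator {t. 0 < t \<and> 2 * t \<le> \<bar>v X\<bar>} t \<partial>lborel) \<partial>lborel)"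
        unfolding indicator_def by (rule lborel_pair.Fubini'[symmetric]) simp
      also have "\<dots> \<le> (\<integral>\<^sup>+t. (\<integral>\<^sup>+X. ennreal (A / t) * indicator {t. 0 < t \<and> t < \<bar>v X\<bar> \<and> \<bar>v X\<bar> < 2 * t} t * ennreal (S X) \<partial>lborel) \<partial>lborel)"
      proof (rule nn_integral_mono)
        fix t :: real
        show "(\<integral>\<^sup>+X. ennreal (t powr (p - 1)) * indicator {t. 0 < t \<and> 2 * t \<le> \<bar>v X\<bar>} t \<partial>lborel)
          \<le> (\<integral>\<^sup>+X. ennreal (A / t) * indicator {t. 0 < t \<and> t < \<bar>v X\<bar> \<and> \<bar>v X\<bar> < 2 * t} t * ennreal (S X) \<partial>lborel)"
        proof (cases "0 < t")
          case True
          have "(\<integral>\<^sup>+X. ennreal (t powr (p - 1)) * indicator {t. 0 < t \<and> 2 * t \<le> \<bar>v X\<bar>} t \<partial>lborel)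
            = (\<integral>\<^sup>+X. ennreal (t powr (p - 1)) * indicator {X. 2 * t \<le> \<bar>v X\<bar>} X \<partial>lborel)"
            using True by (intro nn_integral_cong) (auto simp: indicator_def)
          also have "\<dots> = ennreal (t powr (p - 1)) * emeasure lborel {X. 2 * t \<le> \<bar>v X\<bar>}"
            by (subst nn_integral_cmult_indicator) auto
          also note level[OF True]
          also have "(\<integral>\<^sup>+X. ennreal (A / t) * (indicator {X. t < \<bar>v X\<bar> \<and> \<bar>v X\<bar> < 2 * t} X * ennreal (S X)) \<partial>lborel)
            = (\<integral>\<^sup>+X. ennreal (A / t) * indicator {t. 0 < t \<and> t < \<bar>v X\<bar> \<and> \<bar>v X\<bar> < 2 * t} t * ennreal (S X) \<partial>lborel)"
            using True by (intro nn_integral_cong) (auto simp: indicator_def)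
          finally show ?thesis .
        qed (simp add: indicator_def)
      qed
      also have "\<dots> = (\<integral>\<^sup>+X. (\<integral>\<^sup>+t. ennreal (A / t) * indicator {t. 0 < t \<and> t < \<bar>v X\<bar> \<and> \<bar>v X\<bar> < 2 * t} t * ennreal (S X) \<partial>lborel) \<partial>lborel)"
        unfolding indicator_def by (rule lborel_pair.Fubini') simp
      also have "\<dots> = (\<integral>\<^sup>+X. (\<integral>\<^sup>+t. ennreal (A / t) * indicator {t. 0 < t \<and> t < \<bar>v X\<bar> \<and> \<bar>v X\<bar> < 2 * t} t \<partial>lborel) * ennreal (S X) \<partial>lborel)"
        unfolding indicator_def by (intro nn_integral_cong nn_integral_multc) simp
      also have "\<dots> \<le> (\<integral>\<^sup>+X. ennreal A * ennreal (S X) \<partial>lborel)"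
        by (intro nn_integral_mono mult_right_mono upper) auto
      also have "\<dots> = ennreal A * ennreal D" by (subst nn_integral_cmult) (auto simp: nnS)
      finally have "4 powr (- p) * N \<le> A * D"
        using N0 A0 D0 by (simp add: ennreal_le_iff flip: ennreal_mult)
      then have ND: "N \<le> 4 powr p * (A * D)" by (simp add: powr_minus field_simps)
      \<comment> \<open>A contains the factor N^(2/Q). Dividing by it, with 0 < N finite, leaves
        N^(1 - 2/Q) = N^(2/p) on the left.\<close>
      have "N powr (2 / p) = N / N powr (2 / Q)" unfolding pQ using N by (simp add: powr_diff)
      also have "\<dots> \<le> 4 powr p * (A * D) / N powr (2 / Q)" using ND N by (intro divide_right_mono) auto
      also have "\<dots> = (C - 1) * D" using N by (simp add: A_def C_def powr_mult)
      also have "\<dots> \<le> C * D" using D0 by (intro mult_right_mono) auto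
      finally show ?thesis by (simp add: N_def D_def S_def)
    qed
  qed
  show ?thesis using C0 main by blast
qed

section \<open>Test functions and the energy space\<close>

lemma GDERIV_unique:
  assumes "GDERIV v X :> D" "GDERIV v X :> D'"
  shows "D = D'"
proof -
  have "(\<lambda>h. h \<bullet> D) = (\<lambda>h. h \<bullet> D')"
    using assms unfolding gderiv_def by (rule has_derivative_unique)
  then have "(D - D') \<bullet> D = (D - D') \<bullet> D'" by metis
  then have "(D - D') \<bullet> (D - D') = 0" by (simp add: inner_diff_right)
  then show ?thesis by simp
qed

lemma gradient_eq: "GDERIV v X :> D \<Longrightarrow> gradient v X = D"
  unfolding gradient_def by (rule the_equality) (auto intro: GDERIV_unique)

lemma grushin_sqrtA_zero [simp]: "grushin_sqrtA lam X 0 = 0"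
  by (simp add: grushin_sqrtA_def zero_prod_def)

lemma GDERIV_transform_open:
  assumes "GDERIV v X :> D" "open S" "X \<in> S" "\<And>Y. Y \<in> S \<Longrightarrow> v Y = w Y"
  shows "GDERIV w X :> D"
  using assms unfolding gderiv_def by (meson has_derivative_transform_within_open)

lemma C1_pair_zero: "C1_pair (\<lambda>X. 0) (\<lambda>X. 0)" and C1_pair_const: "C1_pair (\<lambda>X. c) (\<lambda>X. 0)"
  by (auto simp: C1_pair_def GDERIV_const)

lemma C1_pair_add: "C1_pair v g \<Longrightarrow> C1_pair w h \<Longrightarrow> C1_pair (\<lambda>X. v X + w X) (\<lambda>X. g X + h X)"
  by (auto simp: C1_pair_def intro: GDERIV_add continuous_intros)

lemma C1_pair_mult:
  assumes "C1_pair v g" "C1_pair w h"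
  shows "C1_pair (\<lambda>X. v X * w X) (\<lambda>X. v X *\<^sub>R h X + w X *\<^sub>R g X)"
  using assms C1_pair_cont[OF assms(1), of UNIV] C1_pair_cont[OF assms(2), of UNIV]
  by (auto simp: C1_pair_def intro!: GDERIV_mult continuous_intros)

text \<open>These functions vanish off a compact subset of \<Omega> on the whole space, so
  whole-space translations and integrals apply to them; members of \<open>C1_0\<close> are arbitrary
  outside \<Omega>.\<close>

definition test_fn :: "'a::euclidean_space set \<Rightarrow> ('a \<Rightarrow> real) \<Rightarrow> ('a \<Rightarrow> 'a) \<Rightarrow> bool" where
  "test_fn \<Omega> v g \<longleftrightarrow> C1_pair v g \<and> (\<exists>K. compact K \<and> K \<subseteq> \<Omega> \<and> (\<forall>X. X \<notin> K \<longrightarrow> v X = 0 \<and> g X = 0))"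

lemma test_fn_C1: "test_fn \<Omega> v g \<Longrightarrow> C1_pair v g"
  by (simp add: test_fn_def)

lemma test_fn_outside: "test_fn \<Omega> v g \<Longrightarrow> X \<notin> \<Omega> \<Longrightarrow> v X = 0 \<and> g X = 0"
  unfolding test_fn_def by blast

lemma test_fn_zero: "test_fn \<Omega> (\<lambda>X. 0) (\<lambda>X. 0)"
  unfolding test_fn_def using C1_pair_zero by blast

lemma test_fn_add:
  assumes "test_fn \<Omega> v g" "test_fn \<Omega> w h"
  shows "test_fn \<Omega> (\<lambda>X. v X + w X) (\<lambda>X. g X + h X)"
proof -
  obtain K L where "compact K" "K \<subseteq> \<Omega>" "\<forall>X. X \<notin> K \<longrightarrow> v X = 0 \<and> g X = 0"
     "compact L" "L \<subseteq> \<Omega>" "\<forall>X. X \<notin> L \<longrightarrow> w X = 0 \<and> h X = 0" using assms unfolding test_fn_def by blast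
  then have "compact (K \<union> L)" "K \<union> L \<subseteq> \<Omega>" "\<forall>X. X \<notin> K \<union> L \<longrightarrow> v X + w X = 0 \<and> g X + h X = 0" by auto
  then show ?thesis unfolding test_fn_def by (intro conjI exI[of _ "K \<union> L"] C1_pair_add[OF assms[THEN test_fn_C1]])
qed

lemma test_fn_scale: "test_fn \<Omega> v g \<Longrightarrow> test_fn \<Omega> (\<lambda>X. c * v X) (\<lambda>X. c *\<^sub>R g X)"
  unfolding test_fn_def using C1_pair_scale by (metis mult_zero_right scaleR_zero_right)

lemma test_fn_diff:
  assumes "test_fn \<Omega> v g" "test_fn \<Omega> w h"
  shows "test_fn \<Omega> (\<lambda>X. v X - w X) (\<lambda>X. g X - h X)"
  using test_fn_add[OF assms(1) test_fn_scale[OF assms(2), of "-1"]] by simp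

lemma test_fn_compose:
  assumes "test_fn \<Omega> v g" "\<And>s. (T has_real_derivative T' s) (at s)" "continuous_on UNIV T'" "T 0 = 0"
  shows "test_fn \<Omega> (\<lambda>X. T (v X)) (\<lambda>X. T' (v X) *\<^sub>R g X)"
proof -
  obtain K where "compact K" "K \<subseteq> \<Omega>" "\<forall>X. X \<notin> K \<longrightarrow> v X = 0 \<and> g X = 0" using assms(1) unfolding test_fn_def by blast
  then have "compact K" "K \<subseteq> \<Omega>" "\<forall>X. X \<notin> K \<longrightarrow> T (v X) = 0 \<and> T' (v X) *\<^sub>R g X = 0" using assms(4) by auto
  then show ?thesis unfolding test_fn_def by (intro conjI exI[of _ K] C1_pair_compose[OF test_fn_C1[OF assms(1)] assms(2,3)])
qed

lemma test_fn_mult: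
  assumes "test_fn \<Omega> v g" "C1_pair w h"
  shows "test_fn \<Omega> (\<lambda>X. v X * w X) (\<lambda>X. v X *\<^sub>R h X + w X *\<^sub>R g X)"
proof -
  obtain K where "compact K" "K \<subseteq> \<Omega>" "\<forall>X. X \<notin> K \<longrightarrow> v X = 0 \<and> g X = 0" using assms(1) unfolding test_fn_def by blast
  then have "compact K" "K \<subseteq> \<Omega>" "\<forall>X. X \<notin> K \<longrightarrow> v X * w X = 0 \<and> v X *\<^sub>R h X + w X *\<^sub>R g X = 0" by auto
  then show ?thesis unfolding test_fn_def by (intro conjI exI[of _ K] C1_pair_mult[OF test_fn_C1[OF assms(1)] assms(2)])
qed

text \<open>Extension by zero. \<Omega> and the complement of the support form an open cover of the
  space; off the support the function is locally zero, so uniqueness makes the gradient vanish there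
  and the two descriptions agree on the overlap.\<close>

lemma C1_0_imp_test_fn:
  assumes "open \<Omega>" "v \<in> C1_0 \<Omega>"
  shows "test_fn \<Omega> (\<lambda>X. if X \<in> \<Omega> then v X else 0) (\<lambda>X. if X \<in> \<Omega> then gradient v X else 0)"
proof -
  define K where "K = closure {X\<in>\<Omega>. v X \<noteq> 0}"
  let ?v = "\<lambda>X. if X \<in> \<Omega> then v X else 0" and ?g = "\<lambda>X. if X \<in> \<Omega> then gradient v X else 0"
  have K: "compact K" "K \<subseteq> \<Omega>" "closed K" and v: "\<And>X. X \<in> \<Omega> \<Longrightarrow> GDERIV v X :> gradient v X" "continuous_on \<Omega> (gradient v)"
    using assms(2) by (auto simp: C1_0_def K_def)
  have vK: "?v X = 0" if "X \<notin> K" for X using that closure_subset[of "{X\<in>\<Omega>. v X \<noteq> 0}"] by (auto simp: K_def)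
  have oK: "open (- K)" using K by auto
  have D\<Omega>: "GDERIV ?v X :> ?g X" if "X \<in> \<Omega>" for X
    using GDERIV_transform_open[OF v(1)[OF that] assms(1) that, of ?v] that by simp
  have D0: "GDERIV ?v X :> 0" if "X \<notin> K" for X
    using GDERIV_transform_open[OF GDERIV_const[of 0 X] oK, of ?v] that vK by auto
  have gK: "?g X = 0" if "X \<notin> K" for X
    using GDERIV_unique[OF D\<Omega> D0[OF that]] by auto
  have "GDERIV ?v X :> ?g X" for X
    using D\<Omega>[of X] D0[of X] gK[of X] K by (cases "X \<in> \<Omega>") auto
  moreover have "continuous_on (\<Omega> \<union> - K) ?g"
  proof (rule continuous_on_open_Un[OF assms(1) oK])
    show "continuous_on \<Omega> ?g" using v(2) by (rule continuous_on_eq) auto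
    show "continuous_on (- K) ?g" using continuous_on_const[of "- K" 0] by (rule continuous_on_eq) (use gK in auto)
  qed
  moreover have "\<Omega> \<union> - K = UNIV" using K by auto
  ultimately show ?thesis unfolding test_fn_def C1_pair_def using K vK gK by (metis (no_types, lifting))
qed

lemma test_fn_imp_C1_0:
  assumes "test_fn \<Omega> v g"
  shows "v \<in> C1_0 \<Omega>" "gradient v = g"
proof -
  obtain K where K: "compact K" "K \<subseteq> \<Omega>" "\<And>X. X \<notin> K \<Longrightarrow> v X = 0" and v: "C1_pair v g"
    using assms unfolding test_fn_def by blast
  show g: "gradient v = g" using v by (auto simp: C1_pair_def intro: gradient_eq)
  have "{X\<in>\<Omega>. v X \<noteq> 0} \<subseteq> K" using K by blast
  then have sub: "closure {X\<in>\<Omega>. v X \<noteq> 0} \<subseteq> K" using K by (intro closure_minimal compact_imp_closed) auto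
  then have "compact (closure {X\<in>\<Omega>. v X \<noteq> 0})"
    using K by (metis closed_closure compact_Int_closed inf.absorb_iff2)
  then show "v \<in> C1_0 \<Omega>" using sub K v C1_pair_cont_grad[OF v] by (auto simp: C1_0_def g C1_pair_def)
qed

lemma Lp_lim_dominated:
  fixes F :: "nat \<Rightarrow> 'a \<Rightarrow> 'b::euclidean_space"
  assumes [measurable]: "\<And>k. F k \<in> borel_measurable M" and p: "0 < p" and G: "Lp_on p M G"
    and lim: "AE x in M. (\<lambda>k. F k x) \<longlonglongrightarrow> 0" and b: "\<And>k. AE x in M. norm (F k x) \<le> C * norm (G x)" and C: "0 \<le> C"
  shows "(\<lambda>k. Lp_int p M (F k)) \<longlonglongrightarrow> 0"
proof -
  have "(\<lambda>k. LINT x|M. norm (F k x) powr p) \<longlonglongrightarrow> (LINT x|M. 0)"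
  proof (rule integral_dominated_convergence[where w="\<lambda>x. C powr p * norm (G x) powr p"])
    show "integrable M (\<lambda>x. C powr p * norm (G x) powr p)" using G by (auto simp: Lp_on_def)
    show "AE x in M. (\<lambda>k. norm (F k x) powr p) \<longlonglongrightarrow> 0"
      using lim
    proof eventually_elim
      case (elim x)
      have "(\<lambda>k. norm (F k x) powr p) \<longlonglongrightarrow> 0 powr p"
        using p by (intro tendsto_powr' tendsto_norm_zero elim tendsto_const) auto
      then show ?case by simp
    qed
    show "AE x in M. norm (norm (F k x) powr p) \<le> C powr p * norm (G x) powr p" for k
      using b[of k]
    proof eventually_elim
      case (elim x)
      then have "norm (F k x) powr p \<le> (C * norm (G x)) powr p" using p by (intro powr_mono2) auto
      then show ?case using C by (simp add: powr_mult)
    qed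
  qed measurable
  then show ?thesis by (simp add: Lp_int_def)
qed

lemma Lp_lim_bound:
  assumes lim: "(\<lambda>k. Lp_int p M (G k)) \<longlonglongrightarrow> 0" and G: "\<And>k. Lp_on p M (G k)" "\<And>k. F k \<in> borel_measurable M"
    and b: "\<And>k. AE x in M. norm (F k x) \<le> C * norm (G k x)" and C: "0 \<le> C" "0 \<le> p"
  shows "(\<lambda>k. Lp_int p M (F k)) \<longlonglongrightarrow> 0"
proof (rule tendsto_sandwich)
  show "\<forall>\<^sub>F k in sequentially. 0 \<le> Lp_int p M (F k)" by (simp add: Lp_int_nonneg)
  show "\<forall>\<^sub>F k in sequentially. Lp_int p M (F k) \<le> C powr p * Lp_int p M (G k)"
    using Lp_on_bound(2)[OF G(1) G(2) b C] by auto
  show "(\<lambda>k. C powr p * Lp_int p M (G k)) \<longlonglongrightarrow> 0" using tendsto_mult_left[OF lim, of "C powr p"] by simp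
qed auto

lemma Lp_lim_add:
  assumes "(\<lambda>k. Lp_int p M (F k)) \<longlonglongrightarrow> 0" "(\<lambda>k. Lp_int p M (G k)) \<longlonglongrightarrow> 0"
    and FG: "\<And>k. Lp_on p M (F k)" "\<And>k. Lp_on p M (G k)" and p: "0 \<le> p"
  shows "(\<lambda>k. Lp_int p M (\<lambda>x. F k x + G k x)) \<longlonglongrightarrow> 0"
proof (rule tendsto_sandwich)
  show "\<forall>\<^sub>F k in sequentially. 0 \<le> Lp_int p M (\<lambda>x. F k x + G k x)" by (simp add: Lp_int_nonneg)
  show "\<forall>\<^sub>F k in sequentially. Lp_int p M (\<lambda>x. F k x + G k x) \<le> 2 powr p * (Lp_int p M (F k) + Lp_int p M (G k))"
    using Lp_on_add(2)[OF FG p] by auto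
  have "(\<lambda>k. 2 powr p * (Lp_int p M (F k) + Lp_int p M (G k))) \<longlonglongrightarrow> 2 powr p * (0 + 0)"
    by (intro tendsto_intros assms)
  then show "(\<lambda>k. 2 powr p * (Lp_int p M (F k) + Lp_int p M (G k))) \<longlonglongrightarrow> 0" by simp
qed auto

section \<open>The domain, its finite measure and the energy space\<close>

locale grushin_domain =
  fixes lam :: real and \<Omega> :: "(real \<times> (real ^ 'm)) set"
  assumes lam: "1 \<le> lam" and open_dom: "open \<Omega>" and bounded_dom: "bounded \<Omega>"
begin

abbreviation M where "M \<equiv> lebesgue_on \<Omega>"

abbreviation sg :: "(real \<times> (real ^ 'm) \<Rightarrow> real \<times> (real ^ 'm)) \<Rightarrow> real \<times> (real ^ 'm) \<Rightarrow> real \<times> (real ^ 'm)" where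
  "sg g X \<equiv> grushin_sqrtA lam X (g X)"

lemma lam_pos: "0 < lam" using lam by simp

sublocale dom: finite_measure "lebesgue_on \<Omega>"
  by (rule finite_measure_lebesgue_on) (simp add: lmeasurable_open open_dom bounded_dom)

lemma dom_lebesgue: "\<Omega> \<in> sets lebesgue"
  using open_dom by (simp add: borel_open)

lemma borel_measurable_dom:
  fixes F :: "real \<times> (real ^ 'm) \<Rightarrow> 'b::euclidean_space"
  assumes "F \<in> borel_measurable borel"
  shows "F \<in> borel_measurable M"
  using assms by (simp add: borel_measurable_if_D measurable_completion measurable_restrict_space1)

lemma LINT_dom_eq:
  fixes F :: "real \<times> (real ^ 'm) \<Rightarrow> real"
  assumes F: "F \<in> borel_measurable borel" and 0: "\<And>X. X \<notin> \<Omega> \<Longrightarrow> F X = 0"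
  shows "(LINT X|M. F X) = (LINT X|lborel. F X)"
proof -
  have "(LINT X|M. F X) = (LINT X|lebesgue. indicator \<Omega> X *\<^sub>R F X)"
    using dom_lebesgue by (intro integral_restrict_space) auto
  also have "(\<lambda>X. indicator \<Omega> X *\<^sub>R F X) = F" using 0 by (auto simp: indicator_def fun_eq_iff)
  also have "(LINT X|lebesgue. F X) = (LINT X|lborel. F X)" using F by (intro integral_completion) auto
  finally show ?thesis .
qed

lemma sg_cont: "continuous_on UNIV g \<Longrightarrow> continuous_on S (sg g)"
  using lam_pos by (intro continuous_on_grushin_sqrtA) (auto intro: continuous_on_subset)

lemma test_fn_measurable:
  assumes "test_fn \<Omega> v g"
  shows "v \<in> borel_measurable M" "sg g \<in> borel_measurable M" "v \<in> borel_measurable borel" "sg g \<in> borel_measurable borel"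
proof -
  note v = test_fn_C1[OF assms]
  show 1: "v \<in> borel_measurable borel" using C1_pair_measurable[OF v] by auto
  show 2: "sg g \<in> borel_measurable borel"
    using C1_pair_cont_grad[OF v] by (intro borel_measurable_continuous_onI sg_cont)
  show "v \<in> borel_measurable M" "sg g \<in> borel_measurable M" using 1 2 by (auto intro: borel_measurable_dom)
qed

lemma test_fn_bounded:
  assumes "test_fn \<Omega> v g"
  shows "\<exists>C\<ge>0. \<forall>X. \<bar>v X\<bar> \<le> C \<and> norm (sg g X) \<le> C"
proof -
  obtain K where K: "compact K" "\<And>X. X \<notin> K \<Longrightarrow> v X = 0 \<and> g X = 0" and v: "C1_pair v g"
    using assms unfolding test_fn_def by blast
  have "compact (v ` K)" "compact (sg g ` K)"
    using C1_pair_cont[OF v] sg_cont[OF C1_pair_cont_grad[OF v]] K by (auto intro!: compact_continuous_image)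
  then have "bounded (v ` K)" "bounded (sg g ` K)" by (auto intro: compact_imp_bounded)
  then obtain a b where ab: "\<And>X. X \<in> K \<Longrightarrow> \<bar>v X\<bar> \<le> a" "\<And>X. X \<in> K \<Longrightarrow> norm (sg g X) \<le> b"
    unfolding bounded_iff by (metis image_eqI real_norm_def)
  have "\<bar>v X\<bar> \<le> max 0 (max a b) \<and> norm (sg g X) \<le> max 0 (max a b)" for X
  proof (cases "X \<in> K")
    case True then show ?thesis using ab[of X] by auto
  next
    case False then show ?thesis using K(2)[of X] by simp
  qed
  then show ?thesis by (intro exI[of _ "max 0 (max a b)"]) auto
qed

lemma test_fn_Lp:
  assumes "test_fn \<Omega> v g" "0 \<le> p"
  shows "Lp_on p M v" "Lp_on p M (sg g)"
proof -
  obtain C where C: "\<And>X. \<bar>v X\<bar> \<le> C" "\<And>X. norm (sg g X) \<le> C" using test_fn_bounded[OF assms(1)] by blast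
  show "Lp_on p M v" by (rule dom.Lp_on_bounded[OF test_fn_measurable(1)[OF assms(1)], of C]) (use C assms(2) in simp_all)
  show "Lp_on p M (sg g)" by (rule dom.Lp_on_bounded[OF test_fn_measurable(2)[OF assms(1)], of C]) (use C assms(2) in simp_all)
qed

lemma test_fn_LINT:
  assumes "test_fn \<Omega> v g" "0 < p"
  shows "Lp_int p M v = (LINT X|lborel. \<bar>v X\<bar> powr p)" "Lp_int p M (sg g) = (LINT X|lborel. norm (sg g X) powr p)"
  unfolding Lp_int_def using test_fn_measurable[OF assms(1)] test_fn_outside[OF assms(1)] assms(2)
  by (auto intro!: LINT_dom_eq)

text \<open>Pairs \<open>(u, \<surd>A \<nabla>\<^sup>*u)\<close> with \<open>u\<close> in the energy space \<open>W\<^sub>0\<^sup>1\<^sup>,\<^sup>\<lambda>\<^sup>,\<^sup>2\<close>.\<close>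

definition H :: "(real \<times> (real ^ 'm) \<Rightarrow> real) \<Rightarrow> (real \<times> (real ^ 'm) \<Rightarrow> real \<times> (real ^ 'm)) \<Rightarrow> bool" where
  "H u U \<longleftrightarrow> Lp_on 2 M u \<and> Lp_on 2 M U \<and> (\<exists>\<phi> g. (\<forall>k::nat. test_fn \<Omega> (\<phi> k) (g k)) \<and>
     (\<lambda>k. Lp_int 2 M (\<lambda>X. \<phi> k X - u X)) \<longlonglongrightarrow> 0 \<and> (\<lambda>k. Lp_int 2 M (\<lambda>X. sg (g k) X - U X)) \<longlonglongrightarrow> 0)"

lemma H_Lp: "H u U \<Longrightarrow> Lp_on 2 M u" "H u U \<Longrightarrow> Lp_on 2 M U"
  by (auto simp: H_def)

lemma H_measurable: "H u U \<Longrightarrow> u \<in> borel_measurable M" "H u U \<Longrightarrow> U \<in> borel_measurable M"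
  by (auto simp: H_def Lp_on_def)

lemma H_test:
  assumes "test_fn \<Omega> v g" shows "H v (sg g)"
  unfolding H_def using test_fn_Lp[OF assms, of 2] assms
  by (auto simp: Lp_int_def intro!: exI[of _ "\<lambda>_. v"] exI[of _ "\<lambda>_. g"])

text \<open>Two successive subsequences give almost everywhere convergence of functions and
  quasi-gradients simultaneously.\<close>

lemma H_approx:
  assumes "H u U"
  obtains \<phi> g where "\<And>k::nat. test_fn \<Omega> (\<phi> k) (g k)"
     "(\<lambda>k. Lp_int 2 M (\<lambda>X. \<phi> k X - u X)) \<longlonglongrightarrow> 0" "(\<lambda>k. Lp_int 2 M (\<lambda>X. sg (g k) X - U X)) \<longlonglongrightarrow> 0"
     "AE X in M. (\<lambda>k. \<phi> k X) \<longlonglongrightarrow> u X" "AE X in M. (\<lambda>k. sg (g k) X) \<longlonglongrightarrow> U X"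
proof -
  obtain \<phi> g where 1: "\<And>k::nat. test_fn \<Omega> (\<phi> k) (g k)"
    and 2: "(\<lambda>k. Lp_int 2 M (\<lambda>X. \<phi> k X - u X)) \<longlonglongrightarrow> 0" and 3: "(\<lambda>k. Lp_int 2 M (\<lambda>X. sg (g k) X - U X)) \<longlonglongrightarrow> 0"
    using assms unfolding H_def by blast
  obtain r where r: "strict_mono r" "AE X in M. (\<lambda>k. \<phi> (r k) X) \<longlonglongrightarrow> u X"
    using Lp_lim_AE_subseq[where F=\<phi> and G=u and p=2 and M=M, OF test_fn_Lp(1)[OF 1] H_Lp(1)[OF assms] _ 2] by auto
  have sub3: "(\<lambda>k. Lp_int 2 M (\<lambda>X. sg (g (r k)) X - U X)) \<longlonglongrightarrow> 0"
    using LIMSEQ_subseq_LIMSEQ[OF 3 r(1)] by (simp add: o_def)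
  obtain s where s: "strict_mono s" "AE X in M. (\<lambda>k. sg (g (r (s k))) X) \<longlonglongrightarrow> U X"
    using Lp_lim_AE_subseq[where F="\<lambda>k. sg (g (r k))" and G=U and p=2 and M=M, OF test_fn_Lp(2)[OF 1] H_Lp(2)[OF assms] _ sub3] by auto
  have rs: "strict_mono (r \<circ> s)" using r s by (simp add: strict_mono_o)
  show ?thesis
  proof (rule that[of "\<lambda>k. \<phi> (r (s k))" "\<lambda>k. g (r (s k))"])
    show "(\<lambda>k. Lp_int 2 M (\<lambda>X. \<phi> (r (s k)) X - u X)) \<longlonglongrightarrow> 0" "(\<lambda>k. Lp_int 2 M (\<lambda>X. sg (g (r (s k))) X - U X)) \<longlonglongrightarrow> 0"
      using LIMSEQ_subseq_LIMSEQ[OF 2 rs] LIMSEQ_subseq_LIMSEQ[OF 3 rs] by (auto simp: o_def)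
    show "AE X in M. (\<lambda>k. \<phi> (r (s k)) X) \<longlonglongrightarrow> u X"
      using r(2)
    proof eventually_elim
      case (elim x)
      show ?case using LIMSEQ_subseq_LIMSEQ[OF elim s(1)] by (simp add: o_def)
    qed
  qed (use 1 s in auto)
qed

lemma H_diff:
  assumes "H u U" "H w W"
  shows "H (\<lambda>X. u X - w X) (\<lambda>X. U X - W X)"
proof -
  obtain \<phi> g where 1: "\<And>k::nat. test_fn \<Omega> (\<phi> k) (g k)"
    "(\<lambda>k. Lp_int 2 M (\<lambda>X. \<phi> k X - u X)) \<longlonglongrightarrow> 0" "(\<lambda>k. Lp_int 2 M (\<lambda>X. sg (g k) X - U X)) \<longlonglongrightarrow> 0"
    using assms(1) unfolding H_def by blast
  obtain \<psi> h where 2: "\<And>k::nat. test_fn \<Omega> (\<psi> k) (h k)"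
    "(\<lambda>k. Lp_int 2 M (\<lambda>X. \<psi> k X - w X)) \<longlonglongrightarrow> 0" "(\<lambda>k. Lp_int 2 M (\<lambda>X. sg (h k) X - W X)) \<longlonglongrightarrow> 0"
    using assms(2) unfolding H_def by blast
  have L: "Lp_on 2 M (\<lambda>X. \<phi> k X - u X)" "Lp_on 2 M (\<lambda>X. sg (g k) X - U X)"
      "Lp_on 2 M (\<lambda>X. w X - \<psi> k X)" "Lp_on 2 M (\<lambda>X. W X - sg (h k) X)" for k
    using test_fn_Lp[OF 1(1)[of k], of 2] test_fn_Lp[OF 2(1)[of k], of 2] H_Lp[OF assms(1)] H_Lp[OF assms(2)]
    by (auto intro: Lp_on_diff)
  have "(\<lambda>k. Lp_int 2 M (\<lambda>X. (\<phi> k X - u X) + (w X - \<psi> k X))) \<longlonglongrightarrow> 0"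
    by (rule Lp_lim_add) (use 1 2 L in \<open>auto simp: Lp_int_commute[of _ _ w]\<close>)
  moreover have "(\<lambda>k. Lp_int 2 M (\<lambda>X. (sg (g k) X - U X) + (W X - sg (h k) X))) \<longlonglongrightarrow> 0"
    by (rule Lp_lim_add) (use 1 2 L in \<open>auto simp: Lp_int_commute[of _ _ W]\<close>)
  moreover have "(\<phi> k X - u X) + (w X - \<psi> k X) = (\<phi> k X - \<psi> k X) - (u X - w X)" for k X by simp
  moreover have "(sg (g k) X - U X) + (W X - sg (h k) X) = sg (\<lambda>X. g k X - h k X) X - (U X - W X)" for k X
    by (simp add: grushin_sqrtA_def prod_eq_iff algebra_simps)
  ultimately show ?thesis unfolding H_def
    using Lp_on_diff(1)[OF H_Lp(1)[OF assms(1)] H_Lp(1)[OF assms(2)]] Lp_on_diff(1)[OF H_Lp(2)[OF assms(1)] H_Lp(2)[OF assms(2)]]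
      test_fn_diff[OF 1(1) 2(1)]
    by (auto intro!: exI[of _ "\<lambda>k X. \<phi> k X - \<psi> k X"] exI[of _ "\<lambda>k X. g k X - h k X"])
qed

lemma H_zero: "H (\<lambda>X. 0) (\<lambda>X. 0)"
  using H_test[OF test_fn_zero] by simp

text \<open>Covers both \<psi> = 1 with \<open>T 0 = 0\<close> and a test function \<psi> with
  arbitrary T. The hypothesis \<open>tst\<close> isolates the only point where the two differ: why
  the approximants have compact support.\<close>

lemma H_mult_compose:
  assumes H: "H u U" and \<psi>: "C1_pair \<psi> h" and T: "\<And>s. (T has_real_derivative T' s) (at s)" "continuous_on UNIV T'"
    and C: "\<And>s. \<bar>T' s\<bar> \<le> C" and C1: "\<And>X. \<bar>\<psi> X\<bar> \<le> C1" and C2: "\<And>X. norm (sg h X) \<le> C2"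
    and tst: "\<And>v g. test_fn \<Omega> v g \<Longrightarrow> test_fn \<Omega> (\<lambda>X. \<psi> X * T (v X)) (\<lambda>X. \<psi> X *\<^sub>R (T' (v X) *\<^sub>R g X) + T (v X) *\<^sub>R h X)"
  shows "H (\<lambda>X. \<psi> X * T (u X)) (\<lambda>X. (\<psi> X * T' (u X)) *\<^sub>R U X + T (u X) *\<^sub>R sg h X)"
proof -
  obtain \<phi> g where \<phi>: "\<And>k::nat. test_fn \<Omega> (\<phi> k) (g k)"
     "(\<lambda>k. Lp_int 2 M (\<lambda>X. \<phi> k X - u X)) \<longlonglongrightarrow> 0" "(\<lambda>k. Lp_int 2 M (\<lambda>X. sg (g k) X - U X)) \<longlonglongrightarrow> 0"
     "AE X in M. (\<lambda>k. \<phi> k X) \<longlonglongrightarrow> u X" "AE X in M. (\<lambda>k. sg (g k) X) \<longlonglongrightarrow> U X"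
    using H_approx[OF H] by blast
  have nn: "0 \<le> C" "0 \<le> C1" "0 \<le> C2" using C[of 0] C1[of 0] C2[of 0] by (meson abs_ge_zero norm_ge_zero order_trans)+
  have [measurable]: "u \<in> borel_measurable M" "U \<in> borel_measurable M" using H_measurable[OF H] by auto
  have [measurable]: "\<phi> k \<in> borel_measurable M" "sg (g k) \<in> borel_measurable M" for k using test_fn_measurable[OF \<phi>(1)] by auto
  have [measurable]: "\<psi> \<in> borel_measurable M" using C1_pair_measurable[OF \<psi>] by (auto intro: borel_measurable_dom)
  have [measurable]: "sg h \<in> borel_measurable M"
    using sg_cont[OF C1_pair_cont_grad[OF \<psi>]] by (intro borel_measurable_dom borel_measurable_continuous_onI)
  have "continuous_on UNIV T" using T(1) by (meson DERIV_isCont continuous_at_imp_continuous_on)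
  then have [measurable]: "T \<in> borel_measurable borel" "T' \<in> borel_measurable borel" using T(2) by (auto intro: borel_measurable_continuous_onI)
  have Tlip: "\<bar>T a - T b\<bar> \<le> C * \<bar>a - b\<bar>" for a b
    using field_differentiable_bound[of UNIV T T' C b a] T(1) C by (auto simp: has_field_derivative_at_within abs_minus_commute)
  have Lu: "Lp_on 2 M (\<lambda>X. \<phi> k X - u X)" "Lp_on 2 M (\<lambda>X. sg (g k) X - U X)" for k
    using test_fn_Lp[OF \<phi>(1)[of k], of 2] H_Lp[OF H] by (auto intro: Lp_on_diff)
  define F where "F k X = \<psi> X * T (\<phi> k X)" for k X
  define G where "G k X = \<psi> X *\<^sub>R (T' (\<phi> k X) *\<^sub>R g k X) + T (\<phi> k X) *\<^sub>R h X" for k X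
  have FG: "test_fn \<Omega> (F k) (G k)" for k unfolding F_def G_def by (rule tst[OF \<phi>(1)])
  have sgG: "sg (G k) X = (\<psi> X * T' (\<phi> k X)) *\<^sub>R sg (g k) X + T (\<phi> k X) *\<^sub>R sg h X" for k X
    by (simp add: G_def grushin_sqrtA_def prod_eq_iff algebra_simps)
  let ?F = "\<lambda>X. \<psi> X * T (u X)" and ?G = "\<lambda>X. (\<psi> X * T' (u X)) *\<^sub>R U X + T (u X) *\<^sub>R sg h X"
  have Fb: "\<bar>F k X - ?F X\<bar> \<le> (C1 * C) * \<bar>\<phi> k X - u X\<bar>" for k X
  proof -
    have "\<bar>F k X - ?F X\<bar> = \<bar>\<psi> X\<bar> * \<bar>T (\<phi> k X) - T (u X)\<bar>" by (simp add: F_def abs_mult flip: right_diff_distrib)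
    also have "\<dots> \<le> C1 * (C * \<bar>\<phi> k X - u X\<bar>)" using C1 Tlip nn by (intro mult_mono) auto
    finally show ?thesis by (simp add: mult.assoc)
  qed
  have Flim: "(\<lambda>k. Lp_int 2 M (\<lambda>X. F k X - ?F X)) \<longlonglongrightarrow> 0"
    by (rule Lp_lim_bound[where C="C1 * C", OF \<phi>(2) Lu(1)]) (use Fb nn in \<open>auto simp: F_def\<close>)
  have LF: "Lp_on 2 M (\<lambda>X. F k X - ?F X)" for k
    by (rule Lp_on_bound(1)[where C="C1 * C", OF Lu(1)[of k]]) (use Fb nn in \<open>auto simp: F_def\<close>)
  \<comment> \<open>The error of the quasi-gradients has three parts: convergence of the gradients
    (a), of T' along the sequence (b), and of T (c). For a and c the bounds on T' suffice; b has
    only pointwise convergence, so it goes by dominated convergence with a multiple of |U| as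
    majorant.\<close>
  define a where "a k X = (\<psi> X * T' (\<phi> k X)) *\<^sub>R (sg (g k) X - U X)" for k X
  define b where "b k X = (\<psi> X * (T' (\<phi> k X) - T' (u X))) *\<^sub>R U X" for k X
  define c where "c k X = (T (\<phi> k X) - T (u X)) *\<^sub>R sg h X" for k X
  have [measurable]: "a k \<in> borel_measurable M" "b k \<in> borel_measurable M" "c k \<in> borel_measurable M" for k
    unfolding a_def b_def c_def by measurable
  have ab: "norm (a k X) \<le> (C1 * C) * norm (sg (g k) X - U X)" for k X
    unfolding a_def norm_scaleR abs_mult by (intro mult_right_mono mult_mono C C1 nn) auto
  have bb: "norm (b k X) \<le> (C1 * (2 * C)) * norm (U X)" for k X
    unfolding b_def norm_scaleR abs_mult
    using C[of "\<phi> k X"] C[of "u X"] by (intro mult_right_mono mult_mono C1 nn) auto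
  have cb: "norm (c k X) \<le> (C * C2) * norm (\<phi> k X - u X)" for k X
  proof -
    have "norm (c k X) \<le> (C * \<bar>\<phi> k X - u X\<bar>) * C2"
      unfolding c_def norm_scaleR using nn by (intro mult_mono Tlip C2) auto
    then show ?thesis by (simp add: algebra_simps)
  qed
  have La: "Lp_on 2 M (a k)" for k by (rule Lp_on_bound(1)[where C="C1 * C", OF Lu(2)[of k]]) (use ab nn in auto)
  have Lb: "Lp_on 2 M (b k)" for k by (rule Lp_on_bound(1)[where C="C1 * (2 * C)", OF H_Lp(2)[OF H]]) (use bb nn in auto)
  have Lc: "Lp_on 2 M (c k)" for k by (rule Lp_on_bound(1)[where C="C * C2", OF Lu(1)[of k]]) (use cb nn in auto)
  have alim: "(\<lambda>k. Lp_int 2 M (a k)) \<longlonglongrightarrow> 0" by (rule Lp_lim_bound[where C="C1 * C", OF \<phi>(3) Lu(2)]) (use ab nn in auto)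
  have clim: "(\<lambda>k. Lp_int 2 M (c k)) \<longlonglongrightarrow> 0" by (rule Lp_lim_bound[where C="C * C2", OF \<phi>(2) Lu(1)]) (use cb nn in auto)
  have blim: "(\<lambda>k. Lp_int 2 M (b k)) \<longlonglongrightarrow> 0"
  proof (rule Lp_lim_dominated[where C="C1 * (2 * C)", OF _ _ H_Lp(2)[OF H]])
    show "AE X in M. (\<lambda>k. b k X) \<longlonglongrightarrow> 0"
      using \<phi>(4)
    proof eventually_elim
      case (elim X)
      have "isCont T' (u X)" using T(2) by (simp add: continuous_on_eq_continuous_at)
      then have "(\<lambda>k. T' (\<phi> k X)) \<longlonglongrightarrow> T' (u X)" using elim by (rule isCont_tendsto_compose)
      then have "(\<lambda>k. (\<psi> X * (T' (\<phi> k X) - T' (u X))) *\<^sub>R U X) \<longlonglongrightarrow> (\<psi> X * (T' (u X) - T' (u X))) *\<^sub>R U X"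
        by (intro tendsto_intros)
      then show ?case by (simp add: b_def)
    qed
  qed (use bb nn in auto)
  have eq: "sg (G k) X - ?G X = a k X + (b k X + c k X)" for k X
    unfolding sgG a_def b_def c_def by (simp add: algebra_simps)
  have Lbc: "Lp_on 2 M (\<lambda>X. b k X + c k X)" for k by (rule Lp_on_add(1)[OF Lb Lc]) simp
  have Glim: "(\<lambda>k. Lp_int 2 M (\<lambda>X. sg (G k) X - ?G X)) \<longlonglongrightarrow> 0"
    unfolding eq by (intro Lp_lim_add alim blim clim La Lb Lc Lbc) auto
  have LG: "Lp_on 2 M (\<lambda>X. sg (G k) X - ?G X)" for k
    unfolding eq by (rule Lp_on_add(1)[OF La Lbc]) simp
  have "Lp_on 2 M ?F" using Lp_on_diff(1)[OF test_fn_Lp(1)[OF FG[of 0], of 2] LF[of 0]] by simp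
  moreover have "Lp_on 2 M ?G"
  proof -
    have "Lp_on 2 M (\<lambda>X. sg (G 0) X - (sg (G 0) X - ?G X))"
      by (rule Lp_on_diff(1)[OF test_fn_Lp(2)[OF FG[of 0], of 2] LG[of 0]]) simp_all
    moreover have "(\<lambda>X. sg (G 0) X - (sg (G 0) X - ?G X)) = ?G" by (rule ext) simp
    ultimately show ?thesis by (simp only:)
  qed
  ultimately show ?thesis unfolding H_def using FG Flim Glim by blast
qed

lemma H_compose:
  assumes H: "H u U" and T: "\<And>s. (T has_real_derivative T' s) (at s)" "continuous_on UNIV T'"
    and C: "\<And>s. \<bar>T' s\<bar> \<le> C" and T0: "T 0 = 0"
  shows "H (\<lambda>X. T (u X)) (\<lambda>X. T' (u X) *\<^sub>R U X)"
proof -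
  have "H (\<lambda>X. 1 * T (u X)) (\<lambda>X. (1 * T' (u X)) *\<^sub>R U X + T (u X) *\<^sub>R sg (\<lambda>X. 0) X)"
    by (rule H_mult_compose[OF H C1_pair_const[of 1] T C, of 1 0]) (use test_fn_compose[OF _ T T0] in auto)
  then show ?thesis by simp
qed

lemma H_test_mult_compose:
  assumes H: "H u U" and \<psi>: "test_fn \<Omega> \<psi> h" and T: "\<And>s. (T has_real_derivative T' s) (at s)" "continuous_on UNIV T'"
    and C: "\<And>s. \<bar>T' s\<bar> \<le> C"
  shows "H (\<lambda>X. \<psi> X * T (u X)) (\<lambda>X. (\<psi> X * T' (u X)) *\<^sub>R U X + T (u X) *\<^sub>R sg h X)"
proof -
  obtain C1 where "\<forall>X. \<bar>\<psi> X\<bar> \<le> C1 \<and> norm (sg h X) \<le> C1" using test_fn_bounded[OF \<psi>] by blast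
  then show ?thesis
    using test_fn_mult[OF \<psi> C1_pair_compose[OF test_fn_C1 T]]
    by (intro H_mult_compose[OF H test_fn_C1[OF \<psi>] T C, of C1 C1]) auto
qed

end

lemma Lp_on_2_eq: "Lp_on 2 M F \<longleftrightarrow> F \<in> borel_measurable M \<and> integrable M (\<lambda>x. (norm (F x))\<^sup>2)"
  by (simp add: Lp_on_def)

lemma Lp_int_2_eq: "Lp_int 2 M F = (LINT x|M. (norm (F x))\<^sup>2)"
  by (simp add: Lp_int_def)

lemma Lp_int_zero_AE:
  assumes "Lp_on p M F" "Lp_int p M F = 0"
  shows "AE x in M. F x = 0"
proof -
  have "AE x in M. norm (F x) powr p = 0"
    using integral_nonneg_eq_0_iff_AE[of M "\<lambda>x. norm (F x) powr p"] assms by (auto simp: Lp_on_def Lp_int_def)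
  then show ?thesis by eventually_elim simp
qed

section \<open>Poincare and Sobolev inequalities on the energy space, weak solutions and
  comparison\<close>

context grushin_domain
begin

lemma nn_integral_dom_eq:
  fixes F :: "real \<times> (real ^ 'm) \<Rightarrow> ennreal"
  assumes F: "F \<in> borel_measurable borel" and 0: "\<And>X. X \<notin> \<Omega> \<Longrightarrow> F X = 0"
  shows "(\<integral>\<^sup>+X. F X \<partial>M) = (\<integral>\<^sup>+X. F X \<partial>lborel)"
proof -
  have "(\<integral>\<^sup>+X. F X \<partial>M) = (\<integral>\<^sup>+X. F X * indicator \<Omega> X \<partial>lebesgue)"
    using dom_lebesgue by (intro nn_integral_restrict_space) auto
  also have "(\<lambda>X. F X * indicator \<Omega> X) = F" using 0 by (auto simp: indicator_def fun_eq_iff)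
  also have "(\<integral>\<^sup>+X. F X \<partial>lebesgue) = (\<integral>\<^sup>+X. F X \<partial>lborel)" by (rule nn_integral_completion)
  finally show ?thesis .
qed

lemma test_fn_nn_integral:
  assumes "test_fn \<Omega> v g"
  shows "ennreal (Lp_int 2 M v) = (\<integral>\<^sup>+X. ennreal ((v X)\<^sup>2) \<partial>lborel)"
    "ennreal (Lp_int 2 M (sg g)) = (\<integral>\<^sup>+X. ennreal ((norm (sg g X))\<^sup>2) \<partial>lborel)"
proof -
  have [measurable]: "v \<in> borel_measurable borel" "sg g \<in> borel_measurable borel" using test_fn_measurable[OF assms] by auto
  have "ennreal (Lp_int 2 M v) = (\<integral>\<^sup>+X. ennreal ((v X)\<^sup>2) \<partial>M)"
    using test_fn_Lp(1)[OF assms, of 2] by (simp add: Lp_on_2_eq Lp_int_2_eq nn_integral_eq_integral)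
  also have "\<dots> = (\<integral>\<^sup>+X. ennreal ((v X)\<^sup>2) \<partial>lborel)"
    using test_fn_outside[OF assms] by (intro nn_integral_dom_eq) auto
  finally show "ennreal (Lp_int 2 M v) = (\<integral>\<^sup>+X. ennreal ((v X)\<^sup>2) \<partial>lborel)" .
  have "ennreal (Lp_int 2 M (sg g)) = (\<integral>\<^sup>+X. ennreal ((norm (sg g X))\<^sup>2) \<partial>M)"
    using test_fn_Lp(2)[OF assms, of 2] by (simp add: Lp_on_2_eq Lp_int_2_eq nn_integral_eq_integral)
  also have "\<dots> = (\<integral>\<^sup>+X. ennreal ((norm (sg g X))\<^sup>2) \<partial>lborel)"
    using test_fn_outside[OF assms] by (intro nn_integral_dom_eq) auto
  finally show "ennreal (Lp_int 2 M (sg g)) = (\<integral>\<^sup>+X. ennreal ((norm (sg g X))\<^sup>2) \<partial>lborel)" .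
qed

text \<open>A shift by h = 2 R + 1 in x moves \<Omega> off itself, so v (X + (h, 0)) - v X equals -
  v X on \<Omega> and the shift estimate in x bounds v itself.\<close>

lemma test_fn_poincare:
  "\<exists>C>0. \<forall>v g. test_fn \<Omega> v g \<longrightarrow> Lp_int 2 M v \<le> C * Lp_int 2 M (sg g)"
proof -
  obtain R where R: "0 < R" "\<And>X. X \<in> \<Omega> \<Longrightarrow> norm X \<le> R" using bounded_dom bounded_pos[of \<Omega>] by auto
  define h where "h = 2 * R + 1"
  have h: "0 < h" using R by (simp add: h_def)
  have out: "X + (h, 0) \<notin> \<Omega>" if "X \<in> \<Omega>" for X
  proof
    assume "X + (h, 0) \<in> \<Omega>"
    then have "norm ((X + (h, 0)) - X) \<le> R + R" using R(2) that by (intro norm_triangle_le_diff add_mono) auto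
    then show False using h R by (simp add: norm_prod_def h_def)
  qed
  have "Lp_int 2 M v \<le> h\<^sup>2 * Lp_int 2 M (sg g)" if v: "test_fn \<Omega> v g" for v g
  proof -
    have "ennreal (Lp_int 2 M v) = (\<integral>\<^sup>+X. ennreal ((v (X + (h, 0)) - v X)\<^sup>2) * indicator \<Omega> X \<partial>lborel)"
      unfolding test_fn_nn_integral[OF v] using out test_fn_outside[OF v]
      by (intro nn_integral_cong) (auto simp: indicator_def)
    also have "\<dots> \<le> ennreal (h\<^sup>2) * (\<integral>\<^sup>+X. ennreal ((norm (sg g X))\<^sup>2) * indicator UNIV X \<partial>lborel)"
      using open_dom lam_pos by (intro grushin_shift_x[OF test_fn_C1[OF v]]) auto
    also have "\<dots> = ennreal (h\<^sup>2 * Lp_int 2 M (sg g))"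
      using test_fn_nn_integral(2)[OF v] by (simp add: ennreal_mult Lp_int_nonneg)
    finally show ?thesis by (subst (asm) ennreal_le_iff) (auto simp: Lp_int_nonneg)
  qed
  then show ?thesis using h by (intro exI[of _ "h\<^sup>2"]) auto
qed

lemma H_norm_lim:
  assumes H: "H u U" and \<phi>: "\<And>k::nat. test_fn \<Omega> (\<phi> k) (g k)"
     "(\<lambda>k. Lp_int 2 M (\<lambda>X. \<phi> k X - u X)) \<longlonglongrightarrow> 0" "(\<lambda>k. Lp_int 2 M (\<lambda>X. sg (g k) X - U X)) \<longlonglongrightarrow> 0"
  shows "(\<lambda>k. Lp_int 2 M (\<phi> k)) \<longlonglongrightarrow> Lp_int 2 M u" "(\<lambda>k. Lp_int 2 M (sg (g k))) \<longlonglongrightarrow> Lp_int 2 M U"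
  using L2_norm_lim[where F=\<phi>, OF test_fn_Lp(1)[OF \<phi>(1)] H_Lp(1)[OF H] \<phi>(2)]
    L2_norm_lim[where F="\<lambda>k. sg (g k)", OF test_fn_Lp(2)[OF \<phi>(1)] H_Lp(2)[OF H] \<phi>(3)] by auto

lemma H_poincare:
  "\<exists>C>0. \<forall>u U. H u U \<longrightarrow> Lp_int 2 M u \<le> C * Lp_int 2 M U"
proof -
  obtain C where C: "C > 0" "\<And>v g. test_fn \<Omega> v g \<Longrightarrow> Lp_int 2 M v \<le> C * Lp_int 2 M (sg g)"
    using test_fn_poincare by blast
  have "Lp_int 2 M u \<le> C * Lp_int 2 M U" if H: "H u U" for u U
  proof -
    obtain \<phi> g where \<phi>: "\<And>k::nat. test_fn \<Omega> (\<phi> k) (g k)"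
     "(\<lambda>k. Lp_int 2 M (\<lambda>X. \<phi> k X - u X)) \<longlonglongrightarrow> 0" "(\<lambda>k. Lp_int 2 M (\<lambda>X. sg (g k) X - U X)) \<longlonglongrightarrow> 0"
      using H_approx[OF H] by blast
    show ?thesis
    proof (rule LIMSEQ_le[OF H_norm_lim(1)[OF H \<phi>] tendsto_mult_left[OF H_norm_lim(2)[OF H \<phi>]]])
      show "\<exists>N. \<forall>n\<ge>N. Lp_int 2 M (\<phi> n) \<le> C * Lp_int 2 M (sg (g n))" using C(2)[OF \<phi>(1)] by blast
    qed
  qed
  then show ?thesis using C(1) by blast
qed

text \<open>The homogeneous dimension of the dilations that scale x by t and y by t^(1 + lam);
  \<open>sob\<close> is the matching Sobolev exponent.\<close>

definition Qdim :: real where "Qdim = (real CARD('m) + 1) + lam * real CARD('m)"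

definition sob :: real where "sob = 2 * Qdim / (Qdim - 2)"

lemma Qdim_ge: "3 \<le> Qdim"
proof -
  have c: "1 \<le> real CARD('m)" by (simp add: Suc_leI)
  have "1 * 1 \<le> lam * real CARD('m)" using lam c by (intro mult_mono) auto
  with c show ?thesis unfolding Qdim_def by linarith
qed

lemma sob_gt: "2 < sob"
  using Qdim_ge by (simp add: sob_def field_simps)

text \<open>Fatou's lemma along an almost everywhere convergent approximation. This also proves that
  u lies in L^p for p = \<open>sob\<close>, which is not part of membership in
  \<open>H\<close>.\<close>

lemma H_sobolev:
  "\<exists>C>0. \<forall>u U. H u U \<longrightarrow> Lp_on sob M u \<and> Lp_int sob M u powr (2 / sob) \<le> C * Lp_int 2 M U"
proof -
  obtain C where C: "C > 0" "\<And>v g K. C1_pair v g \<Longrightarrow> compact K \<Longrightarrow> (\<forall>X. X \<notin> K \<longrightarrow> v X = 0 \<and> g X = 0) \<Longrightarrow>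
    (LINT X|lborel. \<bar>v X\<bar> powr sob) powr (2 / sob) \<le> C * (LINT X|lborel. (norm (sg g X))\<^sup>2)"
    using grushin_sobolev[OF lam_pos, where 'm='m, OF Qdim_def] Qdim_ge unfolding sob_def[symmetric] by auto
  have t: "Lp_int sob M v powr (2 / sob) \<le> C * Lp_int 2 M (sg g)" if v: "test_fn \<Omega> v g" for v g
  proof -
    obtain K where "compact K" "\<forall>X. X \<notin> K \<longrightarrow> v X = 0 \<and> g X = 0" using v unfolding test_fn_def by blast
    from C(2)[OF test_fn_C1[OF v] this] show ?thesis
      using test_fn_LINT(1)[OF v, of sob] test_fn_LINT(2)[OF v, of 2] sob_gt by simp
  qed
  have "Lp_on sob M u \<and> Lp_int sob M u powr (2 / sob) \<le> C * Lp_int 2 M U" if H: "H u U" for u U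
  proof -
    obtain \<phi> g where \<phi>: "\<And>k::nat. test_fn \<Omega> (\<phi> k) (g k)"
     "(\<lambda>k. Lp_int 2 M (\<lambda>X. \<phi> k X - u X)) \<longlonglongrightarrow> 0" "(\<lambda>k. Lp_int 2 M (\<lambda>X. sg (g k) X - U X)) \<longlonglongrightarrow> 0"
     "AE X in M. (\<lambda>k. \<phi> k X) \<longlonglongrightarrow> u X" "AE X in M. (\<lambda>k. sg (g k) X) \<longlonglongrightarrow> U X"
      using H_approx[OF H] by blast
    have [measurable]: "u \<in> borel_measurable M" using H_measurable[OF H] by auto
    have [measurable]: "\<phi> k \<in> borel_measurable M" for k using test_fn_measurable[OF \<phi>(1)] by auto
    define B where "B k = (C * Lp_int 2 M (sg (g k))) powr (sob / 2)" for k
    define B' where "B' = (C * Lp_int 2 M U) powr (sob / 2)"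
    have Blim: "B \<longlonglongrightarrow> B'" unfolding B_def B'_def
      using H_norm_lim(2)[OF H \<phi>(1-3)] sob_gt C(1)
      by (intro tendsto_powr' tendsto_mult tendsto_const) (auto simp: Lp_int_nonneg intro!: always_eventually)
    have kB: "(\<integral>\<^sup>+X. ennreal (\<bar>\<phi> k X\<bar> powr sob) \<partial>M) \<le> ennreal (B k)" for k
    proof -
      have "Lp_int sob M (\<phi> k) = (Lp_int sob M (\<phi> k) powr (2 / sob)) powr (sob / 2)"
        using sob_gt by (simp add: powr_powr Lp_int_nonneg)
      also have "\<dots> \<le> B k" unfolding B_def
        using t[OF \<phi>(1)[of k]] sob_gt by (intro powr_mono2) auto
      finally have "Lp_int sob M (\<phi> k) \<le> B k" .
      moreover have "(\<integral>\<^sup>+X. ennreal (\<bar>\<phi> k X\<bar> powr sob) \<partial>M) = ennreal (Lp_int sob M (\<phi> k))"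
        using test_fn_Lp(1)[OF \<phi>(1)[of k], of sob] sob_gt unfolding Lp_int_def Lp_on_def
        by (auto intro!: nn_integral_eq_integral)
      ultimately show ?thesis by (simp add: ennreal_leI)
    qed
    have "(\<integral>\<^sup>+X. ennreal (\<bar>u X\<bar> powr sob) \<partial>M) = (\<integral>\<^sup>+X. liminf (\<lambda>k. ennreal (\<bar>\<phi> k X\<bar> powr sob)) \<partial>M)"
    proof (rule nn_integral_cong_AE)
      show "AE X in M. ennreal (\<bar>u X\<bar> powr sob) = liminf (\<lambda>k. ennreal (\<bar>\<phi> k X\<bar> powr sob))"
        using \<phi>(4)
      proof eventually_elim
        case (elim X)
        have "(\<lambda>k. \<bar>\<phi> k X\<bar> powr sob) \<longlonglongrightarrow> \<bar>u X\<bar> powr sob"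
          using sob_gt by (intro tendsto_powr' tendsto_rabs elim tendsto_const) auto
        then have "(\<lambda>k. ennreal (\<bar>\<phi> k X\<bar> powr sob)) \<longlonglongrightarrow> ennreal (\<bar>u X\<bar> powr sob)"
          by (intro tendsto_ennrealI)
        then show ?case using lim_imp_Liminf[OF sequentially_bot] by metis
      qed
    qed
    also have "\<dots> \<le> liminf (\<lambda>k. \<integral>\<^sup>+X. ennreal (\<bar>\<phi> k X\<bar> powr sob) \<partial>M)"
      by (rule nn_integral_liminf) measurable
    also have "\<dots> \<le> liminf (\<lambda>k. ennreal (B k))"
      by (intro Liminf_mono always_eventually allI kB)
    also have "\<dots> = ennreal B'"
      by (intro lim_imp_Liminf tendsto_ennrealI Blim) auto
    finally have le: "(\<integral>\<^sup>+X. ennreal (\<bar>u X\<bar> powr sob) \<partial>M) \<le> ennreal B'" .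
    then have i: "integrable M (\<lambda>X. \<bar>u X\<bar> powr sob)"
      by (intro integrableI_bounded) (auto simp: le_less_trans[OF _ ennreal_less_top])
    then have L: "Lp_on sob M u" by (simp add: Lp_on_def)
    have "ennreal (Lp_int sob M u) \<le> ennreal B'"
      using le nn_integral_eq_integral[OF i] by (simp add: Lp_int_def)
    then have "Lp_int sob M u \<le> B'" by (subst (asm) ennreal_le_iff) (auto simp: B'_def)
    then have "Lp_int sob M u powr (2 / sob) \<le> B' powr (2 / sob)"
      using sob_gt by (intro powr_mono2) (auto simp: Lp_int_nonneg)
    also have "\<dots> = C * Lp_int 2 M U"
      using sob_gt C(1) by (simp add: B'_def powr_powr Lp_int_nonneg)
    finally show ?thesis using L by blast
  qed
  then show ?thesis using C(1) by blast
qed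

text \<open>Testing with the whole energy space allows functions of the solutions themselves to be
  inserted; \<open>weak_solI\<close> reduces this to C1 test functions, and G in L^2 makes the right
  side continuous in v.\<close>

definition weak_sol where
  "weak_sol u U G \<longleftrightarrow> H u U \<and> Lp_on 2 M G \<and> (\<forall>v V. H v V \<longrightarrow> (LINT X|M. U X \<bullet> V X) = (LINT X|M. G X * v X))"

lemma weak_solD:
  assumes "weak_sol u U G"
  shows "H u U" "Lp_on 2 M G" "H v V \<Longrightarrow> (LINT X|M. U X \<bullet> V X) = (LINT X|M. G X * v X)"
  using assms by (auto simp: weak_sol_def)

lemma weak_solI:
  assumes H: "H u U" and G: "Lp_on 2 M G"
    and t: "\<And>v g. test_fn \<Omega> v g \<Longrightarrow> (LINT X|M. U X \<bullet> sg g X) = (LINT X|M. G X * v X)"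
  shows "weak_sol u U G"
  unfolding weak_sol_def
proof (intro conjI allI impI H G)
  fix v V assume v: "H v V"
  obtain \<phi> g where \<phi>: "\<And>k::nat. test_fn \<Omega> (\<phi> k) (g k)"
     "(\<lambda>k. Lp_int 2 M (\<lambda>X. \<phi> k X - v X)) \<longlonglongrightarrow> 0" "(\<lambda>k. Lp_int 2 M (\<lambda>X. sg (g k) X - V X)) \<longlonglongrightarrow> 0"
    using H_approx[OF v] by blast
  have 1: "(\<lambda>k. LINT X|M. sg (g k) X \<bullet> U X) \<longlonglongrightarrow> (LINT X|M. V X \<bullet> U X)"
    by (rule L2_inner_lim[OF test_fn_Lp(2)[OF \<phi>(1)] H_Lp(2)[OF v] H_Lp(2)[OF H] \<phi>(3)]) simp
  have 2: "(\<lambda>k. LINT X|M. \<phi> k X \<bullet> G X) \<longlonglongrightarrow> (LINT X|M. v X \<bullet> G X)"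
    by (rule L2_inner_lim[OF test_fn_Lp(1)[OF \<phi>(1)] H_Lp(1)[OF v] G \<phi>(2)]) simp
  have "(LINT X|M. sg (g k) X \<bullet> U X) = (LINT X|M. \<phi> k X \<bullet> G X)" for k
    using t[OF \<phi>(1)[of k]] by (simp add: inner_commute mult.commute)
  then have "(LINT X|M. V X \<bullet> U X) = (LINT X|M. v X \<bullet> G X)" using 1 2 by (auto intro: LIMSEQ_unique)
  then show "(LINT X|M. U X \<bullet> V X) = (LINT X|M. G X * v X)" by (simp add: inner_commute mult.commute)
qed

text \<open>The difference of the equations is tested with a C1 substitute T for the positive part
  of u - w. Wherever the test function is positive, G <= K, so the tested energy is at most 0; the
  Poincare inequality then gives T (u - w) = 0. Restricting \<open>le\<close> to w < u is what lets
  a right side antitone in the solution qualify.\<close>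

lemma weak_sol_comparison:
  assumes u: "weak_sol u U G" and w: "weak_sol w W K"
    and le: "AE X in M. w X < u X \<longrightarrow> G X \<le> K X"
  shows "AE X in M. u X \<le> w X"
proof -
  \<comment> \<open>Quadratic at 0, hence C1 across it; linear growth keeps the derivative in
    [0, 1]; positive exactly for s > 0.\<close>
  define T where "T s = (max s 0)\<^sup>2 / (1 + max s 0)" for s :: real
  define T' where "T' s = ((max s 0)\<^sup>2 + 2 * max s 0) / (1 + max s 0)\<^sup>2" for s :: real
  have TD: "(T has_real_derivative T' s) (at s)" for s
  proof -
    have "((\<lambda>t. t\<^sup>2 / (1 + t)) has_real_derivative (t\<^sup>2 + 2 * t) / (1 + t)\<^sup>2) (at t within {0..})" if "0 \<le> t" for t :: real
      using that by (auto intro!: derivative_eq_intros simp: power2_eq_square algebra_simps)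
    from DERIV_extend_linear[OF this, of s] show ?thesis by (simp add: T_def[abs_def] T'_def)
  qed
  have T'c: "continuous_on UNIV T'" unfolding T'_def
    by (intro continuous_intros) (auto simp: add_nonneg_eq_0_iff)
  have T'b: "0 \<le> T' s" "T' s \<le> 1" for s
  proof -
    define m where "m = max s 0"
    have m: "0 \<le> m" "0 < (1 + m)\<^sup>2" by (auto simp: m_def add_pos_nonneg)
    then show "0 \<le> T' s" unfolding T'_def m_def[symmetric] by simp
    have "m\<^sup>2 + 2 * m \<le> (1 + m)\<^sup>2" by (simp add: power2_eq_square algebra_simps)
    then show "T' s \<le> 1" unfolding T'_def m_def[symmetric] using m by (simp add: divide_le_eq)
  qed
  have T0: "T 0 = 0" "0 \<le> T s" "s \<le> 0 \<Longrightarrow> T s = 0" "0 < s \<Longrightarrow> 0 < T s" for s by (auto simp: T_def add_pos_pos)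
  define d where "d X = u X - w X" for X
  define D where "D X = U X - W X" for X
  have Hd: "H d D" unfolding d_def D_def by (rule H_diff[OF weak_solD(1)[OF u] weak_solD(1)[OF w]])
  have HT: "H (\<lambda>X. T (d X)) (\<lambda>X. T' (d X) *\<^sub>R D X)"
    by (rule H_compose[OF Hd TD T'c, of 1]) (use T'b T0 in auto)
  have [measurable]: "d \<in> borel_measurable M" "D \<in> borel_measurable M" using H_measurable[OF Hd] by auto
  note L = H_Lp[OF HT] and Lu = H_Lp[OF weak_solD(1)[OF u]] and Lw = H_Lp[OF weak_solD(1)[OF w]]
  note LG = weak_solD(2)[OF u] and LK = weak_solD(2)[OF w]
  have "(LINT X|M. D X \<bullet> (T' (d X) *\<^sub>R D X)) = (LINT X|M. U X \<bullet> (T' (d X) *\<^sub>R D X)) - (LINT X|M. W X \<bullet> (T' (d X) *\<^sub>R D X))"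
    unfolding D_def[of _] inner_diff_left
    using L2_inner(2)[OF Lu(2) L(2)] L2_inner(2)[OF Lw(2) L(2)] by (simp add: D_def)
  also have "\<dots> = (LINT X|M. G X * T (d X)) - (LINT X|M. K X * T (d X))"
    using weak_solD(3)[OF u HT] weak_solD(3)[OF w HT] by simp
  also have "\<dots> = (LINT X|M. (G X - K X) * T (d X))"
    using L2_inner(2)[OF LG L(1)] L2_inner(2)[OF LK L(1)] by (simp add: left_diff_distrib)
  also have "\<dots> \<le> (LINT X|M. 0)"
  proof (rule integral_mono_AE)
    show "integrable M (\<lambda>X. (G X - K X) * T (d X))"
      using L2_inner(2)[OF LG L(1)] L2_inner(2)[OF LK L(1)] by (simp add: left_diff_distrib)
    show "AE X in M. (G X - K X) * T (d X) \<le> 0"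
      using le
    proof eventually_elim
      case (elim X)
      then show ?case using T0(2,3)[of "d X"] by (cases "w X < u X") (auto simp: d_def mult_le_0_iff)
    qed
  qed simp
  finally have le0: "(LINT X|M. D X \<bullet> (T' (d X) *\<^sub>R D X)) \<le> 0" by simp
  \<comment> \<open>From 0 <= T' <= 1 follows T'^2 <= T', so the energy of T (d) is dominated by the
    tested integral.\<close>
  have "Lp_int 2 M (\<lambda>X. T' (d X) *\<^sub>R D X) \<le> (LINT X|M. D X \<bullet> (T' (d X) *\<^sub>R D X))"
    unfolding Lp_int_2_eq
  proof (rule integral_mono)
    show "integrable M (\<lambda>X. D X \<bullet> (T' (d X) *\<^sub>R D X))" by (rule L2_inner(2)[OF H_Lp(2)[OF Hd] L(2)])
    show "integrable M (\<lambda>X. (norm (T' (d X) *\<^sub>R D X))\<^sup>2)" using L(2) by (simp add: Lp_on_2_eq)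
    show "(norm (T' (d X) *\<^sub>R D X))\<^sup>2 \<le> D X \<bullet> (T' (d X) *\<^sub>R D X)" for X
    proof -
      have "T' (d X) * T' (d X) * (norm (D X))\<^sup>2 \<le> T' (d X) * (norm (D X))\<^sup>2"
        using T'b[of "d X"] by (intro mult_right_mono mult_left_le) auto
      then show ?thesis by (simp add: power_mult_distrib dot_square_norm power2_eq_square[of "T' _"])
    qed
  qed
  then have "Lp_int 2 M (\<lambda>X. T' (d X) *\<^sub>R D X) = 0" using le0 Lp_int_nonneg[of 2 M "\<lambda>X. T' (d X) *\<^sub>R D X"] by linarith
  moreover obtain C where "Lp_int 2 M (\<lambda>X. T (d X)) \<le> C * Lp_int 2 M (\<lambda>X. T' (d X) *\<^sub>R D X)"
    using H_poincare HT by blast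
  ultimately have "Lp_int 2 M (\<lambda>X. T (d X)) = 0" using Lp_int_nonneg[of 2 M "\<lambda>X. T (d X)"] by simp
  from Lp_int_zero_AE[OF L(1) this] show ?thesis
  proof eventually_elim
    case (elim X)
    then show ?case using T0(4)[of "d X"] by (cases "0 < d X") (auto simp: d_def)
  qed
qed

end

section \<open>Existence for regularised equations\<close>

lemma concave_midpoint_of_antitone_derivative:
  fixes \<Phi> h :: "real \<Rightarrow> real"
  assumes D: "\<And>s. (\<Phi> has_real_derivative h s) (at s)" and anti: "\<And>a b. a \<le> b \<Longrightarrow> h b \<le> h a"
  shows "(\<Phi> a + \<Phi> b) / 2 \<le> \<Phi> ((a + b) / 2)"
proof -
  have *: "(\<Phi> a + \<Phi> b) / 2 \<le> \<Phi> ((a + b) / 2)" if ab: "a < b" for a b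
  proof -
    let ?m = "(a + b) / 2"
    obtain x where x: "a < x" "x < ?m" "\<Phi> ?m - \<Phi> a = (?m - a) * h x"
      using MVT2[of a ?m \<Phi> h] D ab by auto
    obtain y where y: "?m < y" "y < b" "\<Phi> b - \<Phi> ?m = (b - ?m) * h y"
      using MVT2[of ?m b \<Phi> h] D ab by auto
    have m: "b - ?m = (b - a) / 2" "?m - a = (b - a) / 2" by (auto simp: field_simps)
    have "(b - a) / 2 * h y \<le> (b - a) / 2 * h x"
      using anti[of x y] x y ab by (intro mult_left_mono) auto
    then have "\<Phi> b - \<Phi> ?m \<le> \<Phi> ?m - \<Phi> a" using x(3) y(3) unfolding m by simp
    then show ?thesis by (simp add: field_simps)
  qed
  show ?thesis using *[of a b] *[of b a] by (cases a b rule: linorder_cases) (auto simp: add.commute)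
qed

lemma Lp_int_2_midpoint:
  fixes F G :: "'a \<Rightarrow> 'b::euclidean_space"
  assumes F: "Lp_on 2 M F" and G: "Lp_on 2 M G"
  shows "Lp_int 2 M (\<lambda>x. (1/2) *\<^sub>R (F x + G x)) = Lp_int 2 M F / 2 + Lp_int 2 M G / 2 - Lp_int 2 M (\<lambda>x. F x - G x) / 4"
proof -
  have iF: "integrable M (\<lambda>x. (norm (F x))\<^sup>2)" and iG: "integrable M (\<lambda>x. (norm (G x))\<^sup>2)"
    and iD: "integrable M (\<lambda>x. (norm (F x - G x))\<^sup>2)"
    using F G Lp_on_diff(1)[OF F G] by (auto simp: Lp_on_2_eq)
  have "Lp_int 2 M (\<lambda>x. (1/2) *\<^sub>R (F x + G x)) = (LINT x|M. (norm (F x))\<^sup>2 / 2 + (norm (G x))\<^sup>2 / 2 - (norm (F x - G x))\<^sup>2 / 4)"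
    unfolding Lp_int_2_eq
    by (rule Bochner_Integration.integral_cong)
       (auto simp: power2_norm_eq_inner inner_add_left inner_add_right inner_diff_left inner_diff_right inner_commute field_simps)
  also have "\<dots> = Lp_int 2 M F / 2 + Lp_int 2 M G / 2 - Lp_int 2 M (\<lambda>x. F x - G x) / 4"
    using iF iG iD by (simp add: Lp_int_2_eq)
  finally show ?thesis .
qed

lemma Lp_int_2_add:
  fixes F G :: "'a \<Rightarrow> 'b::euclidean_space"
  assumes F: "Lp_on 2 M F" and G: "Lp_on 2 M G"
  shows "Lp_int 2 M (\<lambda>x. F x + t *\<^sub>R G x) = Lp_int 2 M F + 2 * t * (LINT x|M. F x \<bullet> G x) + t\<^sup>2 * Lp_int 2 M G"
proof -
  have iF: "integrable M (\<lambda>x. (norm (F x))\<^sup>2)" and iG: "integrable M (\<lambda>x. (norm (G x))\<^sup>2)"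
    using F G by (auto simp: Lp_on_2_eq)
  have "Lp_int 2 M (\<lambda>x. F x + t *\<^sub>R G x) = (LINT x|M. (norm (F x))\<^sup>2 + 2 * t * (F x \<bullet> G x) + t\<^sup>2 * (norm (G x))\<^sup>2)"
    unfolding Lp_int_2_eq
    by (rule Bochner_Integration.integral_cong)
       (simp_all only: power2_norm_eq_inner, simp_all add: inner_add_left inner_add_right inner_commute power2_eq_square algebra_simps)
  also have "\<dots> = Lp_int 2 M F + 2 * t * (LINT x|M. F x \<bullet> G x) + t\<^sup>2 * Lp_int 2 M G"
    using iF iG L2_inner(2)[OF F G] by (simp add: Lp_int_2_eq)
  finally show ?thesis .
qed

section \<open>Minimisation of the convex energy functional\<close>

context grushin_domain
begin

lemma L2_imp_L1:
  assumes v: "Lp_on 2 M (v :: _ \<Rightarrow> real)"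
  shows "integrable M (\<lambda>X. \<bar>v X\<bar>)" "integrable M v" "(LINT X|M. \<bar>v X\<bar>) \<le> sqrt (Lp_int 2 M v) * sqrt (measure M (space M))"
proof -
  note d = dom.Lp_int_mono_exponent[OF v, of 1]
  show 1: "integrable M (\<lambda>X. \<bar>v X\<bar>)" using d(1) by (simp add: Lp_on_def)
  show "integrable M v" using 1 v by (simp add: Lp_on_def integrable_abs_iff)
  show "(LINT X|M. \<bar>v X\<bar>) \<le> sqrt (Lp_int 2 M v) * sqrt (measure M (space M))"
    using d(2) by (simp add: Lp_int_def powr_half_sqrt)
qed

text \<open>The functional J is half the energy minus the integral of f \<Phi>(v). Antitone h makes
  \<Phi> concave, so the parallelogram law turns minimising sequences into Cauchy sequences; bounded
  h gives the lower bound and the continuity of the second term; Lipschitz h makes the error in the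
  first variation quadratic.\<close>

lemma exists_weak_sol:
  fixes f :: "real \<times> (real ^ 'm) \<Rightarrow> real" and \<Phi> h :: "real \<Rightarrow> real"
  assumes f: "f \<in> borel_measurable M" "\<And>X. 0 \<le> f X" "\<And>X. f X \<le> K"
    and \<Phi>: "\<And>s. (\<Phi> has_real_derivative h s) (at s)" "\<Phi> 0 = 0"
    and anti: "\<And>a b. a \<le> b \<Longrightarrow> h b \<le> h a" and h: "\<And>s. 0 \<le> h s" "\<And>s. h s \<le> B"
    and lip: "\<And>a b. \<bar>h a - h b\<bar> \<le> L * \<bar>a - b\<bar>"
  shows "\<exists>u U. weak_sol u U (\<lambda>X. f X * h (u X))"
proof -
  note [measurable] = f(1)
  have K0: "0 \<le> K" and B0: "0 \<le> B" and L0: "0 \<le> L"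
    using f(2,3)[of 0] h[of 0] lip[of 1 0] by (auto intro: order_trans)
  have hc: "continuous_on UNIV h"
    by (rule lipschitz_on_continuous_on[of L], rule lipschitz_onI) (use lip L0 in \<open>auto simp: dist_real_def\<close>)
  have \<Phi>c: "continuous_on UNIV \<Phi>" using \<Phi>(1) by (meson DERIV_isCont continuous_at_imp_continuous_on)
  have [measurable]: "\<Phi> \<in> borel_measurable borel" "h \<in> borel_measurable borel"
    using \<Phi>c hc by (auto intro: borel_measurable_continuous_onI)
  have \<Phi>lip: "\<bar>\<Phi> a - \<Phi> b\<bar> \<le> B * \<bar>a - b\<bar>" for a b
    using field_differentiable_bound[of UNIV \<Phi> h B b a] \<Phi>(1) h by (auto simp: has_field_derivative_at_within abs_minus_commute)
  define E where "E v = (LINT X|M. f X * \<Phi> (v X))" for v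
  have iE: "integrable M (\<lambda>X. f X * \<Phi> (v X))" if v: "Lp_on 2 M v" for v
  proof (rule Bochner_Integration.integrable_bound)
    show "integrable M (\<lambda>X. (K * B) * \<bar>v X\<bar>)" using L2_imp_L1(1)[OF v] by auto
    have [measurable]: "v \<in> borel_measurable M" using v by (simp add: Lp_on_def)
    show "(\<lambda>X. f X * \<Phi> (v X)) \<in> borel_measurable M" by measurable
    have "\<bar>f X\<bar> * \<bar>\<Phi> (v X)\<bar> \<le> K * (B * \<bar>v X\<bar>)" for X
      using \<Phi>lip[of "v X" 0] f(2,3)[of X] B0 K0 by (intro mult_mono) (auto simp: \<Phi>(2))
    then show "AE X in M. norm (f X * \<Phi> (v X)) \<le> norm (K * B * \<bar>v X\<bar>)"
      using K0 B0 by (auto simp: abs_mult mult.assoc)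
  qed
  have Ediff: "\<bar>E v - E w\<bar> \<le> K * B * (LINT X|M. \<bar>v X - w X\<bar>)" if v: "Lp_on 2 M v" and w: "Lp_on 2 M w" for v w
  proof -
    have "\<bar>E v - E w\<bar> = \<bar>LINT X|M. f X * \<Phi> (v X) - f X * \<Phi> (w X)\<bar>" unfolding E_def using iE[OF v] iE[OF w] by simp
    also have "\<dots> \<le> (LINT X|M. \<bar>f X * \<Phi> (v X) - f X * \<Phi> (w X)\<bar>)" by (rule integral_abs_bound)
    also have "\<dots> \<le> (LINT X|M. (K * B) * \<bar>v X - w X\<bar>)"
    proof (rule integral_mono)
      show "integrable M (\<lambda>X. \<bar>f X * \<Phi> (v X) - f X * \<Phi> (w X)\<bar>)" using iE[OF v] iE[OF w] by auto
      show "integrable M (\<lambda>X. (K * B) * \<bar>v X - w X\<bar>)" using L2_imp_L1(1)[OF Lp_on_diff(1)[OF v w]] by auto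
      fix X
      have "\<bar>f X * \<Phi> (v X) - f X * \<Phi> (w X)\<bar> = \<bar>f X\<bar> * \<bar>\<Phi> (v X) - \<Phi> (w X)\<bar>" by (simp add: abs_mult flip: right_diff_distrib)
      also have "\<dots> \<le> K * (B * \<bar>v X - w X\<bar>)"
        using \<Phi>lip f(2,3)[of X] B0 K0 by (intro mult_mono) auto
      finally show "\<bar>f X * \<Phi> (v X) - f X * \<Phi> (w X)\<bar> \<le> (K * B) * \<bar>v X - w X\<bar>" by (simp add: mult.assoc)
    qed
    finally show ?thesis by simp
  qed
  define J where "J v V = Lp_int 2 M V / 2 - E v" for v and V :: "real \<times> (real ^ 'm) \<Rightarrow> real \<times> (real ^ 'm)"
  obtain C where C: "C > 0" "\<And>v g. test_fn \<Omega> v g \<Longrightarrow> Lp_int 2 M v \<le> C * Lp_int 2 M (sg g)"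
    using test_fn_poincare by blast
  define \<mu> where "\<mu> = measure M (space M)"
  define c where "c = K * B * sqrt C * sqrt \<mu>"
  \<comment> \<open>By Poincare, E v is at most linear in the energy norm x, and c x <= x^2/2 +
    c^2/2.\<close>
  have low: "- (c\<^sup>2 / 2) \<le> J v (sg g)" if v: "test_fn \<Omega> v g" for v g
  proof -
    define x where "x = sqrt (Lp_int 2 M (sg g))"
    have E0: "E (\<lambda>X. 0) = 0" by (simp add: E_def \<Phi>(2))
    have z: "Lp_on 2 M (\<lambda>X. 0 :: real)" by (simp add: Lp_on_def)
    have "E v \<le> K * B * (LINT X|M. \<bar>v X\<bar>)" using Ediff[OF test_fn_Lp(1)[OF v] z] E0 by auto
    also have "\<dots> \<le> K * B * (sqrt (Lp_int 2 M v) * sqrt \<mu>)"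
      using L2_imp_L1(3)[OF test_fn_Lp(1)[OF v]] K0 B0 by (intro mult_left_mono) (auto simp: \<mu>_def)
    also have "\<dots> \<le> K * B * (sqrt (C * Lp_int 2 M (sg g)) * sqrt \<mu>)"
      using C(2)[OF v] K0 B0 by (intro mult_left_mono mult_right_mono) (auto simp: \<mu>_def)
    also have "\<dots> = c * x" by (simp add: c_def x_def real_sqrt_mult)
    finally have "E v \<le> c * x" .
    moreover have "Lp_int 2 M (sg g) = x\<^sup>2" by (simp add: x_def Lp_int_nonneg)
    moreover have "0 \<le> (x - c)\<^sup>2" by simp
    ultimately show ?thesis by (simp add: J_def power2_diff field_simps)
  qed
  define S where "S = {J v (sg g) | v g. test_fn \<Omega> v g}"
  define m where "m = Inf S"
  have bdd: "bdd_below S" using low by (auto simp: S_def bdd_below_def intro!: exI[of _ "- (c\<^sup>2 / 2)"])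
  have mle: "m \<le> J v (sg g)" if "test_fn \<Omega> v g" for v g
    unfolding m_def using that by (intro cInf_lower bdd) (auto simp: S_def)
  have Sne: "S \<noteq> {}" using test_fn_zero[of \<Omega>] by (auto simp: S_def)
  have "\<exists>v g. test_fn \<Omega> v g \<and> J v (sg g) < m + 1 / Suc k" for k
    using cInf_lessD[OF Sne, of "m + 1 / Suc k"] by (auto simp: S_def m_def)
  then obtain \<phi> g where \<phi>: "\<And>k. test_fn \<Omega> (\<phi> k) (g k)" and \<phi>J: "\<And>k. J (\<phi> k) (sg (g k)) < m + 1 / Suc k"
    by metis
  note L\<phi> = test_fn_Lp(1)[OF \<phi>, of 2] and Lg = test_fn_Lp(2)[OF \<phi>, of 2]
  \<comment> \<open>The midpoint of two almost minimisers is admissible, so m <= J(midpoint).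
    Concavity and the parallelogram law leave an eighth of the squared distance, bounded by the mean
    of the two excesses 1/(j+1) and 1/(k+1).\<close>
  have gap: "Lp_int 2 M (\<lambda>X. sg (g j) X - sg (g k) X) \<le> 4 / Suc j + 4 / Suc k" for j k
  proof -
    let ?v = "\<lambda>X. (1/2) * (\<phi> j X + \<phi> k X)" and ?g = "\<lambda>X. (1/2) *\<^sub>R (g j X + g k X)"
    have t: "test_fn \<Omega> ?v ?g" by (intro test_fn_scale test_fn_add \<phi>)
    have sgm: "sg ?g X = (1/2) *\<^sub>R (sg (g j) X + sg (g k) X)" for X
      by (simp add: grushin_sqrtA_def prod_eq_iff algebra_simps)
    have "(E (\<phi> j) + E (\<phi> k)) / 2 = (LINT X|M. (f X * \<Phi> (\<phi> j X) + f X * \<Phi> (\<phi> k X)) / 2)"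
      using iE[OF L\<phi>] by (simp add: E_def)
    also have "\<dots> \<le> E ?v" unfolding E_def
    proof (rule integral_mono)
      show "integrable M (\<lambda>X. (f X * \<Phi> (\<phi> j X) + f X * \<Phi> (\<phi> k X)) / 2)" using iE[OF L\<phi>] by simp
      show "integrable M (\<lambda>X. f X * \<Phi> (?v X))" by (rule iE[OF test_fn_Lp(1)[OF t]]) simp
      fix X
      have "f X * ((\<Phi> (\<phi> j X) + \<Phi> (\<phi> k X)) / 2) \<le> f X * \<Phi> ((\<phi> j X + \<phi> k X) / 2)"
        by (intro mult_left_mono concave_midpoint_of_antitone_derivative[OF \<Phi>(1) anti] f)
      then show "(f X * \<Phi> (\<phi> j X) + f X * \<Phi> (\<phi> k X)) / 2 \<le> f X * \<Phi> (?v X)" by (simp add: add_divide_distrib algebra_simps)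
    qed
    finally have Em: "(E (\<phi> j) + E (\<phi> k)) / 2 \<le> E ?v" .
    have "m \<le> J ?v (sg ?g)" by (rule mle[OF t])
    also have "\<dots> = (Lp_int 2 M (sg (g j)) / 2 + Lp_int 2 M (sg (g k)) / 2 - Lp_int 2 M (\<lambda>X. sg (g j) X - sg (g k) X) / 4) / 2 - E ?v"
      unfolding J_def sgm using Lp_int_2_midpoint[OF Lg Lg] by simp
    finally have mid: "m \<le> (Lp_int 2 M (sg (g j)) / 2 + Lp_int 2 M (sg (g k)) / 2 - Lp_int 2 M (\<lambda>X. sg (g j) X - sg (g k) X) / 4) / 2 - E ?v" .
    have arith: "D \<le> 4 * a + 4 * b" if "m \<le> (Lj / 2 + Lk / 2 - D / 4) / 2 - Ev" "(Ej + Ek) / 2 \<le> Ev"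
      "Lj / 2 - Ej < m + a" "Lk / 2 - Ek < m + b" for Lj Lk D Ev Ej Ek a b :: real
      using that by (simp add: field_simps)
    from arith[OF mid Em \<phi>J[of j, unfolded J_def] \<phi>J[of k, unfolded J_def]] show ?thesis by simp
  qed
  have inv_small: "\<exists>N. \<forall>j\<ge>N. \<forall>k\<ge>N. C0 * (4 / Suc j + 4 / Suc k) < e" if "e > 0" "C0 > 0" for e C0 :: real
  proof -
    have "(\<lambda>n. C0 * (8 / Suc n)) \<longlonglongrightarrow> C0 * 0"
      by (intro tendsto_intros LIMSEQ_Suc[OF lim_const_over_n])
    then have "\<forall>\<^sub>F n in sequentially. C0 * (8 / Suc n) < e" using that by (intro order_tendstoD) auto
    then obtain N where N: "C0 * (8 / Suc N) < e" by (auto simp: eventually_sequentially)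
    have "C0 * (4 / Suc j + 4 / Suc k) < e" if "j \<ge> N" "k \<ge> N" for j k
    proof -
      have "4 / real (Suc j) \<le> 4 / Suc N" "4 / real (Suc k) \<le> 4 / Suc N" using that by (auto intro!: divide_left_mono)
      then have "4 / Suc j + 4 / Suc k \<le> 8 / real (Suc N)" by linarith
      then have "C0 * (4 / Suc j + 4 / Suc k) \<le> C0 * (8 / Suc N)" using \<open>C0 > 0\<close> by (intro mult_left_mono) auto
      then show ?thesis using N by linarith
    qed
    then show ?thesis by blast
  qed
  have cauU: "\<exists>N. \<forall>j\<ge>N. \<forall>k\<ge>N. Lp_int 2 M (\<lambda>X. sg (g j) X - sg (g k) X) < e" if e: "e > 0" for e
  proof -
    obtain N where "\<forall>j\<ge>N. \<forall>k\<ge>N. 1 * (4 / real (Suc j) + 4 / real (Suc k)) < e" using inv_small[OF e, of 1] by auto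
    then show ?thesis by (intro exI[of _ N] allI impI le_less_trans[OF gap]) auto
  qed
  have cauu: "\<exists>N. \<forall>j\<ge>N. \<forall>k\<ge>N. Lp_int 2 M (\<lambda>X. \<phi> j X - \<phi> k X) < e" if e: "e > 0" for e
  proof -
    have *: "Lp_int 2 M (\<lambda>X. \<phi> j X - \<phi> k X) \<le> C * (4 / Suc j + 4 / Suc k)" for j k
    proof -
      have "Lp_int 2 M (\<lambda>X. \<phi> j X - \<phi> k X) \<le> C * Lp_int 2 M (sg (\<lambda>X. g j X - g k X))"
        by (rule C(2)[OF test_fn_diff[OF \<phi> \<phi>]])
      also have "sg (\<lambda>X. g j X - g k X) = (\<lambda>X. sg (g j) X - sg (g k) X)"
        by (simp add: fun_eq_iff grushin_sqrtA_def prod_eq_iff algebra_simps)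
      also have "C * Lp_int 2 M \<dots> \<le> C * (4 / Suc j + 4 / Suc k)" using gap C(1) by (intro mult_left_mono) auto
      finally show ?thesis .
    qed
    obtain N where "\<forall>j\<ge>N. \<forall>k\<ge>N. C * (4 / real (Suc j) + 4 / real (Suc k)) < e" using inv_small[OF e C(1)] by auto
    then show ?thesis by (intro exI[of _ N] allI impI le_less_trans[OF *]) auto
  qed
  obtain u where u: "Lp_on 2 M u" "(\<lambda>k. Lp_int 2 M (\<lambda>X. \<phi> k X - u X)) \<longlonglongrightarrow> 0"
    using dom.Lp_complete[where F=\<phi> and p=2, OF L\<phi> _ cauu] by auto
  obtain U where U: "Lp_on 2 M U" "(\<lambda>k. Lp_int 2 M (\<lambda>X. sg (g k) X - U X)) \<longlonglongrightarrow> 0"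
    using dom.Lp_complete[where F="\<lambda>k. sg (g k)" and p=2, OF Lg _ cauU] by auto
  have H: "H u U" unfolding H_def using u U \<phi> by blast
  \<comment> \<open>The perturbation t v is carried along because m is an infimum over test
    functions: J at the perturbed limit is compared with m through the perturbed sequence. The case
    t = 0 gives the value at the minimiser.\<close>
  have Jlim: "(\<lambda>k. J (\<lambda>X. \<phi> k X + t * v X) (\<lambda>X. sg (g k) X + t *\<^sub>R V X)) \<longlonglongrightarrow> J (\<lambda>X. u X + t * v X) (\<lambda>X. U X + t *\<^sub>R V X)"
    if v: "Lp_on 2 M v" and V: "Lp_on 2 M V" for t v V
    unfolding J_def
  proof (intro tendsto_intros)
    have tV: "Lp_on 2 M (\<lambda>X. t *\<^sub>R V X)" by (rule Lp_on_scaleR[OF V]) simp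
    have tv: "Lp_on 2 M (\<lambda>X. t * v X)" using Lp_on_scaleR[OF v, of t] by simp
    show "(\<lambda>k. Lp_int 2 M (\<lambda>X. sg (g k) X + t *\<^sub>R V X)) \<longlonglongrightarrow> Lp_int 2 M (\<lambda>X. U X + t *\<^sub>R V X)"
      by (rule L2_norm_lim) (use U Lp_on_add(1)[OF Lg tV] Lp_on_add(1)[OF U(1) tV] in auto)
    have L1: "Lp_on 2 M (\<lambda>X. \<phi> k X + t * v X)" for k by (rule Lp_on_add(1)[OF L\<phi> tv]) simp_all
    have L2: "Lp_on 2 M (\<lambda>X. u X + t * v X)" by (rule Lp_on_add(1)[OF u(1) tv]) simp
    have l1: "(\<lambda>k. LINT X|M. \<bar>\<phi> k X - u X\<bar>) \<longlonglongrightarrow> 0"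
      using dom.Lp_lim_mono_exponent[where F=\<phi> and s=1, OF L\<phi> u(1) _ _ u(2)] by (simp add: Lp_int_def)
    show "(\<lambda>k. E (\<lambda>X. \<phi> k X + t * v X)) \<longlonglongrightarrow> E (\<lambda>X. u X + t * v X)"
    proof (rule Lim_null[THEN iffD2], rule Lim_null_comparison)
      show "\<forall>\<^sub>F k in sequentially. norm (E (\<lambda>X. \<phi> k X + t * v X) - E (\<lambda>X. u X + t * v X)) \<le> K * B * (LINT X|M. \<bar>\<phi> k X - u X\<bar>)"
        using Ediff[OF L1 L2] by simp
      show "(\<lambda>k. K * B * (LINT X|M. \<bar>\<phi> k X - u X\<bar>)) \<longlonglongrightarrow> 0" using tendsto_mult_left[OF l1, of "K * B"] by simp
    qed
  qed auto
  have Ju: "J u U = m"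
  proof (rule LIMSEQ_unique)
    show "(\<lambda>k. J (\<phi> k) (sg (g k))) \<longlonglongrightarrow> J u U" using Jlim[OF u(1) U(1), of 0] by simp
    show "(\<lambda>k. J (\<phi> k) (sg (g k))) \<longlonglongrightarrow> m"
    proof (rule tendsto_sandwich)
      show "\<forall>\<^sub>F k in sequentially. m \<le> J (\<phi> k) (sg (g k))" using mle[OF \<phi>] by simp
      show "\<forall>\<^sub>F k in sequentially. J (\<phi> k) (sg (g k)) \<le> m + 1 / Suc k" by (intro always_eventually allI less_imp_le \<phi>J)
      have "(\<lambda>k. m + 1 / Suc k) \<longlonglongrightarrow> m + 0" by (intro tendsto_intros LIMSEQ_Suc[OF lim_const_over_n])
      then show "(\<lambda>k. m + 1 / Suc k) \<longlonglongrightarrow> m" by simp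
    qed simp
  qed
  define G where "G X = f X * h (u X)" for X
  have [measurable]: "u \<in> borel_measurable M" using u(1) by (simp add: Lp_on_def)
  have LG: "Lp_on 2 M G"
  proof (rule dom.Lp_on_bounded)
    show "G \<in> borel_measurable M" unfolding G_def by measurable
    show "AE X in M. norm (G X) \<le> K * B" unfolding G_def using f h K0 by (auto simp: abs_mult intro!: mult_mono)
  qed simp
  \<comment> \<open>One inequality suffices, since -v is a test function as well.\<close>
  have var: "0 \<le> (LINT X|M. U X \<bullet> sg w X) - (LINT X|M. G X * v X)" if v: "test_fn \<Omega> v w" for v w
  proof (rule ccontr)
    note Lv = test_fn_Lp(1)[OF v, of 2] and Lw = test_fn_Lp(2)[OF v, of 2]
    define a where "a = (LINT X|M. U X \<bullet> sg w X) - (LINT X|M. G X * v X)"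
    define b where "b = Lp_int 2 M (sg w) / 2 + K * L * Lp_int 2 M v"
    assume "\<not> ?thesis"
    then have a: "a < 0" by (simp add: a_def)
    have b: "0 \<le> b" using K0 L0 by (simp add: b_def Lp_int_nonneg)
    have iGv: "integrable M (\<lambda>X. G X * v X)" using L2_inner(2)[OF LG Lv] by simp
    have iv2: "integrable M (\<lambda>X. (v X)\<^sup>2)" using Lv by (simp add: Lp_on_2_eq)
    have key: "0 \<le> t * a + t\<^sup>2 * b" if t: "0 < t" for t
    proof -
      have Ltv: "Lp_on 2 M (\<lambda>X. u X + t * v X)"
        using Lp_on_add(1)[OF u(1) Lp_on_scaleR[OF Lv, of t]] by simp
      have "m \<le> J (\<lambda>X. u X + t * v X) (\<lambda>X. U X + t *\<^sub>R sg w X)"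
      proof (rule LIMSEQ_le_const[OF Jlim[of v "sg w" t]])
        show "\<exists>N. \<forall>n\<ge>N. m \<le> J (\<lambda>X. \<phi> n X + t * v X) (\<lambda>X. sg (g n) X + t *\<^sub>R sg w X)"
        proof (intro exI allI impI)
          fix n
          have "test_fn \<Omega> (\<lambda>X. \<phi> n X + t * v X) (\<lambda>X. g n X + t *\<^sub>R w X)" by (intro test_fn_add test_fn_scale \<phi> v)
          then have "m \<le> J (\<lambda>X. \<phi> n X + t * v X) (sg (\<lambda>X. g n X + t *\<^sub>R w X))" by (rule mle)
          also have "sg (\<lambda>X. g n X + t *\<^sub>R w X) = (\<lambda>X. sg (g n) X + t *\<^sub>R sg w X)"
            by (simp add: fun_eq_iff grushin_sqrtA_def prod_eq_iff algebra_simps)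
          finally show "m \<le> J (\<lambda>X. \<phi> n X + t * v X) (\<lambda>X. sg (g n) X + t *\<^sub>R sg w X)" .
        qed
      qed (use Lv Lw in auto)
      then have 1: "0 \<le> t * (LINT X|M. U X \<bullet> sg w X) + t\<^sup>2 * Lp_int 2 M (sg w) / 2 - (E (\<lambda>X. u X + t * v X) - E u)"
        unfolding Ju[symmetric] J_def using Lp_int_2_add[OF U(1) Lw, of t] by (simp add: add_divide_distrib)
      have "t * (LINT X|M. G X * v X) - t\<^sup>2 * (K * L * Lp_int 2 M v) = (LINT X|M. t * (G X * v X) - t\<^sup>2 * (K * L * (v X)\<^sup>2))"
        using iGv iv2 by (simp add: Lp_int_2_eq)
      also have "\<dots> \<le> (LINT X|M. f X * \<Phi> (u X + t * v X) - f X * \<Phi> (u X))"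
      proof (rule integral_mono)
        show "integrable M (\<lambda>X. t * (G X * v X) - t\<^sup>2 * (K * L * (v X)\<^sup>2))" using iGv iv2 by auto
        show "integrable M (\<lambda>X. f X * \<Phi> (u X + t * v X) - f X * \<Phi> (u X))" using iE[OF Ltv] iE[OF u(1)] by auto
        fix X
        define x where "x = u X"
        define y where "y = t * v X"
        \<comment> \<open>Mean value theorem with an intermediate z at distance at most |y| from x,
          then the Lipschitz bound replaces h z by h x.\<close>
        have pt: "y * h x - L * y\<^sup>2 \<le> \<Phi> (x + y) - \<Phi> x"
        proof -
          have "\<exists>z. \<bar>z - x\<bar> \<le> \<bar>y\<bar> \<and> \<Phi> (x + y) - \<Phi> x = y * h z"
          proof (cases y "0::real" rule: linorder_cases)
            case less
            then obtain z where "x + y < z" "z < x" "\<Phi> x - \<Phi> (x + y) = (x - (x + y)) * h z"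
              using MVT2[of "x + y" x \<Phi> h] \<Phi>(1) by auto
            then show ?thesis by (intro exI[of _ z]) (auto simp: algebra_simps)
          next
            case greater
            then obtain z where "x < z" "z < x + y" "\<Phi> (x + y) - \<Phi> x = ((x + y) - x) * h z"
              using MVT2[of x "x + y" \<Phi> h] \<Phi>(1) by auto
            then show ?thesis by (intro exI[of _ z]) auto
          qed (auto intro: exI[of _ x])
          then obtain z where z: "\<bar>z - x\<bar> \<le> \<bar>y\<bar>" "\<Phi> (x + y) - \<Phi> x = y * h z" by blast
          have "\<bar>y\<bar> * \<bar>h z - h x\<bar> \<le> \<bar>y\<bar> * (L * \<bar>y\<bar>)"
            using lip[of z x] z(1) L0 by (intro mult_left_mono) (auto intro: order_trans mult_left_mono)
          also have "\<bar>y\<bar> * (L * \<bar>y\<bar>) = L * y\<^sup>2" by (simp add: power2_eq_square flip: abs_mult)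
          finally have "\<bar>y * (h z - h x)\<bar> \<le> L * y\<^sup>2" by (simp only: abs_mult)
          then show ?thesis unfolding z(2) by (auto simp: algebra_simps abs_le_iff)
        qed
        have "f X * (y * h x - L * y\<^sup>2) \<le> f X * (\<Phi> (x + y) - \<Phi> x)" using pt f by (intro mult_left_mono) auto
        moreover have "f X * (L * y\<^sup>2) \<le> K * (L * y\<^sup>2)" using f L0 by (intro mult_right_mono) auto
        ultimately have "f X * (y * h x) - K * (L * y\<^sup>2) \<le> f X * (\<Phi> (x + y) - \<Phi> x)" by (simp add: right_diff_distrib)
        then show "t * (G X * v X) - t\<^sup>2 * (K * L * (v X)\<^sup>2) \<le> f X * \<Phi> (u X + t * v X) - f X * \<Phi> (u X)"
          by (simp add: x_def y_def G_def power_mult_distrib algebra_simps)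
      qed
      also have "\<dots> = E (\<lambda>X. u X + t * v X) - E u" unfolding E_def using iE[OF Ltv] iE[OF u(1)] by simp
      finally show ?thesis using 1 by (simp add: a_def b_def algebra_simps)
    qed
    \<comment> \<open>A step this small gives t b <= - a/2, contradicting \<open>key\<close>; the +
      1 covers b = 0.\<close>
    define t where "t = - a / (2 * (b + 1))"
    have t: "0 < t" using a b by (simp add: t_def divide_neg_pos)
    have "0 \<le> a + t * b" using key[OF t] t by (simp add: power2_eq_square mult.assoc flip: distrib_left zero_le_mult_iff) (simp add: zero_le_mult_iff)
    moreover have "t * b \<le> t * (b + 1)" using t by (intro mult_left_mono) auto
    moreover have "t * (b + 1) = - a / 2" using b by (simp add: t_def field_simps)
    ultimately show False using a by simp
  qed
  have "(LINT X|M. U X \<bullet> sg w X) = (LINT X|M. G X * v X)" if v: "test_fn \<Omega> v w" for v w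
  proof -
    have "grushin_sqrtA lam X (- w X) = - sg w X" for X by (simp add: grushin_sqrtA_def)
    then have "0 \<le> - (LINT X|M. U X \<bullet> sg w X) + (LINT X|M. G X * v X)"
      using var[OF test_fn_scale[OF v, of "-1"]] by simp
    then show ?thesis using var[OF v] by simp
  qed
  then have "weak_sol u U G" by (intro weak_solI H LG)
  then show ?thesis unfolding G_def by blast
qed

end

section \<open>Strict positivity of supersolutions\<close>

lemma tendsto_zero_of_less_inverse:
  fixes a :: "nat \<Rightarrow> real"
  assumes "\<And>k. 0 \<le> a k" "\<And>k. a k < 1 / real (Suc k)"
  shows "a \<longlonglongrightarrow> 0"
proof (rule tendsto_sandwich[OF _ _ tendsto_const])
  show "(\<lambda>k. 1 / real (Suc k)) \<longlonglongrightarrow> 0" by (rule LIMSEQ_Suc[OF lim_const_over_n])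
qed (use assms in \<open>auto intro!: always_eventually less_imp_le\<close>)

section \<open>Bump and cut-off functions\<close>

lemma test_fn_sum:
  assumes "finite F" "\<And>i. i \<in> F \<Longrightarrow> test_fn \<Omega> (v i) (g i)"
  shows "test_fn \<Omega> (\<lambda>X. \<Sum>i\<in>F. v i X) (\<lambda>X. \<Sum>i\<in>F. g i X)"
  using assms
proof (induction F rule: finite_induct)
  case empty
  then show ?case using test_fn_zero by simp
next
  case (insert i F)
  then show ?case using test_fn_add[of \<Omega> "v i" "g i"] by simp
qed

text \<open>The squared positive part of \<rho>^2 - |X - P|^2 is C1, and on the ball of half the
  radius it is at least (\<rho>^2/2)^2, which explains the normalising factor. Values above 1 are
  allowed.\<close>

lemma test_fn_bump:
  fixes P :: "'a::euclidean_space"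
  assumes "cball P \<rho> \<subseteq> \<Omega>" "0 < \<rho>"
  shows "\<exists>\<psi> g. test_fn \<Omega> \<psi> g \<and> (\<forall>X. 0 \<le> \<psi> X) \<and> (\<forall>X\<in>ball P (\<rho> / 2). 1 \<le> \<psi> X)"
proof -
  define s where "s X = \<rho>\<^sup>2 - (X - P) \<bullet> (X - P)" for X
  have s: "C1_pair s (\<lambda>X. - 2 *\<^sub>R (X - P))"
    unfolding C1_pair_def gderiv_def s_def
    by (auto intro!: derivative_eq_intros continuous_intros simp: inner_diff_right inner_diff_left inner_commute algebra_simps fun_eq_iff)
  define b where "b X = (max (s X) 0)\<^sup>2" for X
  define h where "h X = (2 * max (s X) 0) *\<^sub>R (- 2 *\<^sub>R (X - P))" for X
  have bh: "C1_pair b h" unfolding b_def h_def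
    by (rule C1_pair_compose[OF s DERIV_max_sq]) (intro continuous_intros)
  have sd: "s X = \<rho>\<^sup>2 - (dist P X)\<^sup>2" for X by (simp add: s_def dist_norm norm_minus_commute[of P X] power2_norm_eq_inner)
  have "b X = 0 \<and> h X = 0" if "X \<notin> cball P \<rho>" for X
  proof -
    have "\<rho>\<^sup>2 \<le> (dist P X)\<^sup>2" using that assms by (intro power_mono) auto
    then show ?thesis by (simp add: b_def h_def sd)
  qed
  then have "test_fn \<Omega> b h" unfolding test_fn_def using bh assms by (intro conjI exI[of _ "cball P \<rho>"]) auto
  then have t: "test_fn \<Omega> (\<lambda>X. (2 / \<rho>\<^sup>2)\<^sup>2 * b X) (\<lambda>X. (2 / \<rho>\<^sup>2)\<^sup>2 *\<^sub>R h X)" by (rule test_fn_scale)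
  have "1 \<le> (2 / \<rho>\<^sup>2)\<^sup>2 * b X" if "X \<in> ball P (\<rho> / 2)" for X
  proof -
    have "(dist P X)\<^sup>2 \<le> (\<rho> / 2)\<^sup>2" using that by (intro power_mono) auto
    then have "(dist P X)\<^sup>2 * 4 \<le> \<rho>\<^sup>2" by (simp add: power_divide)
    then have "\<rho>\<^sup>2 / 2 \<le> s X" unfolding sd using zero_le_power2[of "dist P X"] by linarith
    then have "(\<rho>\<^sup>2 / 2)\<^sup>2 \<le> b X" unfolding b_def by (intro power_mono) auto
    then have "(2 / \<rho>\<^sup>2)\<^sup>2 * (\<rho>\<^sup>2 / 2)\<^sup>2 \<le> (2 / \<rho>\<^sup>2)\<^sup>2 * b X" by (intro mult_left_mono) auto
    moreover have "(2 / \<rho>\<^sup>2)\<^sup>2 * (\<rho>\<^sup>2 / 2)\<^sup>2 = 1" using assms by (simp flip: power_mult_distrib)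
    ultimately show ?thesis by simp
  qed
  then show ?thesis using t
    by (intro exI[of _ "\<lambda>X. (2 / \<rho>\<^sup>2)\<^sup>2 * b X"] exI[of _ "\<lambda>X. (2 / \<rho>\<^sup>2)\<^sup>2 *\<^sub>R h X"]) (auto simp: b_def)
qed

text \<open>A finite sum of nonnegative bumps over a subcover of K: at each point of K one summand
  is already at least 1.\<close>

lemma test_fn_cutoff:
  fixes K :: "'a::euclidean_space set"
  assumes "open \<Omega>" "compact K" "K \<subseteq> \<Omega>"
  shows "\<exists>\<psi> g. test_fn \<Omega> \<psi> g \<and> (\<forall>X. 0 \<le> \<psi> X) \<and> (\<forall>X\<in>K. 1 \<le> \<psi> X)"
proof -
  have "\<exists>\<rho> \<psi> g. 0 < \<rho> \<and> test_fn \<Omega> \<psi> g \<and> (\<forall>X. 0 \<le> \<psi> X) \<and> (\<forall>X\<in>ball P \<rho>. 1 \<le> \<psi> X)" if P: "P \<in> K" for P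
  proof -
    obtain \<rho> where "0 < \<rho>" "cball P \<rho> \<subseteq> \<Omega>" using assms P by (meson open_contains_cball subsetD)
    with test_fn_bump[of P \<rho> \<Omega>] show ?thesis by (metis half_gt_zero)
  qed
  then obtain \<rho> \<psi> g where H: "\<And>P. P \<in> K \<Longrightarrow> 0 < \<rho> P \<and> test_fn \<Omega> (\<psi> P) (g P) \<and> (\<forall>X. 0 \<le> \<psi> P X) \<and> (\<forall>X\<in>ball P (\<rho> P). 1 \<le> \<psi> P X)"
    by metis
  have "K \<subseteq> (\<Union>P\<in>K. ball P (\<rho> P))" using H by force
  then obtain F where F: "F \<subseteq> K" "finite F" "K \<subseteq> (\<Union>P\<in>F. ball P (\<rho> P))"
    using compactE_image[OF assms(2), of K "\<lambda>P. ball P (\<rho> P)"] by auto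
  have "1 \<le> (\<Sum>P\<in>F. \<psi> P X)" if "X \<in> K" for X
  proof -
    have "X \<in> (\<Union>P\<in>F. ball P (\<rho> P))" using F(3) that by blast
    then obtain P where P: "P \<in> F" "X \<in> ball P (\<rho> P)" by blast
    then have "1 \<le> \<psi> P X" using H F by blast
    also have "\<dots> \<le> (\<Sum>P\<in>F. \<psi> P X)" using H F P by (intro member_le_sum) auto
    finally show ?thesis .
  qed
  moreover have "test_fn \<Omega> (\<lambda>X. \<Sum>i\<in>F. \<psi> i X) (\<lambda>X. \<Sum>i\<in>F. g i X)" using H F by (intro test_fn_sum) auto
  moreover have "0 \<le> (\<Sum>P\<in>F. \<psi> P X)" for X using H F by (intro sum_nonneg) auto
  ultimately show ?thesis by blast
qed

section \<open>The logarithmic estimate and the indicator of the positivity set\<close>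

context grushin_domain
begin

text \<open>Test with \<open>\<psi>\<^sup>2 / (w + e)\<close>.\<close>

lemma log_caccioppoli:
  assumes w: "weak_sol w W G" and w0: "AE X in M. 0 \<le> w X" and G: "\<And>X. 0 \<le> G X"
    and \<psi>: "test_fn \<Omega> \<psi> h" and e: "0 < e"
  shows "integrable M (\<lambda>X. (\<psi> X)\<^sup>2 * (norm (W X))\<^sup>2 / (max (w X) 0 + e)\<^sup>2)"
    "(LINT X|M. (\<psi> X)\<^sup>2 * (norm (W X))\<^sup>2 / (max (w X) 0 + e)\<^sup>2) \<le> 4 * Lp_int 2 M (sg h)"
proof -
  note Hw = weak_solD(1)[OF w]
  \<comment> \<open>The function 1 / (s + e) on [0, infinity), continued by its tangent; w is
    nonnegative almost everywhere, so only the first branch is seen.\<close>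
  define T where "T s = 1 / (max s 0 + e) - 1 / e\<^sup>2 * min s 0" for s :: real
  define T' where "T' s = - 1 / (max s 0 + e)\<^sup>2" for s :: real
  have "((\<lambda>t. 1 / (t + e)) has_real_derivative - 1 / (t + e)\<^sup>2) (at t within {0..})" if "0 \<le> t" for t
    using that e by (auto intro!: derivative_eq_intros simp: power2_eq_square)
  from DERIV_extend_linear[OF this]
  have TD: "(T has_real_derivative T' s) (at s)" for s by (simp add: T_def[abs_def] T'_def)
  have pos: "0 < max s 0 + e" for s :: real using e by simp
  have T'c: "continuous_on UNIV T'" unfolding T'_def using pos
    by (intro continuous_intros) (auto dest: less_imp_neq[THEN not_sym] simp: less_imp_neq[THEN not_sym])
  have T'b: "\<bar>T' s\<bar> \<le> 1 / e\<^sup>2" for s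
    unfolding T'_def using e by (auto simp: abs_div_pos intro!: divide_left_mono power_mono)
  have [measurable]: "w \<in> borel_measurable M" "W \<in> borel_measurable M" using H_measurable[OF Hw] by auto
  have [measurable]: "\<psi> \<in> borel_measurable M" "sg h \<in> borel_measurable M" using test_fn_measurable[OF \<psi>] by auto
  obtain C where C: "0 \<le> C" "\<And>X. \<bar>\<psi> X\<bar> \<le> C" using test_fn_bounded[OF \<psi>] by blast
  define A where "A X = (\<psi> X)\<^sup>2 * (norm (W X))\<^sup>2 / (max (w X) 0 + e)\<^sup>2" for X
  have iA: "integrable M A"
  proof (rule Bochner_Integration.integrable_bound)
    show "integrable M (\<lambda>X. C\<^sup>2 * (norm (W X))\<^sup>2 / e\<^sup>2)" using H_Lp(2)[OF Hw] by (simp add: Lp_on_2_eq)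
    have "(\<psi> X)\<^sup>2 \<le> C\<^sup>2" for X using C(2)[of X] by (metis abs_ge_zero power2_abs power_mono)
    then have sq: "(\<psi> X)\<^sup>2 * (norm (W X))\<^sup>2 \<le> C\<^sup>2 * (norm (W X))\<^sup>2" for X by (intro mult_right_mono) auto
    have "e\<^sup>2 \<le> (max (w X) 0 + e)\<^sup>2" for X using e by (intro power_mono) auto
    then have "A X \<le> C\<^sup>2 * (norm (W X))\<^sup>2 / e\<^sup>2" for X
      unfolding A_def using e sq by (intro frac_le) auto
    then show "AE X in M. norm (A X) \<le> norm (C\<^sup>2 * (norm (W X))\<^sup>2 / e\<^sup>2)" by (simp add: A_def)
    show "A \<in> borel_measurable M" unfolding A_def by measurable
  qed
  then show "integrable M (\<lambda>X. (\<psi> X)\<^sup>2 * (norm (W X))\<^sup>2 / (max (w X) 0 + e)\<^sup>2)" by (simp add: A_def[abs_def])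
  have \<psi>2: "test_fn \<Omega> (\<lambda>X. \<psi> X * \<psi> X) (\<lambda>X. \<psi> X *\<^sub>R h X + \<psi> X *\<^sub>R h X)"
    by (rule test_fn_mult[OF \<psi> test_fn_C1[OF \<psi>]])
  have sg2: "sg (\<lambda>X. \<psi> X *\<^sub>R h X + \<psi> X *\<^sub>R h X) X = (2 * \<psi> X) *\<^sub>R sg h X" for X
    by (simp add: grushin_sqrtA_def prod_eq_iff algebra_simps scaleR_2[symmetric])
  define v where "v X = (\<psi> X * \<psi> X) * T (w X)" for X
  define V where "V X = ((\<psi> X * \<psi> X) * T' (w X)) *\<^sub>R W X + T (w X) *\<^sub>R ((2 * \<psi> X) *\<^sub>R sg h X)" for X
  have Hv: "H v V" unfolding v_def V_def
    using H_test_mult_compose[OF Hw \<psi>2 TD T'c T'b] by (simp only: sg2)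
  have "0 \<le> (LINT X|M. G X * v X)"
  proof (rule integral_nonneg_AE)
    show "AE X in M. 0 \<le> G X * v X"
      using w0
    proof eventually_elim
      case (elim X)
      then show ?case using e G by (auto simp: v_def T_def)
    qed
  qed
  also have "\<dots> = (LINT X|M. W X \<bullet> V X)" by (rule weak_solD(3)[OF w Hv, symmetric])
  also have "\<dots> \<le> (LINT X|M. - A X / 2 + 2 * (norm (sg h X))\<^sup>2)"
  proof (rule integral_mono_AE)
    show "integrable M (\<lambda>X. W X \<bullet> V X)" by (rule L2_inner(2)[OF H_Lp(2)[OF Hw] H_Lp(2)[OF Hv]])
    show "integrable M (\<lambda>X. - A X / 2 + 2 * (norm (sg h X))\<^sup>2)" using iA test_fn_Lp(2)[OF \<psi>, of 2] by (simp add: Lp_on_2_eq)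
    show "AE X in M. W X \<bullet> V X \<le> - A X / 2 + 2 * (norm (sg h X))\<^sup>2"
      using w0
    proof eventually_elim
      case (elim X)
      define z where "z = 1 / (w X + e)"
      define a where "a = (\<psi> X * z) *\<^sub>R W X"
      have Tz: "T (w X) = z" "T' (w X) = - z\<^sup>2" using elim by (auto simp: T_def T'_def z_def power_divide)
      have Aa: "A X = (norm a)\<^sup>2" using elim by (simp add: A_def a_def z_def power_mult_distrib power_divide)
      have "(norm a)\<^sup>2 = (\<psi> X * z) * ((\<psi> X * z) * (W X \<bullet> W X))" unfolding a_def power2_norm_eq_inner by simp
      moreover have "W X \<bullet> V X = - ((\<psi> X * z) * ((\<psi> X * z) * (W X \<bullet> W X))) + 2 * (a \<bullet> sg h X)"
        by (simp add: V_def Tz a_def inner_add_right power2_eq_square algebra_simps)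
      ultimately have "W X \<bullet> V X = - (norm a)\<^sup>2 + 2 * (a \<bullet> sg h X)" by simp
      also have "2 * (a \<bullet> sg h X) \<le> 2 * (norm a * norm (sg h X))" using norm_cauchy_schwarz by (intro mult_left_mono) auto
      \<comment> \<open>Young's inequality in the form 2 a b <= a^2/2 + 2 b^2 absorbs half of the
        energy; moving the other half across gives the constant 4.\<close>
      also have "\<dots> \<le> (norm a)\<^sup>2 / 2 + 2 * (norm (sg h X))\<^sup>2"
        using zero_le_power2[of "norm a - 2 * norm (sg h X)"] by (simp add: power2_diff power_mult_distrib field_simps)
      finally show ?case by (simp add: Aa)
    qed
  qed
  also have "\<dots> = - (LINT X|M. A X) / 2 + 2 * Lp_int 2 M (sg h)"
    using iA test_fn_Lp(2)[OF \<psi>, of 2] by (simp add: Lp_on_2_eq Lp_int_2_eq)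
  finally have "(LINT X|M. A X) \<le> 4 * Lp_int 2 M (sg h)" by simp
  then show "(LINT X|M. (\<psi> X)\<^sup>2 * (norm (W X))\<^sup>2 / (max (w X) 0 + e)\<^sup>2) \<le> 4 * Lp_int 2 M (sg h)" by (simp add: A_def)
qed

text \<open>With \<epsilon> = 1/(j+1) the numerator is the logarithm of (t + \<epsilon>) /
  \<epsilon>. It is at most t + ln (j+2), and ln (j+2) >= 1/2 makes the majorant 1 + 2 t uniform in
  j. Dividing by ln (j+2) rather than ln (j+1) keeps the quotient meaningful at j = 0.\<close>

lemma log_profile_bounds:
  fixes t :: real
  assumes "0 \<le> t"
  shows "ln (1 + t * real (Suc j)) / ln (real j + 2) \<le> 1 + 2 * t" "0 \<le> ln (1 + t * real (Suc j)) / ln (real j + 2)"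
proof -
  have l2: "1 / 2 \<le> ln (real j + 2)"
  proof -
    have "ln 2 \<le> ln (real j + 2)" by simp
    then show ?thesis using ln2_ge_two_thirds by linarith
  qed
  have "1 + t * real (Suc j) \<le> (1 + t) * (real j + 2)" using assms by (simp add: algebra_simps)
  then have "ln (1 + t * real (Suc j)) \<le> ln ((1 + t) * (real j + 2))" using assms by (subst ln_le_cancel_iff) (auto intro: add_pos_nonneg)
  also have "\<dots> = ln (1 + t) + ln (real j + 2)" using assms by (intro ln_mult_pos) auto
  also have "\<dots> \<le> t + ln (real j + 2)" using assms ln_add_one_self_le_self by simp
  also have "t \<le> 2 * t * ln (real j + 2)"
    using mult_left_mono[OF l2, of "2 * t"] assms by simp
  finally have "ln (1 + t * real (Suc j)) \<le> (1 + 2 * t) * ln (real j + 2)" by (simp add: algebra_simps)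
  then show "ln (1 + t * real (Suc j)) / ln (real j + 2) \<le> 1 + 2 * t" using l2 by (simp add: divide_le_eq)
  show "0 \<le> ln (1 + t * real (Suc j)) / ln (real j + 2)" using assms l2 by (intro divide_nonneg_nonneg) auto
qed

lemma ln_plus2_at_top: "filterlim (\<lambda>j. ln (real j + 2)) at_top sequentially"
proof (rule filterlim_compose[OF ln_at_top])
  have "filterlim (\<lambda>j. 2 + real j) at_top sequentially"
    by (rule filterlim_tendsto_add_at_top[OF tendsto_const filterlim_real_sequentially])
  then show "filterlim (\<lambda>j. real j + 2) at_top sequentially" by (simp add: add.commute)
qed

text \<open>The numerator differs from ln (j+2) by an amount bounded in terms of t alone, and ln
  (j+2) tends to infinity.\<close>

lemma log_profile_limit:
  fixes t :: real
  assumes "0 < t"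
  shows "(\<lambda>j. ln (1 + t * real (Suc j)) / ln (real j + 2)) \<longlonglongrightarrow> 1"
proof (rule tendsto_sandwich)
  have l: "0 < ln (real j + 2)" for j by simp
  have lim: "(\<lambda>j. 1 + c / ln (real j + 2)) \<longlonglongrightarrow> 1" for c :: real
  proof -
    have "(\<lambda>j. c / ln (real j + 2)) \<longlonglongrightarrow> 0"
      by (rule real_tendsto_divide_at_top[OF tendsto_const ln_plus2_at_top])
    from tendsto_add[OF tendsto_const[of 1] this] show ?thesis by simp
  qed
  show "(\<lambda>j. 1 + min (ln t) 0 / ln (real j + 2)) \<longlonglongrightarrow> 1" "(\<lambda>j. 1 + ln (1 + t) / ln (real j + 2)) \<longlonglongrightarrow> 1"
    by (rule lim)+
  have up: "ln (1 + t * real (Suc j)) \<le> ln (real j + 2) + ln (1 + t)" for j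
  proof -
    have "1 + t * real (Suc j) \<le> (1 + t) * (real j + 2)" using assms by (simp add: algebra_simps)
    then have "ln (1 + t * real (Suc j)) \<le> ln ((1 + t) * (real j + 2))" using assms by (subst ln_le_cancel_iff) (auto intro: add_pos_nonneg)
    also have "\<dots> = ln (1 + t) + ln (real j + 2)" using assms by (intro ln_mult_pos) auto
    finally show ?thesis by simp
  qed
  have low: "ln (real j + 2) + min (ln t) 0 \<le> ln (1 + t * real (Suc j))" for j
  proof -
    define m where "m = min t 1"
    have m: "0 < m" "m \<le> 1" "m \<le> t" using assms by (auto simp: m_def)
    have "m * (real j + 2) = m + m * real (Suc j)" by (simp add: algebra_simps)
    also have "\<dots> \<le> 1 + t * real (Suc j)" using m by (intro add_mono mult_right_mono) auto
    finally have "ln (m * (real j + 2)) \<le> ln (1 + t * real (Suc j))"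
      using m assms by (subst ln_le_cancel_iff) (auto intro: add_pos_nonneg)
    moreover have "ln (m * (real j + 2)) = ln m + ln (real j + 2)" using m by (intro ln_mult_pos) auto
    moreover have "ln m = min (ln t) 0" using assms by (auto simp: m_def min_def)
    ultimately show ?thesis by simp
  qed
  show "\<forall>\<^sub>F j in sequentially. 1 + min (ln t) 0 / ln (real j + 2) \<le> ln (1 + t * real (Suc j)) / ln (real j + 2)"
  proof (intro always_eventually allI)
    fix j
    show "1 + min (ln t) 0 / ln (real j + 2) \<le> ln (1 + t * real (Suc j)) / ln (real j + 2)"
      using divide_right_mono[OF low[of j] less_imp_le[OF l[of j]]] l[of j] by (simp add: add_divide_distrib)
  qed
  show "\<forall>\<^sub>F j in sequentially. ln (1 + t * real (Suc j)) / ln (real j + 2) \<le> 1 + ln (1 + t) / ln (real j + 2)"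
  proof (intro always_eventually allI)
    fix j
    show "ln (1 + t * real (Suc j)) / ln (real j + 2) \<le> 1 + ln (1 + t) / ln (real j + 2)"
      using divide_right_mono[OF up[of j] less_imp_le[OF l[of j]]] l[of j] by (simp add: add_divide_distrib)
  qed
qed

text \<open>The normalised logarithms of \<open>w + \<epsilon>\<close> converge to the indicator of \<open>w > 0\<close>, while their energies
  vanish locally.\<close>

lemma positivity_indicator_approx:
  assumes w: "weak_sol w W G" and w0: "AE X in M. 0 \<le> w X" and G: "\<And>X. 0 \<le> G X"
  shows "\<exists>\<omega> c. (\<forall>j::nat. test_fn \<Omega> (\<omega> j) (c j)) \<and>
    (\<lambda>j. Lp_int 2 M (\<lambda>X. \<omega> j X - (if 0 < w X then 1 else 0))) \<longlonglongrightarrow> 0 \<and>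
    (\<forall>\<psi> h. test_fn \<Omega> \<psi> h \<longrightarrow> (\<lambda>j. Lp_int 2 M (\<lambda>X. \<psi> X *\<^sub>R sg (c j) X)) \<longlonglongrightarrow> 0)"
proof -
  note Hw = weak_solD(1)[OF w]
  have [measurable]: "w \<in> borel_measurable M" "W \<in> borel_measurable M" using H_measurable[OF Hw] by auto
  define l where "l j = ln (real j + 2)" for j :: nat
  have lpos: "0 < l j" for j by (simp add: l_def)
  define z where "z X = (if 0 < w X then 1 else 0 :: real)" for X
  have [measurable]: "z \<in> borel_measurable M" unfolding z_def by measurable
  define L where "L j s = ln (1 + max s 0 * real (Suc j)) / l j + (real (Suc j) / l j) * min s 0" for j and s :: real
  define L' where "L' j s = 1 / (max s 0 + 1 / real (Suc j)) / l j" for j and s :: real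
  have LD: "(L j has_real_derivative L' j s) (at s)" for j s
  proof -
    have "((\<lambda>t. ln (1 + t * real (Suc j)) / l j) has_real_derivative 1 / (t + 1 / real (Suc j)) / l j) (at t within {0..})" if "0 \<le> t" for t
    proof -
      have "0 < 1 + t * real (Suc j)" using that by (intro add_pos_nonneg) auto
      moreover have "real (Suc j) / (1 + t * real (Suc j)) = 1 / (t + 1 / real (Suc j))" using calculation by (simp add: field_simps)
      ultimately show ?thesis using lpos[of j] by (auto intro!: derivative_eq_intros)
    qed
    from DERIV_extend_linear[OF this, of s] show ?thesis by (simp add: L_def[abs_def] L'_def)
  qed
  have pos: "0 < max s 0 + 1 / real (Suc j)" for s :: real and j by (intro add_nonneg_pos) auto
  have L'c: "continuous_on UNIV (L' j)" for j unfolding L'_def using pos[of _ j] lpos[of j]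
    by (intro continuous_intros) (auto simp: less_imp_neq[THEN not_sym])
  have L'b: "\<bar>L' j s\<bar> \<le> real (Suc j) / l j" for j s
  proof -
    have "1 / (max s 0 + 1 / real (Suc j)) \<le> 1 / (1 / real (Suc j))" using pos[of s j] by (intro divide_left_mono) auto
    then have "L' j s \<le> real (Suc j) / l j" unfolding L'_def using lpos[of j] by (intro divide_right_mono) auto
    moreover have "0 \<le> L' j s" unfolding L'_def using pos[of s j] lpos[of j] by simp
    ultimately show ?thesis by simp
  qed
  define Y where "Y j X = L j (w X)" for j X
  define V where "V j X = L' j (w X) *\<^sub>R W X" for j X
  have HY: "H (Y j) (V j)" for j unfolding Y_def V_def
    by (rule H_compose[OF Hw LD L'c L'b]) (simp add: L_def)
  have [measurable]: "Y j \<in> borel_measurable M" "V j \<in> borel_measurable M" for j using H_measurable[OF HY] by auto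
  have LY: "Lp_on 2 M (Y j)" "Lp_on 2 M (V j)" for j using H_Lp[OF HY] by auto
  have Lz: "Lp_on 2 M z" by (rule dom.Lp_on_bounded[where C=1]) (auto simp: z_def)
  have Ylim: "(\<lambda>j. Lp_int 2 M (\<lambda>X. Y j X - z X)) \<longlonglongrightarrow> 0"
  proof (rule Lp_lim_dominated[where G="\<lambda>X. 2 + 2 * w X" and C=1])
    have "Lp_on 2 M (\<lambda>X. 2 * w X)" using Lp_on_scaleR[OF H_Lp(1)[OF Hw], of 2] by simp
    then show "Lp_on 2 M (\<lambda>X. 2 + 2 * w X)" by (intro Lp_on_add(1)) (auto simp: Lp_on_def)
    show "AE X in M. (\<lambda>j. Y j X - z X) \<longlonglongrightarrow> 0"
      using w0
    proof eventually_elim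
      case (elim X)
      show ?case
      proof (cases "w X = 0")
        case True then show ?thesis by (simp add: Y_def L_def z_def)
      next
        case False
        with elim have "0 < w X" by simp
        then have "(\<lambda>j. Y j X) \<longlonglongrightarrow> 1" "z X = 1" using log_profile_limit[of "w X"]
          by (simp_all add: Y_def L_def z_def l_def)
        then show ?thesis using tendsto_diff[OF _ tendsto_const[of 1], of "\<lambda>j. Y j X" 1 sequentially] by simp
      qed
    qed
    show "AE X in M. norm (Y j X - z X) \<le> 1 * norm (2 + 2 * w X)" for j
      using w0
    proof eventually_elim
      case (elim X)
      have "0 \<le> Y j X" "Y j X \<le> 1 + 2 * w X" using log_profile_bounds[OF elim, of j] elim by (simp_all add: Y_def L_def l_def)
      moreover have "0 \<le> z X" "z X \<le> 1" by (auto simp: z_def)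
      ultimately show ?case using elim by auto
    qed
  qed auto
  \<comment> \<open>\<open>Y j\<close> is only known to lie in the energy space; a diagonal choice
    replaces it by a test function with error below 1/(j+1).\<close>
  have "\<exists>v g. test_fn \<Omega> v g \<and> Lp_int 2 M (\<lambda>X. v X - Y j X) < 1 / Suc j \<and> Lp_int 2 M (\<lambda>X. sg g X - V j X) < 1 / Suc j" for j
  proof -
    obtain \<phi> g where \<phi>: "\<And>k::nat. test_fn \<Omega> (\<phi> k) (g k)"
     "(\<lambda>k. Lp_int 2 M (\<lambda>X. \<phi> k X - Y j X)) \<longlonglongrightarrow> 0" "(\<lambda>k. Lp_int 2 M (\<lambda>X. sg (g k) X - V j X)) \<longlonglongrightarrow> 0"
      using HY[of j] unfolding H_def by blast
    have "\<forall>\<^sub>F k in sequentially. Lp_int 2 M (\<lambda>X. \<phi> k X - Y j X) < 1 / Suc j \<and> Lp_int 2 M (\<lambda>X. sg (g k) X - V j X) < 1 / Suc j"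
      using \<phi>(2,3) by (intro eventually_conj order_tendstoD(2)) auto
    then obtain k where "Lp_int 2 M (\<lambda>X. \<phi> k X - Y j X) < 1 / Suc j" "Lp_int 2 M (\<lambda>X. sg (g k) X - V j X) < 1 / Suc j"
      using eventually_happens'[OF sequentially_bot] by blast
    then show ?thesis using \<phi>(1)[of k] by blast
  qed
  then have "\<forall>n. \<exists>p. test_fn \<Omega> (fst p) (snd p) \<and> Lp_int 2 M (\<lambda>X. fst p X - Y n X) < 1 / Suc n \<and> Lp_int 2 M (\<lambda>X. sg (snd p) X - V n X) < 1 / Suc n"
    by (simp only: split_paired_Ex fst_conv snd_conv) blast
  from choice[OF this] obtain p where p: "\<And>n. test_fn \<Omega> (fst (p n)) (snd (p n)) \<and> Lp_int 2 M (\<lambda>X. fst (p n) X - Y n X) < 1 / Suc n \<and> Lp_int 2 M (\<lambda>X. sg (snd (p n)) X - V n X) < 1 / Suc n"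
    by blast
  define \<omega> where "\<omega> n = fst (p n)" for n
  define c where "c n = snd (p n)" for n
  have \<omega>: "\<And>j. test_fn \<Omega> (\<omega> j) (c j)" "\<And>j. Lp_int 2 M (\<lambda>X. \<omega> j X - Y j X) < 1 / Suc j"
     "\<And>j. Lp_int 2 M (\<lambda>X. sg (c j) X - V j X) < 1 / Suc j" using p unfolding \<omega>_def c_def by simp_all
  have l1: "(\<lambda>j. Lp_int 2 M (\<lambda>X. \<omega> j X - Y j X)) \<longlonglongrightarrow> 0" "(\<lambda>j. Lp_int 2 M (\<lambda>X. sg (c j) X - V j X)) \<longlonglongrightarrow> 0"
    by (rule tendsto_zero_of_less_inverse, rule Lp_int_nonneg, rule \<omega>(2))
       (rule tendsto_zero_of_less_inverse, rule Lp_int_nonneg, rule \<omega>(3))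
  have LX: "Lp_on 2 M (\<lambda>X. \<omega> j X - Y j X)" "Lp_on 2 M (\<lambda>X. sg (c j) X - V j X)" "Lp_on 2 M (\<lambda>X. Y j X - z X)" for j
    by (rule Lp_on_diff(1)[OF test_fn_Lp(1)[OF \<omega>(1)] LY(1)]; simp)
       (rule Lp_on_diff(1)[OF test_fn_Lp(2)[OF \<omega>(1)] LY(2)] Lp_on_diff(1)[OF LY(1) Lz]; simp)+
  have "(\<lambda>j. Lp_int 2 M (\<lambda>X. (\<omega> j X - Y j X) + (Y j X - z X))) \<longlonglongrightarrow> 0"
    by (rule Lp_lim_add[OF l1(1) Ylim LX(1,3)]) simp
  then have 1: "(\<lambda>j. Lp_int 2 M (\<lambda>X. \<omega> j X - z X)) \<longlonglongrightarrow> 0" by simp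
  have 2: "(\<lambda>j. Lp_int 2 M (\<lambda>X. \<psi> X *\<^sub>R sg (c j) X)) \<longlonglongrightarrow> 0" if \<psi>: "test_fn \<Omega> \<psi> h" for \<psi> h
  proof -
    have [measurable]: "\<psi> \<in> borel_measurable M" using test_fn_measurable[OF \<psi>] by auto
    have [measurable]: "sg (c j) \<in> borel_measurable M" for j using test_fn_measurable[OF \<omega>(1)] by auto
    obtain C where C: "0 \<le> C" "\<And>X. \<bar>\<psi> X\<bar> \<le> C" using test_fn_bounded[OF \<psi>] by blast
    have a: "(\<lambda>j. Lp_int 2 M (\<lambda>X. \<psi> X *\<^sub>R (sg (c j) X - V j X))) \<longlonglongrightarrow> 0"
      by (rule Lp_lim_bound[OF l1(2) LX(2), where C=C]) (use C in \<open>auto intro!: mult_right_mono\<close>)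
    have La: "Lp_on 2 M (\<lambda>X. \<psi> X *\<^sub>R (sg (c j) X - V j X))" for j
      by (rule Lp_on_bound(1)[OF LX(2)[of j], where C=C]) (use C in \<open>auto intro!: mult_right_mono\<close>)
    have Lb: "Lp_on 2 M (\<lambda>X. \<psi> X *\<^sub>R V j X)" for j
      by (rule Lp_on_bound(1)[OF LY(2)[of j], where C=C]) (use C in \<open>auto intro!: mult_right_mono\<close>)
    \<comment> \<open>The logarithmic estimate with e = 1/(j+1) has a bound independent of j, so
      division by the square of the normalisation \<open>l j\<close> makes this energy vanish in the
      limit.\<close>
    have Vb: "Lp_int 2 M (\<lambda>X. \<psi> X *\<^sub>R V j X) \<le> 4 * Lp_int 2 M (sg h) / (l j)\<^sup>2" for j
    proof -
      have e: "0 < 1 / real (Suc j)" by simp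
      have "(norm (\<psi> X *\<^sub>R V j X))\<^sup>2 = (\<psi> X)\<^sup>2 * (norm (W X))\<^sup>2 / (max (w X) 0 + 1 / real (Suc j))\<^sup>2 / (l j)\<^sup>2" for X
        by (simp add: V_def L'_def power_mult_distrib power_divide)
      then have "Lp_int 2 M (\<lambda>X. \<psi> X *\<^sub>R V j X) = (LINT X|M. (\<psi> X)\<^sup>2 * (norm (W X))\<^sup>2 / (max (w X) 0 + 1 / real (Suc j))\<^sup>2 / (l j)\<^sup>2)"
        unfolding Lp_int_2_eq by (simp only:)
      also have "\<dots> = (LINT X|M. (\<psi> X)\<^sup>2 * (norm (W X))\<^sup>2 / (max (w X) 0 + 1 / real (Suc j))\<^sup>2) / (l j)\<^sup>2"
        by (rule integral_divide_zero)
      also have "\<dots> \<le> 4 * Lp_int 2 M (sg h) / (l j)\<^sup>2"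
        by (intro divide_right_mono log_caccioppoli(2)[OF w w0 G \<psi> e]) auto
      finally show ?thesis .
    qed
    have "(\<lambda>j. 4 * Lp_int 2 M (sg h) / (l j)\<^sup>2) \<longlonglongrightarrow> 0"
    proof (rule real_tendsto_divide_at_top[OF tendsto_const])
      show "filterlim (\<lambda>j. (l j)\<^sup>2) at_top sequentially"
        unfolding l_def by (rule filterlim_pow_at_top[OF _ ln_plus2_at_top]) simp
    qed
    then have b: "(\<lambda>j. Lp_int 2 M (\<lambda>X. \<psi> X *\<^sub>R V j X)) \<longlonglongrightarrow> 0"
      using Vb by (rule_tac tendsto_sandwich[OF _ _ tendsto_const]) (auto simp: Lp_int_nonneg)
    have "(\<lambda>j. Lp_int 2 M (\<lambda>X. \<psi> X *\<^sub>R (sg (c j) X - V j X) + \<psi> X *\<^sub>R V j X)) \<longlonglongrightarrow> 0"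
      by (rule Lp_lim_add[OF a b La Lb]) simp
    then show ?thesis by (simp flip: scaleR_add_right)
  qed
  show ?thesis using \<omega>(1) 1 2 unfolding z_def by blast
qed

end

lemma cball_Times_subset_cball:
  fixes x :: real and y :: "'b::euclidean_space"
  assumes "0 \<le> \<rho>"
  shows "cball x \<rho> \<times> cball y \<rho> \<subseteq> cball (x, y) (2 * \<rho>)"
proof clarsimp
  fix a b assume "dist x a \<le> \<rho>" "dist y b \<le> \<rho>"
  then have "sqrt ((dist x a)\<^sup>2 + (dist y b)\<^sup>2) \<le> \<rho> + \<rho>"
    by (intro order_trans[OF sqrt_sum_squares_le_sum] add_mono) auto
  then show "dist (x, y) (a, b) \<le> 2 * \<rho>" by (simp add: dist_Pair_Pair)
qed

text \<open>Points of \<open>D\<close> are joined by moving in \<open>x\<close> to a region away from \<open>x = 0\<close>, then in \<open>y\<close>, then back in \<open>x\<close>.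
  The error \<open>\<delta>\<close> allows \<open>c\<close> to be a value of \<open>v\<close> chosen by averaging.\<close>

lemma grushin_local_oscillation:
  fixes \<Omega> :: "(real \<times> (real ^ 'm)) set"
  assumes lam: "0 < lam" and \<Omega>: "open \<Omega>" and P: "P \<in> \<Omega>"
  shows "\<exists>D K C. open D \<and> P \<in> D \<and> D \<subseteq> K \<and> compact K \<and> K \<subseteq> \<Omega> \<and> 0 < C \<and>
    (\<forall>v g \<delta>. C1_pair v g \<longrightarrow> 0 < \<delta> \<longrightarrow> (\<exists>c. (\<integral>\<^sup>+X. ennreal ((v X - c)\<^sup>2) * indicator D X \<partial>lborel)
      \<le> ennreal C * (\<integral>\<^sup>+X. ennreal ((norm (grushin_sqrtA lam X (g X)))\<^sup>2) * indicator K X \<partial>lborel) + ennreal \<delta>))"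
proof -
  obtain x0 y0 where P0: "P = (x0, y0)" by (cases P)
  obtain R where R: "0 < R" "cball P R \<subseteq> \<Omega>" using \<Omega> P by (meson open_contains_cball)
  \<comment> \<open>K has half-width 12 \<eta> in both variables, so it fits into the ball of radius
    24 \<eta> = R.\<close>
  define \<eta> where "\<eta> = R / 24"
  have \<eta>: "0 < \<eta>" using R by (simp add: \<eta>_def)
  define K where "K = cball x0 (12 * \<eta>) \<times> cball y0 (12 * \<eta>)"
  define D where "D = ball x0 \<eta> \<times> ball y0 \<eta>"
  \<comment> \<open>Contains every difference of two points of D.\<close>
  define E where "E = cball (0::real) (2 * \<eta>) \<times> cball (0::real^'m) (2 * \<eta>)"
  have "K \<subseteq> cball P R" unfolding K_def P0 using cball_Times_subset_cball[of "12 * \<eta>" x0 y0] \<eta> by (simp add: \<eta>_def)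
  then have K: "K \<subseteq> \<Omega>" "compact K" using R by (auto simp: K_def intro: compact_Times)
  have D: "open D" "P \<in> D" "D \<subseteq> K" using \<eta> by (auto simp: D_def K_def P0 intro: open_Times)
  have E: "compact E" by (auto simp: E_def intro: compact_Times)
  have [measurable]: "D \<in> sets borel" "K \<in> sets borel" "E \<in> sets borel"
    using D K E by (auto intro: borel_open borel_closed compact_imp_closed)
  obtain e0 where e0: "emeasure lborel E = ennreal e0" "0 \<le> e0"
    using emeasure_bounded_finite[OF compact_imp_bounded[OF E]] by (cases "emeasure lborel E") auto
  have "bounded D" using D K by (meson bounded_subset compact_imp_bounded)
  then obtain d0 where d0: "emeasure lborel D = ennreal d0" "0 \<le> d0"
    using emeasure_bounded_finite[of D] by (cases "emeasure lborel D") auto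
  have "emeasure lborel D \<noteq> 0"
  proof
    assume "emeasure lborel D = 0"
    then have "D \<in> null_sets lborel" by (auto simp: null_sets_def)
    then have "negligible D" by (simp add: negligible_iff_null_sets null_sets_completionI)
    then show False using D open_not_negligible by blast
  qed
  with d0 have d0p: "0 < d0" by (cases "d0 = 0") auto
  \<comment> \<open>The excursion in x takes the sign of x0. Starting within \<eta> of x0, it ends
    where |x| >= 5 \<eta>, also when x0 = 0.\<close>
  define \<rho> where "\<rho> = (if 0 \<le> x0 then 6 * \<eta> else - 6 * \<eta>)"
  have \<rho>2: "\<rho>\<^sup>2 = 36 * \<eta>\<^sup>2" by (simp add: \<rho>_def power_mult_distrib)
  define c1 where "c1 = (2 * \<eta> / (5 * \<eta>) powr lam)\<^sup>2"
  \<comment> \<open>Going out in x and across in y costs 2 c1 + 72 \<eta>^2, coming back in x costs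
    64 \<eta>^2; the squared sum doubles both.\<close>
  define C0 where "C0 = 2 * (2 * c1 + 72 * \<eta>\<^sup>2) + 128 * \<eta>\<^sup>2"
  have C0: "0 < C0" using \<eta> by (auto simp: C0_def c1_def intro!: add_nonneg_pos)
  have shift: "(\<integral>\<^sup>+X. ennreal ((v (X + e) - v X)\<^sup>2) * indicator D X \<partial>lborel)
      \<le> ennreal C0 * (\<integral>\<^sup>+X. ennreal ((norm (grushin_sqrtA lam X (g X)))\<^sup>2) * indicator K X \<partial>lborel)"
    if v: "C1_pair v g" and eE: "e \<in> E" for v g e
  proof -
    let ?DK = "\<integral>\<^sup>+X. ennreal ((norm (grushin_sqrtA lam X (g X)))\<^sup>2) * indicator K X \<partial>lborel"
    have [measurable]: "v \<in> borel_measurable borel" using C1_pair_measurable[OF v] by auto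
    obtain h k where e: "e = (h, k)" by (cases e)
    have hk: "\<bar>h\<bar> \<le> 2 * \<eta>" "norm k \<le> 2 * \<eta>" using eE by (auto simp: E_def e)
    let ?B2 = "K \<inter> {X. 5 * \<eta> \<le> \<bar>fst X\<bar>}"
    have B2m: "?B2 \<in> sets borel"
      using K by (intro borel_closed closed_Int compact_imp_closed closed_Collect_le continuous_intros)
    have 1: "(\<integral>\<^sup>+X. ennreal ((v (X + (\<rho>, k)) - v X)\<^sup>2) * indicator D X \<partial>lborel) \<le> ennreal (2 * c1 + 72 * \<eta>\<^sup>2) * ?DK"
    proof -
      have "(\<integral>\<^sup>+X. ennreal ((v (X + (\<rho>, k)) - v X)\<^sup>2) * indicator D X \<partial>lborel)
        \<le> 2 * (ennreal ((norm k / (5 * \<eta>) powr lam)\<^sup>2) * (\<integral>\<^sup>+X. ennreal ((norm (grushin_sqrtA lam X (g X)))\<^sup>2) * indicator ?B2 X \<partial>lborel))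
         + 2 * (ennreal (\<rho>\<^sup>2) * ?DK)"
      proof (rule grushin_shift_xy[OF v lam _ _ B2m])
        fix X t assume X: "X \<in> D" and t: "0 \<le> t" "t \<le> (1::real)"
        obtain x y where xy: "X = (x, y)" by (cases X)
        have x: "\<bar>x - x0\<bar> < \<eta>" "dist y0 y < \<eta>" using X by (auto simp: D_def xy dist_real_def abs_minus_commute)
        have "\<bar>t * \<rho>\<bar> \<le> 6 * \<eta>" using t \<eta> by (auto simp: \<rho>_def abs_mult mult_left_le_one_le)
        then have "\<bar>x0 - (x + t * \<rho>)\<bar> \<le> 12 * \<eta>" using x \<eta> by linarith
        then show "X + (t * \<rho>, 0) \<in> K" using x \<eta> by (auto simp: K_def xy dist_real_def)
        have "norm (t *\<^sub>R k) \<le> 2 * \<eta>" using hk t by (auto simp: intro: order_trans[OF mult_left_le_one_le])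
        moreover have "dist y0 (y + t *\<^sub>R k) \<le> dist y0 y + norm (t *\<^sub>R k)"
          using dist_triangle[of y0 "y + t *\<^sub>R k" y] by (simp add: dist_norm)
        ultimately have 2: "dist y0 (y + t *\<^sub>R k) \<le> 12 * \<eta>" using x \<eta> by linarith
        have 3: "\<bar>x0 - (x + \<rho>)\<bar> \<le> 12 * \<eta>" using x \<eta> unfolding \<rho>_def by (auto split: if_splits)
        have 4: "5 * \<eta> \<le> \<bar>x + \<rho>\<bar>" using x \<eta> unfolding \<rho>_def by (auto split: if_splits)
        show "X + (\<rho>, t *\<^sub>R k) \<in> ?B2" using 2 3 4 by (auto simp: K_def xy dist_real_def)
      qed (use \<eta> in auto)
      also have "\<dots> \<le> 2 * (ennreal c1 * ?DK) + 2 * (ennreal (36 * \<eta>\<^sup>2) * ?DK)"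
      proof -
        have "(norm k / (5 * \<eta>) powr lam)\<^sup>2 \<le> c1" unfolding c1_def using hk \<eta> by (intro power_mono divide_right_mono) auto
        then show ?thesis unfolding \<rho>2
          by (intro add_mono mult_left_mono mult_mono ennreal_leI nn_integral_mono) (auto simp: indicator_def)
      qed
      also have "\<dots> = (ennreal (2 * c1) + ennreal (2 * (36 * \<eta>\<^sup>2))) * ?DK"
        by (simp add: ennreal_mult distrib_right mult.assoc c1_def)
      also have "\<dots> = ennreal (2 * c1 + 72 * \<eta>\<^sup>2) * ?DK"
        by (subst ennreal_plus[symmetric]) (auto simp: c1_def)
      finally show ?thesis .
    qed
    define B' where "B' = (\<lambda>Y. Y - e) -` D"
    have [measurable]: "B' \<in> sets borel"
      using measurable_sets[of "\<lambda>Y. Y - e" borel borel D] by (simp add: B'_def)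
    have 2: "(\<integral>\<^sup>+X. ennreal ((v (X + e) - v (X + (\<rho>, k)))\<^sup>2) * indicator D X \<partial>lborel) \<le> ennreal (64 * \<eta>\<^sup>2) * ?DK"
    proof -
      have "(\<integral>\<^sup>+X. ennreal ((v (X + e) - v (X + (\<rho>, k)))\<^sup>2) * indicator D X \<partial>lborel)
        = (\<integral>\<^sup>+X. (\<lambda>Y. ennreal ((v (Y + (\<rho> - h, 0)) - v Y)\<^sup>2) * indicator B' Y) (X + e) \<partial>lborel)"
        by (intro nn_integral_cong) (simp add: B'_def indicator_def e add.assoc power2_commute)
      also have "\<dots> = (\<integral>\<^sup>+Y. ennreal ((v (Y + (\<rho> - h, 0)) - v Y)\<^sup>2) * indicator B' Y \<partial>lborel)"
        by (rule nn_integral_lborel_shift) measurable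
      also have "\<dots> \<le> ennreal ((\<rho> - h)\<^sup>2) * ?DK"
      proof (rule grushin_shift_x[OF v lam])
        fix Y t assume Y: "Y \<in> B'" and t: "0 \<le> t" "t \<le> (1::real)"
        obtain x y where xy: "Y = (x, y)" by (cases Y)
        have x: "\<bar>(x - h) - x0\<bar> < \<eta>" "dist y0 (y - k) < \<eta>" using Y by (auto simp: B'_def D_def xy e dist_real_def abs_minus_commute)
        have "\<bar>\<rho> - h\<bar> \<le> 8 * \<eta>" using hk \<eta> by (auto simp: \<rho>_def)
        then have "\<bar>t * (\<rho> - h)\<bar> \<le> 8 * \<eta>" using t by (auto simp: abs_mult intro: order_trans[OF mult_left_le_one_le])
        then have 1: "\<bar>x0 - (x + t * (\<rho> - h))\<bar> \<le> 12 * \<eta>" using x hk \<eta> by linarith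
        have "dist y0 y \<le> dist y0 (y - k) + dist (y - k) y" by (rule dist_triangle)
        also have "dist (y - k) y = norm k" by (simp add: dist_norm)
        finally have "dist y0 y \<le> 12 * \<eta>" using x hk \<eta> by linarith
        then show "Y + (t * (\<rho> - h), 0) \<in> K" using 1 by (auto simp: K_def xy dist_real_def)
      qed auto
      also have "\<dots> \<le> ennreal (64 * \<eta>\<^sup>2) * ?DK"
      proof -
        have "\<bar>\<rho> - h\<bar> \<le> 8 * \<eta>" using hk \<eta> by (auto simp: \<rho>_def)
        then have "(\<rho> - h)\<^sup>2 \<le> (8 * \<eta>)\<^sup>2" using \<eta> by (intro power2_le_iff_abs_le[THEN iffD2]) auto
        then show ?thesis by (intro mult_right_mono ennreal_leI) (auto simp: power_mult_distrib)
      qed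
      finally show ?thesis .
    qed
    have "(\<integral>\<^sup>+X. ennreal ((v (X + e) - v X)\<^sup>2) * indicator D X \<partial>lborel)
      = (\<integral>\<^sup>+X. ennreal (((v (X + (\<rho>, k)) - v X) + (v (X + e) - v (X + (\<rho>, k))))\<^sup>2) * indicator D X \<partial>lborel)" by simp
    also have "\<dots> \<le> 2 * (\<integral>\<^sup>+X. ennreal ((v (X + (\<rho>, k)) - v X)\<^sup>2) * indicator D X \<partial>lborel)
       + 2 * (\<integral>\<^sup>+X. ennreal ((v (X + e) - v (X + (\<rho>, k)))\<^sup>2) * indicator D X \<partial>lborel)"
      by (rule nn_integral_add_sq_le) measurable
    also have "\<dots> \<le> 2 * (ennreal (2 * c1 + 72 * \<eta>\<^sup>2) * ?DK) + 2 * (ennreal (64 * \<eta>\<^sup>2) * ?DK)"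
      by (rule add_mono; rule mult_left_mono) (use 1 2 in auto)
    also have "\<dots> = (2 * ennreal (2 * c1 + 72 * \<eta>\<^sup>2) + 2 * ennreal (64 * \<eta>\<^sup>2)) * ?DK"
      by (simp add: distrib_right mult.assoc)
    also have "2 * ennreal (2 * c1 + 72 * \<eta>\<^sup>2) + 2 * ennreal (64 * \<eta>\<^sup>2) = ennreal (2 * (2 * c1 + 72 * \<eta>\<^sup>2)) + ennreal (2 * (64 * \<eta>\<^sup>2))"
      by (simp only: ennreal_mult' ennreal_numeral zero_le_numeral)
    also have "\<dots> = ennreal C0" by (subst ennreal_plus[symmetric]) (auto simp: C0_def c1_def)
    finally show ?thesis .
  qed
  \<comment> \<open>Integrating the shift bound over E and dividing by the measure d0 of D gives C0
    e0 / d0; the 1 keeps C positive.\<close>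
  define C where "C = C0 * e0 / d0 + 1"
  have C: "0 < C" using C0 e0 d0p by (simp add: C_def add_nonneg_pos)
  have "\<exists>c. (\<integral>\<^sup>+X. ennreal ((v X - c)\<^sup>2) * indicator D X \<partial>lborel)
      \<le> ennreal C * (\<integral>\<^sup>+X. ennreal ((norm (grushin_sqrtA lam X (g X)))\<^sup>2) * indicator K X \<partial>lborel) + ennreal \<delta>"
    if v: "C1_pair v g" and \<delta>: "0 < \<delta>" for v g \<delta>
  proof -
    have [measurable]: "v \<in> borel_measurable borel" using C1_pair_measurable[OF v] by auto
    let ?DK = "\<integral>\<^sup>+X. ennreal ((norm (grushin_sqrtA lam X (g X)))\<^sup>2) * indicator K X \<partial>lborel"
    let ?I = "\<lambda>X. \<integral>\<^sup>+Y. ennreal ((v Y - v X)\<^sup>2) * indicator D Y \<partial>lborel"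
    show ?thesis
    proof (cases ?DK)
      case (real d)
      show ?thesis
      proof (rule ccontr)
        assume neg: "\<not> ?thesis"
        \<comment> \<open>The candidates are the values c = v X. If all of them failed, integration
          over X in D would contradict the shift bound; \<delta> keeps the contradiction strict when
          the energy on K is 0.\<close>
        have big: "ennreal (C * d + \<delta>) \<le> ?I X" for X
        proof -
          have "ennreal C * ?DK + ennreal \<delta> \<le> ?I X" using neg by (auto simp: not_le intro: less_imp_le)
          then show ?thesis unfolding real using real C \<delta> by (simp add: ennreal_mult ennreal_plus)
        qed
        have "ennreal ((C * d + \<delta>) * d0) = (\<integral>\<^sup>+X. ennreal (C * d + \<delta>) * indicator D X \<partial>lborel)"
          using C real \<delta> d0 by (subst nn_integral_cmult_indicator) (auto simp: ennreal_mult)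
        also have "\<dots> \<le> (\<integral>\<^sup>+X. (\<integral>\<^sup>+e. ennreal ((v (X + e) - v X)\<^sup>2) * indicator E e * indicator D X \<partial>lborel) \<partial>lborel)"
        proof (rule nn_integral_mono)
          fix X
          show "ennreal (C * d + \<delta>) * indicator D X \<le> (\<integral>\<^sup>+e. ennreal ((v (X + e) - v X)\<^sup>2) * indicator E e * indicator D X \<partial>lborel)"
          proof (cases "X \<in> D")
            case True
            have "?I X = (\<integral>\<^sup>+e. (\<lambda>Y. ennreal ((v Y - v X)\<^sup>2) * indicator D Y) (e + X) \<partial>lborel)"
              by (rule nn_integral_lborel_shift[symmetric]) measurable
            also have "\<dots> \<le> (\<integral>\<^sup>+e. ennreal ((v (X + e) - v X)\<^sup>2) * indicator E e * indicator D X \<partial>lborel)"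
            proof (rule nn_integral_mono)
              fix e
              have "e \<in> E" if "e + X \<in> D"
              proof -
                obtain x y h k where xy: "X = (x, y)" "e = (h, k)" by (cases X, cases e)
                have "dist x0 x < \<eta>" "dist y0 y < \<eta>" "dist x0 (h + x) < \<eta>" "dist y0 (k + y) < \<eta>"
                  using True that by (auto simp: D_def xy)
                moreover have "dist x (h + x) \<le> dist x0 x + dist x0 (h + x)" "dist y (k + y) \<le> dist y0 y + dist y0 (k + y)"
                  using dist_triangle[of x "h + x" x0] dist_triangle[of y "k + y" y0] by (simp_all add: dist_commute)
                ultimately have "dist x (h + x) \<le> 2 * \<eta>" "dist y (k + y) \<le> 2 * \<eta>" by linarith+
                then show ?thesis by (simp add: E_def xy dist_norm)
              qed
              then show "(\<lambda>Y. ennreal ((v Y - v X)\<^sup>2) * indicator D Y) (e + X) \<le> ennreal ((v (X + e) - v X)\<^sup>2) * indicator E e * indicator D X"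
                using True by (auto simp: indicator_def add.commute)
            qed
            finally show ?thesis using big[of X] True by (auto intro: order_trans)
          qed simp
        qed
        also have "\<dots> = (\<integral>\<^sup>+e. (\<integral>\<^sup>+X. ennreal ((v (X + e) - v X)\<^sup>2) * indicator E e * indicator D X \<partial>lborel) \<partial>lborel)"
          by (rule lborel_pair.Fubini'[symmetric]) measurable
        also have "\<dots> \<le> (\<integral>\<^sup>+e. (ennreal C0 * ?DK) * indicator E e \<partial>lborel)"
        proof (rule nn_integral_mono)
          fix e
          show "(\<integral>\<^sup>+X. ennreal ((v (X + e) - v X)\<^sup>2) * indicator E e * indicator D X \<partial>lborel) \<le> (ennreal C0 * ?DK) * indicator E e"
            using shift[OF v, of e] by (auto simp: indicator_def)
        qed
        also have "\<dots> = ennreal C0 * ?DK * ennreal e0" by (subst nn_integral_cmult_indicator) (auto simp: e0)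
        also have "\<dots> = ennreal (C0 * d * e0)" unfolding real using C0 real e0 by (simp flip: ennreal_mult)
        finally have "(C * d + \<delta>) * d0 \<le> C0 * d * e0"
          using C0 real e0 by (subst (asm) ennreal_le_iff) auto
        moreover have "(C * d + \<delta>) * d0 = C0 * d * e0 + d * d0 + \<delta> * d0" using d0p by (simp add: C_def field_simps)
        moreover have "0 \<le> d * d0" "0 < \<delta> * d0" using real \<delta> d0p by auto
        ultimately show False by linarith
      qed
    next
      case top
      then show ?thesis using C by (simp add: ennreal_mult_top)
    qed
  qed
  then show ?thesis using D K C by blast
qed

section \<open>From local constancy of the positivity set to strict positivity on \<Omega>\<close>

context grushin_domain
begin

text \<open>The indicator of w > 0 is an L^2 limit of functions whose energy on K vanishes, so by
  \<open>grushin_local_oscillation\<close> it is nearly a constant b on D. No b is closer than 1/2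
  to both 0 and 1, so one of the two values is taken only on a set of small measure.\<close>

lemma local_positivity_dichotomy:
  assumes w: "weak_sol w W G" and w0: "AE X in M. 0 \<le> w X" and G: "\<And>X. 0 \<le> G X" and P: "P \<in> \<Omega>"
  shows "\<exists>D. open D \<and> P \<in> D \<and> D \<subseteq> \<Omega> \<and> (negligible {X\<in>D. \<not> 0 < w X} \<or> negligible {X\<in>D. 0 < w X})"
proof -
  have [measurable]: "w \<in> borel_measurable M" using H_measurable[OF weak_solD(1)[OF w]] by auto
  obtain D K C where D: "open D" "P \<in> D" "D \<subseteq> K" "compact K" "K \<subseteq> \<Omega>" "0 < C"
    and osc0: "\<forall>v g \<delta>. C1_pair v g \<longrightarrow> 0 < \<delta> \<longrightarrow> (\<exists>c. (\<integral>\<^sup>+X. ennreal ((v X - c)\<^sup>2) * indicator D X \<partial>lborel)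
      \<le> ennreal C * (\<integral>\<^sup>+X. ennreal ((norm (sg g X))\<^sup>2) * indicator K X \<partial>lborel) + ennreal \<delta>)"
    using grushin_local_oscillation[OF lam_pos open_dom P] by (elim exE conjE) (rule that, assumption+)
  note osc = osc0[rule_format]
  obtain \<psi> h where \<psi>: "test_fn \<Omega> \<psi> h" "\<And>X. 0 \<le> \<psi> X" "\<And>X. X \<in> K \<Longrightarrow> 1 \<le> \<psi> X"
    using test_fn_cutoff[OF open_dom D(4,5)] by blast
  define z where "z = (\<lambda>X. if 0 < w X then 1 else 0 :: real)"
  have [measurable]: "z \<in> borel_measurable M" unfolding z_def by measurable
  obtain \<omega> c where \<omega>: "\<And>j::nat. test_fn \<Omega> (\<omega> j) (c j)"
    and \<omega>z: "(\<lambda>j. Lp_int 2 M (\<lambda>X. \<omega> j X - z X)) \<longlonglongrightarrow> 0"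
    and \<omega>E: "(\<lambda>j. Lp_int 2 M (\<lambda>X. \<psi> X *\<^sub>R sg (c j) X)) \<longlonglongrightarrow> 0"
  proof -
    obtain \<omega> c where 1: "\<forall>j::nat. test_fn \<Omega> (\<omega> j) (c j)"
      "(\<lambda>j. Lp_int 2 M (\<lambda>X. \<omega> j X - (if 0 < w X then 1 else 0))) \<longlonglongrightarrow> 0"
      and 2: "\<forall>\<psi> h. test_fn \<Omega> \<psi> h \<longrightarrow> (\<lambda>j. Lp_int 2 M (\<lambda>X. \<psi> X *\<^sub>R sg (c j) X)) \<longlonglongrightarrow> 0"
      using positivity_indicator_approx[OF w w0 G] by (elim exE conjE) (rule that, assumption+)
    show thesis
      by (rule that[OF spec[OF 1(1)]]) (use 1(2) 2[rule_format, OF \<psi>(1)] in \<open>simp_all add: z_def\<close>)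
  qed
  have Dm[measurable]: "D \<in> sets borel" and Km[measurable]: "K \<in> sets borel"
    using D by (auto intro: borel_open borel_closed compact_imp_closed)
  have iD: "(\<lambda>X. indicator D X :: ennreal) \<in> borel_measurable M" "(\<lambda>X. indicator D X :: real) \<in> borel_measurable M"
    by (auto intro!: measurable_restrict_space1 measurable_completion)
  define A where "A b = {X\<in>space M. indicator D X = (1::real) \<and> z X = b}" for b :: real
  have Am[measurable]: "A b \<in> sets M" for b unfolding A_def using iD(2) by measurable
  have Lz: "Lp_on 2 M z" by (rule dom.Lp_on_bounded[where C=1]) (auto simp: z_def)
  have L\<omega>: "Lp_on 2 M (\<lambda>X. \<omega> j X - z X)" for j by (rule Lp_on_diff(1)[OF test_fn_Lp(1)[OF \<omega>] Lz]) simp_all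
  \<comment> \<open>The constant b, and with it the alternative, may change with \<epsilon>. The
    minimum of the two measures does not, and it vanishes as \<epsilon> tends to 0.\<close>
  have key: "min (emeasure M (A 1)) (emeasure M (A 0)) \<le> ennreal \<epsilon>" if \<epsilon>: "0 < \<epsilon>" for \<epsilon>
  proof -
    \<comment> \<open>The squared errors add up to at most 8 \<delta>, and they are compared with a
      squared gap of at least 1/4.\<close>
    define \<delta> where "\<delta> = \<epsilon> / 32"
    have \<delta>: "0 < \<delta>" using \<epsilon> by (simp add: \<delta>_def)
    have "\<forall>\<^sub>F j in sequentially. Lp_int 2 M (\<lambda>X. \<omega> j X - z X) < \<delta> \<and> Lp_int 2 M (\<lambda>X. \<psi> X *\<^sub>R sg (c j) X) < \<delta> / C"
      using \<delta> D(6) by (intro eventually_conj order_tendstoD(2)[OF \<omega>z] order_tendstoD(2)[OF \<omega>E]) auto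
    then obtain j where j: "Lp_int 2 M (\<lambda>X. \<omega> j X - z X) < \<delta>" "Lp_int 2 M (\<lambda>X. \<psi> X *\<^sub>R sg (c j) X) < \<delta> / C"
      using eventually_happens'[OF sequentially_bot] by blast
    have [measurable]: "\<omega> j \<in> borel_measurable M" "sg (c j) \<in> borel_measurable M" "\<omega> j \<in> borel_measurable borel" "sg (c j) \<in> borel_measurable borel"
      using test_fn_measurable[OF \<omega>] by auto
    have [measurable]: "\<psi> \<in> borel_measurable M" using test_fn_measurable[OF \<psi>(1)] by auto
    obtain b where b: "(\<integral>\<^sup>+X. ennreal ((\<omega> j X - b)\<^sup>2) * indicator D X \<partial>lborel)
      \<le> ennreal C * (\<integral>\<^sup>+X. ennreal ((norm (sg (c j) X))\<^sup>2) * indicator K X \<partial>lborel) + ennreal \<delta>"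
      using osc[OF test_fn_C1[OF \<omega>] \<delta>] by blast
    obtain C1 where C1: "0 \<le> C1" "\<And>X. \<bar>\<psi> X\<bar> \<le> C1" using test_fn_bounded[OF \<psi>(1)] by blast
    have L\<psi>: "Lp_on 2 M (\<lambda>X. \<psi> X *\<^sub>R sg (c j) X)"
      by (rule Lp_on_bound(1)[OF test_fn_Lp(2)[OF \<omega>[of j], of 2], where C=C1]) (use C1 in \<open>auto intro!: mult_right_mono\<close>)
    have "(\<integral>\<^sup>+X. ennreal ((norm (sg (c j) X))\<^sup>2) * indicator K X \<partial>lborel) = (\<integral>\<^sup>+X. ennreal ((norm (sg (c j) X))\<^sup>2) * indicator K X \<partial>M)"
      using D by (intro nn_integral_dom_eq[symmetric]) (auto simp: indicator_def)
    also have "\<dots> \<le> (\<integral>\<^sup>+X. ennreal ((norm (\<psi> X *\<^sub>R sg (c j) X))\<^sup>2) \<partial>M)"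
    proof (rule nn_integral_mono)
      fix X
      show "ennreal ((norm (sg (c j) X))\<^sup>2) * indicator K X \<le> ennreal ((norm (\<psi> X *\<^sub>R sg (c j) X))\<^sup>2)"
      proof (cases "X \<in> K")
        case True
        then have "1 * norm (sg (c j) X) \<le> \<bar>\<psi> X\<bar> * norm (sg (c j) X)" using \<psi>(3)[of X] by (intro mult_right_mono) auto
        then have "(norm (sg (c j) X))\<^sup>2 \<le> (norm (\<psi> X *\<^sub>R sg (c j) X))\<^sup>2" by (intro power_mono) auto
        then show ?thesis using True by (simp add: ennreal_leI)
      qed simp
    qed
    also have "\<dots> = ennreal (Lp_int 2 M (\<lambda>X. \<psi> X *\<^sub>R sg (c j) X))"
      using L\<psi> unfolding Lp_int_2_eq Lp_on_2_eq by (intro nn_integral_eq_integral) auto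
    also have "\<dots> \<le> ennreal (\<delta> / C)" using j(2) by (intro ennreal_leI) simp
    finally have "ennreal C * (\<integral>\<^sup>+X. ennreal ((norm (sg (c j) X))\<^sup>2) * indicator K X \<partial>lborel) \<le> ennreal C * ennreal (\<delta> / C)"
      by (intro mult_left_mono) auto
    also have "\<dots> = ennreal \<delta>" using D(6) \<delta> by (simp flip: ennreal_mult)
    finally have "(\<integral>\<^sup>+X. ennreal ((\<omega> j X - b)\<^sup>2) * indicator D X \<partial>lborel) \<le> ennreal \<delta> + ennreal \<delta>"
      using order_trans[OF b add_right_mono] by blast
    also have "(\<integral>\<^sup>+X. ennreal ((\<omega> j X - b)\<^sup>2) * indicator D X \<partial>lborel) = (\<integral>\<^sup>+X. ennreal ((\<omega> j X - b)\<^sup>2) * indicator D X \<partial>M)"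
      using D by (intro nn_integral_dom_eq[symmetric]) (auto simp: indicator_def)
    finally have 1: "(\<integral>\<^sup>+X. ennreal ((\<omega> j X - b)\<^sup>2) * indicator D X \<partial>M) \<le> ennreal (2 * \<delta>)"
      using \<delta> by (simp flip: ennreal_plus)
    have 2: "(\<integral>\<^sup>+X. ennreal ((\<omega> j X - z X)\<^sup>2) \<partial>M) \<le> ennreal \<delta>"
    proof -
      have "(\<integral>\<^sup>+X. ennreal ((\<omega> j X - z X)\<^sup>2) \<partial>M) = ennreal (Lp_int 2 M (\<lambda>X. \<omega> j X - z X))"
        using L\<omega>[of j] unfolding Lp_int_2_eq Lp_on_2_eq real_norm_def power2_abs by (intro nn_integral_eq_integral) auto
      then show ?thesis using j(1) by (simp add: ennreal_leI)
    qed
    have bnd: "ennreal (1 / 4) * emeasure M (A a) \<le> ennreal (8 * \<delta>)" if a: "1 / 4 \<le> (a - b)\<^sup>2" for a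
    proof -
      have "ennreal (1 / 4) * emeasure M (A a) = (\<integral>\<^sup>+X. ennreal (1 / 4) * indicator (A a) X \<partial>M)"
        by (subst nn_integral_cmult_indicator) auto
      also have "\<dots> \<le> (\<integral>\<^sup>+X. 2 * (ennreal ((\<omega> j X - b)\<^sup>2) * indicator D X) + 2 * ennreal ((\<omega> j X - z X)\<^sup>2) \<partial>M)"
      proof (rule nn_integral_mono)
        fix X
        show "ennreal (1 / 4) * indicator (A a) X \<le> 2 * (ennreal ((\<omega> j X - b)\<^sup>2) * indicator D X) + 2 * ennreal ((\<omega> j X - z X)\<^sup>2)"
        proof (cases "X \<in> A a")
          case True
          then have XD: "X \<in> D" and za: "z X = a" by (auto simp: A_def indicator_def split: if_splits)
          have "(a - b)\<^sup>2 \<le> 2 * (\<omega> j X - b)\<^sup>2 + 2 * (\<omega> j X - a)\<^sup>2"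
            using zero_le_power2[of "(\<omega> j X - b) + (\<omega> j X - a)"] by (simp add: power2_eq_square algebra_simps)
          then have "ennreal (1 / 4) \<le> ennreal (2 * (\<omega> j X - b)\<^sup>2 + 2 * (\<omega> j X - a)\<^sup>2)" using a by (intro ennreal_leI) linarith
          also have "\<dots> = 2 * ennreal ((\<omega> j X - b)\<^sup>2) + 2 * ennreal ((\<omega> j X - a)\<^sup>2)"
            by (subst ennreal_plus) (auto simp: ennreal_mult)
          finally show ?thesis using True XD za by simp
        qed simp
      qed
      also have "\<dots> = 2 * (\<integral>\<^sup>+X. ennreal ((\<omega> j X - b)\<^sup>2) * indicator D X \<partial>M) + 2 * (\<integral>\<^sup>+X. ennreal ((\<omega> j X - z X)\<^sup>2) \<partial>M)"
        using iD(1) by (simp add: nn_integral_add nn_integral_cmult)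
      also have "\<dots> \<le> 2 * ennreal (2 * \<delta>) + 2 * ennreal \<delta>"
        by (rule add_mono; rule mult_left_mono) (use 1 2 in auto)
      also have "\<dots> = ennreal (2 * (2 * \<delta>)) + ennreal (2 * \<delta>)"
        by (simp only: ennreal_mult' ennreal_numeral zero_le_numeral)
      also have "\<dots> \<le> ennreal (8 * \<delta>)" using \<delta> by (subst ennreal_plus[symmetric]) (auto intro: ennreal_leI)
      finally show ?thesis .
    qed
    have fin: "emeasure M (A a) \<le> ennreal \<epsilon>" if a: "1 / 4 \<le> (a - b)\<^sup>2" for a
    proof -
      have "ennreal 4 * (ennreal (1 / 4) * emeasure M (A a)) \<le> ennreal 4 * ennreal (8 * \<delta>)"
        by (intro mult_left_mono bnd[OF a]) auto
      also have "ennreal 4 * (ennreal (1 / 4) * emeasure M (A a)) = (ennreal 4 * ennreal (1 / 4)) * emeasure M (A a)"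
        by (simp only: mult.assoc)
      also have "ennreal 4 * ennreal (1 / 4) = 1" by (subst ennreal_mult[symmetric]) auto
      also have "ennreal 4 * ennreal (8 * \<delta>) = ennreal \<epsilon>" using \<delta> by (subst ennreal_mult[symmetric]) (auto simp: \<delta>_def)
      finally show ?thesis by simp
    qed
    have "1 / 4 \<le> (1 - b)\<^sup>2 \<or> 1 / 4 \<le> (0 - b)\<^sup>2"
    proof (cases "b \<le> 1 / 2")
      case True
      then have "(1 / 2)\<^sup>2 \<le> (1 - b)\<^sup>2" by (intro power_mono) auto
      then show ?thesis by (simp add: power2_eq_square)
    next
      case False
      then have "(1 / 2)\<^sup>2 \<le> b\<^sup>2" by (intro power_mono) auto
      then show ?thesis by (simp add: power2_eq_square)
    qed
    then show ?thesis using fin by (auto simp: min_le_iff_disj)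
  qed
  have "min (emeasure M (A 1)) (emeasure M (A 0)) \<le> 0"
    by (rule ennreal_le_epsilon) (simp only: add_0_left key)
  then have "emeasure M (A 1) = 0 \<or> emeasure M (A 0) = 0" by (auto simp: min_def split: if_splits)
  moreover have neg: "negligible (A b)" if "emeasure M (A b) = 0" for b
  proof -
    have sub: "A b \<subseteq> \<Omega>" by (auto simp: A_def)
    have "A b \<in> sets lebesgue" using Am[of b] dom_lebesgue by (simp add: sets_restrict_space_iff)
    moreover have "emeasure lebesgue (A b) = 0"
      using that sub dom_lebesgue by (simp add: emeasure_restrict_space)
    ultimately show ?thesis by (simp add: negligible_iff_null_sets null_sets_def)
  qed
  moreover have "{X\<in>D. 0 < w X} = A 1" "{X\<in>D. \<not> 0 < w X} = A 0"
    using D by (auto simp: A_def z_def indicator_def split: if_splits)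
  ultimately have "negligible {X\<in>D. \<not> 0 < w X} \<or> negligible {X\<in>D. 0 < w X}" using neg[of 1] neg[of 0] by auto
  then show ?thesis using D by (intro exI[of _ D]) auto
qed

lemma AE_dom_negligible: "negligible {X\<in>\<Omega>. \<not> Q X} \<Longrightarrow> AE X in M. Q X"
proof -
  assume "negligible {X\<in>\<Omega>. \<not> Q X}"
  then have "AE X in lebesgue. X \<in> \<Omega> \<longrightarrow> Q X"
    by (intro AE_I'[of "{X\<in>\<Omega>. \<not> Q X}"]) (auto simp: negligible_iff_null_sets)
  then show ?thesis using dom_lebesgue by (subst AE_restrict_space_iff) auto
qed

text \<open>The points near which w > 0 almost everywhere and those near which w = 0 almost
  everywhere form two open sets. They cover \<Omega> by the local dichotomy and are disjoint because
  a nonempty open set is not null; connectedness leaves one of them, and \<open>nz\<close> excludes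
  the second.\<close>

lemma strict_positivity:
  assumes w: "weak_sol w W G" and w0: "AE X in M. 0 \<le> w X" and G: "\<And>X. 0 \<le> G X"
    and conn: "connected \<Omega>" and nz: "\<not> (AE X in M. w X = 0)"
  shows "AE X in M. 0 < w X"
proof -
  define Z where "Z S = {P\<in>\<Omega>. \<exists>D. open D \<and> P \<in> D \<and> D \<subseteq> \<Omega> \<and> negligible (D \<inter> S)}" for S
  have Zo: "open (Z S)" for S
    unfolding open_subopen[of "Z S"] by (auto simp: Z_def)
  let ?p = "{X. 0 < w X}"
  have cover: "\<Omega> \<subseteq> Z ?p \<union> Z (- ?p)"
  proof
    fix P assume P: "P \<in> \<Omega>"
    obtain D where "open D" "P \<in> D" "D \<subseteq> \<Omega>" "negligible {X\<in>D. \<not> 0 < w X} \<or> negligible {X\<in>D. 0 < w X}"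
      using local_positivity_dichotomy[OF w w0 G P] by blast
    moreover have "{X\<in>D. \<not> 0 < w X} = D \<inter> - ?p" "{X\<in>D. 0 < w X} = D \<inter> ?p" by auto
    ultimately show "P \<in> Z ?p \<union> Z (- ?p)" using P unfolding Z_def by auto
  qed
  have disj: "Z ?p \<inter> Z (- ?p) \<inter> \<Omega> = {}"
  proof (rule ccontr)
    assume "\<not> ?thesis"
    then obtain P D D' where "open D" "P \<in> D" "negligible (D \<inter> ?p)" "open D'" "P \<in> D'" "negligible (D' \<inter> - ?p)"
      unfolding Z_def by blast
    then have n: "negligible ((D \<inter> ?p) \<union> (D' \<inter> - ?p))" and o: "open (D \<inter> D')" "D \<inter> D' \<noteq> {}"
      by (auto intro: negligible_Un)
    have "negligible (D \<inter> D')" by (rule negligible_subset[OF n]) auto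
    with open_not_negligible[OF o] show False by contradiction
  qed
  have full: "negligible (\<Omega> \<inter> S)" if "\<Omega> \<subseteq> Z S" for S
  proof (subst locally_negligible_alt, rule ballI)
    fix P assume P: "P \<in> \<Omega> \<inter> S"
    then have "P \<in> Z S" using that by auto
    then obtain D where "open D" "P \<in> D" "negligible (D \<inter> S)" unfolding Z_def by auto
    then show "\<exists>U. openin (top_of_set (\<Omega> \<inter> S)) U \<and> P \<in> U \<and> negligible U"
      using \<open>P \<in> \<Omega> \<inter> S\<close> by (intro exI[of _ "(\<Omega> \<inter> S) \<inter> D"]) (auto intro: openin_open_Int negligible_subset[OF \<open>negligible (D \<inter> S)\<close>])
  qed
  have "Z ?p \<inter> \<Omega> = {} \<or> Z (- ?p) \<inter> \<Omega> = {}"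
    using connectedD[OF conn Zo Zo disj cover] by blast
  then have "\<Omega> \<subseteq> Z (- ?p) \<or> \<Omega> \<subseteq> Z ?p" using cover by blast
  then show ?thesis
  proof
    assume "\<Omega> \<subseteq> Z (- ?p)"
    from full[OF this] have "negligible {X\<in>\<Omega>. \<not> 0 < w X}" by (simp add: Int_def)
    then show ?thesis by (rule AE_dom_negligible)
  next
    assume "\<Omega> \<subseteq> Z ?p"
    from full[OF this] have "negligible {X\<in>\<Omega>. \<not> \<not> 0 < w X}" by (simp add: Int_def)
    then have "AE X in M. \<not> 0 < w X" by (rule AE_dom_negligible)
    then have "AE X in M. w X = 0" using w0 by eventually_elim auto
    with nz show ?thesis by simp
  qed
qed

text \<open>The image of each joining curve is a connected subset of \<Omega> containing both
  points.\<close>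

lemma Lambda_connected_imp_connected:
  assumes "Lambda_connected lam \<Omega>"
  shows "connected \<Omega>"
  unfolding connected_iff_connected_component
proof (intro ballI)
  fix P R assume "P \<in> \<Omega>" "R \<in> \<Omega>"
  then obtain \<gamma> and T :: real where "0 \<le> T" "continuous_on {0..T} \<gamma>" "\<gamma> ` {0..T} \<subseteq> \<Omega>" "\<gamma> 0 = P" "\<gamma> T = R"
    using assms[unfolded Lambda_connected_def, rule_format, OF \<open>P \<in> \<Omega>\<close> \<open>R \<in> \<Omega>\<close>] by (elim exE conjE) (rule that, assumption+)
  then show "connected_component \<Omega> P R"
    by (intro connected_componentI[of "\<gamma> ` {0..T}"] connected_continuous_image) auto
qed

end

section \<open>The approximating sequence\<close>

text \<open>A \<open>C\<^sup>1\<close> substitute for \<open>\<bar>s\<bar>\<^sup>2\<^sup>a s\<close> with bounded derivative when \<open>a \<le> 0\<close>.\<close>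

definition smooth_pow :: "real \<Rightarrow> real \<Rightarrow> real" where
  "smooth_pow a s = s * (1 + s\<^sup>2) powr a"

definition smooth_pow' :: "real \<Rightarrow> real \<Rightarrow> real" where
  "smooth_pow' a s = (1 + s\<^sup>2) powr (a - 1) * (1 + (1 + 2 * a) * s\<^sup>2)"

lemma one_plus_sq_pos: "0 < 1 + (s::real)\<^sup>2"
  by (simp add: add_pos_nonneg)

lemma DERIV_smooth_pow: "(smooth_pow a has_real_derivative smooth_pow' a s) (at s)"
proof -
  have "((\<lambda>s. s * (1 + s\<^sup>2) powr a) has_real_derivative (1 + s\<^sup>2) powr a + s * (a * (1 + s\<^sup>2) powr (a - 1) * (2 * s))) (at s)"
    using one_plus_sq_pos[of s] by (auto intro!: derivative_eq_intros)
  moreover have "(1 + s\<^sup>2) powr a = (1 + s\<^sup>2) powr (a - 1) * (1 + s\<^sup>2)"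
    using one_plus_sq_pos[of s] by (simp add: powr_diff)
  ultimately show ?thesis
    by (simp add: smooth_pow_def[abs_def] smooth_pow'_def algebra_simps power2_eq_square)
qed

lemma continuous_smooth_pow': "continuous_on S (smooth_pow' a)"
  unfolding smooth_pow'_def[abs_def] using one_plus_sq_pos
  by (intro continuous_intros) (auto simp: less_imp_neq[THEN not_sym])

text \<open>The derivative lies between 1 + 2 a times and once the weight (1 + s^2)^a. With 1 + 2 a
  = \<theta> > 0 the lower bound is what lets a tested equation control a weighted energy; the bound
  by 1 makes composition admissible.\<close>

lemma smooth_pow'_bounds:
  assumes "-1/2 \<le> a" "a \<le> 0"
  shows "(1 + 2 * a) * (1 + s\<^sup>2) powr a \<le> smooth_pow' a s" "smooth_pow' a s \<le> (1 + s\<^sup>2) powr a"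
    "0 \<le> smooth_pow' a s" "smooth_pow' a s \<le> 1" "(1 + s\<^sup>2) powr a \<le> 1"
proof -
  have eq: "(1 + s\<^sup>2) powr a = (1 + s\<^sup>2) powr (a - 1) * (1 + s\<^sup>2)"
    using one_plus_sq_pos[of s] by (simp add: powr_diff)
  have "(1 + 2 * a) * (1 + s\<^sup>2) \<le> 1 + (1 + 2 * a) * s\<^sup>2" using assms by (simp add: algebra_simps)
  then show 1: "(1 + 2 * a) * (1 + s\<^sup>2) powr a \<le> smooth_pow' a s"
    unfolding eq smooth_pow'_def by (metis mult.left_commute mult_left_mono powr_ge_zero)
  have "(1 + 2 * a) * s\<^sup>2 \<le> 1 * s\<^sup>2" using assms by (intro mult_right_mono) auto
  then show 2: "smooth_pow' a s \<le> (1 + s\<^sup>2) powr a"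
    unfolding eq smooth_pow'_def by (intro mult_left_mono) auto
  have "0 \<le> (1 + 2 * a) * (1 + s\<^sup>2) powr a" using assms by (intro mult_nonneg_nonneg) auto
  with 1 show "0 \<le> smooth_pow' a s" by linarith
  have "(1 + s\<^sup>2) powr a \<le> 1 powr a" using assms by (intro powr_mono2') auto
  then show "(1 + s\<^sup>2) powr a \<le> 1" by simp
  with 2 show "smooth_pow' a s \<le> 1" by linarith
qed

lemma smooth_pow_le:
  assumes "0 \<le> s" "a \<le> 0"
  shows "smooth_pow a s \<le> s" "smooth_pow a s \<le> s powr (1 + 2 * a)" "0 \<le> smooth_pow a s"
proof -
  have "(1 + s\<^sup>2) powr a \<le> 1 powr a" using assms by (intro powr_mono2') auto
  then show "smooth_pow a s \<le> s" using assms by (simp add: smooth_pow_def mult_left_le)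
  show "0 \<le> smooth_pow a s" using assms by (simp add: smooth_pow_def)
  show "smooth_pow a s \<le> s powr (1 + 2 * a)"
  proof (cases "s = 0")
    case False
    with assms have s: "0 < s" by simp
    have "(1 + s\<^sup>2) powr a \<le> (s\<^sup>2) powr a" using s assms by (intro powr_mono2') auto
    also have "\<dots> = s powr (2 * a)" using s by (simp add: powr_powr flip: powr_numeral)
    finally have "smooth_pow a s \<le> s powr 1 * s powr (2 * a)" using s by (simp add: smooth_pow_def mult_left_mono)
    then show ?thesis by (simp add: powr_add)
  qed (simp add: smooth_pow_def)
qed

text \<open>With t = 1/r and a = 1 + \<theta> one finds q = a Q / (Q - 2 + a) and \<sigma> = a Q /
  (Q - 2), from which the statements on q follow; 1 < a < 2 holds because the bound on r says 2
  \<kappa> < 1 - \<nu>. The identity for \<theta> - \<nu> matches f in L^r with u in L^\<sigma>; the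
  one for (1 - \<theta>) q / (2 - q) is the exponent that appears when the weight is removed from
  the quasi-gradients.\<close>

lemma exponent_identities:
  fixes Q \<nu> r q :: real
  assumes Q: "3 \<le> Q" and \<nu>: "0 < \<nu>" "\<nu> < 1" and r: "1 \<le> r" "r < 2 * Q / ((Q + 2) + \<nu> * (Q - 2))"
    and q: "q = Q * r * (\<nu> + 1) / (Q - r * (1 - \<nu>))"
  defines "\<kappa> \<equiv> (1 - 1 / r) * Q / (Q - 2)"
  defines "\<theta> \<equiv> (\<nu> + \<kappa>) / (1 - \<kappa>)"
  defines "\<sigma> \<equiv> (1 + \<theta>) * Q / (Q - 2)"
  shows "0 \<le> \<kappa>" "\<kappa> < 1" "\<nu> \<le> \<theta>" "\<theta> < 1" "\<theta> - \<nu> = (1 - 1 / r) * \<sigma>" "1 < q" "q < 2"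
    "(1 - \<theta>) * q / (2 - q) = \<sigma>" "q \<le> \<sigma>"
proof -
  define t where "t = 1 / r"
  define a where "a = 1 + \<theta>"
  have t: "0 < t" "t \<le> 1" using r by (auto simp: t_def)
  have den: "0 < (Q + 2) + \<nu> * (Q - 2)" using Q \<nu> by (intro add_pos_nonneg mult_nonneg_nonneg) auto
  have "r * ((Q + 2) + \<nu> * (Q - 2)) < 2 * Q" using r(2) den by (simp add: field_simps)
  then have tl: "(Q + 2) + \<nu> * (Q - 2) < 2 * Q * t" using r(1) by (simp add: t_def field_simps)
  have \<kappa>: "\<kappa> * (Q - 2) = (1 - t) * Q" using Q by (simp add: \<kappa>_def t_def)
  show k0: "0 \<le> \<kappa>" using t Q by (simp add: \<kappa>_def t_def[symmetric])
  have "\<kappa> * (Q - 2) * 2 < (1 - \<nu>) * (Q - 2)" unfolding \<kappa> using tl by (simp add: algebra_simps)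
  then have "(\<kappa> * 2) * (Q - 2) < (1 - \<nu>) * (Q - 2)" by (simp add: algebra_simps)
  then have k2: "\<kappa> * 2 < 1 - \<nu>" using Q by (subst (asm) mult_less_cancel_right_pos) auto
  then show k1: "\<kappa> < 1" using k0 \<nu> by linarith
  show th1: "\<theta> < 1" using k1 k2 by (simp add: \<theta>_def divide_less_eq)
  have "\<nu> * (1 - \<kappa>) \<le> \<nu> + \<kappa>" using k0 \<nu> by (simp add: algebra_simps add_increasing2)
  then show th0: "\<nu> \<le> \<theta>" using k1 by (simp add: \<theta>_def le_divide_eq)
  have ak: "a * (1 - \<kappa>) = 1 + \<nu>" using k1 by (simp add: a_def \<theta>_def field_simps)
  have a: "1 < a" "a < 2" using th0 th1 \<nu> by (auto simp: a_def)
  have \<sigma>a: "\<sigma> = a * Q / (Q - 2)" by (simp add: \<sigma>_def a_def)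
  have "\<theta> - \<nu> = a * \<kappa>" using ak by (simp add: a_def algebra_simps)
  also have "\<dots> = (1 - 1 / r) * \<sigma>" by (simp add: \<sigma>a \<kappa>_def)
  finally show "\<theta> - \<nu> = (1 - 1 / r) * \<sigma>" .
  have qd: "0 < t * Q - (1 - \<nu>)"
  proof -
    have "0 < (Q + 2) + \<nu> * (Q - 2) - 2 * (1 - \<nu>)" using Q \<nu> by (simp add: algebra_simps add_pos_pos)
    then show ?thesis using tl by (simp add: algebra_simps)
  qed
  have "q = Q * (\<nu> + 1) / (t * Q - (1 - \<nu>))"
    using r(1) by (simp add: q t_def field_simps)
  \<comment> \<open>Expressed through a, numerator and denominator both carry the factor 1 -
    \<kappa>, which then cancels.\<close>
  also have "\<dots> = (a * Q * (1 - \<kappa>)) / ((Q - 2 + a) * (1 - \<kappa>))"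
  proof -
    have "(Q - 2 + a) * (1 - \<kappa>) = (Q - 2) - \<kappa> * (Q - 2) + a * (1 - \<kappa>)" by (simp add: algebra_simps)
    also have "\<dots> = t * Q - (1 - \<nu>)" unfolding ak \<kappa> by (simp add: algebra_simps)
    finally have "(Q - 2 + a) * (1 - \<kappa>) = t * Q - (1 - \<nu>)" .
    moreover have "a * Q * (1 - \<kappa>) = Q * (\<nu> + 1)" using ak by (metis add.commute mult.assoc mult.commute)
    ultimately show ?thesis by (simp only:)
  qed
  also have "\<dots> = a * Q / (Q - 2 + a)" using k1 by simp
  finally have qa: "q = a * Q / (Q - 2 + a)" .
  have dq: "0 < Q - 2 + a" using Q a by auto
  show "q < 2"
  proof -
    have "a * (Q - 2) < 2 * (Q - 2)" using a Q by (intro mult_strict_right_mono) auto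
    then show ?thesis unfolding qa using dq by (simp add: divide_less_eq algebra_simps)
  qed
  have "a * (Q - 2 + a) \<le> a * Q" using a by (intro mult_left_mono) auto
  then have "a \<le> q" unfolding qa using dq by (simp add: le_divide_eq)
  then show "1 < q" using a by linarith
  have q2: "2 - q = (Q - 2) * (2 - a) / (Q - 2 + a)" unfolding qa using dq by (simp add: field_simps)
  have th2: "1 - \<theta> = 2 - a" by (simp add: a_def)
  show "(1 - \<theta>) * q / (2 - q) = \<sigma>" unfolding q2 \<sigma>a th2 using dq a Q by (simp add: qa)
  show "q \<le> \<sigma>" unfolding qa \<sigma>a using a Q by (intro divide_left_mono) auto
qed

text \<open>Supplies the hypotheses of \<open>exists_weak_sol\<close> for the regularised
  singularity. The Lipschitz constant is the size of the slope at 0; it blows up as e tends to 0,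
  but existence is applied for each fixed e.\<close>

lemma singular_primitive:
  fixes \<nu> e :: real
  assumes \<nu>: "0 < \<nu>" "\<nu> < 1" and e: "0 < e"
  defines "h \<equiv> \<lambda>s. (max s 0 + e) powr (- \<nu>)"
  shows "\<exists>\<Phi>. (\<forall>s. (\<Phi> has_real_derivative h s) (at s)) \<and> \<Phi> 0 = 0"
    "\<And>a b. a \<le> b \<Longrightarrow> h b \<le> h a" "\<And>s. 0 \<le> h s" "\<And>s. h s \<le> e powr (- \<nu>)"
    "\<And>a b. \<bar>h a - h b\<bar> \<le> (\<nu> * e powr (- \<nu> - 1)) * \<bar>a - b\<bar>"
proof -
  define T where "T t = ((t + e) powr (1 - \<nu>) - e powr (1 - \<nu>)) / (1 - \<nu>)" for t
  define T' where "T' t = (t + e) powr (- \<nu>)" for t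
  have "(T has_real_derivative T' t) (at t within {0..})" if "0 \<le> t" for t
    unfolding T_def T'_def using that e \<nu> by (auto intro!: derivative_eq_intros)
  from DERIV_extend_linear[OF this]
  have "((\<lambda>t. T (max t 0) + T' 0 * min t 0) has_real_derivative h s) (at s)" for s
    by (simp add: T'_def h_def)
  moreover have "T (max 0 0) + T' 0 * min 0 0 = 0" by (simp add: T_def)
  ultimately show "\<exists>\<Phi>. (\<forall>s. (\<Phi> has_real_derivative h s) (at s)) \<and> \<Phi> 0 = 0"
    by (intro exI[of _ "\<lambda>t. T (max t 0) + T' 0 * min t 0"]) simp
  show "h b \<le> h a" if "a \<le> b" for a b
    unfolding h_def using that e \<nu> by (intro powr_mono2') auto
  show "0 \<le> h s" for s by (simp add: h_def)
  show "h s \<le> e powr (- \<nu>)" for s unfolding h_def using e \<nu> by (intro powr_mono2') auto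
  show "\<bar>h a - h b\<bar> \<le> (\<nu> * e powr (- \<nu> - 1)) * \<bar>a - b\<bar>" for a b
  proof -
    have "norm (T' (max a 0) - T' (max b 0)) \<le> (\<nu> * e powr (- \<nu> - 1)) * norm (max a 0 - max b 0)"
    proof (rule field_differentiable_bound[of "{0..}"])
      fix z :: real assume z: "z \<in> {0..}"
      show "(T' has_field_derivative (- \<nu>) * (z + e) powr (- \<nu> - 1)) (at z within {0..})"
        unfolding T'_def using z e by (auto intro!: derivative_eq_intros)
      have "(z + e) powr (- \<nu> - 1) \<le> e powr (- \<nu> - 1)" using z e \<nu> by (intro powr_mono2') auto
      then show "norm ((- \<nu>) * (z + e) powr (- \<nu> - 1)) \<le> \<nu> * e powr (- \<nu> - 1)"
        using \<nu> by (simp add: abs_mult)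
    qed auto
    also have "\<dots> \<le> (\<nu> * e powr (- \<nu> - 1)) * \<bar>a - b\<bar>"
      using \<nu> by (intro mult_left_mono) auto
    finally show ?thesis by (simp add: T'_def h_def)
  qed
qed

section \<open>The singular problem, its exponents and the monotone approximations\<close>

locale grushin_singular = grushin_domain lam \<Omega> for lam :: real and \<Omega> :: "(real \<times> (real ^ 'm)) set" +
  fixes \<nu> r q :: real and f :: "real \<times> (real ^ 'm) \<Rightarrow> real"
  assumes nu: "0 < \<nu>" "\<nu> < 1" and r: "1 \<le> r" "r < 2 * Qdim / ((Qdim + 2) + \<nu> * (Qdim - 2))"
    and q: "q = Qdim * r * (\<nu> + 1) / (Qdim - r * (1 - \<nu>))"
    and f_Lr: "Lp_on r (lebesgue_on \<Omega>) f" and f_nonneg: "\<And>X. 0 \<le> f X"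
begin

text \<open>The exponents are determined by two requirements: \<open>f u\<^sup>\<theta>\<^sup>-\<^sup>\<nu>\<close> is integrable for \<open>f \<in> L\<^sup>r\<close>, \<open>u \<in> L\<^sup>\<sigma>\<close>, and
  \<open>u\<^sup>\<sigma>\<close> is the Sobolev power of \<open>u\<^sup>(\<^sup>1\<^sup>+\<^sup>\<theta>\<^sup>)\<^sup>/\<^sup>2\<close>. The right-hand side of the resulting estimate grows with
  power \<open>\<kappa> < 1\<close> of the quantity estimated.\<close>

definition kap where "kap = (1 - 1 / r) * Qdim / (Qdim - 2)"
definition th where "th = (\<nu> + kap) / (1 - kap)"
definition sig where "sig = (1 + th) * Qdim / (Qdim - 2)"

lemmas expo = exponent_identities[OF Qdim_ge nu r q, folded kap_def, folded th_def, folded sig_def]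

lemma sig_sob: "sig = (1 + th) / 2 * sob" "0 < sig" "sig < sob"
proof -
  show 1: "sig = (1 + th) / 2 * sob" by (simp add: sig_def sob_def)
  have "0 < (1 + th) / 2" "(1 + th) / 2 < 1" using expo(3,4) nu by auto
  then show "0 < sig" "sig < sob" unfolding 1 using sob_gt by auto
qed

lemma kap_sob: "(1 - 1 / r) * (sob / 2) = kap"
  using Qdim_ge by (simp add: kap_def sob_def field_simps)

lemma th_pos: "0 < th" "th < 1" using expo(3,4) nu by auto

lemma f_measurable [measurable]: "f \<in> borel_measurable M"
  using f_Lr by (simp add: Lp_on_def)

lemma f_integrable: "integrable M f"
proof (cases "r = 1")
  case True
  have "(\<lambda>X. norm (f X) powr 1) = f" using f_nonneg by (auto simp: fun_eq_iff)
  then show ?thesis using f_Lr True unfolding Lp_on_def by metis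
next
  case False
  then have "Lp_on 1 M f" using dom.Lp_int_mono_exponent(1)[OF f_Lr, of 1] r by auto
  moreover have "(\<lambda>X. norm (f X) powr 1) = f" using f_nonneg by (auto simp: fun_eq_iff)
  ultimately show ?thesis unfolding Lp_on_def by metis
qed

definition fn :: "nat \<Rightarrow> real \<times> (real ^ 'm) \<Rightarrow> real" where "fn n X = min (f X) (real (Suc n))"

definition hn :: "nat \<Rightarrow> real \<Rightarrow> real" where "hn n s = (max s 0 + 1 / real (Suc n)) powr (- \<nu>)"

lemma fn_bounds: "0 \<le> fn n X" "fn n X \<le> f X" "fn n X \<le> real (Suc n)" "fn n X \<le> fn (Suc n) X"
  using f_nonneg[of X] by (auto simp: fn_def)

lemma fn_measurable [measurable]: "fn n \<in> borel_measurable M"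
  unfolding fn_def by measurable

lemma hn_nonneg: "0 \<le> hn n s" by (simp add: hn_def)

lemma hn_le: "0 < s \<Longrightarrow> hn n s \<le> s powr (- \<nu>)"
  unfolding hn_def using nu by (intro powr_mono2') auto

text \<open>Combines the decrease in the argument with the growth caused by a smaller
  regularisation: exactly what comparison of consecutive solutions asks for on the set where
  \<open>un (Suc n) < un n\<close>.\<close>

lemma hn_mono: "t \<le> s \<Longrightarrow> hn n s \<le> hn (Suc n) t"
  unfolding hn_def using nu by (intro powr_mono2' add_mono divide_left_mono) (auto simp: add_nonneg_pos)

lemma approx_exists: "\<exists>u U. weak_sol u U (\<lambda>X. fn n X * hn n (u X))"
proof -
  have e: "0 < 1 / real (Suc n)" by simp
  obtain \<Phi> where \<Phi>: "\<And>s. (\<Phi> has_real_derivative hn n s) (at s)" "\<Phi> 0 = 0"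
    using singular_primitive(1)[OF nu e] unfolding hn_def by blast
  show ?thesis
    by (rule exists_weak_sol[OF fn_measurable fn_bounds(1) fn_bounds(3) \<Phi>])
       (use singular_primitive(2-5)[OF nu e] in \<open>auto simp: hn_def\<close>)
qed

definition uU where "uU n = (SOME p. weak_sol (fst p) (snd p) (\<lambda>X. fn n X * hn n (fst p X)))"
definition un where "un n = fst (uU n)"
definition Wn where "Wn n = snd (uU n)"
definition gn where "gn n X = fn n X * hn n (un n X)"

lemma un_sol: "weak_sol (un n) (Wn n) (gn n)"
proof -
  have "\<exists>p. weak_sol (fst p) (snd p) (\<lambda>X. fn n X * hn n (fst p X))" using approx_exists[of n] by auto
  from someI_ex[OF this] show ?thesis unfolding uU_def[symmetric] by (simp add: un_def Wn_def gn_def[abs_def])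
qed

lemmas un_H = weak_solD(1)[OF un_sol]

lemma un_measurable [measurable]: "un n \<in> borel_measurable M" "Wn n \<in> borel_measurable M"
  using H_measurable[OF un_H] by auto

lemma gn_measurable [measurable]: "gn n \<in> borel_measurable M"
  using weak_solD(2)[OF un_sol] by (simp add: Lp_on_def)

lemma gn_nonneg: "0 \<le> gn n X" using fn_bounds hn_nonneg by (simp add: gn_def)

lemma un_nonneg: "AE X in M. 0 \<le> un n X"
proof -
  have z: "weak_sol (\<lambda>X. 0) (\<lambda>X. 0) (\<lambda>X. 0)" by (auto simp: weak_sol_def H_zero Lp_on_def)
  show ?thesis by (rule weak_sol_comparison[OF z un_sol]) (simp add: gn_nonneg)
qed

lemma un_mono: "AE X in M. un n X \<le> un (Suc n) X"
proof (rule weak_sol_comparison[OF un_sol un_sol], intro AE_I2 impI)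
  fix X assume "un (Suc n) X < un n X"
  then show "gn n X \<le> gn (Suc n) X"
    unfolding gn_def by (intro mult_mono fn_bounds hn_mono hn_nonneg) auto
qed

lemma un_AE: "AE X in M. (\<forall>n. 0 \<le> un n X) \<and> incseq (\<lambda>n. un n X)"
proof -
  have "AE X in M. \<forall>n. 0 \<le> un n X" "AE X in M. \<forall>n. un n X \<le> un (Suc n) X"
    using un_nonneg un_mono by (auto simp: AE_all_countable)
  then show ?thesis by eventually_elim (auto intro: incseq_SucI)
qed

text \<open>Hoelder with r and its conjugate, since (v^\<sigma>)^(1 - 1/r) = v^(\<theta> - \<nu>) by
  \<open>expo(5)\<close>. The + 1 and the maximum with 1 give a single bound that also covers r = 1,
  where \<theta> = \<nu> and f itself is the majorant.\<close>

lemma f_powr_integrable: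
  assumes "Lp_on sig M v" and v: "\<And>X. 0 \<le> v X"
  shows "integrable M (\<lambda>X. f X * v X powr (th - \<nu>))"
    "(LINT X|M. f X * v X powr (th - \<nu>)) \<le> (Lp_int r M f + 1) * (max (Lp_int sig M v) 1) powr (1 - 1 / r)"
proof -
  have [measurable]: "v \<in> borel_measurable M" using assms by (simp add: Lp_on_def)
  show "integrable M (\<lambda>X. f X * v X powr (th - \<nu>))"
    "(LINT X|M. f X * v X powr (th - \<nu>)) \<le> (Lp_int r M f + 1) * (max (Lp_int sig M v) 1) powr (1 - 1 / r)"
  proof (atomize (full), cases "r = 1")
    case True
    \<comment> \<open>The exponent is 0 here, and \<open>0 powr 0 = 0\<close>, so zeros of v are
      treated apart.\<close>
    have le: "f X * v X powr (th - \<nu>) \<le> f X" for X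
      using expo(5) True f_nonneg by (cases "v X = 0") (auto simp: )
    have i: "integrable M (\<lambda>X. f X * v X powr (th - \<nu>))"
      by (rule Bochner_Integration.integrable_bound[OF f_integrable]) (use le f_nonneg in auto)
    have "(LINT X|M. f X * v X powr (th - \<nu>)) \<le> (LINT X|M. f X)"
      by (rule integral_mono[OF i f_integrable le])
    also have "\<dots> = Lp_int r M f"
      unfolding Lp_int_def by (rule Bochner_Integration.integral_cong) (use f_nonneg in \<open>simp_all add: True\<close>)
    finally have le1: "(LINT X|M. f X * v X powr (th - \<nu>)) \<le> Lp_int r M f" .
    show "integrable M (\<lambda>X. f X * v X powr (th - \<nu>)) \<and>
      (LINT X|M. f X * v X powr (th - \<nu>)) \<le> (Lp_int r M f + 1) * (max (Lp_int sig M v) 1) powr (1 - 1 / r)"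
    proof -
      have "1 - 1 / r = 0" using True by simp
      then have "(max (Lp_int sig M v) 1) powr (1 - 1 / r) = 1" by (simp add: max_def)
      then show ?thesis using i le1 by simp
    qed
  next
    case False
    then have r1: "1 < r" using r by simp
    have if1: "integrable M (\<lambda>X. f X powr r)" using f_Lr f_nonneg by (simp add: Lp_on_def)
    have iv: "integrable M (\<lambda>X. v X powr sig)" using assms by (simp add: Lp_on_def)
    have eq: "(f X powr r) powr (1 / r) * (v X powr sig) powr (1 - 1 / r) = f X * v X powr (th - \<nu>)" for X
      using r1 f_nonneg by (simp add: powr_powr expo(5) mult.commute)
    note H = Holder_integral[OF if1 iv, of "1 / r", unfolded eq]
    have i: "integrable M (\<lambda>X. f X * v X powr (th - \<nu>))" using H(1) r1 by simp
    have "(LINT X|M. f X * v X powr (th - \<nu>)) \<le> (Lp_int r M f) powr (1 / r) * (Lp_int sig M v) powr (1 - 1 / r)"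
      using H(2) r1 f_nonneg v by (simp add: Lp_int_def)
    also have "\<dots> \<le> (Lp_int r M f + 1) * (max (Lp_int sig M v) 1) powr (1 - 1 / r)"
    proof (rule mult_mono)
      have "(Lp_int r M f) powr (1 / r) \<le> (Lp_int r M f + 1) powr (1 / r)"
        using r1 by (intro powr_mono2) (auto simp: Lp_int_nonneg)
      also have "\<dots> \<le> (Lp_int r M f + 1) powr 1" using r1 by (intro powr_mono) (auto simp: Lp_int_nonneg)
      finally show "(Lp_int r M f) powr (1 / r) \<le> Lp_int r M f + 1" using Lp_int_nonneg[of r M f] by simp
      show "(Lp_int sig M v) powr (1 - 1 / r) \<le> (max (Lp_int sig M v) 1) powr (1 - 1 / r)"
        using r1 by (intro powr_mono2) (auto simp: Lp_int_nonneg)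
    qed (auto simp: Lp_int_nonneg)
    finally show "integrable M (\<lambda>X. f X * v X powr (th - \<nu>)) \<and>
      (LINT X|M. f X * v X powr (th - \<nu>)) \<le> (Lp_int r M f + 1) * (max (Lp_int sig M v) 1) powr (1 - 1 / r)"
      using i by simp
  qed
qed

lemma un_sig: "Lp_on sig M (un n)"
proof -
  have "Lp_on sob M (un n)" using H_sobolev un_H by blast
  then show ?thesis using dom.Lp_int_mono_exponent(1) sig_sob by blast
qed

text \<open>Testing with the smooth power of exponent \<theta> controls the energy of the smooth
  power of exponent (1+\<theta>)/2. Sobolev turns this into Z <= A + B Z^\<open>kap\<close> for Z
  the integral of u_n^\<sigma>, cut below at 1, with A and B independent of n; since
  \<open>kap\<close> < 1, Z is bounded.\<close>

lemma un_bound: "\<exists>Y. \<forall>n. Lp_int sig M (un n) \<le> Y"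
proof -
  obtain C where C: "C > 0" "\<And>u U. H u U \<Longrightarrow> Lp_on sob M u \<and> Lp_int sob M u powr (2 / sob) \<le> C * Lp_int 2 M U"
    using H_sobolev by blast
  define F where "F = Lp_int r M f + 1"
  define A where "A = measure M (space M) + 1"
  define B where "B = 2 powr sob * (C * (F / th)) powr (sob / 2)"
  have F: "0 < F" by (simp add: F_def add_nonneg_pos Lp_int_nonneg)
  have A0: "1 \<le> A" and B0: "0 \<le> B" by (auto simp: A_def B_def)
  have "Lp_int sig M (un n) \<le> (A + B) powr (1 / (1 - kap))" for n
  proof -
    \<comment> \<open>Agrees with \<open>un n\<close> almost everywhere and is nonnegative at every
      point, as \<open>f_powr_integrable\<close> demands.\<close>
    define u where "u X = \<bar>un n X\<bar>" for X
    \<comment> \<open>1 + 2 a = \<open>th\<close> is the growth of the test function. Taking 2 b = a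
      makes the square of \<open>smooth_pow' b\<close> at most the weight of
      \<open>smooth_pow' a\<close>, and 1 + 2 b = (1 + th)/2 becomes \<open>sig\<close> after
      multiplication by \<open>sob\<close>.\<close>
    define a where "a = (th - 1) / 2"
    define b where "b = (th - 1) / 4"
    have ab: "-1/2 \<le> a" "a \<le> 0" "-1/2 \<le> b" "b \<le> 0" "1 + 2 * a = th" "1 + 2 * b = (1 + th) / 2" "2 * b = a"
      using th_pos by (auto simp: a_def b_def field_simps)
    have Lu: "Lp_on sig M u" using un_sig[of n] unfolding Lp_on_def u_def by auto
    have Yeq: "Lp_int sig M u = Lp_int sig M (un n)" by (simp add: Lp_int_def u_def)
    \<comment> \<open>Z >= 1 allows the additive constant to be absorbed into
      Z^\<open>kap\<close>.\<close>
    define Z where "Z = max (Lp_int sig M u) 1"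
    have HT: "H (\<lambda>X. smooth_pow a (un n X)) (\<lambda>X. smooth_pow' a (un n X) *\<^sub>R Wn n X)"
      by (rule H_compose[OF un_H DERIV_smooth_pow continuous_smooth_pow', where C=1])
         (use smooth_pow'_bounds[OF ab(1,2)] in \<open>auto simp: smooth_pow_def\<close>)
    have HS: "H (\<lambda>X. smooth_pow b (un n X)) (\<lambda>X. smooth_pow' b (un n X) *\<^sub>R Wn n X)"
      by (rule H_compose[OF un_H DERIV_smooth_pow continuous_smooth_pow', where C=1])
         (use smooth_pow'_bounds[OF ab(3,4)] in \<open>auto simp: smooth_pow_def\<close>)
    have "(LINT X|M. Wn n X \<bullet> (smooth_pow' a (un n X) *\<^sub>R Wn n X)) = (LINT X|M. gn n X * smooth_pow a (un n X))"
      by (rule weak_solD(3)[OF un_sol HT])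
    also have "\<dots> \<le> (LINT X|M. f X * u X powr (th - \<nu>))"
    proof (rule integral_mono_AE)
      show "integrable M (\<lambda>X. gn n X * smooth_pow a (un n X))"
        using L2_inner(2)[OF weak_solD(2)[OF un_sol] H_Lp(1)[OF HT]] by simp
      show "integrable M (\<lambda>X. f X * u X powr (th - \<nu>))" by (rule f_powr_integrable(1)[OF Lu]) (simp add: u_def)
      show "AE X in M. gn n X * smooth_pow a (un n X) \<le> f X * u X powr (th - \<nu>)"
        using un_nonneg[of n]
      proof eventually_elim
        case (elim X)
        show ?case
        proof (cases "un n X = 0")
          case True then show ?thesis using f_nonneg by (simp add: smooth_pow_def u_def)
        next
          case False
          with elim have p: "0 < un n X" by simp
          have "gn n X * smooth_pow a (un n X) \<le> (f X * un n X powr (- \<nu>)) * un n X powr th"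
            unfolding gn_def using smooth_pow_le[of "un n X" a] ab p
            by (intro mult_mono fn_bounds hn_le hn_nonneg f_nonneg mult_nonneg_nonneg) auto
          also have "\<dots> = f X * u X powr (th - \<nu>)" using p by (simp add: u_def mult.assoc flip: powr_add)
          finally show ?thesis .
        qed
      qed
    qed
    also have "\<dots> \<le> F * Z powr (1 - 1 / r)"
      unfolding F_def Z_def by (rule f_powr_integrable(2)[OF Lu]) (simp add: u_def)
    finally have E1: "(LINT X|M. Wn n X \<bullet> (smooth_pow' a (un n X) *\<^sub>R Wn n X)) \<le> F * Z powr (1 - 1 / r)" .
    have "th * Lp_int 2 M (\<lambda>X. smooth_pow' b (un n X) *\<^sub>R Wn n X) = (LINT X|M. th * (norm (smooth_pow' b (un n X) *\<^sub>R Wn n X))\<^sup>2)"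
      by (simp add: Lp_int_2_eq)
    also have "\<dots> \<le> (LINT X|M. Wn n X \<bullet> (smooth_pow' a (un n X) *\<^sub>R Wn n X))"
    proof (rule integral_mono)
      show "integrable M (\<lambda>X. th * (norm (smooth_pow' b (un n X) *\<^sub>R Wn n X))\<^sup>2)"
        using H_Lp(2)[OF HS] by (simp add: Lp_on_2_eq)
      show "integrable M (\<lambda>X. Wn n X \<bullet> (smooth_pow' a (un n X) *\<^sub>R Wn n X))"
        by (rule L2_inner(2)[OF H_Lp(2)[OF un_H] H_Lp(2)[OF HT]])
      fix X
      define s where "s = un n X"
      have "(smooth_pow' b s)\<^sup>2 \<le> ((1 + s\<^sup>2) powr b)\<^sup>2"
        using smooth_pow'_bounds[OF ab(3,4), of s] by (intro power_mono) auto
      also have "\<dots> = (1 + s\<^sup>2) powr a" by (simp add: power2_eq_square ab(7)[symmetric] flip: powr_add)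
      finally have "th * (smooth_pow' b s)\<^sup>2 \<le> th * (1 + s\<^sup>2) powr a" using th_pos by (intro mult_left_mono) auto
      also have "\<dots> \<le> smooth_pow' a s" using smooth_pow'_bounds(1)[OF ab(1,2), of s] by (simp add: ab)
      finally have "th * (smooth_pow' b s)\<^sup>2 * (norm (Wn n X))\<^sup>2 \<le> smooth_pow' a s * (norm (Wn n X))\<^sup>2"
        by (intro mult_right_mono) auto
      then show "th * (norm (smooth_pow' b (un n X) *\<^sub>R Wn n X))\<^sup>2 \<le> Wn n X \<bullet> (smooth_pow' a (un n X) *\<^sub>R Wn n X)"
        by (simp add: s_def power_mult_distrib dot_square_norm mult.assoc)
    qed
    also note E1
    finally have E2: "Lp_int 2 M (\<lambda>X. smooth_pow' b (un n X) *\<^sub>R Wn n X) \<le> F / th * Z powr (1 - 1 / r)"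
      using th_pos by (simp add: field_simps)
    have LS: "Lp_on sob M (\<lambda>X. smooth_pow b (un n X))" using C(2)[OF HS] by simp
    have "Lp_int sob M (\<lambda>X. smooth_pow b (un n X)) = (Lp_int sob M (\<lambda>X. smooth_pow b (un n X)) powr (2 / sob)) powr (sob / 2)"
      using sob_gt by (simp add: powr_powr Lp_int_nonneg)
    also have "\<dots> \<le> (C * (F / th * Z powr (1 - 1 / r))) powr (sob / 2)"
    proof (rule powr_mono2)
      have "Lp_int sob M (\<lambda>X. smooth_pow b (un n X)) powr (2 / sob) \<le> C * Lp_int 2 M (\<lambda>X. smooth_pow' b (un n X) *\<^sub>R Wn n X)"
        using C(2)[OF HS] by simp
      also have "\<dots> \<le> C * (F / th * Z powr (1 - 1 / r))" using E2 C(1) by (intro mult_left_mono) auto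
      finally show "Lp_int sob M (\<lambda>X. smooth_pow b (un n X)) powr (2 / sob) \<le> C * (F / th * Z powr (1 - 1 / r))" .
    qed (use sob_gt in auto)
    also have "C * (F / th * Z powr (1 - 1 / r)) = (C * (F / th)) * Z powr (1 - 1 / r)" by (simp only: mult.assoc)
    also have "\<dots> powr (sob / 2) = (C * (F / th)) powr (sob / 2) * Z powr kap"
      using C(1) F th_pos by (simp only: powr_mult[of "C * (F / th)"] powr_powr kap_sob)
    finally have E3: "Lp_int sob M (\<lambda>X. smooth_pow b (un n X)) \<le> (C * (F / th)) powr (sob / 2) * Z powr kap" .
    have "Lp_int sig M u \<le> (LINT X|M. 1 + 2 powr sob * norm (smooth_pow b (un n X)) powr sob)"
      unfolding Lp_int_def
    proof (rule integral_mono)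
      show "integrable M (\<lambda>X. norm (u X) powr sig)" using Lu by (simp add: Lp_on_def)
      show "integrable M (\<lambda>X. 1 + 2 powr sob * norm (smooth_pow b (un n X)) powr sob)" using LS by (auto simp: Lp_on_def)
      fix X
      define s where "s = u X"
      have s0: "0 \<le> s" by (simp add: s_def u_def)
      have nrm: "norm (smooth_pow b (un n X)) = smooth_pow b s" by (simp add: smooth_pow_def s_def u_def abs_mult)
      show "norm (u X) powr sig \<le> 1 + 2 powr sob * norm (smooth_pow b (un n X)) powr sob"
      proof (cases "s \<le> 1")
        case True
        then have "s powr sig \<le> 1" using s0 sig_sob by (intro powr_le1) auto
        then show ?thesis using s0 by (simp add: s_def add_increasing2)
      next
        case False
        \<comment> \<open>For s > 1 the smooth power loses at most a factor 2, because 1 + s^2 <= 2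
          s^2 and 2^b >= 1/2.\<close>
        have "s powr ((1 + th) / 2) \<le> 2 * smooth_pow b s"
        proof -
          have "1 + s\<^sup>2 \<le> 2 * s\<^sup>2" using False by (simp add: one_le_power)
          then have "(2 * s\<^sup>2) powr b \<le> (1 + s\<^sup>2) powr b" using ab False by (intro powr_mono2') (auto simp: one_plus_sq_pos)
          moreover have "(2 * s\<^sup>2) powr b = 2 powr b * s powr (2 * b)" using False by (simp add: powr_mult powr_powr flip: powr_numeral)
          moreover have "1 / 2 \<le> 2 powr b" using powr_mono[of "-1" b "2::real"] ab by (simp add: powr_minus)
          ultimately have "1 / 2 * s powr (2 * b) \<le> (1 + s\<^sup>2) powr b" by (smt (verit) mult_right_mono powr_ge_zero)
          then have "s * (1 / 2 * s powr (2 * b)) \<le> s * (1 + s\<^sup>2) powr b" using s0 by (intro mult_left_mono)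
          moreover have "s powr ((1 + th) / 2) = s * s powr (2 * b)"
            unfolding ab(6)[symmetric] powr_add using False by simp
          ultimately show ?thesis by (simp add: smooth_pow_def)
        qed
        then have "(s powr ((1 + th) / 2)) powr sob \<le> (2 * smooth_pow b s) powr sob" using sob_gt by (intro powr_mono2) auto
        then have "s powr sig \<le> 2 powr sob * smooth_pow b s powr sob"
          using smooth_pow_le(3)[OF s0 ab(4)] by (simp add: powr_powr sig_sob(1) powr_mult)
        then show ?thesis unfolding nrm using s0 by (simp add: s_def[symmetric] add_increasing)
      qed
    qed
    also have "\<dots> = measure M (space M) + 2 powr sob * Lp_int sob M (\<lambda>X. smooth_pow b (un n X))"
      using LS by (simp add: Lp_on_def Lp_int_def)
    also have "\<dots> \<le> measure M (space M) + 2 powr sob * ((C * (F / th)) powr (sob / 2) * Z powr kap)"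
      using E3 by (intro add_left_mono mult_left_mono) auto
    finally have "Lp_int sig M u \<le> measure M (space M) + B * Z powr kap" by (simp add: B_def mult.assoc)
    moreover have Z1: "1 \<le> Z" by (simp add: Z_def)
    moreover have Zk: "1 \<le> Z powr kap" using Z1 expo(1) by (rule ge_one_powr_ge_zero)
    moreover have "0 \<le> B * Z powr kap" using B0 by simp
    ultimately have "Z \<le> A + B * Z powr kap" unfolding Z_def A_def by auto
    also have "\<dots> \<le> A * Z powr kap + B * Z powr kap" using Zk A0 by (simp add: mult_le_cancel_left1)
    finally have "Z \<le> (A + B) * Z powr kap" by (simp add: distrib_right)
    \<comment> \<open>Sublinearity closes the estimate: Z^(1 - kap) is bounded and 1 - kap is
      positive.\<close>
    then have "Z / Z powr kap \<le> A + B" using Z1 by (simp add: divide_le_eq)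
    then have "Z powr (1 - kap) \<le> A + B" using Z1 by (simp add: powr_diff)
    then have "(Z powr (1 - kap)) powr (1 / (1 - kap)) \<le> (A + B) powr (1 / (1 - kap))"
      using expo(2) by (intro powr_mono2) auto
    then have "Z \<le> (A + B) powr (1 / (1 - kap))" using expo(2) Z1 by (simp add: powr_powr)
    then show ?thesis unfolding Yeq[symmetric] Z_def by simp
  qed
  then show ?thesis by blast
qed

end

section \<open>Convergence of the quasi-gradients\<close>

context grushin_domain
begin

lemma weak_sol_diff:
  assumes u: "weak_sol u U G" and w: "weak_sol w W K" and v: "H v V"
  shows "(LINT X|M. (U X - W X) \<bullet> V X) = (LINT X|M. (G X - K X) * v X)"
    "integrable M (\<lambda>X. (G X - K X) * v X)" "integrable M (\<lambda>X. (U X - W X) \<bullet> V X)"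
proof -
  note i = L2_inner(2)[OF H_Lp(2)[OF weak_solD(1)[OF u]] H_Lp(2)[OF v]] L2_inner(2)[OF H_Lp(2)[OF weak_solD(1)[OF w]] H_Lp(2)[OF v]]
    L2_inner(2)[OF weak_solD(2)[OF u] H_Lp(1)[OF v]] L2_inner(2)[OF weak_solD(2)[OF w] H_Lp(1)[OF v]]
  show "integrable M (\<lambda>X. (G X - K X) * v X)" "integrable M (\<lambda>X. (U X - W X) \<bullet> V X)"
    using i by (simp_all add: left_diff_distrib inner_diff_left)
  show "(LINT X|M. (U X - W X) \<bullet> V X) = (LINT X|M. (G X - K X) * v X)"
    using i weak_solD(3)[OF u v] weak_solD(3)[OF w v] by (simp add: left_diff_distrib inner_diff_left)
qed

end

context grushin_singular
begin

definition u where "u X = lim (\<lambda>n. un n X)"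

lemma u_measurable [measurable]: "u \<in> borel_measurable M"
  unfolding u_def by measurable

text \<open>Fatou's lemma and the uniform bound make the liminf of u_n^\<sigma> integrable, hence
  finite almost everywhere; with monotonicity this gives a finite limit of the whole
  sequence.\<close>

lemma un_limit:
  shows un_lim: "AE X in M. (\<lambda>n. un n X) \<longlonglongrightarrow> u X \<and> (\<forall>n. 0 \<le> un n X \<and> un n X \<le> u X \<and> incseq (\<lambda>n. un n X))"
    and u_sig: "Lp_on sig M u"
proof -
  obtain Y where Y: "\<And>n. Lp_int sig M (un n) \<le> Y" using un_bound by blast
  define F where "F n X = ennreal (\<bar>un n X\<bar> powr sig)" for n X
  have [measurable]: "F n \<in> borel_measurable M" for n unfolding F_def by measurable
  have FY: "(\<integral>\<^sup>+X. F n X \<partial>M) \<le> ennreal Y" for n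
  proof -
    have "(\<integral>\<^sup>+X. F n X \<partial>M) = ennreal (Lp_int sig M (un n))"
      unfolding F_def Lp_int_def using un_sig[of n] by (subst nn_integral_eq_integral) (auto simp: Lp_on_def)
    then show ?thesis using Y by (simp add: ennreal_leI)
  qed
  have "(\<integral>\<^sup>+X. liminf (\<lambda>n. F n X) \<partial>M) \<le> liminf (\<lambda>n. \<integral>\<^sup>+X. F n X \<partial>M)"
    by (rule nn_integral_liminf) measurable
  also have "\<dots> \<le> liminf (\<lambda>n. ennreal Y)" by (intro Liminf_mono always_eventually allI FY)
  also have "\<dots> = ennreal Y" by (simp add: Liminf_const)
  finally have fin: "(\<integral>\<^sup>+X. liminf (\<lambda>n. F n X) \<partial>M) \<le> ennreal Y" .
  then have "(\<integral>\<^sup>+X. liminf (\<lambda>n. F n X) \<partial>M) \<noteq> \<infinity>" by (auto simp: top_unique)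
  then have "AE X in M. liminf (\<lambda>n. F n X) \<noteq> \<infinity>" by (intro nn_integral_PInf_AE) auto
  then show lim: "AE X in M. (\<lambda>n. un n X) \<longlonglongrightarrow> u X \<and> (\<forall>n. 0 \<le> un n X \<and> un n X \<le> u X \<and> incseq (\<lambda>n. un n X))"
    using un_AE
  proof eventually_elim
    case (elim X)
    have incF: "incseq (\<lambda>n. F n X)" unfolding F_def
      using elim sig_sob(2) by (intro incseq_SucI ennreal_leI powr_mono2) (auto simp: incseq_Suc_iff)
    have "liminf (\<lambda>n. F n X) = (SUP n. F n X)"
      by (rule lim_imp_Liminf[OF sequentially_bot LIMSEQ_SUP[OF incF]])
    then obtain c where c: "0 \<le> c" "(SUP n. F n X) = ennreal c" using elim(1) by (cases "SUP n. F n X") auto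
    have "un n X \<le> c powr (1 / sig)" for n
    proof -
      have "F n X \<le> ennreal c" unfolding c(2)[symmetric] by (rule SUP_upper) simp
      then have "un n X powr sig \<le> c" using elim c(1) unfolding F_def by (subst (asm) ennreal_le_iff) auto
      then have "(un n X powr sig) powr (1 / sig) \<le> c powr (1 / sig)" using sig_sob(2) by (intro powr_mono2) auto
      then show ?thesis using elim sig_sob(2) by (simp add: powr_powr)
    qed
    then obtain L where L: "(\<lambda>n. un n X) \<longlonglongrightarrow> L" "\<forall>i. un i X \<le> L"
      using incseq_convergent[of "\<lambda>n. un n X"] elim by blast
    then show ?case using elim limI[OF L(1)] by (simp add: u_def)
  qed
  have "(\<integral>\<^sup>+X. ennreal (\<bar>u X\<bar> powr sig) \<partial>M) = (\<integral>\<^sup>+X. liminf (\<lambda>n. F n X) \<partial>M)"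
  proof (rule nn_integral_cong_AE)
    show "AE X in M. ennreal (\<bar>u X\<bar> powr sig) = liminf (\<lambda>n. F n X)"
      using lim
    proof eventually_elim
      case (elim X)
      then have "(\<lambda>k. \<bar>un k X\<bar> powr sig) \<longlonglongrightarrow> \<bar>u X\<bar> powr sig"
        using sig_sob(2) by (intro tendsto_powr' tendsto_rabs tendsto_const) auto
      then have "(\<lambda>k. F k X) \<longlonglongrightarrow> ennreal (\<bar>u X\<bar> powr sig)" unfolding F_def
        by (intro tendsto_ennrealI)
      then show ?case using lim_imp_Liminf[OF sequentially_bot] by metis
    qed
  qed
  with fin have "(\<integral>\<^sup>+X. ennreal (\<bar>u X\<bar> powr sig) \<partial>M) < \<infinity>" by (simp add: le_less_trans)
  then show "Lp_on sig M u" by (auto simp: Lp_on_def intro!: integrableI_bounded)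
qed

lemma u_q: "Lp_on q M u"
  using u_sig dom.Lp_int_mono_exponent(1)[OF u_sig, of q] expo(6,9) by (cases "q = sig") auto

text \<open>With \<open>s = u\<^sub>m - u\<^sub>n \<ge> 0\<close> and \<open>T s = s (1 + s\<^sup>2)\<^sup>(\<^sup>\<theta>\<^sup>-\<^sup>1\<^sup>)\<^sup>/\<^sup>2\<close>, the difference of the right-hand sides tested with
  \<open>T s\<close> is at most \<open>f u\<^sub>m\<^sup>-\<^sup>\<nu> T s\<close>, which this weight bounds because \<open>u\<^sub>m \<ge> s\<close>.\<close>

definition gap_weight :: "real \<Rightarrow> real" where
  "gap_weight e = min (e powr (1 - \<nu>)) (e powr (th - \<nu>))"

lemma gap_weight_mono: "0 \<le> d \<Longrightarrow> d \<le> e \<Longrightarrow> gap_weight d \<le> gap_weight e"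
  unfolding gap_weight_def using nu expo(3) by (intro min.mono powr_mono2) auto

text \<open>The two branches of \<open>gap_weight\<close> do different jobs. The power th - \<nu>
  provides the integrable majorant f u^(th - \<nu>); the power 1 - \<nu> forces pointwise decay,
  which the other one fails to do when r = 1 and th = \<nu>.\<close>

lemma gap_tendsto_zero: "(\<lambda>n. LINT X|M. f X * gap_weight \<bar>u X - un n X\<bar>) \<longlonglongrightarrow> 0"
  and gap_integrable: "integrable M (\<lambda>X. f X * gap_weight \<bar>u X - un n X\<bar>)"
proof -
  have Lu: "Lp_on sig M (\<lambda>X. \<bar>u X\<bar>)" using u_sig by (simp add: Lp_on_def)
  have iw: "integrable M (\<lambda>X. f X * \<bar>u X\<bar> powr (th - \<nu>))" by (rule f_powr_integrable(1)[OF Lu]) simp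
  have [measurable]: "(\<lambda>X. gap_weight \<bar>u X - un n X\<bar>) \<in> borel_measurable M" for n unfolding gap_weight_def by measurable
  have le: "AE X in M. norm (f X * gap_weight \<bar>u X - un n X\<bar>) \<le> f X * \<bar>u X\<bar> powr (th - \<nu>)" for n
    using un_lim
  proof eventually_elim
    case (elim X)
    then have "\<bar>u X - un n X\<bar> \<le> \<bar>u X\<bar>" by auto (smt (verit))
    then have "gap_weight \<bar>u X - un n X\<bar> \<le> gap_weight \<bar>u X\<bar>" by (intro gap_weight_mono) auto
    also have "\<dots> \<le> \<bar>u X\<bar> powr (th - \<nu>)" by (simp add: gap_weight_def)
    finally have "f X * gap_weight \<bar>u X - un n X\<bar> \<le> f X * \<bar>u X\<bar> powr (th - \<nu>)" using f_nonneg by (intro mult_left_mono)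
    moreover have "0 \<le> f X * gap_weight \<bar>u X - un n X\<bar>" using f_nonneg[of X] by (simp add: gap_weight_def)
    ultimately show ?case by simp
  qed
  show "integrable M (\<lambda>X. f X * gap_weight \<bar>u X - un n X\<bar>)"
    by (rule Bochner_Integration.integrable_bound[OF iw]) (use le[of n] in \<open>auto elim!: eventually_mono\<close>)
  have "(\<lambda>n. LINT X|M. f X * gap_weight \<bar>u X - un n X\<bar>) \<longlonglongrightarrow> (LINT X|M. 0)"
  proof (rule integral_dominated_convergence[OF _ _ iw _ le])
    show "AE X in M. (\<lambda>n. f X * gap_weight \<bar>u X - un n X\<bar>) \<longlonglongrightarrow> 0"
      using un_lim
    proof eventually_elim
      case (elim X)
      then have z: "(\<lambda>n. \<bar>u X - un n X\<bar>) \<longlonglongrightarrow> 0"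
        by (intro tendsto_rabs_zero) (auto intro!: tendsto_eq_intros)
      have "(\<lambda>n. \<bar>u X - un n X\<bar> powr (1 - \<nu>)) \<longlonglongrightarrow> 0 powr (1 - \<nu>)"
        using nu by (intro tendsto_powr' z tendsto_const) auto
      then have z2: "(\<lambda>n. \<bar>u X - un n X\<bar> powr (1 - \<nu>)) \<longlonglongrightarrow> 0" by simp
      have "(\<lambda>n. gap_weight \<bar>u X - un n X\<bar>) \<longlonglongrightarrow> 0"
        by (rule tendsto_sandwich[OF _ _ tendsto_const z2]) (auto simp: gap_weight_def)
      then show ?case using tendsto_mult_left[of _ 0 sequentially "f X"] by simp
    qed
  qed measurable
  then show "(\<lambda>n. LINT X|M. f X * gap_weight \<bar>u X - un n X\<bar>) \<longlonglongrightarrow> 0" by simp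
qed

text \<open>The right side depends on n alone, because u_m - u_n <= u - u_n; this uniformity in m is
  what produces a Cauchy sequence. P is the lower bound for the derivative of the test
  function.\<close>

lemma energy_gap:
  assumes nm: "n \<le> m"
  defines "P \<equiv> \<lambda>X. th * (1 + (un m X - un n X)\<^sup>2) powr ((th - 1) / 2)"
  shows "integrable M (\<lambda>X. P X * (norm (Wn m X - Wn n X))\<^sup>2)"
    "(LINT X|M. P X * (norm (Wn m X - Wn n X))\<^sup>2) \<le> (LINT X|M. f X * gap_weight \<bar>u X - un n X\<bar>)"
proof -
  define a where "a = (th - 1) / 2"
  have a: "-1/2 \<le> a" "a \<le> 0" "1 + 2 * a = th" using th_pos by (auto simp: a_def field_simps)
  define d where "d X = un m X - un n X" for X
  define D where "D X = Wn m X - Wn n X" for X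
  have Pd: "P X = th * (1 + (d X)\<^sup>2) powr a" for X by (simp add: P_def a_def d_def)
  have HD: "H d D" unfolding d_def D_def by (rule H_diff[OF un_H un_H])
  have [measurable]: "d \<in> borel_measurable M" "D \<in> borel_measurable M" using H_measurable[OF HD] by auto
  have [measurable]: "P \<in> borel_measurable M" unfolding P_def by measurable
  have HT: "H (\<lambda>X. smooth_pow a (d X)) (\<lambda>X. smooth_pow' a (d X) *\<^sub>R D X)"
    by (rule H_compose[OF HD DERIV_smooth_pow continuous_smooth_pow', where C=1])
       (use smooth_pow'_bounds[OF a(1,2)] in \<open>auto simp: smooth_pow_def\<close>)
  note wd = weak_sol_diff[OF un_sol un_sol HT, of m n, folded D_def]
  have P01: "0 \<le> P X" "P X \<le> 1" for X
    using th_pos smooth_pow'_bounds(5)[OF a(1,2), of "d X"] by (auto simp: Pd intro: mult_le_one)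
  have "integrable M (\<lambda>X. P X * (norm (D X))\<^sup>2)"
  proof (rule Bochner_Integration.integrable_bound)
    show "integrable M (\<lambda>X. (norm (D X))\<^sup>2)" using H_Lp(2)[OF HD] by (simp add: Lp_on_2_eq)
    show "AE X in M. norm (P X * (norm (D X))\<^sup>2) \<le> norm ((norm (D X))\<^sup>2)"
      using P01 by (auto simp: abs_mult intro!: mult_left_le_one_le)
  qed measurable
  then show i: "integrable M (\<lambda>X. P X * (norm (Wn m X - Wn n X))\<^sup>2)" by (simp add: D_def)
  have "(LINT X|M. P X * (norm (D X))\<^sup>2) \<le> (LINT X|M. D X \<bullet> (smooth_pow' a (d X) *\<^sub>R D X))"
  proof (rule integral_mono)
    show "integrable M (\<lambda>X. P X * (norm (D X))\<^sup>2)" using i by (simp add: D_def)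
    show "P X * (norm (D X))\<^sup>2 \<le> D X \<bullet> (smooth_pow' a (d X) *\<^sub>R D X)" for X
      using smooth_pow'_bounds(1)[OF a(1,2), of "d X"] a(3)
      by (auto simp: Pd dot_square_norm intro!: mult_right_mono)
  qed (rule wd(3))
  also have "\<dots> = (LINT X|M. (gn m X - gn n X) * smooth_pow a (d X))" by (rule wd(1))
  also have "\<dots> \<le> (LINT X|M. f X * gap_weight \<bar>u X - un n X\<bar>)"
  proof (rule integral_mono_AE[OF wd(2) gap_integrable])
    show "AE X in M. (gn m X - gn n X) * smooth_pow a (d X) \<le> f X * gap_weight \<bar>u X - un n X\<bar>"
      using un_lim
    proof eventually_elim
      case (elim X)
      have mono: "un n X \<le> un m X" using elim nm by (auto simp: incseq_def)
      then have d0: "0 \<le> d X" by (simp add: d_def)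
      show ?case
      proof (cases "d X = 0")
        case True
        then show ?thesis using f_nonneg by (simp add: smooth_pow_def gap_weight_def)
      next
        case False
        with d0 have dp: "0 < d X" by simp
        have du: "d X \<le> un m X" using elim by (simp add: d_def)
        have "gn m X \<le> f X * un m X powr (- \<nu>)"
          unfolding gn_def using dp du by (intro mult_mono fn_bounds hn_le hn_nonneg f_nonneg) auto
        also have "\<dots> \<le> f X * d X powr (- \<nu>)"
          using dp du nu f_nonneg by (intro mult_left_mono powr_mono2') auto
        finally have g: "gn m X - gn n X \<le> f X * d X powr (- \<nu>)" using gn_nonneg[of n X] by linarith
        have s: "smooth_pow a (d X) \<le> min (d X) (d X powr th)" "0 \<le> smooth_pow a (d X)"
          using smooth_pow_le[OF d0 a(2)] a(3) by auto
        have "(gn m X - gn n X) * smooth_pow a (d X) \<le> (f X * d X powr (- \<nu>)) * smooth_pow a (d X)"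
          using g s by (intro mult_right_mono) auto
        also have "\<dots> \<le> (f X * d X powr (- \<nu>)) * min (d X) (d X powr th)"
          using s f_nonneg by (intro mult_left_mono) auto
        also have "\<dots> = f X * (d X powr (- \<nu>) * min (d X powr 1) (d X powr th))" using dp by simp
        also have "d X powr (- \<nu>) * min (d X powr 1) (d X powr th) = gap_weight (d X)"
        proof -
          have "d X powr (- \<nu>) * d X powr 1 = d X powr (1 - \<nu>)" "d X powr (- \<nu>) * d X powr th = d X powr (th - \<nu>)"
            unfolding powr_add[symmetric] by (simp_all add: algebra_simps)
          then show ?thesis by (simp only: gap_weight_def min_mult_distrib_left powr_ge_zero if_True)
        qed
        also have "f X * gap_weight (d X) \<le> f X * gap_weight \<bar>u X - un n X\<bar>"
        proof (intro mult_left_mono gap_weight_mono d0 f_nonneg)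
          have "un m X \<le> u X" using elim by blast
          then show "d X \<le> \<bar>u X - un n X\<bar>" by (simp add: d_def)
        qed
        finally show ?thesis .
      qed
    qed
  qed
  finally show "(LINT X|M. P X * (norm (Wn m X - Wn n X))\<^sup>2) \<le> (LINT X|M. f X * gap_weight \<bar>u X - un n X\<bar>)"
    by (simp add: D_def)
qed

lemma Wn_q: "Lp_on q M (Wn n)"
  using dom.Lp_int_mono_exponent(1)[OF H_Lp(2)[OF un_H], of q] expo(6,7) by auto

text \<open>With D the difference of quasi-gradients, |D|^q = (P |D|^2)^(q/2) (P^(-q/(2-q)))^(1 -
  q/2), and Hoelder separates the factors. By \<open>expo(8)\<close> the power P^(-q/(2-q)) is a
  multiple of (1 + (u_m - u_n)^2)^(\<sigma>/2), which is majorised through u in L^\<sigma>.\<close>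

lemma Wn_gap:
  "\<exists>B\<ge>0. \<forall>n m. n \<le> m \<longrightarrow> Lp_int q M (\<lambda>X. Wn m X - Wn n X) \<le> (LINT X|M. f X * gap_weight \<bar>u X - un n X\<bar>) powr (q / 2) * B"
proof -
  define c where "c = th powr (- q / (2 - q)) * 2 powr (sig / 2)"
  define B where "B = (LINT X|M. c * (1 + \<bar>u X\<bar> powr sig)) powr (1 - q / 2)"
  have q2: "0 < q / 2" "q / 2 < 1" "0 < q" "0 < 2 - q" using expo(6,7) by auto
  have c0: "0 \<le> c" by (simp add: c_def)
  have iB: "integrable M (\<lambda>X. c * (1 + \<bar>u X\<bar> powr sig))" using u_sig by (auto simp: Lp_on_def)
  have main: "Lp_int q M (\<lambda>X. Wn m X - Wn n X) \<le> (LINT X|M. f X * gap_weight \<bar>u X - un n X\<bar>) powr (q / 2) * B"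
    if nm: "n \<le> m" for n m
  proof -
    define P where "P X = th * (1 + (un m X - un n X)\<^sup>2) powr ((th - 1) / 2)" for X
    have [measurable]: "P \<in> borel_measurable M" unfolding P_def by measurable
    have Ppos: "0 < P X" for X using th_pos one_plus_sq_pos[of "un m X - un n X"] by (simp add: P_def)
    define R where "R X = P X powr (- q / (2 - q))" for X
    have [measurable]: "R \<in> borel_measurable M" unfolding R_def by measurable
    have Rle: "AE X in M. R X \<le> c * (1 + \<bar>u X\<bar> powr sig)"
      using un_lim
    proof eventually_elim
      case (elim X)
      define s where "s = un m X - un n X"
      have s: "0 \<le> s" "s \<le> u X"
      proof -
        show "0 \<le> s" using elim nm by (auto simp: incseq_def s_def)
        have "0 \<le> un n X" "un m X \<le> u X" using elim by auto
        then show "s \<le> u X" by (simp add: s_def)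
      qed
      have "R X = th powr (- q / (2 - q)) * (1 + s\<^sup>2) powr ((th - 1) / 2 * (- q / (2 - q)))"
        using th_pos one_plus_sq_pos[of s] by (simp add: R_def P_def s_def powr_mult powr_powr)
      also have "(th - 1) / 2 * (- q / (2 - q)) = sig / 2" unfolding expo(8)[symmetric] using q2 by (simp add: field_simps)
      finally have Req: "R X = th powr (- q / (2 - q)) * (1 + s\<^sup>2) powr (sig / 2)" .
      have "(1 + s\<^sup>2) powr (sig / 2) \<le> (2 * max 1 ((u X)\<^sup>2)) powr (sig / 2)"
      proof (rule powr_mono2)
        have "s\<^sup>2 \<le> (u X)\<^sup>2" using s by (intro power_mono) auto
        then show "1 + s\<^sup>2 \<le> 2 * max 1 ((u X)\<^sup>2)" by auto
      qed (use sig_sob(2) one_plus_sq_pos[of s] in auto)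
      also have "\<dots> = 2 powr (sig / 2) * (max 1 ((u X)\<^sup>2)) powr (sig / 2)" by (simp add: powr_mult)
      also have "(max 1 ((u X)\<^sup>2)) powr (sig / 2) \<le> 1 + \<bar>u X\<bar> powr sig"
      proof -
        have "\<bar>u X\<bar> powr 2 = (u X)\<^sup>2" by simp
        moreover have "(\<bar>u X\<bar> powr 2) powr (sig / 2) = \<bar>u X\<bar> powr sig" by (simp only: powr_powr) simp
        ultimately have "((u X)\<^sup>2) powr (sig / 2) = \<bar>u X\<bar> powr sig" by (simp only:)
        then show ?thesis by (auto simp: max_def add_increasing add_increasing2)
      qed
      finally have "(1 + s\<^sup>2) powr (sig / 2) \<le> 2 powr (sig / 2) * (1 + \<bar>u X\<bar> powr sig)" by (simp add: mult_left_mono)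
      then have "R X \<le> th powr (- q / (2 - q)) * (2 powr (sig / 2) * (1 + \<bar>u X\<bar> powr sig))"
        unfolding Req by (intro mult_left_mono) auto
      then show ?case by (simp add: c_def mult.assoc)
    qed
    have iR: "integrable M R"
      by (rule Bochner_Integration.integrable_bound[OF iB]) (use Rle c0 in \<open>auto elim!: eventually_mono simp: R_def\<close>)
    have iP: "integrable M (\<lambda>X. P X * (norm (Wn m X - Wn n X))\<^sup>2)"
      and leP: "(LINT X|M. P X * (norm (Wn m X - Wn n X))\<^sup>2) \<le> (LINT X|M. f X * gap_weight \<bar>u X - un n X\<bar>)"
      using energy_gap[OF nm] by (simp_all add: P_def)
    have eq: "(P X * (norm (Wn m X - Wn n X))\<^sup>2) powr (q / 2) * R X powr (1 - q / 2) = norm (Wn m X - Wn n X) powr q" for X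
    proof -
      have "(P X * (norm (Wn m X - Wn n X))\<^sup>2) powr (q / 2) = P X powr (q / 2) * ((norm (Wn m X - Wn n X)) powr 2) powr (q / 2)"
        using Ppos[of X] by (simp add: powr_mult)
      also have "((norm (Wn m X - Wn n X)) powr 2) powr (q / 2) = norm (Wn m X - Wn n X) powr q" by (simp only: powr_powr) simp
      finally have 1: "(P X * (norm (Wn m X - Wn n X))\<^sup>2) powr (q / 2) = P X powr (q / 2) * norm (Wn m X - Wn n X) powr q" .
      have "R X powr (1 - q / 2) = P X powr ((- q / (2 - q)) * (1 - q / 2))" unfolding R_def by (rule powr_powr)
      also have "(- q / (2 - q)) * (1 - q / 2) = - (q / 2)" using q2 by (simp add: field_simps)
      finally have 2: "R X powr (1 - q / 2) = P X powr (- (q / 2))" .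
      show ?thesis unfolding 1 2 using Ppos[of X] by (simp add: powr_minus)
    qed
    have "Lp_int q M (\<lambda>X. Wn m X - Wn n X) \<le> (LINT X|M. P X * (norm (Wn m X - Wn n X))\<^sup>2) powr (q / 2) * (LINT X|M. R X) powr (1 - q / 2)"
      using Holder_integral(2)[OF iP iR, of "q / 2", unfolded eq] q2 less_imp_le[OF Ppos] by (simp add: Lp_int_def R_def)
    also have "\<dots> \<le> (LINT X|M. f X * gap_weight \<bar>u X - un n X\<bar>) powr (q / 2) * B"
    proof (rule mult_mono)
      show "(LINT X|M. P X * (norm (Wn m X - Wn n X))\<^sup>2) powr (q / 2) \<le> (LINT X|M. f X * gap_weight \<bar>u X - un n X\<bar>) powr (q / 2)"
        using leP q2 less_imp_le[OF Ppos] by (intro powr_mono2) auto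
      have "(LINT X|M. R X) \<le> (LINT X|M. c * (1 + \<bar>u X\<bar> powr sig))" by (rule integral_mono_AE[OF iR iB Rle])
      then show "(LINT X|M. R X) powr (1 - q / 2) \<le> B" unfolding B_def
        using q2 by (intro powr_mono2) (auto simp: R_def)
    qed auto
    finally show ?thesis .
  qed
  have "0 \<le> B" by (simp add: B_def)
  then show ?thesis using main by blast
qed

lemma U_exists: "\<exists>U. Lp_on q M U \<and> (\<lambda>n. Lp_int q M (\<lambda>X. Wn n X - U X)) \<longlonglongrightarrow> 0"
proof (rule dom.Lp_complete[OF Wn_q])
  show "1 \<le> q" using expo(6) by simp
  fix e :: real assume e: "0 < e"
  obtain B where B: "B \<ge> 0" "\<And>n m. n \<le> m \<Longrightarrow> Lp_int q M (\<lambda>X. Wn m X - Wn n X) \<le> (LINT X|M. f X * gap_weight \<bar>u X - un n X\<bar>) powr (q / 2) * B"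
    using Wn_gap by blast
  have "(\<lambda>n. (LINT X|M. f X * gap_weight \<bar>u X - un n X\<bar>) powr (q / 2) * B) \<longlonglongrightarrow> 0 powr (q / 2) * B"
    using expo(6) f_nonneg by (intro tendsto_mult tendsto_powr' gap_tendsto_zero tendsto_const)
      (auto intro!: always_eventually integral_nonneg simp: gap_weight_def)
  then have "(\<lambda>n. (LINT X|M. f X * gap_weight \<bar>u X - un n X\<bar>) powr (q / 2) * B) \<longlonglongrightarrow> 0" by simp
  then have "\<forall>\<^sub>F n in sequentially. (LINT X|M. f X * gap_weight \<bar>u X - un n X\<bar>) powr (q / 2) * B < e"
    using e by (rule order_tendstoD(2))
  then obtain N where N: "\<And>n. n \<ge> N \<Longrightarrow> (LINT X|M. f X * gap_weight \<bar>u X - un n X\<bar>) powr (q / 2) * B < e"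
    by (auto simp: eventually_sequentially)
  have "Lp_int q M (\<lambda>X. Wn j X - Wn k X) < e" if "j \<ge> N" "k \<ge> N" for j k
  proof (cases "k \<le> j")
    case True then show ?thesis using B(2)[OF True] N[OF that(2)] by linarith
  next
    case False
    then have "j \<le> k" by simp
    then show ?thesis using B(2)[of j k] N[OF that(1)] Lp_int_commute[of q M "Wn j" "Wn k"] by linarith
  qed
  then show "\<exists>N. \<forall>j\<ge>N. \<forall>k\<ge>N. Lp_int q M (\<lambda>X. Wn j X - Wn k X) < e" by blast
qed

definition U where "U = (SOME U. Lp_on q M U \<and> (\<lambda>n. Lp_int q M (\<lambda>X. Wn n X - U X)) \<longlonglongrightarrow> 0)"

lemma U_q: "Lp_on q M U" and Wn_lim: "(\<lambda>n. Lp_int q M (\<lambda>X. Wn n X - U X)) \<longlonglongrightarrow> 0"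
  using someI_ex[OF U_exists] unfolding U_def by auto

lemma un_lim_q: "(\<lambda>n. Lp_int q M (\<lambda>X. un n X - u X)) \<longlonglongrightarrow> 0"
proof (rule Lp_lim_dominated[where C=1, OF _ _ u_q])
  show "AE X in M. (\<lambda>k. un k X - u X) \<longlonglongrightarrow> 0"
    using un_lim by eventually_elim (auto intro!: tendsto_eq_intros)
  show "AE X in M. norm (un k X - u X) \<le> 1 * norm (u X)" for k
    using un_lim
  proof eventually_elim
    case (elim X)
    then have "0 \<le> un k X" "un k X \<le> u X" by auto
    then show ?case by simp
  qed
qed (use expo(6) in auto)

text \<open>Each u_n is replaced by a test function whose squared L^2 errors, in value and
  quasi-gradient, are below 1/(n+1). As q < 2 and the measure is finite, these errors vanish in L^q
  too, so the limits of u_n and \<open>Wn n\<close> are inherited.\<close>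

lemma approximating_test_fns:
  "\<exists>\<phi> g. (\<forall>k::nat. test_fn \<Omega> (\<phi> k) (g k)) \<and> (\<lambda>k. Lp_int q M (\<lambda>X. \<phi> k X - u X)) \<longlonglongrightarrow> 0
     \<and> (\<lambda>k. Lp_int q M (\<lambda>X. sg (g k) X - U X)) \<longlonglongrightarrow> 0"
proof -
  have "\<exists>v w. test_fn \<Omega> v w \<and> Lp_int 2 M (\<lambda>X. v X - un n X) < 1 / Suc n \<and> Lp_int 2 M (\<lambda>X. sg w X - Wn n X) < 1 / Suc n" for n
  proof -
    obtain \<phi> g where \<phi>: "\<And>k::nat. test_fn \<Omega> (\<phi> k) (g k)"
     "(\<lambda>k. Lp_int 2 M (\<lambda>X. \<phi> k X - un n X)) \<longlonglongrightarrow> 0" "(\<lambda>k. Lp_int 2 M (\<lambda>X. sg (g k) X - Wn n X)) \<longlonglongrightarrow> 0"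
      using un_H[of n] unfolding H_def by blast
    have "\<forall>\<^sub>F k in sequentially. Lp_int 2 M (\<lambda>X. \<phi> k X - un n X) < 1 / Suc n \<and> Lp_int 2 M (\<lambda>X. sg (g k) X - Wn n X) < 1 / Suc n"
      using \<phi>(2,3) by (intro eventually_conj order_tendstoD(2)) auto
    then obtain k where "Lp_int 2 M (\<lambda>X. \<phi> k X - un n X) < 1 / Suc n" "Lp_int 2 M (\<lambda>X. sg (g k) X - Wn n X) < 1 / Suc n"
      using eventually_happens'[OF sequentially_bot] by blast
    then show ?thesis using \<phi>(1)[of k] by blast
  qed
  then have "\<forall>n. \<exists>p. test_fn \<Omega> (fst p) (snd p) \<and> Lp_int 2 M (\<lambda>X. fst p X - un n X) < 1 / Suc n \<and> Lp_int 2 M (\<lambda>X. sg (snd p) X - Wn n X) < 1 / Suc n"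
    by (simp only: split_paired_Ex fst_conv snd_conv) blast
  from choice[OF this] obtain p where p: "\<And>n. test_fn \<Omega> (fst (p n)) (snd (p n)) \<and> Lp_int 2 M (\<lambda>X. fst (p n) X - un n X) < 1 / Suc n \<and> Lp_int 2 M (\<lambda>X. sg (snd (p n)) X - Wn n X) < 1 / Suc n"
    by blast
  define \<phi> where "\<phi> n = fst (p n)" for n
  define g where "g n = snd (p n)" for n
  have \<phi>: "\<And>k::nat. test_fn \<Omega> (\<phi> k) (g k)" "\<And>k. Lp_int 2 M (\<lambda>X. \<phi> k X - un k X) < 1 / Suc k"
     "\<And>k. Lp_int 2 M (\<lambda>X. sg (g k) X - Wn k X) < 1 / Suc k" using p unfolding \<phi>_def g_def by simp_all
  have lim2: "(\<lambda>k. Lp_int 2 M (\<lambda>X. (\<phi> k X - un k X) - 0)) \<longlonglongrightarrow> 0" "(\<lambda>k. Lp_int 2 M (\<lambda>X. (sg (g k) X - Wn k X) - 0)) \<longlonglongrightarrow> 0"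
    unfolding diff_0_right
    by (rule tendsto_zero_of_less_inverse, rule Lp_int_nonneg, rule \<phi>(2))
       (rule tendsto_zero_of_less_inverse, rule Lp_int_nonneg, rule \<phi>(3))
  have L: "Lp_on 2 M (\<lambda>X. \<phi> k X - un k X)" "Lp_on 2 M (\<lambda>X. sg (g k) X - Wn k X)" for k
    by (rule Lp_on_diff(1)[OF test_fn_Lp(1)[OF \<phi>(1)] H_Lp(1)[OF un_H]]; simp)
       (rule Lp_on_diff(1)[OF test_fn_Lp(2)[OF \<phi>(1)] H_Lp(2)[OF un_H]]; simp)
  have z: "Lp_on 2 M (\<lambda>X. 0 :: 'c::euclidean_space)" by (simp add: Lp_on_def)
  have q2: "0 < q" "q < 2" using expo(6,7) by auto
  have Lq: "Lp_on q M (\<lambda>X. \<phi> k X - un k X)" "Lp_on q M (\<lambda>X. sg (g k) X - Wn k X)" for k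
    using dom.Lp_int_mono_exponent(1)[OF L(1) q2] dom.Lp_int_mono_exponent(1)[OF L(2) q2] by auto
  have lq: "(\<lambda>k. Lp_int q M (\<lambda>X. \<phi> k X - un k X)) \<longlonglongrightarrow> 0" "(\<lambda>k. Lp_int q M (\<lambda>X. sg (g k) X - Wn k X)) \<longlonglongrightarrow> 0"
    using dom.Lp_lim_mono_exponent[OF L(1) z q2 lim2(1)] dom.Lp_lim_mono_exponent[OF L(2) z q2 lim2(2)] by auto
  have unq: "Lp_on q M (\<lambda>X. un k X - u X)" for k
    by (rule Lp_on_diff(1)[OF dom.Lp_int_mono_exponent(1)[OF H_Lp(1)[OF un_H] q2] u_q less_imp_le[OF q2(1)]])
  have Unq: "Lp_on q M (\<lambda>X. Wn k X - U X)" for k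
    by (rule Lp_on_diff(1)[OF Wn_q U_q less_imp_le[OF q2(1)]])
  have "(\<lambda>k. Lp_int q M (\<lambda>X. (\<phi> k X - un k X) + (un k X - u X))) \<longlonglongrightarrow> 0"
    by (rule Lp_lim_add[OF lq(1) un_lim_q Lq(1) unq]) (use q2 in auto)
  moreover have "(\<lambda>k. Lp_int q M (\<lambda>X. (sg (g k) X - Wn k X) + (Wn k X - U X))) \<longlonglongrightarrow> 0"
    by (rule Lp_lim_add[OF lq(2) Wn_lim Lq(2) Unq]) (use q2 in auto)
  ultimately show ?thesis using \<phi>(1) by auto
qed

lemma norm0_eq:
  assumes "test_fn \<Omega> v g"
  shows "norm0 lam q \<Omega> v = Lp_int q M (sg g) powr (1 / q)"
proof -
  have "(grushin_A lam X h \<bullet> h) powr (q / 2) = norm (grushin_sqrtA lam X h) powr q" for X and h :: "real \<times> (real ^ 'm)"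
  proof -
    have "grushin_A lam X h \<bullet> h = (norm (grushin_sqrtA lam X h))\<^sup>2"
      unfolding norm_grushin_sqrtA_sq
      by (simp add: grushin_A_def inner_prod_def dot_square_norm power2_eq_square flip: powr_add)
    also have "\<dots> powr (q / 2) = (norm (grushin_sqrtA lam X h) powr 2) powr (q / 2)" by simp
    also have "\<dots> = norm (grushin_sqrtA lam X h) powr q" by (simp only: powr_powr) simp
    finally show ?thesis .
  qed
  then show ?thesis unfolding norm0_def test_fn_imp_C1_0(2)[OF assms] by (simp add: Lp_int_def)
qed

lemma solution_in_W0:
  "u \<in> W0 lam q \<Omega>" "has_weak_quasi_gradient lam q \<Omega> u (\<lambda>X. inv (grushin_sqrtA lam X) (U X))"
proof -
  obtain \<phi> g where t: "\<And>k::nat. test_fn \<Omega> (\<phi> k) (g k)" and lim: "(\<lambda>k. Lp_int q M (\<lambda>X. \<phi> k X - u X)) \<longlonglongrightarrow> 0"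
     "(\<lambda>k. Lp_int q M (\<lambda>X. sg (g k) X - U X)) \<longlonglongrightarrow> 0"
    using approximating_test_fns by blast
  have q0: "0 < q" using expo(6) by simp
  note Lt = test_fn_Lp[OF t less_imp_le[OF q0]]
  have gr: "gradient (\<phi> k) = g k" for k by (rule test_fn_imp_C1_0(2)[OF t])
  have root: "(\<lambda>k. a k powr (1 / q)) \<longlonglongrightarrow> 0" if "a \<longlonglongrightarrow> 0" "\<And>k. 0 \<le> a k" for a :: "nat \<Rightarrow> real"
  proof -
    have "(\<lambda>k. a k powr (1 / q)) \<longlonglongrightarrow> 0 powr (1 / q)" using that q0 by (intro tendsto_powr' tendsto_const) auto
    then show ?thesis by simp
  qed
  have l1: "Lp_lim q \<Omega> \<phi> u"
    using root[OF lim(1) Lp_int_nonneg] Lt(1) u_q by (simp add: Lp_lim_def Lp_fun_def Lp_on_def Lp_norm_def Lp_int_def)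
  have l2: "Lp_lim q \<Omega> (\<lambda>n X. grushin_sqrtA lam X (gradient (\<phi> n) X)) U"
    using root[OF lim(2) Lp_int_nonneg] Lt(2) U_q unfolding gr
    by (simp add: Lp_lim_def Lp_fun_def Lp_on_def Lp_norm_def Lp_int_def)
  have C: "Cauchy0 lam q \<Omega> \<phi>"
    unfolding Cauchy0_def
  proof (intro conjI allI impI)
    show "\<phi> n \<in> C1_0 \<Omega>" for n by (rule test_fn_imp_C1_0(1)[OF t])
    fix e :: real assume e: "0 < e"
    \<comment> \<open>The power e^q undoes the root in the norm, and the divisor 2 * 2^q compensates
      the two summands and the factor in \<open>Lp_int_triangle\<close>.\<close>
    define e' where "e' = e powr q / (2 * 2 powr q)"
    have "0 < e'" using e by (simp add: e'_def)
    then have "\<forall>\<^sub>F k in sequentially. Lp_int q M (\<lambda>X. sg (g k) X - U X) < e'" by (rule order_tendstoD(2)[OF lim(2)])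
    then obtain N where N: "\<And>k. k \<ge> N \<Longrightarrow> Lp_int q M (\<lambda>X. sg (g k) X - U X) < e'" by (auto simp: eventually_sequentially)
    have "norm0 lam q \<Omega> (\<lambda>X. \<phi> j X - \<phi> k X) < e" if "j \<ge> N" "k \<ge> N" for j k
    proof -
      have sgd: "sg (\<lambda>X. g j X - g k X) = (\<lambda>X. sg (g j) X - sg (g k) X)"
        by (simp add: fun_eq_iff grushin_sqrtA_def prod_eq_iff algebra_simps)
      have "Lp_int q M (\<lambda>X. sg (g j) X - sg (g k) X) \<le> 2 powr q * (Lp_int q M (\<lambda>X. sg (g j) X - U X) + Lp_int q M (\<lambda>X. U X - sg (g k) X))"
        by (rule Lp_int_triangle) (use Lt U_q q0 in auto)
      also have "\<dots> < 2 powr q * (e' + e')"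
        using N[OF that(1)] N[OF that(2)] Lp_int_commute[of q M U "sg (g k)"] by (intro mult_strict_left_mono add_strict_mono) auto
      also have "\<dots> = e powr q" by (simp add: e'_def)
      finally have "Lp_int q M (\<lambda>X. sg (g j) X - sg (g k) X) powr (1 / q) < (e powr q) powr (1 / q)"
        using q0 by (intro powr_less_mono2) (auto simp: Lp_int_nonneg)
      then show ?thesis using e q0 by (simp add: norm0_eq[OF test_fn_diff[OF t t]] sgd powr_powr)
    qed
    then show "\<exists>M. \<forall>j\<ge>M. \<forall>k\<ge>M. norm0 lam q \<Omega> (\<lambda>X. \<phi> j X - \<phi> k X) < e" by blast
  qed
  show "u \<in> W0 lam q \<Omega>" unfolding W0_def using C l1 by blast
  show "has_weak_quasi_gradient lam q \<Omega> u (\<lambda>X. inv (grushin_sqrtA lam X) (U X))"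
    unfolding has_weak_quasi_gradient_def
    by (intro exI[of _ \<phi>] exI[of _ U] conjI C l1 l2 AE_I2 refl)
qed

end

section \<open>The limit equation\<close>

text \<open>Its decrease for s >= 0 gives the additional energy term a favourable sign, and 1 -
  \<open>low_cut d s\<close> vanishes quadratically at s = 0, which beats the singularity
  s^(-\<nu>).\<close>

definition low_cut :: "real \<Rightarrow> real \<Rightarrow> real" where "low_cut d s = d\<^sup>2 / (d\<^sup>2 + s\<^sup>2)"

definition low_cut' :: "real \<Rightarrow> real \<Rightarrow> real" where "low_cut' d s = - 2 * s * d\<^sup>2 / (d\<^sup>2 + s\<^sup>2)\<^sup>2"

lemma low_cut_props:
  assumes d: "0 < d"
  shows "(low_cut d has_real_derivative low_cut' d s) (at s)" "continuous_on S (low_cut' d)" "\<bar>low_cut' d s\<bar> \<le> 1 / d"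
    "0 \<le> low_cut d s" "low_cut d s \<le> 1" "0 \<le> s \<Longrightarrow> low_cut' d s \<le> 0"
proof -
  have pos: "0 < d\<^sup>2 + s\<^sup>2" for s :: real using d by (simp add: add_pos_nonneg)
  show "(low_cut d has_real_derivative low_cut' d s) (at s)"
    unfolding low_cut_def[abs_def] low_cut'_def using pos[of s]
    by (auto intro!: derivative_eq_intros simp: power2_eq_square)
  show "continuous_on S (low_cut' d)" unfolding low_cut'_def[abs_def] using pos
    by (intro continuous_intros) (auto simp: less_imp_neq[THEN not_sym])
  show "0 \<le> low_cut d s" "low_cut d s \<le> 1" unfolding low_cut_def using pos[of s] d by (auto simp: divide_le_eq)
  show "low_cut' d s \<le> 0" if "0 \<le> s" using that by (simp add: low_cut'_def divide_nonpos_nonneg)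
  have "2 * \<bar>s\<bar> * d \<le> d\<^sup>2 + s\<^sup>2" using sum_squares_bound[of "\<bar>s\<bar>" d] by simp
  then have "(2 * \<bar>s\<bar> * d) * d\<^sup>2 \<le> (d\<^sup>2 + s\<^sup>2) * (d\<^sup>2 + s\<^sup>2)" using pos[of s] by (intro mult_mono) auto
  then have "2 * \<bar>s\<bar> * d\<^sup>2 * d \<le> (d\<^sup>2 + s\<^sup>2)\<^sup>2" by (simp add: power2_eq_square algebra_simps)
  then have "2 * \<bar>s\<bar> * d\<^sup>2 / (d\<^sup>2 + s\<^sup>2)\<^sup>2 \<le> 1 / d" using pos[of s] d by (simp add: field_simps)
  moreover have "\<bar>low_cut' d s\<bar> = 2 * \<bar>s\<bar> * d\<^sup>2 / (d\<^sup>2 + s\<^sup>2)\<^sup>2" by (simp add: low_cut'_def abs_mult)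
  ultimately show "\<bar>low_cut' d s\<bar> \<le> 1 / d" by simp
qed

lemma low_cut_zero_lim: "0 < s \<Longrightarrow> (\<lambda>j. low_cut (1 / real (Suc j)) s) \<longlonglongrightarrow> 0"
proof -
  assume s: "0 < s"
  have i: "(\<lambda>j. 1 / real (Suc j)) \<longlonglongrightarrow> 0" by (rule LIMSEQ_Suc[OF lim_const_over_n])
  have "(\<lambda>j. (1 / real (Suc j))\<^sup>2 / ((1 / real (Suc j))\<^sup>2 + s\<^sup>2)) \<longlonglongrightarrow> 0\<^sup>2 / (0\<^sup>2 + s\<^sup>2)"
    using s by (intro tendsto_intros i) auto
  then show ?thesis by (simp add: low_cut_def)
qed

lemma low_cut_mono:
  assumes "0 < d" "d \<le> e"
  shows "low_cut d s \<le> low_cut e s"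
proof -
  have de: "d\<^sup>2 \<le> e\<^sup>2" using assms by (intro power_mono) auto
  have p: "0 < d\<^sup>2 + s\<^sup>2" "0 < e\<^sup>2 + s\<^sup>2" using assms by (auto intro: add_pos_nonneg)
  have "d\<^sup>2 * s\<^sup>2 \<le> e\<^sup>2 * s\<^sup>2" using de by (intro mult_right_mono) auto
  then show ?thesis using p by (simp add: low_cut_def divide_le_eq le_divide_eq) (simp add: field_simps)
qed

text \<open>For s <= d the ratio of the two sides is at most (s/d)^(2 - \<nu>) <= 1; for s > d the
  singular power is already below d^(-\<nu>).\<close>

lemma powr_one_minus_low_cut_le:
  assumes "0 < d" "0 < s" "0 < \<nu>" "\<nu> < 1"
  shows "s powr (- \<nu>) * (1 - low_cut d s) \<le> d powr (- \<nu>)"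
proof -
  have p: "0 < d\<^sup>2 + s\<^sup>2" using assms by (auto intro: add_pos_nonneg)
  have "d\<^sup>2 / (d\<^sup>2 + s\<^sup>2) + s\<^sup>2 / (d\<^sup>2 + s\<^sup>2) = 1"
    unfolding add_divide_distrib[symmetric] by (rule divide_self[OF less_imp_neq[OF p, THEN not_sym]])
  then have eq: "1 - low_cut d s = s\<^sup>2 / (d\<^sup>2 + s\<^sup>2)" by (simp add: low_cut_def)
  show ?thesis
  proof (cases "s \<le> d")
    case True
    have "s powr (- \<nu>) * (s\<^sup>2 / (d\<^sup>2 + s\<^sup>2)) \<le> s powr (- \<nu>) * (s\<^sup>2 / d\<^sup>2)"
      using assms p by (intro mult_left_mono divide_left_mono mult_pos_pos) auto
    also have "\<dots> = d powr (- \<nu>) * (s / d) powr (2 - \<nu>)"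
    proof -
      have "(s / d) powr (2 - \<nu>) = (s / d) powr 2 * (s / d) powr (- \<nu>)" by (simp flip: powr_add)
      also have "(s / d) powr (- \<nu>) = s powr (- \<nu>) / d powr (- \<nu>)" by (rule powr_divide)
      finally show ?thesis using assms by (simp add: power_divide)
    qed
    also have "\<dots> \<le> d powr (- \<nu>) * 1" using True assms by (intro mult_left_mono powr_le1) auto
    finally show ?thesis by (simp add: eq)
  next
    case False
    have "s powr (- \<nu>) * (1 - low_cut d s) \<le> s powr (- \<nu>) * 1"
      using low_cut_props(4)[OF assms(1), of s] by (intro mult_left_mono) auto
    also have "\<dots> \<le> d powr (- \<nu>)" using False assms by (simp add: powr_mono2')
    finally show ?thesis .
  qed
qed

section \<open>Positivity of the limit and passage to the limit in the equation\<close>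

context grushin_singular
begin

text \<open>If u_0 vanished, testing its equation with u_0 would give zero energy, so the right side
  would integrate to 0 against every cut-off. With u_0 = 0 that right side is min f 1, so f would be
  locally null and hence null.\<close>

lemma un_zero_not_zero:
  assumes f: "\<not> (AE X in M. f X = 0)"
  shows "\<not> (AE X in M. un 0 X = 0)"
proof
  assume z: "AE X in M. un 0 X = 0"
  have "Lp_int 2 M (Wn 0) = (LINT X|M. Wn 0 X \<bullet> Wn 0 X)" by (simp add: Lp_int_2_eq power2_norm_eq_inner)
  also have "\<dots> = (LINT X|M. gn 0 X * un 0 X)" by (rule weak_solD(3)[OF un_sol un_H])
  also have "\<dots> = 0" by (rule integral_eq_zero_AE) (use z in \<open>auto elim!: eventually_mono\<close>)
  finally have W0: "AE X in M. Wn 0 X = 0" by (rule Lp_int_zero_AE[OF H_Lp(2)[OF un_H]])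
  have "negligible {X\<in>\<Omega>. \<not> f X = 0}"
  proof (subst locally_negligible_alt, rule ballI)
    fix P assume P: "P \<in> {X\<in>\<Omega>. \<not> f X = 0}"
    obtain \<rho> where \<rho>: "0 < \<rho>" "cball P \<rho> \<subseteq> \<Omega>" using open_dom P by (auto simp: open_contains_cball)
    obtain \<psi> h where \<psi>: "test_fn \<Omega> \<psi> h" "\<And>X. 0 \<le> \<psi> X" "\<And>X. X \<in> cball P \<rho> \<Longrightarrow> 1 \<le> \<psi> X"
      using test_fn_cutoff[OF open_dom compact_cball \<rho>(2)] by blast
    have [measurable]: "\<psi> \<in> borel_measurable M" using test_fn_measurable[OF \<psi>(1)] by auto
    have "(LINT X|M. gn 0 X * \<psi> X) = (LINT X|M. Wn 0 X \<bullet> sg h X)"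
      by (rule weak_solD(3)[OF un_sol H_test[OF \<psi>(1)], symmetric])
    also have "\<dots> = 0" by (rule integral_eq_zero_AE) (use W0 in \<open>auto elim!: eventually_mono\<close>)
    finally have "AE X in M. gn 0 X * \<psi> X = 0"
      using integral_nonneg_eq_0_iff_AE[OF L2_inner(2)[OF weak_solD(2)[OF un_sol] test_fn_Lp(1)[OF \<psi>(1)], of 0]] gn_nonneg \<psi>(2)
      by auto
    then have "AE X in M. X \<in> cball P \<rho> \<longrightarrow> f X = 0"
      using z
    proof eventually_elim
      case (elim X)
      \<comment> \<open>The regularisation at index 0 is 1 / (0 + 1) = 1.\<close>
      have "hn 0 (un 0 X) = 1" using elim by (simp add: hn_def)
      then show ?case using elim \<psi>(3)[of X] f_nonneg[of X] by (auto simp: gn_def fn_def min_def split: if_splits)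
    qed
    then have "AE X in lebesgue. X \<in> \<Omega> \<longrightarrow> X \<in> cball P \<rho> \<longrightarrow> f X = 0"
      using dom_lebesgue by (subst (asm) AE_restrict_space_iff) auto
    then obtain N where N: "{X. \<not> (X \<in> \<Omega> \<longrightarrow> X \<in> cball P \<rho> \<longrightarrow> f X = 0)} \<subseteq> N" "N \<in> null_sets lebesgue"
      by (auto elim!: AE_E simp: null_sets_def)
    then have "negligible N" by (simp add: negligible_iff_null_sets)
    then have "negligible {X. \<not> (X \<in> \<Omega> \<longrightarrow> X \<in> cball P \<rho> \<longrightarrow> f X = 0)}" using N(1) by (rule negligible_subset)
    then have "negligible ({X\<in>\<Omega>. \<not> f X = 0} \<inter> ball P \<rho>)" by (rule negligible_subset) auto
    then show "\<exists>U. openin (top_of_set {X\<in>\<Omega>. \<not> f X = 0}) U \<and> P \<in> U \<and> negligible U"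
      using P \<rho> by (intro exI[of _ "{X\<in>\<Omega>. \<not> f X = 0} \<inter> ball P \<rho>"]) (auto intro: openin_open_Int)
  qed
  then have "AE X in M. f X = 0" by (rule AE_dom_negligible)
  with f show False by simp
qed

lemma u_positive:
  assumes "connected \<Omega>" and f: "\<not> (AE X in M. f X = 0)"
  shows "AE X in M. 0 < u X"
proof -
  have "AE X in M. 0 < un 0 X"
    by (rule strict_positivity[OF un_sol un_nonneg gn_nonneg assms(1) un_zero_not_zero[OF f]])
  then show ?thesis using un_lim by eventually_elim (meson less_le_trans)
qed

lemma Wn_lim_L1:
  shows "(\<lambda>n. LINT X|M. norm (Wn n X - U X)) \<longlonglongrightarrow> 0" and "integrable M (\<lambda>X. norm (Wn n X - U X))"
    and "integrable M (\<lambda>X. norm (U X))"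
proof -
  have q1: "0 < (1::real)" "1 < q" using expo(6) by auto
  show "(\<lambda>n. LINT X|M. norm (Wn n X - U X)) \<longlonglongrightarrow> 0"
    using dom.Lp_lim_mono_exponent[OF Wn_q U_q q1 Wn_lim] by (simp add: Lp_int_def)
  show "integrable M (\<lambda>X. norm (Wn n X - U X))"
    using dom.Lp_int_mono_exponent(1)[OF Lp_on_diff(1)[OF Wn_q U_q] q1] q1 by (simp add: Lp_on_def)
  show "integrable M (\<lambda>X. norm (U X))"
    using dom.Lp_int_mono_exponent(1)[OF U_q q1] by (simp add: Lp_on_def)
qed

text \<open>Testing the \<open>n\<close>-th equation with \<open>\<psi> low_cut d u\<^sub>n\<close> shows that no mass of the right-hand side
  concentrates where \<open>u\<close> is small, so no lower bound on \<open>u\<close> is needed.\<close>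

lemma limit_equation_nonneg:
  assumes pos: "AE X in M. 0 < u X" and \<psi>: "test_fn \<Omega> \<psi> h" and \<psi>0: "\<And>X. 0 \<le> \<psi> X"
  shows "integrable M (\<lambda>X. f X * \<psi> X * u X powr (- \<nu>))" (is ?int)
    "(LINT X|M. U X \<bullet> sg h X) = (LINT X|M. f X * \<psi> X * u X powr (- \<nu>))" (is ?eq)
proof -
  obtain C where C: "0 \<le> C" "\<And>X. \<bar>\<psi> X\<bar> \<le> C" "\<And>X. norm (sg h X) \<le> C" using test_fn_bounded[OF \<psi>] by blast
  have [measurable]: "\<psi> \<in> borel_measurable M" "sg h \<in> borel_measurable M" using test_fn_measurable[OF \<psi>] by auto
  have [measurable]: "U \<in> borel_measurable M" using U_q by (simp add: Lp_on_def)
  have cm[measurable]: "low_cut d \<in> borel_measurable borel" "low_cut' d \<in> borel_measurable borel" for d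
    unfolding low_cut_def[abs_def] low_cut'_def[abs_def] by measurable
  define I where "I = (LINT X|M. U X \<bullet> sg h X)"
  have iU: "integrable M (\<lambda>X. U X \<bullet> sg h X)"
  proof (rule Bochner_Integration.integrable_bound)
    show "integrable M (\<lambda>X. C * norm (U X))" using Wn_lim_L1(3) by auto
    have "\<bar>U X \<bullet> sg h X\<bar> \<le> C * norm (U X)" for X
      using Cauchy_Schwarz_ineq2[of "U X" "sg h X"] mult_left_mono[OF C(3)[of X], of "norm (U X)"] by (simp add: mult.commute)
    then show "AE X in M. norm (U X \<bullet> sg h X) \<le> norm (C * norm (U X))" using C(1) by auto
  qed measurable
  have Ilim: "(\<lambda>n. LINT X|M. Wn n X \<bullet> sg h X) \<longlonglongrightarrow> I"
  proof (rule Lim_null[THEN iffD2], rule Lim_null_comparison)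
    show "\<forall>\<^sub>F n in sequentially. norm ((LINT X|M. Wn n X \<bullet> sg h X) - I) \<le> C * (LINT X|M. norm (Wn n X - U X))"
    proof (intro always_eventually allI)
      fix n
      have iW: "integrable M (\<lambda>X. Wn n X \<bullet> sg h X)" by (rule L2_inner(2)[OF H_Lp(2)[OF un_H] test_fn_Lp(2)[OF \<psi>]]) simp
      have "(LINT X|M. Wn n X \<bullet> sg h X) - I = (LINT X|M. (Wn n X - U X) \<bullet> sg h X)"
        unfolding I_def using iW iU by (simp add: inner_diff_left)
      also have "norm \<dots> \<le> (LINT X|M. norm ((Wn n X - U X) \<bullet> sg h X))" by (rule integral_norm_bound)
      also have "\<dots> \<le> (LINT X|M. C * norm (Wn n X - U X))"
      proof (rule integral_mono)
        show "integrable M (\<lambda>X. norm ((Wn n X - U X) \<bullet> sg h X))" using iW iU by (auto simp: inner_diff_left)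
        show "integrable M (\<lambda>X. C * norm (Wn n X - U X))" using Wn_lim_L1(2) by auto
        show "norm ((Wn n X - U X) \<bullet> sg h X) \<le> C * norm (Wn n X - U X)" for X
          using Cauchy_Schwarz_ineq2[of "Wn n X - U X" "sg h X"] mult_left_mono[OF C(3)[of X], of "norm (Wn n X - U X)"]
          by (simp add: mult.commute)
      qed
      finally show "norm ((LINT X|M. Wn n X \<bullet> sg h X) - I) \<le> C * (LINT X|M. norm (Wn n X - U X))" by simp
    qed
    show "(\<lambda>n. C * (LINT X|M. norm (Wn n X - U X))) \<longlonglongrightarrow> 0" using tendsto_mult_left[OF Wn_lim_L1(1), of C] by simp
  qed
  \<comment> \<open>J d is the mass of the limit right side seen away from the zero set. The aim is
    I - C K d <= J d <= I: the defect K d tends to 0 with d by dominated convergence, because u > 0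
    almost everywhere.\<close>
  define J where "J d = (LINT X|M. f X * \<psi> X * u X powr (- \<nu>) * (1 - low_cut d (u X)))" for d
  define K where "K d = (LINT X|M. low_cut d (u X) * norm (U X))" for d
  have iKu: "integrable M (\<lambda>X. low_cut d (v X) * norm (U X))" if d: "0 < d" and v[measurable]: "v \<in> borel_measurable M" for d v
    by (rule Bochner_Integration.integrable_bound[OF Wn_lim_L1(3)])
       (use low_cut_props(4,5)[OF d] in \<open>auto simp: abs_mult intro!: mult_left_le_one_le\<close>)
  have iJ: "integrable M (\<lambda>X. f X * \<psi> X * u X powr (- \<nu>) * (1 - low_cut d (u X)))"
    and bound: "I - C * K d \<le> J d" "J d \<le> I" if d: "0 < d" for d
  proof -
    have dom1: "integrable M (\<lambda>X. f X * (C * d powr (- \<nu>)))" using f_integrable by auto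
    have db: "f X * \<psi> X * s powr (- \<nu>) * (1 - low_cut d s) \<le> f X * (C * d powr (- \<nu>))" if s: "0 < s" for X s
    proof -
      have "\<psi> X * (s powr (- \<nu>) * (1 - low_cut d s)) \<le> C * d powr (- \<nu>)"
        using C(2)[of X] \<psi>0[of X] powr_one_minus_low_cut_le[OF d s nu] low_cut_props(5)[OF d, of s] by (intro mult_mono) auto
      then have "f X * (\<psi> X * (s powr (- \<nu>) * (1 - low_cut d s))) \<le> f X * (C * d powr (- \<nu>))" using f_nonneg by (intro mult_left_mono)
      then show ?thesis by (simp only: mult.assoc)
    qed
    have nn: "0 \<le> f X * \<psi> X * s powr (- \<nu>) * (1 - low_cut d s)" for X s
      using f_nonneg[of X] \<psi>0[of X] low_cut_props(5)[OF d, of s] by simp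
    show "integrable M (\<lambda>X. f X * \<psi> X * u X powr (- \<nu>) * (1 - low_cut d (u X)))"
    proof (rule Bochner_Integration.integrable_bound[OF dom1])
      show "AE X in M. norm (f X * \<psi> X * u X powr (- \<nu>) * (1 - low_cut d (u X))) \<le> norm (f X * (C * d powr (- \<nu>)))"
        using pos
      proof eventually_elim
        case (elim X)
        show ?case using db[OF elim, of X] nn[of X "u X"] f_nonneg[of X] C(1) by simp
      qed
    qed measurable
    have nb: "gn n X * \<psi> X * (1 - low_cut d (un n X)) \<le> f X * (C * d powr (- \<nu>))" if "0 \<le> un n X" for n X
    proof (cases "un n X = 0")
      case True
      \<comment> \<open>At u_n = 0 the cut-off equals 1, so \<open>gn\<close> is multiplied by
        0.\<close>
      then show ?thesis using d f_nonneg[of X] C(1) by (simp add: low_cut_def)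
    next
      case False
      with that have s: "0 < un n X" by simp
      have "gn n X * \<psi> X * (1 - low_cut d (un n X)) \<le> f X * un n X powr (- \<nu>) * \<psi> X * (1 - low_cut d (un n X))"
        unfolding gn_def using \<psi>0[of X] low_cut_props(5)[OF d, of "un n X"]
        by (intro mult_right_mono mult_mono fn_bounds hn_le s hn_nonneg f_nonneg) auto
      also have "\<dots> = f X * \<psi> X * un n X powr (- \<nu>) * (1 - low_cut d (un n X))" by simp
      also note db[OF s]
      finally show ?thesis .
    qed
    have Jlim: "(\<lambda>n. LINT X|M. gn n X * \<psi> X * (1 - low_cut d (un n X))) \<longlonglongrightarrow> J d"
      unfolding J_def
    proof (rule integral_dominated_convergence[OF _ _ dom1])
      show "AE X in M. (\<lambda>n. gn n X * \<psi> X * (1 - low_cut d (un n X))) \<longlonglongrightarrow> f X * \<psi> X * u X powr (- \<nu>) * (1 - low_cut d (u X))"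
        using pos un_lim
      proof eventually_elim
        case (elim X)
        then have ul: "(\<lambda>n. un n X) \<longlonglongrightarrow> u X" and u0: "0 < u X" by auto
        have i: "(\<lambda>n. 1 / real (Suc n)) \<longlonglongrightarrow> 0" by (rule LIMSEQ_Suc[OF lim_const_over_n])
        have "eventually (\<lambda>n. f X \<le> real n) sequentially"
          using filterlim_real_sequentially by (simp add: filterlim_at_top)
        then have "eventually (\<lambda>n. f X = fn n X) sequentially" by eventually_elim (auto simp: fn_def)
        then have fl: "(\<lambda>n. fn n X) \<longlonglongrightarrow> f X" by (rule Lim_transform_eventually[OF tendsto_const])
        have "(\<lambda>n. (max (un n X) 0 + 1 / real (Suc n)) powr (- \<nu>)) \<longlonglongrightarrow> (max (u X) 0 + 0) powr (- \<nu>)"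
          using u0 by (intro tendsto_powr tendsto_add tendsto_max ul tendsto_const i) auto
        then have hl: "(\<lambda>n. hn n (un n X)) \<longlonglongrightarrow> u X powr (- \<nu>)" using u0 by (simp add: hn_def)
        have zl: "(\<lambda>n. low_cut d (un n X)) \<longlonglongrightarrow> low_cut d (u X)"
          by (rule isCont_tendsto_compose[OF DERIV_isCont[OF low_cut_props(1)[OF d]] ul])
        have "(\<lambda>n. fn n X * hn n (un n X) * \<psi> X * (1 - low_cut d (un n X))) \<longlonglongrightarrow> f X * u X powr (- \<nu>) * \<psi> X * (1 - low_cut d (u X))"
          by (intro tendsto_intros fl hl zl)
        then show ?case by (simp add: gn_def ac_simps)
      qed
      show "AE X in M. norm (gn n X * \<psi> X * (1 - low_cut d (un n X))) \<le> f X * (C * d powr (- \<nu>))" for n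
        using un_nonneg[of n]
      proof eventually_elim
        case (elim X)
        have "0 \<le> gn n X * \<psi> X * (1 - low_cut d (un n X))"
          using gn_nonneg[of n X] \<psi>0[of X] low_cut_props(5)[OF d, of "un n X"] by simp
        then show ?case using nb[OF elim] by simp
      qed
    qed measurable
    \<comment> \<open>The part of the tested right side that sits where u_n is small. Inserting its
      test function into the equation rewrites it as an energy integral.\<close>
    define R where "R n = (LINT X|M. gn n X * (\<psi> X * low_cut d (un n X)))" for n
    have HZ: "H (\<lambda>X. \<psi> X * low_cut d (un n X)) (\<lambda>X. (\<psi> X * low_cut' d (un n X)) *\<^sub>R Wn n X + low_cut d (un n X) *\<^sub>R sg h X)" for n
      by (rule H_test_mult_compose[OF un_H \<psi> low_cut_props(1)[OF d] low_cut_props(2)[OF d] low_cut_props(3)[OF d]])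
    have split: "(LINT X|M. Wn n X \<bullet> sg h X) = (LINT X|M. gn n X * \<psi> X * (1 - low_cut d (un n X))) + R n" for n
    proof -
      have i1: "integrable M (\<lambda>X. gn n X * \<psi> X)" using L2_inner(2)[OF weak_solD(2)[OF un_sol] test_fn_Lp(1)[OF \<psi>, of 2]] by simp
      have i2: "integrable M (\<lambda>X. gn n X * (\<psi> X * low_cut d (un n X)))" using L2_inner(2)[OF weak_solD(2)[OF un_sol] H_Lp(1)[OF HZ]] by simp
      have "(LINT X|M. Wn n X \<bullet> sg h X) = (LINT X|M. gn n X * \<psi> X)" by (rule weak_solD(3)[OF un_sol H_test[OF \<psi>]])
      also have "\<dots> = (LINT X|M. gn n X * \<psi> X - gn n X * (\<psi> X * low_cut d (un n X))) + R n" unfolding R_def using i1 i2 by simp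
      finally show ?thesis by (simp add: right_diff_distrib mult.assoc)
    qed
    have "(\<lambda>n. (LINT X|M. Wn n X \<bullet> sg h X) - (LINT X|M. gn n X * \<psi> X * (1 - low_cut d (un n X)))) \<longlonglongrightarrow> I - J d"
      by (intro tendsto_diff Ilim Jlim)
    then have Rlim: "R \<longlonglongrightarrow> I - J d" unfolding split by simp
    have R0: "0 \<le> R n" for n unfolding R_def
      using gn_nonneg \<psi>0 low_cut_props(4)[OF d] by (intro integral_nonneg_AE) auto
    have Rle: "R n \<le> C * ((LINT X|M. low_cut d (un n X) * norm (U X)) + (LINT X|M. norm (Wn n X - U X)))" for n
    proof -
      have "R n = (LINT X|M. Wn n X \<bullet> ((\<psi> X * low_cut' d (un n X)) *\<^sub>R Wn n X + low_cut d (un n X) *\<^sub>R sg h X))"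
        unfolding R_def by (rule weak_solD(3)[OF un_sol HZ, symmetric])
      also have "\<dots> \<le> (LINT X|M. C * (low_cut d (un n X) * norm (U X) + norm (Wn n X - U X)))"
      proof (rule integral_mono_AE)
        show "integrable M (\<lambda>X. Wn n X \<bullet> ((\<psi> X * low_cut' d (un n X)) *\<^sub>R Wn n X + low_cut d (un n X) *\<^sub>R sg h X))"
          by (rule L2_inner(2)[OF H_Lp(2)[OF un_H] H_Lp(2)[OF HZ]])
        show "integrable M (\<lambda>X. C * (low_cut d (un n X) * norm (U X) + norm (Wn n X - U X)))"
          using iKu[OF d un_measurable(1)] Wn_lim_L1(2) by auto
        show "AE X in M. Wn n X \<bullet> ((\<psi> X * low_cut' d (un n X)) *\<^sub>R Wn n X + low_cut d (un n X) *\<^sub>R sg h X)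
            \<le> C * (low_cut d (un n X) * norm (U X) + norm (Wn n X - U X))"
          using un_nonneg[of n]
        proof eventually_elim
          case (elim X)
          let ?z = "low_cut d (un n X)"
          have z: "0 \<le> ?z" "?z \<le> 1" using low_cut_props(4,5)[OF d] by auto
          \<comment> \<open>The term with the square of \<open>Wn n\<close>, for which no bound
            uniform in n is available, has a good sign and is dropped.\<close>
          have a: "(\<psi> X * low_cut' d (un n X)) * (Wn n X \<bullet> Wn n X) \<le> 0"
            using \<psi>0[of X] low_cut_props(6)[OF d elim] by (intro mult_nonpos_nonneg mult_nonneg_nonpos) auto
          have "Wn n X \<bullet> sg h X \<le> norm (Wn n X) * norm (sg h X)" by (rule norm_cauchy_schwarz)
          also have "\<dots> \<le> norm (Wn n X) * C" using C(3) by (intro mult_left_mono) auto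
          finally have "?z * (Wn n X \<bullet> sg h X) \<le> ?z * (norm (Wn n X) * C)" using z by (intro mult_left_mono) auto
          also have "\<dots> \<le> ?z * ((norm (U X) + norm (Wn n X - U X)) * C)"
            using z C(1) norm_triangle_sub[of "Wn n X" "U X"] by (intro mult_left_mono mult_right_mono) auto
          also have "\<dots> = C * (?z * norm (U X) + ?z * norm (Wn n X - U X))" by (simp add: algebra_simps)
          also have "\<dots> \<le> C * (?z * norm (U X) + norm (Wn n X - U X))"
            using z C(1) by (intro mult_left_mono add_left_mono mult_left_le_one_le) auto
          finally show ?case using a by (simp add: inner_add_right)
        qed
      qed
      also have "\<dots> = C * ((LINT X|M. low_cut d (un n X) * norm (U X)) + (LINT X|M. norm (Wn n X - U X)))"
        using iKu[OF d un_measurable(1)] Wn_lim_L1(2) by simp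
      finally show ?thesis .
    qed
    have Klim: "(\<lambda>n. LINT X|M. low_cut d (un n X) * norm (U X)) \<longlonglongrightarrow> K d"
      unfolding K_def
    proof (rule integral_dominated_convergence[OF _ _ Wn_lim_L1(3)])
      show "AE X in M. (\<lambda>n. low_cut d (un n X) * norm (U X)) \<longlonglongrightarrow> low_cut d (u X) * norm (U X)"
        using un_lim
      proof eventually_elim
        case (elim X)
        then have "(\<lambda>n. low_cut d (un n X)) \<longlonglongrightarrow> low_cut d (u X)"
          by (intro isCont_tendsto_compose[OF DERIV_isCont[OF low_cut_props(1)[OF d]]]) auto
        then show ?case by (intro tendsto_intros)
      qed
      show "AE X in M. norm (low_cut d (un n X) * norm (U X)) \<le> norm (U X)" for n
        using low_cut_props(4,5)[OF d] by (auto simp: abs_mult intro!: mult_left_le_one_le)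
    qed measurable
    have "I - J d \<le> C * (K d + 0)"
      by (rule LIMSEQ_le[OF Rlim tendsto_mult_left[OF tendsto_add[OF Klim Wn_lim_L1(1)]]]) (use Rle in auto)
    then show "I - C * K d \<le> J d" by simp
    have "0 \<le> I - J d" by (rule LIMSEQ_le_const[OF Rlim]) (use R0 in auto)
    then show "J d \<le> I" by simp
  qed
  define \<delta> where "\<delta> j = 1 / real (Suc j)" for j
  have \<delta>: "0 < \<delta> j" "\<delta> (Suc j) \<le> \<delta> j" for j by (auto simp: \<delta>_def intro!: divide_left_mono)
  have lc0: "(\<lambda>j. low_cut (\<delta> j) s) \<longlonglongrightarrow> 0" if "0 < s" for s using low_cut_zero_lim[OF that] by (simp add: \<delta>_def)
  have K0: "(\<lambda>j. K (\<delta> j)) \<longlonglongrightarrow> (LINT X|M. 0)" unfolding K_def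
  proof (rule integral_dominated_convergence[OF _ _ Wn_lim_L1(3)])
    show "AE X in M. (\<lambda>j. low_cut (\<delta> j) (u X) * norm (U X)) \<longlonglongrightarrow> 0"
      using pos
    proof eventually_elim
      case (elim X)
      show ?case using tendsto_mult_right[OF lc0[OF elim], of "norm (U X)"] by simp
    qed
    show "AE X in M. norm (low_cut (\<delta> j) (u X) * norm (U X)) \<le> norm (U X)" for j
      using low_cut_props(4,5)[OF \<delta>(1)] by (auto simp: abs_mult intro!: mult_left_le_one_le)
  qed measurable
  have JI: "(\<lambda>j. J (\<delta> j)) \<longlonglongrightarrow> I"
  proof (rule tendsto_sandwich)
    show "\<forall>\<^sub>F j in sequentially. I - C * K (\<delta> j) \<le> J (\<delta> j)" "\<forall>\<^sub>F j in sequentially. J (\<delta> j) \<le> I"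
      using bound \<delta> by auto
    show "(\<lambda>j. I - C * K (\<delta> j)) \<longlonglongrightarrow> I" using tendsto_diff[OF tendsto_const[of I] tendsto_mult_left[OF K0, of C]] by simp
  qed auto
  \<comment> \<open>The cut-offs decrease with d, so monotone convergence applies; together with the
    convergent J it also yields integrability of the singular term.\<close>
  have mono: "AE X in M. mono (\<lambda>j. f X * \<psi> X * u X powr (- \<nu>) * (1 - low_cut (\<delta> j) (u X)))"
  proof (intro AE_I2 incseq_SucI mult_left_mono diff_left_mono low_cut_mono \<delta>)
    show "0 \<le> f X * \<psi> X * u X powr (- \<nu>)" for X using f_nonneg[of X] \<psi>0[of X] by simp
  qed
  have lim: "AE X in M. (\<lambda>j. f X * \<psi> X * u X powr (- \<nu>) * (1 - low_cut (\<delta> j) (u X))) \<longlonglongrightarrow> f X * \<psi> X * u X powr (- \<nu>)"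
    using pos
  proof eventually_elim
    case (elim X)
    have "(\<lambda>j. f X * \<psi> X * u X powr (- \<nu>) * (1 - low_cut (\<delta> j) (u X))) \<longlonglongrightarrow> f X * \<psi> X * u X powr (- \<nu>) * (1 - 0)"
      by (intro tendsto_intros lc0 elim)
    then show ?case by simp
  qed
  have m: "(\<lambda>X. f X * \<psi> X * u X powr (- \<nu>)) \<in> borel_measurable M" by measurable
  show ?int by (rule integrable_monotone_convergence[OF iJ[OF \<delta>(1)] mono lim JI[unfolded J_def] m])
  have "(LINT X|M. f X * \<psi> X * u X powr (- \<nu>)) = I"
    by (rule integral_monotone_convergence[OF iJ[OF \<delta>(1)] mono lim JI[unfolded J_def] m])
  then show ?eq by (simp add: I_def)
qed

text \<open>A signed v is the difference of the nonnegative test functions v + C \<eta> and C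
  \<eta>, where \<eta> is a cut-off at least 1 on a compact set outside which v vanishes and C
  bounds |v|.\<close>

lemma limit_equation:
  assumes pos: "AE X in M. 0 < u X" and v: "test_fn \<Omega> v g"
  shows "integrable M (\<lambda>X. U X \<bullet> sg g X)" "integrable M (\<lambda>X. f X * v X * u X powr (- \<nu>))"
    "(LINT X|M. U X \<bullet> sg g X) = (LINT X|M. f X * v X * u X powr (- \<nu>))"
proof -
  have iU: "integrable M (\<lambda>X. U X \<bullet> sg h X)" if h: "test_fn \<Omega> \<psi> h" for \<psi> h
  proof -
    obtain C where C: "0 \<le> C" "\<And>X. norm (sg h X) \<le> C" using test_fn_bounded[OF h] by blast
    show ?thesis
    proof (rule Bochner_Integration.integrable_bound)
      show "integrable M (\<lambda>X. C * norm (U X))" using Wn_lim_L1(3) by auto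
      have "\<bar>U X \<bullet> sg h X\<bar> \<le> C * norm (U X)" for X
        using Cauchy_Schwarz_ineq2[of "U X" "sg h X"] mult_left_mono[OF C(2)[of X], of "norm (U X)"] by (simp add: mult.commute)
      then show "AE X in M. norm (U X \<bullet> sg h X) \<le> norm (C * norm (U X))" using C(1) by auto
      have "U \<in> borel_measurable M" using U_q by (simp add: Lp_on_def)
      then show "(\<lambda>X. U X \<bullet> sg h X) \<in> borel_measurable M" using test_fn_measurable(2)[OF h] by (rule borel_measurable_inner)
    qed
  qed
  obtain K where K: "compact K" "K \<subseteq> \<Omega>" "\<And>X. X \<notin> K \<Longrightarrow> v X = 0" using v unfolding test_fn_def by blast
  obtain C where C: "0 \<le> C" "\<And>X. \<bar>v X\<bar> \<le> C" using test_fn_bounded[OF v] by blast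
  obtain \<eta> h where \<eta>: "test_fn \<Omega> \<eta> h" "\<And>X. 0 \<le> \<eta> X" "\<And>X. X \<in> K \<Longrightarrow> 1 \<le> \<eta> X"
    using test_fn_cutoff[OF open_dom K(1,2)] by blast
  define \<psi> where "\<psi> X = v X + C * \<eta> X" for X
  define k where "k X = g X + C *\<^sub>R h X" for X
  have \<psi>: "test_fn \<Omega> \<psi> k" unfolding \<psi>_def k_def by (intro test_fn_add test_fn_scale v \<eta>)
  have \<psi>0: "0 \<le> \<psi> X" for X
  proof (cases "X \<in> K")
    case True
    then have "C * 1 \<le> C * \<eta> X" using \<eta>(3) C(1) by (intro mult_left_mono) auto
    then show ?thesis using C(2)[of X] by (simp add: \<psi>_def abs_le_iff)
  next
    case False then show ?thesis using K(3) C(1) \<eta>(2) by (simp add: \<psi>_def)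
  qed
  note e1 = limit_equation_nonneg[OF pos \<psi> \<psi>0] and e2 = limit_equation_nonneg[OF pos \<eta>(1,2)]
  have vd: "f X * v X * u X powr (- \<nu>) = f X * \<psi> X * u X powr (- \<nu>) - C * (f X * \<eta> X * u X powr (- \<nu>))" for X
    by (simp add: \<psi>_def algebra_simps)
  have gd: "U X \<bullet> sg g X = U X \<bullet> sg k X - C * (U X \<bullet> sg h X)" for X
  proof -
    have "sg k X = sg g X + C *\<^sub>R sg h X" by (simp add: k_def grushin_sqrtA_def prod_eq_iff algebra_simps)
    then show ?thesis by (simp add: inner_add_right)
  qed
  show "integrable M (\<lambda>X. U X \<bullet> sg g X)" by (rule iU[OF v])
  show "integrable M (\<lambda>X. f X * v X * u X powr (- \<nu>))" unfolding vd using e1(1) e2(1) by auto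
  show "(LINT X|M. U X \<bullet> sg g X) = (LINT X|M. f X * v X * u X powr (- \<nu>))"
    unfolding vd gd using e1 e2 iU[OF \<psi>] iU[OF \<eta>(1)] by simp
qed

end

text \<open>Integrability of both sides belongs to the conclusion: the integral of a non-integrable
  function is 0 by convention, so the bare identity would say too little.\<close>

theorem theorem3p7:
  fixes lam \<nu> r Q q :: real
    and \<Omega> :: "(real \<times> (real ^ 'm)) set"
    and f :: "real \<times> (real ^ 'm) \<Rightarrow> real"
  assumes "lam \<ge> 1"
    and "0 < \<nu>" and "\<nu> < 1"
    and "Q = (real CARD('m) + 1) + lam * real CARD('m)"
    and "open \<Omega>" and "bounded \<Omega>" and "Lambda_connected lam \<Omega>"
    and "1 \<le> r" and "r < 2 * Q / ((Q + 2) + \<nu> * (Q - 2))"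
    and "Lp_fun r \<Omega> f"
    and "AE X in lebesgue_on \<Omega>. 0 \<le> f X"
    and "\<not> (AE X in lebesgue_on \<Omega>. f X = 0)"
    and "q = Q * r * (\<nu> + 1) / (Q - r * (1 - \<nu>))"
  shows "\<exists>u\<in>W0 lam q \<Omega>. \<exists>G. has_weak_quasi_gradient lam q \<Omega> u G \<and>
           (AE X in lebesgue_on \<Omega>. 0 < u X) \<and>
           (\<forall>v\<in>C1_0 \<Omega>.
              integrable (lebesgue_on \<Omega>) (\<lambda>X. grushin_A lam X (G X) \<bullet> gradient v X) \<and>
              integrable (lebesgue_on \<Omega>) (\<lambda>X. f X * v X / (u X powr \<nu>)) \<and>
              (LINT X|lebesgue_on \<Omega>. grushin_A lam X (G X) \<bullet> gradient v X) =
              (LINT X|lebesgue_on \<Omega>. f X * v X / (u X powr \<nu>)))"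
proof -
  interpret D: grushin_domain lam \<Omega> by unfold_locales (use assms in auto)
  have Qeq: "Q = grushin_domain.Qdim TYPE('m) lam" using assms(4) by (simp add: D.Qdim_def)
  \<comment> \<open>A version of f that is nonnegative at every point, as the locale requires; it
    equals f almost everywhere.\<close>
  define f' where "f' = (\<lambda>X. max (f X) 0)"
  have fm[measurable]: "f \<in> borel_measurable (lebesgue_on \<Omega>)" and fi: "integrable (lebesgue_on \<Omega>) (\<lambda>X. norm (f X) powr r)"
    using assms(10) by (auto simp: Lp_fun_def)
  have ff': "AE X in lebesgue_on \<Omega>. f X = f' X" using assms(11) by eventually_elim (simp add: f'_def)
  have f'm[measurable]: "f' \<in> borel_measurable (lebesgue_on \<Omega>)" unfolding f'_def by measurable
  have "integrable (lebesgue_on \<Omega>) (\<lambda>X. norm (f' X) powr r)"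
  proof (rule Bochner_Integration.integrable_bound[OF fi])
    show "AE X in lebesgue_on \<Omega>. norm (norm (f' X) powr r) \<le> norm (norm (f X) powr r)"
      using ff' by eventually_elim simp
    show "(\<lambda>X. norm (f' X) powr r) \<in> borel_measurable (lebesgue_on \<Omega>)" by measurable
  qed
  then have Lf: "Lp_on r (lebesgue_on \<Omega>) f'" by (simp add: Lp_on_def)
  interpret S: grushin_singular lam \<Omega> \<nu> r q f'
    by unfold_locales (use assms Lf in \<open>auto simp: Qeq f'_def\<close>)
  have nz: "\<not> (AE X in lebesgue_on \<Omega>. f' X = 0)"
  proof
    assume "AE X in lebesgue_on \<Omega>. f' X = 0"
    then have "AE X in lebesgue_on \<Omega>. f X = 0" using ff' by eventually_elim simp
    with assms(12) show False by simp
  qed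
  have pos: "AE X in lebesgue_on \<Omega>. 0 < S.u X"
    by (rule S.u_positive[OF D.Lambda_connected_imp_connected[OF assms(7)] nz])
  \<comment> \<open>An explicit inverse of \<open>grushin_sqrtA\<close>. At x = 0 all the powers of
    |x| are 0 by convention, so the identity \<open>AG\<close> holds at every point.\<close>
  define G where "G X = (fst (S.U X), (\<bar>fst X\<bar> powr (- lam)) *\<^sub>R snd (S.U X))" for X
  have AG: "grushin_A lam X (G X) \<bullet> k = S.U X \<bullet> grushin_sqrtA lam X k" for X k
  proof -
    have "\<bar>fst X\<bar> powr (2 * lam) * \<bar>fst X\<bar> powr (- lam) = \<bar>fst X\<bar> powr lam" by (simp flip: powr_add)
    then show ?thesis by (simp add: G_def grushin_A_def grushin_sqrtA_def inner_prod_def)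
  qed
  \<comment> \<open>G is the true inverse image of \<open>S.U\<close> off the hyperplane x = 0,
    which is null.\<close>
  have "AE X in lborel. (X :: real \<times> (real ^ 'm)) \<bullet> (1, 0) \<noteq> 0"
    by (rule AE_lborel_inner_neq) (auto simp: Basis_prod_def)
  then have "AE X in lebesgue. fst (X :: real \<times> (real ^ 'm)) \<noteq> 0" by (intro AE_completion) (simp add: inner_prod_def)
  then have x0: "AE X in lebesgue_on \<Omega>. fst X \<noteq> 0"
    using D.dom_lebesgue by (subst AE_restrict_space_iff) auto
  obtain \<phi> U' where \<phi>: "Cauchy0 lam q \<Omega> \<phi>" "Lp_lim q \<Omega> \<phi> S.u" "Lp_lim q \<Omega> (\<lambda>n X. grushin_sqrtA lam X (gradient (\<phi> n) X)) U'"
     "AE X in lebesgue_on \<Omega>. inv (grushin_sqrtA lam X) (S.U X) = inv (grushin_sqrtA lam X) (U' X)"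
    using S.solution_in_W0(2) unfolding has_weak_quasi_gradient_def by blast
  have wq: "has_weak_quasi_gradient lam q \<Omega> S.u G"
    unfolding has_weak_quasi_gradient_def
  proof (rule exI[of _ \<phi>], rule exI[of _ U'], intro conjI \<phi>(1-3))
    show "AE X in lebesgue_on \<Omega>. G X = inv (grushin_sqrtA lam X) (U' X)"
      using \<phi>(4) x0
    proof eventually_elim
      case (elim X)
      then show ?case using inv_grushin_sqrtA[OF elim(2), of lam "S.U X"] by (simp add: G_def)
    qed
  qed
  have eq: "integrable (lebesgue_on \<Omega>) (\<lambda>X. grushin_A lam X (G X) \<bullet> gradient v X) \<and>
      integrable (lebesgue_on \<Omega>) (\<lambda>X. f X * v X / (S.u X powr \<nu>)) \<and>
      (LINT X|lebesgue_on \<Omega>. grushin_A lam X (G X) \<bullet> gradient v X) = (LINT X|lebesgue_on \<Omega>. f X * v X / (S.u X powr \<nu>))"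
    if v: "v \<in> C1_0 \<Omega>" for v
  proof -
    let ?v = "\<lambda>X. if X \<in> \<Omega> then v X else 0" and ?g = "\<lambda>X. if X \<in> \<Omega> then gradient v X else 0"
    have t: "test_fn \<Omega> ?v ?g" by (rule C1_0_imp_test_fn[OF assms(5) v])
    note L = S.limit_equation[OF pos t]
    have vm[measurable]: "?v \<in> borel_measurable (lebesgue_on \<Omega>)" using D.test_fn_measurable[OF t] by auto
    have "v \<in> borel_measurable (lebesgue_on \<Omega>) \<longleftrightarrow> ?v \<in> borel_measurable (lebesgue_on \<Omega>)"
      by (rule measurable_cong) simp
    then have [measurable]: "v \<in> borel_measurable (lebesgue_on \<Omega>)" using vm by simp
    have 1: "grushin_A lam X (G X) \<bullet> gradient v X = S.U X \<bullet> grushin_sqrtA lam X (?g X)" if "X \<in> space (lebesgue_on \<Omega>)" for X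
      using that by (simp add: AG)
    have ae: "AE X in lebesgue_on \<Omega>. f X * v X / (S.u X powr \<nu>) = f' X * ?v X * S.u X powr (- \<nu>)"
      using ff' AE_space
    proof eventually_elim
      case (elim X)
      then show ?case by (simp add: powr_minus divide_inverse)
    qed
    have i1: "integrable (lebesgue_on \<Omega>) (\<lambda>X. grushin_A lam X (G X) \<bullet> gradient v X)"
      using L(1) by (subst Bochner_Integration.integrable_cong[OF refl 1])
    have m1: "(\<lambda>X. f X * v X / (S.u X powr \<nu>)) \<in> borel_measurable (lebesgue_on \<Omega>)" by measurable
    have m2: "(\<lambda>X. f' X * ?v X * S.u X powr (- \<nu>)) \<in> borel_measurable (lebesgue_on \<Omega>)" using L(2) by (rule borel_measurable_integrable)
    have i2: "integrable (lebesgue_on \<Omega>) (\<lambda>X. f X * v X / (S.u X powr \<nu>))"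
      using L(2) integrable_cong_AE[OF m1 m2 ae] by blast
    have "(LINT X|lebesgue_on \<Omega>. grushin_A lam X (G X) \<bullet> gradient v X) = (LINT X|lebesgue_on \<Omega>. S.U X \<bullet> grushin_sqrtA lam X (?g X))"
      by (rule Bochner_Integration.integral_cong[OF refl 1])
    also have "\<dots> = (LINT X|lebesgue_on \<Omega>. f' X * ?v X * S.u X powr (- \<nu>))" by (rule L(3))
    also have "\<dots> = (LINT X|lebesgue_on \<Omega>. f X * v X / (S.u X powr \<nu>))"
      by (rule integral_cong_AE[OF m1 m2 ae, symmetric])
    finally show ?thesis using i1 i2 by blast
  qed
  show ?thesis using S.solution_in_W0(1) wq pos eq by blast
qed

end
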